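(* Let $\mathfrak{g}$ be a finite dimensional real Lie algebra, and let $\star$ be Kontsevich's star product (with $\hbar=1$) on $\mathcal{S}=\mathcal{S}(\mathfrak g)$. Given $p\in\mathcal{S}$, there is a unique element $\partial_p^\star\in\mathfrak{D}$ such that for all $r\in\mathcal{S}$ $$r\star p=r\cdot\partial_p^\star .$$
   Context: $\mathcal{S}=\mathcal{S}(\mathfrak g)$ (complex scalars) is identified both with the algebra of polynomial functions on $\mathfrak{g}^*$ and with the space of (complex-valued) distributions on $\mathfrak g$ supported at $0$, with $a\in\mathfrak g$ corresponding to $f\mapsto\frac{d}{dt}f(ta)|_{t=0}$ and the ordinary product of $\mathcal S$ corresponding to additive convolution. $\mathfrak{D}$ is the algebra (under composition, acting on functions) of germs at $0$ of differential operators on $\mathfrak g$ with analytic coefficients. It acts on distributions $r$ on the right by $\langle r\cdot D,f\rangle=\langle r,Df\rangle$. Kontsevich's star product. Let $e_1,\dots,e_d$ be a basis of $\mathfrak g$ with $[e_i,e_j]=\sum_k c_{ij}^k e_k$. Regard $x_i=e_i$ as linear coordinates on $\mathfrak g^*$, put $\partial_i=\partial/\partial x_i$, and $\gamma^{ij}=\frac12\sum_k c_{ij}^k x_k$. For $n\ge0$ let $G_n$ be the set of directed graphs $\Gamma$ with vertices $1,\dots,n,L,R$ and $2n$ labelled edges $e_1^1,e_1^2,\dots,e_n^1,e_n^2$, where $e_k^1,e_k^2$ both start at the vertex $k$ and end at two distinct elements of $\{1,\dots,n,L,R\}\setminus\{k\}$. For $\Gamma\in G_n$ with edge set $E$ define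 the bidifferential operator $$B_\Gamma(f,g)=\sum_{I:E\to\{1,\dots,d\}}\left[\prod_{k=1}^n\Bigl(\prod_{e=( *,k)}\partial_{I(e)}\Bigr)\gamma^{I(e_k^1)I(e_k^2)}\right]\Bigl(\prod_{e=( *,L)}\partial_{I(e)}f\Bigr)\Bigl(\prod_{e=( *,R)}\partial_{I(e)}g\Bigr),$$ where $e=( *,v)$ runs over edges ending at $v$ and, in the last two factors, all the derivatives are composed and applied to the single function $f$ (resp. $g$). The weight of $\Gamma$ is $$w_\Gamma=\frac{1}{n!(2\pi)^{2n}}\int_{\mathcal{H}_n}\bigwedge_{k=1}^n\bigl(d\varphi_{e_k^1}\wedge d\varphi_{e_k^2}\bigr),$$ where $\mathcal{H}_n$ is the space of $n$-tuples $(z_1,\dots,z_n)$ of distinct points of the open upper half plane, with its complex orientation. The vertex $k$ is placed at $z_k$, $L$ at $0$, $R$ at $1$, and for an edge $e$ from a vertex at $u$ to a vertex at $v$, $\varphi_e=\operatorname{Arg}\frac{v-u}{v-\bar u}$ (mod $2\pi$). These integrals converge absolutely. Then $$f\star g=\sum_{n\ge0}\sum_{\Gamma\in G_n}w_\Gamma B_\Gamma(f,g)$$ for polynomials $f,g$ on $\mathfrak g^*$. Since $\gamma$ is linear the sum is finite. The normalization is such that $a\star b-b\star a=[a,b]$ for $a,b\in\mathfrak g$. *)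

theory Defs
  imports "HOL-Analysis.Analysis" "HOL-Library.Poly_Mapping" "Jordan_Normal_Form.Determinant"
begin

section \<open>Lie algebras with a basis\<close>

definition lie_bracket :: "('g::real_vector \<Rightarrow> 'g \<Rightarrow> 'g) \<Rightarrow> bool" where
  "lie_bracket br \<longleftrightarrow> bilinear br \<and> (\<forall>x. br x x = 0) \<and>
     (\<forall>x y z. br x (br y z) + br y (br z x) + br z (br x y) = 0)"

text \<open>The basis is \<open>e 0, \<dots>, e (d - 1)\<close>; the case \<open>d = 0\<close> is allowed.\<close>

definition is_basis :: "nat \<Rightarrow> (nat \<Rightarrow> 'g::real_vector) \<Rightarrow> bool" where
  "is_basis d e \<longleftrightarrow> inj_on e {..<d} \<and> independent (e ` {..<d}) \<and> span (e ` {..<d}) = UNIV"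

definition coord :: "nat \<Rightarrow> (nat \<Rightarrow> 'g::real_vector) \<Rightarrow> nat \<Rightarrow> 'g \<Rightarrow> real" where
  "coord d e i x = representation (e ` {..<d}) x (e i)"

definition structure_const ::
    "('g::real_vector \<Rightarrow> 'g \<Rightarrow> 'g) \<Rightarrow> nat \<Rightarrow> (nat \<Rightarrow> 'g) \<Rightarrow> nat \<Rightarrow> nat \<Rightarrow> nat \<Rightarrow> real" where
  "structure_const br d e i j k = coord d e k (br (e i) (e j))"


section \<open>The symmetric algebra as an algebra of polynomials\<close>

type_synonym multi_index = "nat \<Rightarrow>\<^sub>0 nat"
type_synonym cpoly = "multi_index \<Rightarrow>\<^sub>0 complex"

definition multi_indices :: "nat \<Rightarrow> multi_index set" where
  "multi_indices d = {m. Poly_Mapping.keys m \<subseteq> {..<d}}"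

text \<open>
  The complexified symmetric algebra, as polynomials in the variables \<open>x\<^sub>i = e i\<close> for
  \<open>i < d\<close>.  Addition and multiplication are those of the type \<open>cpoly\<close> (a monoid algebra).
\<close>

definition Sym :: "nat \<Rightarrow> cpoly set" where
  "Sym d = {p. Poly_Mapping.keys p \<subseteq> multi_indices d}"

definition pconst :: "complex \<Rightarrow> cpoly" where
  "pconst c = Poly_Mapping.single 0 c"

definition pvar :: "nat \<Rightarrow> cpoly" where
  "pvar i = Poly_Mapping.single (Poly_Mapping.single i 1) 1"

definition pdiff :: "nat \<Rightarrow> cpoly \<Rightarrow> cpoly" where
  "pdiff i p = (\<Sum>m\<in>Poly_Mapping.keys p.
     Poly_Mapping.single (m - Poly_Mapping.single i 1)
       (of_nat (Poly_Mapping.lookup m i) * Poly_Mapping.lookup p m))"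


section \<open>Kontsevich's star product\<close>

text \<open>
  The vertices \<open>1, \<dots>, n\<close> are \<open>Inner 0, \<dots>, Inner (n - 1)\<close>.  The edge \<open>(k, a)\<close>, with
  \<open>a\<close> equal to \<open>0\<close> or \<open>1\<close>, is the first resp. second edge starting at \<open>Inner k\<close>.  A graph is
  the function sending each edge to its end point.
\<close>

datatype vertex = Inner nat | Left_Vertex | Right_Vertex

type_synonym kedge = "nat \<times> nat"

definition kedges :: "nat \<Rightarrow> kedge list" where
  "kedges n = List.product [0..<n] [0, 1]"

definition vertices :: "nat \<Rightarrow> vertex set" where
  "vertices n = Inner ` {..<n} \<union> {Left_Vertex, Right_Vertex}"

definition kgraphs :: "nat \<Rightarrow> (kedge \<Rightarrow> vertex) set" where
  "kgraphs n = {\<Gamma> \<in> set (kedges n) \<rightarrow>\<^sub>E vertices n.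
     \<forall>k<n. \<Gamma> (k, 0) \<noteq> Inner k \<and> \<Gamma> (k, 1) \<noteq> Inner k \<and> \<Gamma> (k, 0) \<noteq> \<Gamma> (k, 1)}"

definition kgamma :: "('g::real_vector \<Rightarrow> 'g \<Rightarrow> 'g) \<Rightarrow> nat \<Rightarrow> (nat \<Rightarrow> 'g) \<Rightarrow> nat \<Rightarrow> nat \<Rightarrow> cpoly" where
  "kgamma br d e i j =
     (\<Sum>k<d. pconst (complex_of_real (structure_const br d e i j k / 2)) * pvar k)"

definition pdiff_incoming ::
    "nat \<Rightarrow> (kedge \<Rightarrow> vertex) \<Rightarrow> (kedge \<Rightarrow> nat) \<Rightarrow> vertex \<Rightarrow> cpoly \<Rightarrow> cpoly" where
  "pdiff_incoming n \<Gamma> I v f = foldr (\<lambda>ed. pdiff (I ed)) (filter (\<lambda>ed. \<Gamma> ed = v) (kedges n)) f"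

definition graph_op ::
    "('g::real_vector \<Rightarrow> 'g \<Rightarrow> 'g) \<Rightarrow> nat \<Rightarrow> (nat \<Rightarrow> 'g) \<Rightarrow> nat \<Rightarrow> (kedge \<Rightarrow> vertex)
      \<Rightarrow> cpoly \<Rightarrow> cpoly \<Rightarrow> cpoly" where
  "graph_op br d e n \<Gamma> f g = (\<Sum>I \<in> set (kedges n) \<rightarrow>\<^sub>E {..<d}.
     (\<Prod>k<n. pdiff_incoming n \<Gamma> I (Inner k) (kgamma br d e (I (k, 0)) (I (k, 1))))
     * pdiff_incoming n \<Gamma> I Left_Vertex f * pdiff_incoming n \<Gamma> I Right_Vertex g)"

fun vertex_pos :: "(nat \<Rightarrow> complex) \<Rightarrow> vertex \<Rightarrow> complex" where
  "vertex_pos z (Inner k) = z k"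
| "vertex_pos z Left_Vertex = 0"
| "vertex_pos z Right_Vertex = 1"

text \<open>The angle \<open>\<phi>\<close> of an edge is \<open>Arg\<close> of the following ratio, taken modulo \<open>2\<pi>\<close>.\<close>

definition edge_ratio :: "(kedge \<Rightarrow> vertex) \<Rightarrow> kedge \<Rightarrow> (nat \<Rightarrow> complex) \<Rightarrow> complex" where
  "edge_ratio \<Gamma> ed z = (let u = z (fst ed); v = vertex_pos z (\<Gamma> ed) in (v - u) / (v - cnj u))"

text \<open>
  Derivative at \<open>0\<close> of the circle-valued function \<open>s \<mapsto> Arg (w s)\<close> (mod \<open>2\<pi>\<close>), computed with
  a real-valued lift \<open>\<theta>\<close>.  The derivative \<open>D\<close> does not depend on the lift: two lifts are continuous
  at \<open>0\<close> and differ by multiples of \<open>2\<pi>\<close>, hence by a constant near \<open>0\<close>.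
\<close>

definition angle_deriv :: "(real \<Rightarrow> complex) \<Rightarrow> real" where
  "angle_deriv w = (THE D. \<exists>\<theta>. (\<forall>\<^sub>F s in nhds 0. \<exists>m::int. \<theta> s = Arg (w s) + 2 * pi * of_int m)
     \<and> (\<theta> has_real_derivative D) (at 0))"

text \<open>
  The real coordinates of \<open>(z\<^sub>1, \<dots>, z\<^sub>n)\<close> in the order of the complex orientation
  \<open>dx\<^sub>1 \<and> dy\<^sub>1 \<and> \<dots> \<and> dx\<^sub>n \<and> dy\<^sub>n\<close>: the pair \<open>(k, 1)\<close> stands for \<open>Re z\<^sub>k\<close> and \<open>(k, \<i>)\<close> for \<open>Im z\<^sub>k\<close>.
\<close>

definition config_coords :: "nat \<Rightarrow> (nat \<times> complex) list" where
  "config_coords n = List.product [0..<n] [1, \<i>]"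

definition dangle :: "(kedge \<Rightarrow> vertex) \<Rightarrow> kedge \<Rightarrow> (nat \<times> complex) \<Rightarrow> (nat \<Rightarrow> complex) \<Rightarrow> real" where
  "dangle \<Gamma> ed c z = (case c of (k, u) \<Rightarrow>
     angle_deriv (\<lambda>s. edge_ratio \<Gamma> ed (z(k := z k + of_real s * u))))"

text \<open>
  The wedge product of the \<open>2n\<close> one-forms \<open>d\<phi>\<close>, in the order of \<^const>\<open>kedges\<close>, equals this Jacobian
  determinant times the volume form \<open>dx\<^sub>1 \<and> dy\<^sub>1 \<and> \<dots> \<and> dx\<^sub>n \<and> dy\<^sub>n\<close>.
\<close>

definition angle_jacobian :: "nat \<Rightarrow> (kedge \<Rightarrow> vertex) \<Rightarrow> (nat \<Rightarrow> complex) \<Rightarrow> real" where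
  "angle_jacobian n \<Gamma> z = Determinant.det (Matrix.mat (2 * n) (2 * n)
     (\<lambda>(i, j). dangle \<Gamma> (kedges n ! i) (config_coords n ! j) z))"

definition configs :: "nat \<Rightarrow> (nat \<Rightarrow> complex) set" where
  "configs n = {z \<in> {..<n} \<rightarrow>\<^sub>E {w. Im w > 0}. inj_on z {..<n}}"

definition weight :: "nat \<Rightarrow> (kedge \<Rightarrow> vertex) \<Rightarrow> real" where
  "weight n \<Gamma> = 1 / (fact n * (2 * pi) ^ (2 * n)) *
     (LINT z : configs n | Pi\<^sub>M {..<n} (\<lambda>_. lborel). angle_jacobian n \<Gamma> z)"

text \<open>
  \<^const>\<open>Sum_any\<close> is the sum over the \<open>n\<close> with nonzero term.  There are only finitely many: the
  graph operator vanishes for \<open>n > deg f + deg g\<close>, since \<^const>\<open>kgamma\<close> is linear.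
\<close>

definition star ::
    "('g::real_vector \<Rightarrow> 'g \<Rightarrow> 'g) \<Rightarrow> nat \<Rightarrow> (nat \<Rightarrow> 'g) \<Rightarrow> cpoly \<Rightarrow> cpoly \<Rightarrow> cpoly" where
  "star br d e f g = Sum_any (\<lambda>n. \<Sum>\<Gamma> \<in> kgraphs n.
     pconst (complex_of_real (weight n \<Gamma>)) * graph_op br d e n \<Gamma> f g)"


section \<open>Smooth functions and distributions supported at the origin\<close>

definition dir_deriv :: "'g::real_normed_vector \<Rightarrow> ('g \<Rightarrow> complex) \<Rightarrow> 'g \<Rightarrow> complex" where
  "dir_deriv v f x = vector_derivative (\<lambda>t. f (x + t *\<^sub>R v)) (at 0)"

primrec C_k_on :: "nat \<Rightarrow> 'g::real_normed_vector set \<Rightarrow> ('g \<Rightarrow> complex) \<Rightarrow> bool" where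
  "C_k_on 0 U f \<longleftrightarrow> continuous_on U f"
| "C_k_on (Suc k) U f \<longleftrightarrow> f differentiable_on U \<and> (\<forall>v. C_k_on k U (dir_deriv v f))"

definition smooth_near :: "'g::real_normed_vector \<Rightarrow> ('g \<Rightarrow> complex) \<Rightarrow> bool" where
  "smooth_near x f \<longleftrightarrow> (\<exists>U. open U \<and> x \<in> U \<and> (\<forall>k. C_k_on k U f))"

text \<open>The mixed partial derivative in the coordinates given by the basis.\<close>

definition mixed_deriv ::
    "nat \<Rightarrow> (nat \<Rightarrow> 'g::real_normed_vector) \<Rightarrow> multi_index \<Rightarrow> ('g \<Rightarrow> complex) \<Rightarrow> 'g \<Rightarrow> complex" where
  "mixed_deriv d e m f =
     foldr (\<lambda>i. dir_deriv (e i) ^^ Poly_Mapping.lookup m i) [0..<d] f"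

text \<open>
  The distribution supported at \<open>0\<close> that corresponds to \<open>r\<close>: the element \<open>e i\<close> gives
  \<open>f \<mapsto> d/dt f(t e\<^sub>i)\<close> at \<open>t = 0\<close> and products become convolutions, so a monomial gives the mixed
  partial derivative at \<open>0\<close>.  Such a distribution is regarded as a functional on all functions
  that are smooth in some neighbourhood of \<open>0\<close>, on which differential operators defined only
  near \<open>0\<close> act.
\<close>

definition distribution_of ::
    "nat \<Rightarrow> (nat \<Rightarrow> 'g::real_normed_vector) \<Rightarrow> cpoly \<Rightarrow> ('g \<Rightarrow> complex) \<Rightarrow> complex" where
  "distribution_of d e r = (\<lambda>f \<in> {f. smooth_near 0 f}.
     \<Sum>m\<in>Poly_Mapping.keys r. Poly_Mapping.lookup r m * mixed_deriv d e m f 0)"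


section \<open>Germs of differential operators with analytic coefficients\<close>

definition real_analytic_on ::
    "nat \<Rightarrow> (nat \<Rightarrow> 'g::real_normed_vector) \<Rightarrow> 'g set \<Rightarrow> ('g \<Rightarrow> complex) \<Rightarrow> bool" where
  "real_analytic_on d e U f \<longleftrightarrow> (\<forall>x\<in>U. \<exists>c :: multi_index \<Rightarrow> complex. \<forall>\<^sub>F y in nhds x.
     ((\<lambda>m. c m * (\<Prod>i<d. of_real (coord d e i (y - x)) ^ Poly_Mapping.lookup m i)) has_sum f y)
       (multi_indices d))"

type_synonym 'g operator = "('g \<Rightarrow> complex) \<Rightarrow> ('g \<Rightarrow> complex)"

text \<open>
  A representative \<open>P\<close> of a differential operator on \<open>U\<close> is only constrained by its values \<open>P f x\<close>
  at points \<open>x\<close> of \<open>U\<close> near which \<open>f\<close> is smooth.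
\<close>

definition analytic_diffop_on ::
    "nat \<Rightarrow> (nat \<Rightarrow> 'g::real_normed_vector) \<Rightarrow> 'g set \<Rightarrow> 'g operator \<Rightarrow> bool" where
  "analytic_diffop_on d e U P \<longleftrightarrow> (\<exists>M a. finite M \<and> M \<subseteq> multi_indices d
     \<and> (\<forall>m\<in>M. real_analytic_on d e U (a m))
     \<and> (\<forall>x\<in>U. \<forall>f. smooth_near x f \<longrightarrow> P f x = (\<Sum>m\<in>M. a m x * mixed_deriv d e m f x)))"

definition local_diffops :: "nat \<Rightarrow> (nat \<Rightarrow> 'g::real_normed_vector) \<Rightarrow> 'g operator set" where
  "local_diffops d e = {P. \<exists>U. open U \<and> 0 \<in> U \<and> analytic_diffop_on d e U P}"

definition diffop_germ_rel ::
    "nat \<Rightarrow> (nat \<Rightarrow> 'g::real_normed_vector) \<Rightarrow> ('g operator \<times> 'g operator) set" where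
  "diffop_germ_rel d e = {(P, Q). P \<in> local_diffops d e \<and> Q \<in> local_diffops d e
     \<and> (\<forall>\<^sub>F x in nhds 0. \<forall>f. smooth_near x f \<longrightarrow> P f x = Q f x)}"

definition diffop_germs :: "nat \<Rightarrow> (nat \<Rightarrow> 'g::real_normed_vector) \<Rightarrow> 'g operator set set" where
  "diffop_germs d e = local_diffops d e // diffop_germ_rel d e"

text \<open>
  For a distribution \<open>u\<close> supported at \<open>0\<close> the result does not depend on the representative of
  the germ, because \<open>u\<close> only sees its argument near \<open>0\<close>.
\<close>

definition right_act ::
    "(('g::real_normed_vector \<Rightarrow> complex) \<Rightarrow> complex) \<Rightarrow> 'g operator set
      \<Rightarrow> ('g \<Rightarrow> complex) \<Rightarrow> complex" where
  "right_act u D = (\<lambda>f \<in> {f. smooth_near 0 f}. u ((SOME P. P \<in> D) f))"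

end

theory Submission
  imports Defs
begin

text \<open>
  The operator is \<open>\<Sum>\<^sub>\<beta> a\<^sub>\<beta> \<partial>\<^sup>\<beta>\<close>.  Under the pairing of \<open>S\<close> with functions, the derivative
  \<open>\<partial>/\<partial>x\<^sub>i\<close> of a polynomial is dual to multiplication by the \<open>i\<close>-th coordinate on the Lie algebra, so a
  graph whose edges into \<open>L\<close> carry the labels \<open>\<alpha>\<close> contributes to the coefficients of \<open>x\<^sup>\<alpha>\<close> in the
  \<open>a\<^sub>\<beta>\<close>.  Counting degrees, \<open>\<beta>\<close> has degree at most \<open>deg p\<close> and the graph has at most
  \<open>\<bar>\<alpha>\<bar> + deg p\<close> inner vertices, so the only issue is the convergence of the \<open>a\<^sub>\<beta>\<close>.

  Since \<open>\<gamma>\<close> is linear, only graphs with at most one edge into each inner vertex matter, and with \<open>n\<close>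
  inner vertices there are at most \<open>9\<^sup>n n!\<close> of them.  It therefore suffices that the weight of such a
  graph is at most \<open>C\<^sup>n / n!\<close>.  Replacing angles by their tangents or cotangents, whichever is at most
  one in absolute value, the area formula bounds the integral by the volume of the target times the largest
  number of nondegenerate configurations with prescribed slopes.  These solve a polynomial
  system in which every variable occurs with bounded degree, because every inner vertex meets at most three
  edges, and an elementary Bezout-type argument bounds their number by \<open>C\<^sup>n\<close>.

  For uniqueness, the coefficients of an operator annihilated by all distributions supported at \<open>0\<close>
  vanish near \<open>0\<close>, by induction on the order: testing on \<open>x\<^sup>m\<close> isolates the coefficient of \<open>\<partial>\<^sup>m\<close>, and an
  analytic function whose derivatives at \<open>0\<close> all vanish is zero near \<open>0\<close>.
\<close>

section \<open>Volume and linear maps\<close>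

text \<open>The balance of factorials is exact: the number of graphs is \<open>n!\<close> up to an
  exponential factor, and the \<open>1 / n!\<close> of the weight uses this up, so the integral
  itself needs an exponential bound. That the angles are bounded says nothing, because the angle map
  may cover its target many times; the number of its sheets has to be controlled. Only nondegenerate
  preimages matter, and for these a count of dimensions of spaces of polynomials replaces
  intersection theory. Only an inequality of the area formula is needed. It is proved on small
  cubes, with an explicit measurable modulus of differentiability, by measuring one set of pairs
  (configuration, value) in two ways; no exceptional null sets appear. The constant is
  \<open>9216 = (2 * 8 * 6)\<^sup>2\<close>: each of the \<open>2 * n\<close> edges contributes 2
  for the choice of tangent or cotangent, 8 from the volumes of cubes, and 6 for three incident
  edges of degree two. The Lie algebra is a normed space with a finite basis, so the continuity of
  its coordinates is derived first; analytic functions are then handled by recentring power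
  series.\<close>

abbreviation real_space :: "nat \<Rightarrow> (nat \<Rightarrow> real) measure" where
  "real_space N \<equiv> Pi\<^sub>M {..<N} (\<lambda>_. lborel)"

definition lin :: "nat \<Rightarrow> real mat \<Rightarrow> (nat \<Rightarrow> real) \<Rightarrow> nat \<Rightarrow> real" where
  "lin N A x = (\<lambda>i\<in>{..<N}. \<Sum>j<N. A $$ (i, j) * x j)"

text \<open>The linear change of variables for nonnegative functions, with the determinant as a
  factor on the left so that nothing is divided in \<open>ennreal\<close>. In this form the property
  passes to products, and it is enough to know it for matrices that change a single
  coordinate.\<close>

definition transforms_volume :: "nat \<Rightarrow> real mat \<Rightarrow> bool" where
  "transforms_volume N A \<longleftrightarrow> A \<in> carrier_mat N N \<and> (\<forall>g \<in> borel_measurable (real_space N).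
     (\<integral>\<^sup>+x. g (lin N A x) \<partial>real_space N) * ennreal \<bar>Determinant.det A\<bar> = (\<integral>\<^sup>+x. g x \<partial>real_space N))"

lemma measurable_lin [measurable]: "lin N A \<in> real_space N \<rightarrow>\<^sub>M real_space N"
  unfolding lin_def by measurable

lemma lin_mult:
  assumes A: "A \<in> carrier_mat N N" and B: "B \<in> carrier_mat N N"
  shows "lin N (A * B) x = lin N A (lin N B x)"
proof
  fix i
  show "lin N (A * B) x i = lin N A (lin N B x) i"
  proof (cases "i < N")
    case True
    have "(\<Sum>j<N. (A * B) $$ (i, j) * x j) = (\<Sum>j<N. (\<Sum>k<N. A $$ (i, k) * B $$ (k, j)) * x j)"
      using True A B by (intro sum.cong) (auto simp: scalar_prod_def atLeast0LessThan)
    also have "\<dots> = (\<Sum>k<N. A $$ (i, k) * (\<Sum>j<N. B $$ (k, j) * x j))"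
      by (simp add: sum_distrib_left sum_distrib_right mult.assoc) (rule sum.swap)
    finally show ?thesis using True by (simp add: lin_def)
  qed (simp add: lin_def)
qed

lemma transforms_volume_mult:
  assumes A: "transforms_volume N A" and B: "transforms_volume N B"
  shows "transforms_volume N (A * B)"
  unfolding transforms_volume_def
proof (intro conjI ballI)
  have cA: "A \<in> carrier_mat N N" and cB: "B \<in> carrier_mat N N"
    using A B by (auto simp: transforms_volume_def)
  show "A * B \<in> carrier_mat N N" using cA cB by auto
  fix g :: "(nat \<Rightarrow> real) \<Rightarrow> ennreal" assume g[measurable]: "g \<in> borel_measurable (real_space N)"
  have "(\<lambda>x. g (lin N A x)) \<in> borel_measurable (real_space N)" by measurable
  then have *: "(\<integral>\<^sup>+x. g (lin N A (lin N B x)) \<partial>real_space N) * ennreal \<bar>Determinant.det B\<bar>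
      = (\<integral>\<^sup>+x. g (lin N A x) \<partial>real_space N)"
    using B unfolding transforms_volume_def by fastforce
  have "(\<integral>\<^sup>+x. g (lin N (A * B) x) \<partial>real_space N) * ennreal \<bar>Determinant.det (A * B)\<bar>
     = ((\<integral>\<^sup>+x. g (lin N A (lin N B x)) \<partial>real_space N) * ennreal \<bar>Determinant.det B\<bar>) * ennreal \<bar>Determinant.det A\<bar>"
    using cA cB by (simp add: lin_mult det_mult abs_mult ennreal_mult mult_ac)
  also have "\<dots> = (\<integral>\<^sup>+x. g x \<partial>real_space N)"
    using A g unfolding * transforms_volume_def by fastforce
  finally show "(\<integral>\<^sup>+x. g (lin N (A * B) x) \<partial>real_space N) * ennreal \<bar>Determinant.det (A * B)\<bar>
     = (\<integral>\<^sup>+x. g x \<partial>real_space N)" .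
qed

text \<open>A permutation other than the identity moves at least two indices, hence one different
  from \<open>k\<close>, and there the row of \<open>E\<close> vanishes off the diagonal. Only the
  identity contributes to the Leibniz sum.\<close>

lemma det_change_row:
  fixes E :: "real mat"
  assumes E: "E \<in> carrier_mat N N" and k: "k < N"
    and rows: "\<And>i j. i < N \<Longrightarrow> j < N \<Longrightarrow> i \<noteq> k \<Longrightarrow> E $$ (i, j) = (if i = j then 1 else 0)"
  shows "Determinant.det E = E $$ (k, k)"
proof -
  have zero: "(\<Prod>i = 0..<N. E $$ (i, p i)) = 0" if p: "p permutes {0..<N}" "p \<noteq> id" for p
  proof -
    obtain i where i: "p i \<noteq> i" using p(2) by (auto simp: fun_eq_iff)
    have iN: "i < N" using p(1) i unfolding permutes_def by auto
    have "\<exists>i<N. i \<noteq> k \<and> p i \<noteq> i"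
    proof (cases "i = k")
      case True
      have "p (p i) \<noteq> p i" using i p(1) by (metis permutes_inj inj_eq)
      moreover have "p i < N" using iN p(1) by (metis permutes_in_image atLeastLessThan_iff zero_le)
      ultimately show ?thesis using i True by auto
    qed (use i iN in auto)
    then obtain i where i: "i < N" "i \<noteq> k" "p i \<noteq> i" by auto
    have "p i < N" using i(1) p(1) by (metis permutes_in_image atLeastLessThan_iff zero_le)
    then have "E $$ (i, p i) = 0" using rows[of i "p i"] i by auto
    then show ?thesis using i(1) by auto
  qed
  have "Determinant.det E = (\<Sum>p\<in>{p. p permutes {0..<N}}. signof p * (\<Prod>i = 0..<N. E $$ (i, p i)))"
    by (rule det_def'[OF E])
  also have "\<dots> = (\<Sum>p\<in>{id}. signof p * (\<Prod>i = 0..<N. E $$ (i, p i)))"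
    by (intro sum.mono_neutral_right) (auto simp: permutes_id zero finite_permutations)
  also have "\<dots> = (\<Prod>i = 0..<N. E $$ (i, i))" by (simp add: sign_id)
  also have "\<dots> = (\<Prod>i\<in>{k}. E $$ (i, i))"
    using k rows by (intro prod.mono_neutral_right) auto
  finally show ?thesis by simp
qed

text \<open>By Tonelli the coordinate \<open>k\<close> can be integrated first. With the others
  frozen the map is affine in it with slope \<open>E $$ (k, k)\<close>, so this is substitution in
  one variable.\<close>

lemma transforms_volume_change_row:
  assumes E: "E \<in> carrier_mat N N" and k: "k < N"
    and rows: "\<And>i j. i < N \<Longrightarrow> j < N \<Longrightarrow> i \<noteq> k \<Longrightarrow> E $$ (i, j) = (if i = j then 1 else 0)"
    and nz: "E $$ (k, k) \<noteq> 0"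
  shows "transforms_volume N E"
  unfolding transforms_volume_def
proof (intro conjI ballI)
  show "E \<in> carrier_mat N N" by fact
  fix g :: "(nat \<Rightarrow> real) \<Rightarrow> ennreal" assume g[measurable]: "g \<in> borel_measurable (real_space N)"
  let ?I = "{..<N} - {k}" and ?c = "E $$ (k, k)"
  have I: "{..<N} = insert k ?I" using k by auto
  interpret product_sigma_finite "\<lambda>_::nat. lborel :: real measure" ..
  have split: "(\<integral>\<^sup>+x. f x \<partial>real_space N) = (\<integral>\<^sup>+x. (\<integral>\<^sup>+t. f (x(k := t)) \<partial>lborel) \<partial>Pi\<^sub>M ?I (\<lambda>_. lborel))"
    if "f \<in> borel_measurable (real_space N)" for f :: "(nat \<Rightarrow> real) \<Rightarrow> ennreal"
    using product_nn_integral_insert[of ?I k f] that I by simp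
  have inner: "(\<integral>\<^sup>+t. g (lin N E (x(k := t))) \<partial>lborel) * ennreal \<bar>?c\<bar> = (\<integral>\<^sup>+t. g (x(k := t)) \<partial>lborel)"
    if x: "x \<in> space (Pi\<^sub>M ?I (\<lambda>_. lborel))" for x
  proof -
    let ?b = "\<Sum>j\<in>?I. E $$ (k, j) * x j"
    have ext: "x i = undefined" if "i \<notin> ?I" for i using x that by (auto simp: space_PiM PiE_def extensional_def)
    have eq: "lin N E (x(k := t)) = x(k := ?b + ?c * t)" for t
    proof
      fix i
      consider "i \<ge> N" | "i = k" | "i < N" "i \<noteq> k" by linarith
      then show "lin N E (x(k := t)) i = (x(k := ?b + ?c * t)) i"
      proof cases
        case 1 then show ?thesis using k ext[of i] by (auto simp: lin_def)
      next
        case 2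
        have "(\<Sum>j<N. E $$ (k, j) * (x(k := t)) j) = ?c * t + (\<Sum>j\<in>?I. E $$ (k, j) * (x(k := t)) j)"
          using k by (subst sum.remove[of _ k]) auto
        also have "(\<Sum>j\<in>?I. E $$ (k, j) * (x(k := t)) j) = ?b" by (intro sum.cong) auto
        finally show ?thesis using k 2 by (simp add: lin_def)
      next
        case 3
        have "(\<Sum>j<N. E $$ (i, j) * (x(k := t)) j) = (\<Sum>j<N. if j = i then x i else 0)"
          using 3 rows by (intro sum.cong) auto
        then show ?thesis using 3 by (simp add: lin_def)
      qed
    qed
    have xk: "x(k := t) \<in> space (real_space N)" for t
      using x k by (auto simp: space_PiM PiE_def extensional_def)
    have m: "(\<lambda>t. g (x(k := t))) \<in> borel_measurable borel"
    proof -
      have "(\<lambda>t. x(k := t)) \<in> lborel \<rightarrow>\<^sub>M real_space N"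
      proof (rule measurable_PiM_single')
        show "(\<lambda>t. x(k := t)) \<in> space lborel \<rightarrow> (\<Pi>\<^sub>E i\<in>{..<N}. space lborel)"
          using xk by (simp add: space_PiM)
      qed auto
      from measurable_compose[OF this g] show ?thesis by simp
    qed
    show ?thesis
      unfolding eq using nn_integral_real_affine[OF m nz, of ?b] by (simp add: mult.commute)
  qed
  have meas: "(\<lambda>x. \<integral>\<^sup>+t. g (lin N E (x(k := t))) \<partial>lborel) \<in> borel_measurable (Pi\<^sub>M ?I (\<lambda>_. lborel))"
  proof -
    have "(\<lambda>(x, t). x(k := t)) \<in> Pi\<^sub>M ?I (\<lambda>_. lborel) \<Otimes>\<^sub>M lborel \<rightarrow>\<^sub>M real_space N"
      using measurable_add_dim[of k ?I "\<lambda>_. lborel :: real measure"] I by simp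
    from measurable_compose[OF measurable_compose[OF this measurable_lin[of N E]] g]
    have "(\<lambda>(x, t). g (lin N E (x(k := t)))) \<in> borel_measurable (Pi\<^sub>M ?I (\<lambda>_. lborel) \<Otimes>\<^sub>M lborel)"
      by (simp add: case_prod_beta)
    from lborel.borel_measurable_nn_integral[OF this] show ?thesis by simp
  qed
  have "(\<integral>\<^sup>+x. g (lin N E x) \<partial>real_space N) * ennreal \<bar>Determinant.det E\<bar>
      = (\<integral>\<^sup>+x. (\<integral>\<^sup>+t. g (lin N E (x(k := t))) \<partial>lborel) \<partial>Pi\<^sub>M ?I (\<lambda>_. lborel)) * ennreal \<bar>?c\<bar>"
    by (subst split) (auto simp: det_change_row[OF E k rows])
  also have "\<dots> = (\<integral>\<^sup>+x. (\<integral>\<^sup>+t. g (lin N E (x(k := t))) \<partial>lborel) * ennreal \<bar>?c\<bar> \<partial>Pi\<^sub>M ?I (\<lambda>_. lborel))"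
    by (rule nn_integral_multc[symmetric, OF meas])
  also have "\<dots> = (\<integral>\<^sup>+x. (\<integral>\<^sup>+t. g (x(k := t)) \<partial>lborel) \<partial>Pi\<^sub>M ?I (\<lambda>_. lborel))"
    by (intro nn_integral_cong inner)
  also have "\<dots> = (\<integral>\<^sup>+x. g x \<partial>real_space N)" by (rule split[symmetric, OF g])
  finally show "(\<integral>\<^sup>+x. g (lin N E x) \<partial>real_space N) * ennreal \<bar>Determinant.det E\<bar> = (\<integral>\<^sup>+x. g x \<partial>real_space N)" .
qed

lemma transforms_volume_one: "transforms_volume N (1\<^sub>m N)"
  unfolding transforms_volume_def
proof (intro conjI ballI)
  fix g :: "(nat \<Rightarrow> real) \<Rightarrow> ennreal" assume "g \<in> borel_measurable (real_space N)"
  have "lin N (1\<^sub>m N) x = x" if "x \<in> space (real_space N)" for x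
  proof
    fix i
    have "(\<Sum>j<N. 1\<^sub>m N $$ (i, j) * x j) = (\<Sum>j<N. if j = i then x i else 0)" if "i < N"
      using that by (intro sum.cong) auto
    then show "lin N (1\<^sub>m N) x i = x i"
      using that by (auto simp: lin_def space_PiM PiE_def extensional_def)
  qed
  then have "(\<integral>\<^sup>+x. g (lin N (1\<^sub>m N) x) \<partial>real_space N) = (\<integral>\<^sup>+x. g x \<partial>real_space N)"
    by (intro nn_integral_cong) auto
  then show "(\<integral>\<^sup>+x. g (lin N (1\<^sub>m N) x) \<partial>real_space N) * ennreal \<bar>Determinant.det (1\<^sub>m N :: real mat)\<bar>
     = (\<integral>\<^sup>+x. g x \<partial>real_space N)" by simp
qed auto

lemma transforms_volume_addrow:
  assumes A: "transforms_volume N A" and kl: "k < N" "l < N" "k \<noteq> l"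
  shows "transforms_volume N (addrow a k l A)"
proof -
  have "A \<in> carrier_mat N N" using A by (simp add: transforms_volume_def)
  then have "addrow a k l A = addrow_mat N a k l * A" by (rule addrow_mat) (use kl in auto)
  moreover have "transforms_volume N (addrow_mat N a k l)"
    by (rule transforms_volume_change_row[where k = k]) (use kl in auto)
  ultimately show ?thesis using A transforms_volume_mult by auto
qed

lemma transforms_volume_multrow:
  assumes A: "transforms_volume N A" and k: "k < N" and a: "a \<noteq> 0"
  shows "transforms_volume N (multrow k a A)"
proof -
  have "A \<in> carrier_mat N N" using A by (simp add: transforms_volume_def)
  then have "multrow k a A = multrow_mat N k a * A" by (rule multrow_mat)
  moreover have "transforms_volume N (multrow_mat N k a)"
    by (rule transforms_volume_change_row[where k = k]) (use k a in auto)
  ultimately show ?thesis using A transforms_volume_mult by auto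
qed

lemma transforms_volume_swaprows:
  assumes kl: "k < N" "l < N"
  shows "transforms_volume N (swaprows_mat N k l)"
proof (cases "k = l")
  case True
  then have "swaprows_mat N k l = (1\<^sub>m N :: real mat)" by (intro eq_matI) auto
  then show ?thesis using transforms_volume_one by simp
next
  case False
  \<comment> \<open>A transposition is three row additions and one change of sign:
    \<open>(x, y)\<close> becomes \<open>(x + y, y)\<close>, \<open>(x + y, - y)\<close>,
    \<open>(x + y, x)\<close>, \<open>(y, x)\<close>.\<close>
  have "swaprows_mat N k l
    = addrow (-1) k l (addrow 1 l k (multrow l (-1) (addrow 1 k l (1\<^sub>m N :: real mat))))"
    using False kl by (intro eq_matI) auto
  then show ?thesis
    using False kl
    by (simp add: transforms_volume_addrow transforms_volume_multrow transforms_volume_one)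
qed

text \<open>Induction on the number of leading rows that may differ from those of the identity. In
  the last of them a unit row with its 1 at a nonzero cofactor keeps the matrix invertible; this is
  \<open>A1\<close>. After an exchange of columns the induction hypothesis applies to it, and
  \<open>A = E * A1\<close> where \<open>E\<close> differs from the identity only in row
  \<open>k\<close>.\<close>

lemma transforms_volume_invertible:
  assumes A: "A \<in> carrier_mat N N" and det: "Determinant.det A \<noteq> 0"
  shows "transforms_volume N A"
proof -
  have "transforms_volume N A" if "k \<le> N" "A \<in> carrier_mat N N" "Determinant.det A \<noteq> 0"
    "\<And>i j. k \<le> i \<Longrightarrow> i < N \<Longrightarrow> j < N \<Longrightarrow> A $$ (i, j) = (if i = j then 1 else 0)" for k A
    using that
  proof (induction k arbitrary: A)
    case 0
    have "A = 1\<^sub>m N" by (intro eq_matI) (use 0 in auto)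
    then show ?case using transforms_volume_one by simp
  next
    case (Suc k)
    note cA = Suc.prems(2)
    have kN: "k < N" using Suc.prems by simp
    have "(\<Sum>j<N. A $$ (k, j) * cofactor A k j) \<noteq> 0"
      using laplace_expansion_row[OF cA kN] Suc.prems(3) by simp
    then obtain j where j: "j < N" and cof: "cofactor A k j \<noteq> 0"
      by (metis (no_types, lifting) sum.neutral lessThan_iff mult_zero_right)
    define A1 where "A1 = Matrix.mat N N (\<lambda>(i, l). if i = k then (if l = j then 1 else 0) else A $$ (i, l))"
    have c1: "A1 \<in> carrier_mat N N" by (simp add: A1_def)
    have "mat_delete A1 k l = mat_delete A k l" if "l < N" for l
      using cA that by (intro eq_matI) (auto simp: A1_def mat_delete_def)
    then have "det A1 = (\<Sum>l<N. (if l = j then 1 else 0) * cofactor A k l)"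
      using kN by (subst laplace_expansion_row[OF c1 kN], intro sum.cong) (auto simp: A1_def cofactor_def)
    also have "\<dots> = (\<Sum>l<N. if l = j then cofactor A k l else 0)" by (intro sum.cong) auto
    also have "\<dots> = cofactor A k j" using j by simp
    finally have det1: "det A1 \<noteq> 0" using cof by simp
    \<comment> \<open>The exchange of columns must leave the rows below \<open>k\<close> alone. A
      pivot \<open>j > k\<close> would repeat row \<open>j\<close>, which is already a row of the
      identity.\<close>
    have jk: "j \<le> k"
    proof (rule ccontr)
      assume "\<not> j \<le> k"
      then have "Matrix.row A1 k = Matrix.row A1 j" 
        using kN j c1 Suc.prems(4)[of j] by (intro eq_vecI) (auto simp: A1_def)
      then have "det A1 = 0" using det_identical_rows[OF c1, of k j] kN j \<open>\<not> j \<le> k\<close> by auto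
      then show False using det1 by simp
    qed
    define S :: "real mat" where "S = swaprows_mat N j k"
    have cS: "S \<in> carrier_mat N N" by (simp add: S_def)
    have SS: "S * S = 1\<^sub>m N"
    proof -
      have "S * S = swaprows j k S" unfolding S_def by (rule swaprows_mat[symmetric]) (use j kN in auto)
      also have "\<dots> = 1\<^sub>m N" unfolding S_def using j kN by (intro eq_matI) auto
      finally show ?thesis .
    qed
    define A2 where "A2 = A1 * S"
    have c2: "A2 \<in> carrier_mat N N" using c1 cS by (simp add: A2_def)
    have detS: "det S \<noteq> 0"
      using det_mult[OF cS cS] SS by auto
    have A2e: "A2 $$ (i, l) = A1 $$ (i, if l = j then k else if l = k then j else l)" if "i < N" "l < N" for i l
    proof -
      have "A2 $$ (i, l) = (\<Sum>m<N. A1 $$ (i, m) * S $$ (m, l))"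
        using that c1 cS by (auto simp: A2_def scalar_prod_def atLeast0LessThan)
      also have "\<dots> = (\<Sum>m<N. if m = (if l = j then k else if l = k then j else l) then A1 $$ (i, m) else 0)"
        using that j kN by (intro sum.cong) (auto simp: S_def)
      finally show ?thesis using that j kN by auto
    qed
    have "transforms_volume N A2"
    proof (rule Suc.IH)
      show "k \<le> N" using kN by simp
      show "A2 \<in> carrier_mat N N" by fact
      show "det A2 \<noteq> 0" using det1 detS det_mult[OF c1 cS] by (simp add: A2_def)
      fix i l assume il: "k \<le> i" "i < N" "l < N"
      show "A2 $$ (i, l) = (if i = l then 1 else 0)"
        using il jk Suc.prems(4)[of i] j kN unfolding A2e[OF il(2,3)] by (auto simp: A1_def)
    qed
    moreover have "A1 = A2 * S"
      using c1 cS SS by (simp add: A2_def)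
    ultimately have T1: "transforms_volume N A1"
      using transforms_volume_mult transforms_volume_swaprows[OF j kN] by (simp add: S_def)
    obtain B where B: "B \<in> carrier_mat N N" "A1 * B = 1\<^sub>m N" "B * A1 = 1\<^sub>m N"
    proof
      show "(1 / det A1) \<cdot>\<^sub>m adj_mat A1 \<in> carrier_mat N N" using adj_mat[OF c1] by auto
      have one: "(1 / det A1) \<cdot>\<^sub>m (det A1 \<cdot>\<^sub>m 1\<^sub>m N) = 1\<^sub>m N"
        using det1 by (intro eq_matI) auto
      show "A1 * ((1 / det A1) \<cdot>\<^sub>m adj_mat A1) = 1\<^sub>m N"
        by (subst mult_smult_distrib[of _ N N _ N]) (use adj_mat[OF c1] c1 one in auto)
      show "((1 / det A1) \<cdot>\<^sub>m adj_mat A1) * A1 = 1\<^sub>m N"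
        by (subst mult_smult_assoc_mat[of _ N N _ N]) (use adj_mat[OF c1] c1 one in auto)
    qed
    define E where "E = A * B"
    have cE: "E \<in> carrier_mat N N" using cA B by (simp add: E_def)
    have AE: "A = E * A1" using cA B c1 by (simp add: E_def)
    have rowE: "E $$ (i, l) = (if i = l then 1 else 0)" if "i < N" "l < N" "i \<noteq> k" for i l
    proof -
      have "Matrix.row A i = Matrix.row A1 i" using that cA by (intro eq_vecI) (auto simp: A1_def)
      moreover have "E $$ (i, l) = Matrix.row A i \<bullet> col B l" "(A1 * B) $$ (i, l) = Matrix.row A1 i \<bullet> col B l"
        using that cA c1 B(1) by (auto simp: E_def)
      ultimately have "E $$ (i, l) = (A1 * B) $$ (i, l)" by simp
      then show ?thesis using that by (simp add: B)
    qed
    have "det E \<noteq> 0" using AE det_mult[OF cE c1] Suc.prems(3) by auto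
    then have "E $$ (k, k) \<noteq> 0" using det_change_row[OF cE kN rowE] by simp
    then have "transforms_volume N E" using cE kN rowE by (intro transforms_volume_change_row[where k = k])
    then show ?case using T1 AE transforms_volume_mult by metis
  qed
  from this[of N A] show ?thesis using assms by auto
qed

text \<open>The set is the preimage under \<open>B\<close> of a cube of side \<open>2 * s\<close>.
  It is meant for the inverse \<open>B\<close> of a derivative, where the volume is that of the cube
  times the determinant of the derivative.\<close>

lemma emeasure_parallelepiped:
  fixes B :: "real mat"
  assumes B: "B \<in> carrier_mat N N" "Determinant.det B \<noteq> 0" and s: "s \<ge> 0"
  shows "emeasure (real_space N) {y \<in> space (real_space N). \<forall>i<N. \<bar>(\<Sum>j<N. B $$ (i, j) * y j) - c i\<bar> < s}
     * ennreal \<bar>Determinant.det B\<bar> = ennreal ((2 * s) ^ N)"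
proof -
  interpret product_sigma_finite "\<lambda>_::nat. lborel :: real measure" ..
  let ?Q = "Pi\<^sub>E {..<N} (\<lambda>i. {c i - s<..<c i + s})"
  have Q[measurable]: "?Q \<in> sets (real_space N)" by (intro sets_PiM_I_finite) auto
  have iff: "\<bar>a - b\<bar> < s \<longleftrightarrow> a \<in> {b - s<..<b + s}" for a b :: real by auto
  have "{y \<in> space (real_space N). \<forall>i<N. \<bar>(\<Sum>j<N. B $$ (i, j) * y j) - c i\<bar> < s}
     = lin N B -` ?Q \<inter> space (real_space N)"
    (is "?S = _")
  proof (rule Set.set_eqI)
    fix y
    have "lin N B y \<in> ?Q \<longleftrightarrow> (\<forall>i<N. \<bar>(\<Sum>j<N. B $$ (i, j) * y j) - c i\<bar> < s)"
    proof -
      have "lin N B y \<in> extensional {..<N}" by (simp add: lin_def)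
      moreover have "lin N B y i = (\<Sum>j<N. B $$ (i, j) * y j)" if "i < N" for i using that by (simp add: lin_def)
      ultimately show ?thesis unfolding iff PiE_iff Ball_def lessThan_iff by presburger
    qed
    then show "y \<in> ?S \<longleftrightarrow> y \<in> lin N B -` ?Q \<inter> space (real_space N)" by blast
  qed
  then have "emeasure (real_space N) {y \<in> space (real_space N). \<forall>i<N. \<bar>(\<Sum>j<N. B $$ (i, j) * y j) - c i\<bar> < s}
     = emeasure (real_space N) (lin N B -` ?Q \<inter> space (real_space N))" by (simp only:)
  also have "\<dots> = (\<integral>\<^sup>+x. indicator (lin N B -` ?Q \<inter> space (real_space N)) x \<partial>real_space N)"
    by (rule nn_integral_indicator[symmetric]) measurable
  also have "\<dots> = (\<integral>\<^sup>+x. indicator ?Q (lin N B x) \<partial>real_space N)"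
    by (intro nn_integral_cong) (simp only: indicator_def vimage_eq Int_iff simp_thms)
  finally have "emeasure (real_space N) {y \<in> space (real_space N). \<forall>i<N. \<bar>(\<Sum>j<N. B $$ (i, j) * y j) - c i\<bar> < s}
     * ennreal \<bar>Determinant.det B\<bar> = (\<integral>\<^sup>+x. indicator ?Q x \<partial>real_space N)"
    using transforms_volume_invertible[OF B] unfolding transforms_volume_def by fastforce
  also have "\<dots> = emeasure (real_space N) ?Q" by simp
  also have "\<dots> = (\<Prod>i<N. emeasure lborel {c i - s<..<c i + s})"
    by (rule emeasure_PiM) auto
  also have "\<dots> = ennreal ((2 * s) ^ N)" using s by (simp add: ennreal_power)
  finally show ?thesis .
qed

section \<open>Zeros of polynomial systems\<close>

text \<open>A bound on the degree in one coordinate at a time, for arbitrary values of the others.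
  No polynomial ring in several variables is involved: what counts is that such a function is
  determined by its values on a grid.\<close>

definition poly_in_coord :: "nat \<Rightarrow> nat \<Rightarrow> ((nat \<Rightarrow> real) \<Rightarrow> real) \<Rightarrow> bool" where
  "poly_in_coord j T f \<longleftrightarrow> (\<forall>x. \<exists>q. Polynomial.degree q \<le> T \<and> (\<forall>t. f (x(j := t)) = poly q t))"

lemma poly_in_coord_mono: "poly_in_coord j S f \<Longrightarrow> S \<le> T \<Longrightarrow> poly_in_coord j T f"
  unfolding poly_in_coord_def by (meson le_trans)

lemma poly_in_coord_const: "poly_in_coord j T (\<lambda>x. c)"
  unfolding poly_in_coord_def by (intro allI exI[of _ "[:c:]"]) auto

lemma poly_in_coord_coord: "T \<ge> 1 \<or> i \<noteq> j \<Longrightarrow> poly_in_coord j T (\<lambda>x. x i)"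
proof (cases "i = j")
  case True
  then show "T \<ge> 1 \<or> i \<noteq> j \<Longrightarrow> poly_in_coord j T (\<lambda>x. x i)"
    unfolding poly_in_coord_def by (intro allI exI[of _ "[:0, 1:]"]) auto
next
  case False
  then show "poly_in_coord j T (\<lambda>x. x i)"
    unfolding poly_in_coord_def by (intro allI, rule_tac x = "[:x i:]" in exI) auto
qed

lemma poly_in_coord_add:
  assumes "poly_in_coord j T f" "poly_in_coord j T g"
  shows "poly_in_coord j T (\<lambda>x. f x + g x)"
  unfolding poly_in_coord_def
proof
  fix x
  obtain p q where "Polynomial.degree p \<le> T" "\<And>t. f (x(j := t)) = poly p t"
    "Polynomial.degree q \<le> T" "\<And>t. g (x(j := t)) = poly q t"
    using assms unfolding poly_in_coord_def by meson
  then show "\<exists>q. Polynomial.degree q \<le> T \<and> (\<forall>t. f (x(j := t)) + g (x(j := t)) = poly q t)"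
    by (intro exI[of _ "p + q"]) (auto intro: degree_add_le)
qed

lemma poly_in_coord_mult:
  assumes "poly_in_coord j S f" "poly_in_coord j T g"
  shows "poly_in_coord j (S + T) (\<lambda>x. f x * g x)"
  unfolding poly_in_coord_def
proof
  fix x
  obtain p q where "Polynomial.degree p \<le> S" "\<And>t. f (x(j := t)) = poly p t"
    "Polynomial.degree q \<le> T" "\<And>t. g (x(j := t)) = poly q t"
    using assms unfolding poly_in_coord_def by meson
  then show "\<exists>q. Polynomial.degree q \<le> S + T \<and> (\<forall>t. f (x(j := t)) * g (x(j := t)) = poly q t)"
    by (intro exI[of _ "p * q"]) (auto intro: order_trans[OF degree_mult_le])
qed

lemma poly_in_coord_diff:
  assumes "poly_in_coord j T f" "poly_in_coord j T g"
  shows "poly_in_coord j T (\<lambda>x. f x - g x)"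
proof -
  have "poly_in_coord j (0 + T) (\<lambda>x. - 1 * g x)"
    by (intro poly_in_coord_mult poly_in_coord_const assms)
  then show ?thesis using poly_in_coord_add[OF assms(1), of "\<lambda>x. - 1 * g x"] by simp
qed

lemma poly_in_coord_power:
  assumes "poly_in_coord j T f"
  shows "poly_in_coord j (a * T) (\<lambda>x. f x ^ a)"
proof (induction a)
  case (Suc a)
  then show ?case using poly_in_coord_mult[OF assms Suc] by simp
qed (simp add: poly_in_coord_const)

lemma poly_in_coord_prod:
  assumes "\<And>i. i \<in> I \<Longrightarrow> poly_in_coord j (T i) (f i)"
  shows "poly_in_coord j (sum T I) (\<lambda>x. \<Prod>i\<in>I. f i x)"
  using assms
proof (induction I rule: infinite_finite_induct)
  case (insert i I)
  then show ?case using poly_in_coord_mult[of j "T i" "f i" "sum T I"] by simp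
qed (auto simp: poly_in_coord_const)

lemma poly_in_coord_sum:
  assumes "\<And>i. i \<in> I \<Longrightarrow> poly_in_coord j T (f i)"
  shows "poly_in_coord j T (\<lambda>x. \<Sum>i\<in>I. f i x)"
  using assms
  by (induction I rule: infinite_finite_induct) (auto simp: poly_in_coord_const intro: poly_in_coord_add)

text \<open>The coordinates are released from the grid one after another: in each of them a
  polynomial of degree at most \<open>T\<close> with \<open>T + 1\<close> roots vanishes.\<close>

lemma eq_zero_if_zero_on_grid:
  assumes f: "\<And>j. j < N \<Longrightarrow> poly_in_coord j T f"
    and grid: "\<And>x. x \<in> {..<N} \<rightarrow>\<^sub>E real ` {..T} \<Longrightarrow> f x = 0"
    and x: "x \<in> extensional {..<N}"
  shows "f x = 0"
proof -
  have "f x = 0" if "k \<le> N" "x \<in> extensional {..<N}" "\<And>j. k \<le> j \<Longrightarrow> j < N \<Longrightarrow> x j \<in> real ` {..T}" for k x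
    using that
  proof (induction k arbitrary: x)
    case 0
    then show ?case by (intro grid) (auto simp: PiE_iff)
  next
    case (Suc k)
    obtain q where q: "Polynomial.degree q \<le> T" "\<And>t. f (x(k := t)) = poly q t"
      using f[of k] Suc.prems unfolding poly_in_coord_def by (meson Suc_le_lessD)
    have "poly q t = 0" if "t \<in> real ` {..T}" for t
    proof -
      have "f (x(k := t)) = 0"
        by (rule Suc.IH) (use Suc.prems that in \<open>auto simp: extensional_def\<close>)
      then show ?thesis using q by simp
    qed
    then have sub: "real ` {..T} \<subseteq> {t. poly q t = 0}" by auto
    have "q = 0"
    proof (rule ccontr)
      assume "q \<noteq> 0"
      then have "card (real ` {..T}) \<le> card {t. poly q t = 0}"
        using sub poly_roots_finite by (intro card_mono) auto
      also have "\<dots> \<le> T" using card_poly_roots_bound[OF \<open>q \<noteq> 0\<close>] q(1) by simp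
      finally show False by (simp add: card_image)
    qed
    then show ?case using q(2)[of "x k"] by simp
  qed
  from this[of N x] show ?thesis using x by auto
qed

text \<open>Elimination: an unknown \<open>u0\<close> with nonzero coefficient in the equation
  \<open>v\<close> is removed together with \<open>v\<close>, and its value is recovered from
  \<open>v\<close> afterwards.\<close>

lemma underdetermined_system:
  fixes c :: "'u \<Rightarrow> 'v \<Rightarrow> 'a::field"
  assumes "finite V" "finite U" "card V < card U"
  shows "\<exists>l. (\<exists>u\<in>U. l u \<noteq> 0) \<and> (\<forall>v\<in>V. (\<Sum>u\<in>U. l u * c u v) = 0)"
  using assms
proof (induction V arbitrary: U c rule: finite_induct)
  case empty
  then have "U \<noteq> {}" by auto
  then show ?case by (intro exI[of _ "\<lambda>_. 1"]) auto
next
  case (insert v V)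
  show ?case
  proof (cases "\<forall>u\<in>U. c u v = 0")
    case True
    have "card V < card U" using insert by simp
    from insert.IH[OF insert.prems(1) this, of c] show ?thesis using True by auto
  next
    case False
    then obtain u0 where u0: "u0 \<in> U" "c u0 v \<noteq> 0" by auto
    have "card V < card (U - {u0})" using insert u0 by (simp add: card_Diff_singleton)
    from insert.IH[OF _ this, of "\<lambda>u w. c u w - c u v / c u0 v * c u0 w"] insert.prems
    obtain l where l: "\<exists>u\<in>U - {u0}. l u \<noteq> 0"
      "\<And>w. w \<in> V \<Longrightarrow> (\<Sum>u\<in>U - {u0}. l u * (c u w - c u v / c u0 v * c u0 w)) = 0" by auto
    define m where "m = - (\<Sum>u\<in>U - {u0}. l u * c u v) / c u0 v"
    have split: "(\<Sum>u\<in>U. (l(u0 := m)) u * c u w) = m * c u0 w + (\<Sum>u\<in>U - {u0}. l u * c u w)" for w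
    proof -
      have "(\<Sum>u\<in>U. (l(u0 := m)) u * c u w)
          = m * c u0 w + (\<Sum>u\<in>U - {u0}. (l(u0 := m)) u * c u w)"
        using u0 insert.prems by (simp add: sum.remove)
      also have "(\<Sum>u\<in>U - {u0}. (l(u0 := m)) u * c u w) = (\<Sum>u\<in>U - {u0}. l u * c u w)"
        by (intro sum.cong) auto
      finally show ?thesis .
    qed
    have "(\<Sum>u\<in>U. (l(u0 := m)) u * c u w) = 0" if "w \<in> insert v V" for w
    proof (cases "w = v")
      case True
      then show ?thesis unfolding split using u0 by (simp add: m_def)
    next
      case False
      then have "0 = (\<Sum>u\<in>U - {u0}. l u * (c u w - c u v / c u0 v * c u0 w))" using l(2) that by simp
      also have "\<dots> = (\<Sum>u\<in>U - {u0}. l u * c u w) - (\<Sum>u\<in>U - {u0}. l u * c u v) / c u0 v * c u0 w"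
        by (simp add: algebra_simps sum_subtractf sum_distrib_left sum_distrib_right sum_divide_distrib)
      finally show ?thesis using split[of w] unfolding m_def by simp
    qed
    then show ?thesis using l(1) by (intro exI[of _ "l(u0 := m)"]) auto
  qed
qed

text \<open>Sorted by powers of the last variable, the sum is a polynomial in one variable that
  vanishes identically for every choice of the others. Its coefficients are sums of the same kind
  with one variable fewer.\<close>

lemma monomials_independent:
  fixes m :: "(nat \<Rightarrow> nat) \<Rightarrow> real"
  assumes "\<And>w. (\<Sum>a\<in>{..<N} \<rightarrow>\<^sub>E {..k}. m a * (\<Prod>i<N. w i ^ a i)) = 0" "a \<in> {..<N} \<rightarrow>\<^sub>E {..k}"
  shows "m a = 0"
  using assms
proof (induction N arbitrary: m a)
  case (Suc N)
  let ?B = "{..<N} \<rightarrow>\<^sub>E {..k}"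
  have eq: "{..<Suc N} \<rightarrow>\<^sub>E {..k} = (\<lambda>(y, g). g(N := y)) ` ({..k} \<times> ?B)"
    using PiE_insert_eq[of N "{..<N}" "\<lambda>_. {..k}"] by (simp add: lessThan_Suc)
  have inj: "inj_on (\<lambda>(y, g). g(N := y)) ({..k} \<times> ?B)"
    by (rule inj_combinator) auto
  have sum_eq: "(\<Sum>y\<le>k. (\<Sum>g\<in>?B. m (g(N := y)) * (\<Prod>i<N. w i ^ g i)) * t ^ y) = 0" for w t
  proof -
    have "0 = (\<Sum>a\<in>{..<Suc N} \<rightarrow>\<^sub>E {..k}. m a * (\<Prod>i<Suc N. (w(N := t)) i ^ a i))"
      by (rule Suc.prems(1)[symmetric])
    also have "\<dots> = (\<Sum>(y, g)\<in>{..k} \<times> ?B. m (g(N := y)) * ((\<Prod>i<N. w i ^ g i) * t ^ y))"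
    proof -
      have "(\<Prod>i<Suc N. (w(N := t)) i ^ (g(N := y)) i) = (\<Prod>i<N. w i ^ g i) * t ^ y" for y and g :: "nat \<Rightarrow> nat"
      proof -
        have "(\<Prod>i<N. (w(N := t)) i ^ (g(N := y)) i) = (\<Prod>i<N. w i ^ g i)"
          by (intro prod.cong) auto
        then show ?thesis by simp
      qed
      then show ?thesis unfolding eq sum.reindex[OF inj] comp_def case_prod_beta by (simp only:)
    qed
    also have "\<dots> = (\<Sum>y\<le>k. (\<Sum>g\<in>?B. m (g(N := y)) * (\<Prod>i<N. w i ^ g i)) * t ^ y)"
      by (simp add: sum.cartesian_product[symmetric] sum_distrib_right mult.assoc)
    finally show ?thesis by simp
  qed
  have "(\<Sum>g\<in>?B. m (g(N := y)) * (\<Prod>i<N. w i ^ g i)) = 0" if "y \<le> k" for w y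
    using polyfun_eq_0[of "\<lambda>y. \<Sum>g\<in>?B. m (g(N := y)) * (\<Prod>i<N. w i ^ g i)" k] sum_eq that by auto
  note zero = this
  obtain y g where yg: "y \<le> k" "g \<in> ?B" "a = g(N := y)"
    using Suc.prems(2) unfolding eq by auto
  have "m (g(N := y)) = 0"
    by (rule Suc.IH[of "\<lambda>g. m (g(N := y))", OF zero[OF yg(1)] yg(2)])
  then show ?case by (simp only: yg(3))
qed simp

text \<open>The dimension count yields this inequality for every exponent bound \<open>k\<close>.
  After division by \<open>(k + 1) ^ N\<close> the summand \<open>M + 1\<close> disappears in the
  limit.\<close>

lemma finite_bound_from_powers:
  fixes M D N :: nat
  assumes "\<And>k. M * (k + 1) ^ N \<le> (k * D + M + 1) ^ N"
  shows "M \<le> D ^ N"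
proof -
  have "(\<lambda>k. ((real k * D + M + 1) / (real k + 1)) ^ N) \<longlonglongrightarrow> real D ^ N"
  proof (rule tendsto_power)
    have "(\<lambda>k. real D + (real M + 1 - real D) * inverse (real (Suc k))) \<longlonglongrightarrow> real D + (real M + 1 - real D) * 0"
      by (intro tendsto_intros LIMSEQ_inverse_real_of_nat)
    moreover have "(real k * D + M + 1) / (real k + 1) = real D + (real M + 1 - real D) * inverse (real (Suc k))" for k
      by (simp add: field_simps)
    ultimately show "(\<lambda>k. (real k * D + M + 1) / (real k + 1)) \<longlonglongrightarrow> real D" by simp
  qed
  moreover have "real M \<le> ((real k * D + M + 1) / (real k + 1)) ^ N" for k
  proof -
    have "real (M * (k + 1) ^ N) \<le> real ((k * D + M + 1) ^ N)" using assms of_nat_le_iff by blast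
    then have "real M * (real k + 1) ^ N \<le> (real k * D + M + 1) ^ N" by (simp add: add_ac)
    then show ?thesis by (simp add: power_divide field_simps)
  qed
  ultimately have "real M \<le> real D ^ N" by (intro LIMSEQ_le_const) auto
  then show ?thesis by (metis of_nat_le_iff of_nat_power)
qed

definition along :: "nat \<Rightarrow> (nat \<Rightarrow> real) \<Rightarrow> (nat \<Rightarrow> real) \<Rightarrow> real \<Rightarrow> nat \<Rightarrow> real" where
  "along N p v t = (\<lambda>j\<in>{..<N}. p j + t * v j)"

text \<open>Near a nondegenerate zero the \<open>f i\<close> behave like local coordinates, so the monomials in the
  \<open>f i\<close>, multiplied by functions that interpolate at the zeros, are linearly independent.
  Comparing their number with the dimension of a space of polynomials bounds the number of zeros.\<close>

lemma card_nondegenerate_zeros_le: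
  fixes f :: "nat \<Rightarrow> (nat \<Rightarrow> real) \<Rightarrow> real"
  assumes S: "finite S" "S \<subseteq> extensional {..<N}"
    and deg: "\<And>i j. i < N \<Longrightarrow> j < N \<Longrightarrow> poly_in_coord j (dg i j) (f i)"
    and D: "\<And>j. j < N \<Longrightarrow> (\<Sum>i<N. dg i j) \<le> D"
    and lim: "\<And>p v i. p \<in> S \<Longrightarrow> i < N \<Longrightarrow>
      ((\<lambda>t. f i (along N p v t) / t) \<longlongrightarrow> J p v i) (at_right 0)"
    and surj: "\<And>p w. p \<in> S \<Longrightarrow> \<exists>v. \<forall>i<N. J p v i = w i"
  shows "card S \<le> D ^ N"
proof (rule finite_bound_from_powers)
  fix k
  let ?A = "{..<N} \<rightarrow>\<^sub>E {..k}" and ?T = "k * D + card S"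
  let ?V = "{..<N} \<rightarrow>\<^sub>E real ` {..?T}"
  have finA: "finite ?A" by (intro finite_PiE) auto
  define sep where "sep p q = (SOME c. c < N \<and> p c \<noteq> q c)" for p q :: "nat \<Rightarrow> real"
  have sep: "sep p q < N \<and> p (sep p q) \<noteq> q (sep p q)" if "p \<in> S" "q \<in> S" "p \<noteq> q" for p q
  proof -
    have "\<exists>c<N. p c \<noteq> q c"
    proof (rule ccontr)
      assume "\<not> ?thesis"
      then have "p = q" using that S(2) by (intro extensionalityI[of _ "{..<N}"]) auto
      then show False using that by simp
    qed
    then show ?thesis unfolding sep_def by (rule someI_ex)
  qed
  \<comment> \<open>Interpolation at the zeros: \<open>g p\<close> is one at \<open>p\<close> and
    zero at the rest of \<open>S\<close>. Every factor is affine in a single coordinate, so the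
    degree in each coordinate is at most \<open>card S\<close>.\<close>
  define g where "g p x = (\<Prod>q\<in>S - {p}. (x (sep p q) - q (sep p q)) / (p (sep p q) - q (sep p q)))"
    for p x :: "nat \<Rightarrow> real"
  have g_at: "g p q = (if p = q then 1 else 0)" if "p \<in> S" "q \<in> S" for p q
  proof (cases "p = q")
    case True
    have "g p p = 1" unfolding g_def
    proof (intro prod.neutral ballI)
      fix q assume "q \<in> S - {p}"
      then have "p (sep p q) - q (sep p q) \<noteq> 0" using sep[of p q] that by auto
      then show "(p (sep p q) - q (sep p q)) / (p (sep p q) - q (sep p q)) = 1" by simp
    qed
    then show ?thesis using True by simp
  next
    case False
    have "g p q = 0" unfolding g_def
      by (rule prod_zero) (use False that S(1) in \<open>auto intro!: bexI[of _ q]\<close>)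
    then show ?thesis using False by simp
  qed
  have g_deg: "poly_in_coord j (card S) (g p)" for j p
  proof -
    have "poly_in_coord j (\<Sum>q\<in>S - {p}. 1) (\<lambda>x. \<Prod>q\<in>S - {p}. (x (sep p q) - q (sep p q)) / (p (sep p q) - q (sep p q)))"
    proof (rule poly_in_coord_prod)
      fix q
      have "poly_in_coord j (0 + 1) (\<lambda>x. 1 / (p (sep p q) - q (sep p q)) * (x (sep p q) - q (sep p q)))"
        by (intro poly_in_coord_mult poly_in_coord_diff poly_in_coord_const poly_in_coord_coord) auto
      then show "poly_in_coord j 1 (\<lambda>x. (x (sep p q) - q (sep p q)) / (p (sep p q) - q (sep p q)))" by simp
    qed
    moreover have "(\<Sum>q\<in>S - {p}. 1) \<le> card S" using S(1) by (simp add: card_mono)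
    ultimately show ?thesis unfolding g_def[abs_def] using poly_in_coord_mono by blast
  qed
  \<comment> \<open>There are \<open>card S * (k + 1) ^ N\<close> of these functions, while a
    function of degree at most \<open>?T\<close> in each coordinate is determined by its
    \<open>(?T + 1) ^ N\<close> values on the grid.\<close>
  define G where "G u x = g (fst u) x * (\<Prod>i<N. f i x ^ snd u i)" for u x
  have G_deg: "poly_in_coord j ?T (G u)" if j: "j < N" and u: "u \<in> S \<times> ?A" for j u
  proof -
    have "poly_in_coord j (\<Sum>i<N. snd u i * dg i j) (\<lambda>x. \<Prod>i<N. f i x ^ snd u i)"
    proof (rule poly_in_coord_prod)
      fix i assume "i \<in> {..<N}"
      then show "poly_in_coord j (snd u i * dg i j) (\<lambda>x. f i x ^ snd u i)"
        by (intro poly_in_coord_power deg j) simp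
    qed
    then have "poly_in_coord j (card S + (\<Sum>i<N. snd u i * dg i j)) (\<lambda>x. g (fst u) x * (\<Prod>i<N. f i x ^ snd u i))"
      by (rule poly_in_coord_mult[OF g_deg])
    moreover have "G u = (\<lambda>x. g (fst u) x * (\<Prod>i<N. f i x ^ snd u i))" by (rule ext) (rule G_def)
    ultimately have "poly_in_coord j (card S + (\<Sum>i<N. snd u i * dg i j)) (G u)" by (simp only:)
    moreover have "(\<Sum>i<N. snd u i * dg i j) \<le> (\<Sum>i<N. k * dg i j)"
    proof (rule sum_mono)
      fix i assume "i \<in> {..<N}"
      then have "snd u i \<le> k" using u PiE_mem[of "snd u" "{..<N}" "\<lambda>_. {..k}" i] by (simp add: mem_Times_iff)
      then show "snd u i * dg i j \<le> k * dg i j" by (rule mult_right_mono) simp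
    qed
    moreover have "(\<Sum>i<N. k * dg i j) \<le> k * D" using D[OF j] by (simp add: sum_distrib_left[symmetric])
    ultimately show ?thesis by (rule_tac poly_in_coord_mono) (assumption, linarith)
  qed
  \<comment> \<open>Among the terms with nonzero coefficient choose one of least order
    \<open>s\<close> in the \<open>f i\<close>, belonging to the zero \<open>p\<close>. On a line
    through \<open>p\<close>, division by \<open>t ^ s\<close> and the limit at 0 keep exactly the
    terms of order \<open>s\<close> that belong to \<open>p\<close>: the interpolating function of
    another zero vanishes at \<open>p\<close>, and higher orders retain a factor \<open>t\<close>.
    What remains is a polynomial in the entries of \<open>J p v\<close>, which take all values, so
    its coefficients vanish.\<close>
  have indep: "l u = 0" if l: "\<And>x. x \<in> extensional {..<N} \<Longrightarrow> (\<Sum>u\<in>S \<times> ?A. l u * G u x) = 0"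
    and u: "u \<in> S \<times> ?A" for l u
  proof (rule ccontr)
    define size where "size u = (\<Sum>i<N. snd u i)" for u :: "(nat \<Rightarrow> real) \<times> (nat \<Rightarrow> nat)"
    assume "l u \<noteq> 0"
    with u have "u \<in> S \<times> ?A \<and> l u \<noteq> 0" by blast
    from ex_has_least_nat[of "\<lambda>u. u \<in> S \<times> ?A \<and> l u \<noteq> 0", OF this, of size]
    obtain u0 where u0: "u0 \<in> S \<times> ?A" "l u0 \<noteq> 0"
      and min: "\<And>u'. u' \<in> S \<times> ?A \<Longrightarrow> l u' \<noteq> 0 \<Longrightarrow> size u0 \<le> size u'"
      by blast
    define p where "p = fst u0"
    define s where "s = size u0"
    have p: "p \<in> S" using u0(1) by (simp add: p_def mem_Times_iff)
    define L where "L v u = (if fst u = p \<and> size u = s then l u * (\<Prod>i<N. J p v i ^ snd u i) else 0)" for v u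
    have term_lim: "((\<lambda>t. l u * G u (along N p v t) / t ^ s) \<longlongrightarrow> L v u) (at_right 0)"
      if u: "u \<in> S \<times> ?A" for u v
    proof (cases "l u = 0")
      case True then show ?thesis by (simp add: L_def)
    next
      case False
      then have ge: "s \<le> size u" using min u by (simp add: s_def)
      have "((\<lambda>t. g (fst u) (along N p v t)) \<longlongrightarrow> (\<Prod>q\<in>S - {fst u}. (p (sep (fst u) q) + 0 * v (sep (fst u) q) - q (sep (fst u) q)) / (fst u (sep (fst u) q) - q (sep (fst u) q)))) (at_right 0)"
        unfolding g_def
      proof (intro tendsto_prod)
        fix q assume q: "q \<in> S - {fst u}"
        have sN: "sep (fst u) q < N" and ne: "fst u (sep (fst u) q) - q (sep (fst u) q) \<noteq> 0"
          using sep[of "fst u" q] q u by (auto simp: mem_Times_iff)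
        have "((\<lambda>t. (p (sep (fst u) q) + t * v (sep (fst u) q) - q (sep (fst u) q)) / (fst u (sep (fst u) q) - q (sep (fst u) q)))
          \<longlongrightarrow> (p (sep (fst u) q) + 0 * v (sep (fst u) q) - q (sep (fst u) q)) / (fst u (sep (fst u) q) - q (sep (fst u) q))) (at_right 0)"
          using ne by (intro tendsto_intros) auto
        then show "((\<lambda>t. (along N p v t (sep (fst u) q) - q (sep (fst u) q)) / (fst u (sep (fst u) q) - q (sep (fst u) q)))
          \<longlongrightarrow> (p (sep (fst u) q) + 0 * v (sep (fst u) q) - q (sep (fst u) q)) / (fst u (sep (fst u) q) - q (sep (fst u) q))) (at_right 0)"
          using sN by (simp add: along_def)
      qed
      also have "(\<Prod>q\<in>S - {fst u}. (p (sep (fst u) q) + 0 * v (sep (fst u) q) - q (sep (fst u) q)) / (fst u (sep (fst u) q) - q (sep (fst u) q))) = g (fst u) p"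
        by (simp add: g_def)
      also have "g (fst u) p = (if fst u = p then 1 else 0)"
        using u p by (intro g_at) (simp_all add: mem_Times_iff)
      finally have glim: "((\<lambda>t. g (fst u) (along N p v t)) \<longlongrightarrow> (if fst u = p then 1 else 0)) (at_right 0)" .
      \<comment> \<open>The factor \<open>0 ^ (size u - s)\<close> in the limit is one for the terms
        of order \<open>s\<close> and zero for those of higher order.\<close>
      have plim: "((\<lambda>t. t ^ (size u - s) * (\<Prod>i<N. (f i (along N p v t) / t) ^ snd u i))
         \<longlongrightarrow> 0 ^ (size u - s) * (\<Prod>i<N. J p v i ^ snd u i)) (at_right 0)"
        by (intro tendsto_mult tendsto_power tendsto_prod lim p tendsto_ident_at) auto
      have "((\<lambda>t. l u * (g (fst u) (along N p v t) * (t ^ (size u - s) * (\<Prod>i<N. (f i (along N p v t) / t) ^ snd u i))))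
         \<longlongrightarrow> l u * ((if fst u = p then 1 else 0) * (0 ^ (size u - s) * (\<Prod>i<N. J p v i ^ snd u i)))) (at_right 0)"
        by (intro tendsto_mult tendsto_const glim plim)
      also have "l u * ((if fst u = p then 1 else 0) * (0 ^ (size u - s) * (\<Prod>i<N. J p v i ^ snd u i))) = L v u"
      proof (cases "fst u = p \<and> size u \<noteq> s")
        case True
        then have "size u - s > 0" using ge by simp
        then show ?thesis using True by (simp add: L_def power_0_left)
      qed (simp add: L_def)
      finally show ?thesis
      proof (rule Lim_transform_eventually)
        have "l u * (g (fst u) (along N p v t) * (t ^ (size u - s) * (\<Prod>i<N. (f i (along N p v t) / t) ^ snd u i)))
          = l u * G u (along N p v t) / t ^ s" if t: "t > 0" for t
        proof -
          have "(\<Prod>i<N. (f i (along N p v t) / t) ^ snd u i) = (\<Prod>i<N. f i (along N p v t) ^ snd u i) / t ^ size u"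
            by (simp add: power_divide prod_dividef size_def power_sum)
          moreover have "t ^ size u = t ^ (size u - s) * t ^ s"
            using ge by (simp add: power_add[symmetric])
          ultimately show ?thesis using t by (simp add: G_def)
        qed
        then show "\<forall>\<^sub>F t in at_right 0. l u * (g (fst u) (along N p v t) * (t ^ (size u - s) * (\<Prod>i<N. (f i (along N p v t) / t) ^ snd u i)))
          = l u * G u (along N p v t) / t ^ s"
          by (auto simp: eventually_at_right_field intro: exI[of _ 1])
      qed
    qed
    have zero: "(\<Sum>u\<in>S \<times> ?A. L v u) = 0" for v
    proof (rule tendsto_unique[OF trivial_limit_at_right_real[of 0]])
      show "((\<lambda>t. \<Sum>u\<in>S \<times> ?A. l u * G u (along N p v t) / t ^ s) \<longlongrightarrow> (\<Sum>u\<in>S \<times> ?A. L v u)) (at_right 0)"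
        by (intro tendsto_sum term_lim)
      have "(\<Sum>u\<in>S \<times> ?A. l u * G u (along N p v t) / t ^ s) = 0" for t
        using l[of "along N p v t"] by (simp add: sum_divide_distrib[symmetric] along_def)
      then show "((\<lambda>t. \<Sum>u\<in>S \<times> ?A. l u * G u (along N p v t) / t ^ s) \<longlongrightarrow> 0) (at_right 0)" by simp
    qed
    define m where "m a = (if size (p, a) = s then l (p, a) else 0)" for a
    have "(\<Sum>a\<in>?A. m a * (\<Prod>i<N. w i ^ a i)) = 0" for w
    proof -
      obtain v where v: "\<And>i. i < N \<Longrightarrow> J p v i = w i" using surj[OF p, of w] by auto
      have "0 = (\<Sum>q\<in>S. \<Sum>a\<in>?A. L v (q, a))" using zero[of v] by (simp add: sum.cartesian_product)
      also have "\<dots> = (\<Sum>q\<in>{p}. \<Sum>a\<in>?A. L v (q, a))"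
        using p S(1) by (intro sum.mono_neutral_right) (simp_all add: L_def)
      also have "\<dots> = (\<Sum>a\<in>?A. m a * (\<Prod>i<N. w i ^ a i))"
      proof -
        have "(\<Prod>i<N. J p v i ^ a i) = (\<Prod>i<N. w i ^ a i)" for a :: "nat \<Rightarrow> nat"
          using v by (intro prod.cong) auto
        then have "L v (p, a) = m a * (\<Prod>i<N. w i ^ a i)" for a by (simp add: L_def m_def)
        then show ?thesis by simp
      qed
      finally show ?thesis by simp
    qed
    then have "m (snd u0) = 0" by (rule monomials_independent) (use u0 in \<open>simp add: mem_Times_iff\<close>)
    then show False using u0(2) by (simp add: m_def s_def p_def)
  qed
  \<comment> \<open>With more functions than grid points, some nontrivial combination would vanish
    on the grid, hence everywhere, against the independence.\<close>
  have "card (S \<times> ?A) \<le> card ?V"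
  proof (rule ccontr)
    assume "\<not> ?thesis"
    then have "card ?V < card (S \<times> ?A)" by simp
    moreover have "finite ?V" by (intro finite_PiE) auto
    ultimately obtain l where l: "\<exists>u\<in>S \<times> ?A. l u \<noteq> 0" "\<forall>x\<in>?V. (\<Sum>u\<in>S \<times> ?A. l u * G u x) = 0"
      using underdetermined_system[of ?V "S \<times> ?A" "\<lambda>u x. G u x"] finite_cartesian_product[OF S(1) finA]
      by blast
    have "(\<Sum>u\<in>S \<times> ?A. l u * G u x) = 0" if "x \<in> extensional {..<N}" for x
    proof (rule eq_zero_if_zero_on_grid[where N = N and T = ?T and f = "\<lambda>x. \<Sum>u\<in>S \<times> ?A. l u * G u x"])
      fix j assume j: "j < N"
      have "poly_in_coord j (0 + ?T) (\<lambda>x. l u * G u x)" if "u \<in> S \<times> ?A" for u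
        by (intro poly_in_coord_mult poly_in_coord_const G_deg j that)
      then show "poly_in_coord j ?T (\<lambda>x. \<Sum>u\<in>S \<times> ?A. l u * G u x)"
        by (intro poly_in_coord_sum) auto
    next
      show "(\<Sum>u\<in>S \<times> ?A. l u * G u x) = 0" if "x \<in> ?V" for x using l(2) that by blast
    qed (rule that)
    then show False using indep l(1) by blast
  qed
  moreover have "card (real ` {..?T}) = ?T + 1" by (simp add: card_image)
  ultimately show "card S * (k + 1) ^ N \<le> (k * D + card S + 1) ^ N"
    by (simp add: card_cartesian_product card_PiE)
qed

section \<open>The area inequality\<close>

definition fmat :: "nat \<Rightarrow> (nat \<Rightarrow> nat \<Rightarrow> real) \<Rightarrow> real mat" where
  "fmat N a = Matrix.mat N N (\<lambda>(i, j). a i j)"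

text \<open>Cramer's rule. As an explicit rational expression in the entries it is measurable in
  every parameter on which they depend measurably.\<close>

definition finv :: "nat \<Rightarrow> (nat \<Rightarrow> nat \<Rightarrow> real) \<Rightarrow> nat \<Rightarrow> nat \<Rightarrow> real" where
  "finv N a i j = cofactor (fmat N a) j i / Determinant.det (fmat N a)"

lemma fmat_carrier [simp]: "fmat N a \<in> carrier_mat N N"
  by (simp add: fmat_def)

lemma fmat_index [simp]: "i < N \<Longrightarrow> j < N \<Longrightarrow> fmat N a $$ (i, j) = a i j"
  by (simp add: fmat_def)

lemma det_fmat: "Determinant.det (fmat N a) = (\<Sum>p\<in>{p. p permutes {0..<N}}. signof p * (\<Prod>i = 0..<N. a i (p i)))"
  unfolding det_def'[OF fmat_carrier]
proof (intro sum.cong refl arg_cong2[where f = "(*)"] prod.cong)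
  fix p i assume "p \<in> {p. p permutes {0..<N}}" "i \<in> {0..<N}"
  then have "p i < N" "i < N" by (auto dest: permutes_in_image[where x = i])
  then show "fmat N a $$ (i, p i) = a i (p i)" by simp
qed

lemma borel_measurable_det [measurable]:
  assumes "\<And>i j. i < N \<Longrightarrow> j < N \<Longrightarrow> a i j \<in> borel_measurable M"
  shows "(\<lambda>x. Determinant.det (fmat N (\<lambda>i j. a i j x))) \<in> borel_measurable M"
  unfolding det_fmat
proof (intro borel_measurable_sum borel_measurable_times borel_measurable_const borel_measurable_prod)
  fix p i assume "p \<in> {p. p permutes {0..<N}}" "i \<in> {0..<N}"
  then have "p i < N" "i < N" by (auto dest: permutes_in_image[where x = i])
  then show "(\<lambda>x. a i (p i) x) \<in> borel_measurable M" using assms by blast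
qed

lemma borel_measurable_finv [measurable]:
  assumes a: "\<And>i j. i < N \<Longrightarrow> j < N \<Longrightarrow> a i j \<in> borel_measurable M" and ij: "i < N" "j < N"
  shows "(\<lambda>x. finv N (\<lambda>i j. a i j x) i j) \<in> borel_measurable M"
proof -
  let ?s = "\<lambda>k l. if l < k then l else Suc l"
  have del: "mat_delete (fmat N b) j i = fmat (N - 1) (\<lambda>k l. b (?s j k) (?s i l))" for b
    unfolding mat_delete_def by (intro eq_matI) (auto simp: fmat_def)
  have m: "(\<lambda>x. Determinant.det (fmat (N - 1) (\<lambda>k l. a (?s j k) (?s i l) x))) \<in> borel_measurable M"
    by (rule borel_measurable_det[where a = "\<lambda>k l. a (?s j k) (?s i l)"]) (auto intro!: a)
  show ?thesis
    unfolding finv_def cofactor_def del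
    by (intro borel_measurable_divide borel_measurable_times borel_measurable_const m borel_measurable_det a)
qed

lemma index_mult_mat_sum:
  assumes "A \<in> carrier_mat N N" "B \<in> carrier_mat N N" "i < N" "j < N"
  shows "(A * B) $$ (i, j) = (\<Sum>k<N. A $$ (i, k) * B $$ (k, j))"
  using assms by (auto simp: scalar_prod_def atLeast0LessThan intro!: sum.cong)

lemma finv_left:
  assumes "Determinant.det (fmat N a) \<noteq> 0" "i < N" "j < N"
  shows "(\<Sum>k<N. finv N a i k * a k j) = (if i = j then 1 else 0)" (is "?s = _")
proof -
  have "(adj_mat (fmat N a) * fmat N a) $$ (i, j) = (\<Sum>k<N. cofactor (fmat N a) k i * a k j)"
    using assms adj_mat(1)[OF fmat_carrier, of N a]
    by (subst index_mult_mat_sum[of _ N]) (auto simp: adj_mat_def fmat_def intro!: sum.cong)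
  moreover have "(adj_mat (fmat N a) * fmat N a) $$ (i, j) = (if i = j then Determinant.det (fmat N a) else 0)"
    unfolding adj_mat(2,3)[OF fmat_carrier] using assms by simp
  ultimately have "?s = (if i = j then Determinant.det (fmat N a) else 0) / Determinant.det (fmat N a)"
    by (simp add: finv_def sum_divide_distrib)
  then show ?thesis using assms(1) by simp
qed

lemma finv_right:
  assumes "Determinant.det (fmat N a) \<noteq> 0" "i < N" "j < N"
  shows "(\<Sum>k<N. a i k * finv N a k j) = (if i = j then 1 else 0)" (is "?s = _")
proof -
  have "(fmat N a * adj_mat (fmat N a)) $$ (i, j) = (\<Sum>k<N. a i k * cofactor (fmat N a) j k)"
    using assms adj_mat(1)[OF fmat_carrier, of N a]
    by (subst index_mult_mat_sum[of _ N]) (auto simp: adj_mat_def fmat_def intro!: sum.cong)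
  moreover have "(fmat N a * adj_mat (fmat N a)) $$ (i, j) = (if i = j then Determinant.det (fmat N a) else 0)"
    unfolding adj_mat(2,3)[OF fmat_carrier] using assms by simp
  ultimately have "?s = (if i = j then Determinant.det (fmat N a) else 0) / Determinant.det (fmat N a)"
    by (simp add: finv_def sum_divide_distrib)
  then show ?thesis using assms(1) by simp
qed

lemma sum_delta_mult: "i < (N::nat) \<Longrightarrow> (\<Sum>j<N. (if i = j then 1 else 0) * (v j :: real)) = v i"
proof -
  assume "i < N"
  moreover have "(\<Sum>j<N. (if i = j then 1 else 0) * v j) = (\<Sum>j<N. if j = i then v i else 0)"
    by (intro sum.cong) auto
  ultimately show ?thesis by simp
qed

lemma matvec_assoc: "(\<Sum>k<N. b i k * (\<Sum>j<N. a k j * v j)) = (\<Sum>j<N. (\<Sum>k<N. b i k * a k j) * (v j :: real))"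
  by (simp add: sum_distrib_left sum_distrib_right mult.assoc) (rule sum.swap)

lemma finv_left_vec:
  assumes "Determinant.det (fmat N a) \<noteq> 0" "i < N"
  shows "(\<Sum>k<N. finv N a i k * (\<Sum>j<N. a k j * v j)) = v i"
  unfolding matvec_assoc using assms finv_left[OF assms] by (simp add: sum_delta_mult)

lemma finv_right_vec:
  assumes "Determinant.det (fmat N a) \<noteq> 0" "i < N"
  shows "(\<Sum>k<N. a i k * (\<Sum>j<N. finv N a k j * v j)) = v i"
  unfolding matvec_assoc using assms finv_right[OF assms] by (simp add: sum_delta_mult)

lemma det_finv:
  assumes "Determinant.det (fmat N a) \<noteq> 0"
  shows "Determinant.det (fmat N (finv N a)) = 1 / Determinant.det (fmat N a)"
proof -
  have "fmat N (finv N a) * fmat N a = 1\<^sub>m N"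
  proof (rule eq_matI)
    fix i j assume "i < dim_row (1\<^sub>m N :: real mat)" "j < dim_col (1\<^sub>m N :: real mat)"
    then show "(fmat N (finv N a) * fmat N a) $$ (i, j) = 1\<^sub>m N $$ (i, j)"
      using finv_left[OF assms, of i j] by (subst index_mult_mat_sum[of _ N]) auto
  qed (simp_all add: fmat_def)
  then have "Determinant.det (fmat N (finv N a)) * Determinant.det (fmat N a) = 1"
    using det_mult[OF fmat_carrier fmat_carrier, of N "finv N a" a] by simp
  then show ?thesis using assms by (simp add: field_simps)
qed

lemma det_fmat_nonzeroI:
  assumes "\<And>v. (\<And>i. i < N \<Longrightarrow> (\<Sum>j<N. a i j * v j) = 0) \<Longrightarrow> (\<And>i. i < N \<Longrightarrow> v i = 0)"
  shows "Determinant.det (fmat N a) \<noteq> 0"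
proof
  assume "Determinant.det (fmat N a) = 0"
  then obtain v where v: "v \<in> carrier_vec N" "v \<noteq> 0\<^sub>v N" "fmat N a *\<^sub>v v = 0\<^sub>v N"
    using det_0_iff_vec_prod_zero_field[OF fmat_carrier] by blast
  have "(\<Sum>j<N. a i j * v $ j) = 0" if "i < N" for i
  proof -
    have "(fmat N a *\<^sub>v v) $ i = (\<Sum>j<N. a i j * v $ j)"
      using that v(1) by (auto simp: fmat_def scalar_prod_def atLeast0LessThan)
    then show ?thesis using v(3) that by simp
  qed
  then have "v $ i = 0" if "i < N" for i using assms[of "\<lambda>i. v $ i" i] that by blast
  then have "v = 0\<^sub>v N" using v(1) by (intro eq_vecI) auto
  then show False using v(2) by simp
qed

text \<open>A crude substitute for the operator norm with respect to the maximum norm, see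
  \<open>matvec_bound\<close>.\<close>

definition entry_sum :: "nat \<Rightarrow> (nat \<Rightarrow> nat \<Rightarrow> real) \<Rightarrow> real" where
  "entry_sum N a = (\<Sum>i<N. \<Sum>j<N. \<bar>a i j\<bar>)"

lemma entry_sum_nonneg: "entry_sum N a \<ge> 0"
  by (auto simp: entry_sum_def intro!: sum_nonneg)

lemma matvec_bound:
  assumes "i < N" "\<And>j. j < N \<Longrightarrow> \<bar>v j\<bar> \<le> m" "m \<ge> 0"
  shows "\<bar>\<Sum>j<N. a i j * v j\<bar> \<le> entry_sum N a * m"
proof -
  have "\<bar>\<Sum>j<N. a i j * v j\<bar> \<le> (\<Sum>j<N. \<bar>a i j\<bar> * m)"
    by (rule order_trans[OF sum_abs]) (auto simp: abs_mult intro!: sum_mono mult_left_mono assms)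
  also have "\<dots> \<le> (\<Sum>i<N. \<Sum>j<N. \<bar>a i j\<bar> * m)"
    using assms by (intro member_le_sum) (auto intro!: sum_nonneg)
  finally show ?thesis by (simp add: entry_sum_def sum_distrib_right)
qed

section \<open>Cubes and local solvability by Newton's iteration\<close>

definition cube :: "nat \<Rightarrow> (nat \<Rightarrow> real) \<Rightarrow> real \<Rightarrow> (nat \<Rightarrow> real) set" where
  "cube N p r = {x \<in> extensional {..<N}. \<forall>j<N. \<bar>x j - p j\<bar> \<le> r}"

text \<open>Newton's iteration with the frozen inverse derivative \<open>b\<close> is a contraction of the cube.\<close>

lemma newton_zero:
  fixes F :: "nat \<Rightarrow> (nat \<Rightarrow> real) \<Rightarrow> real"
  assumes x: "x \<in> extensional {..<N}" and r: "r > 0" and eta: "eta \<ge> 0"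
    and approx: "\<And>u v m i. u \<in> cube N x r \<Longrightarrow> v \<in> cube N x r \<Longrightarrow> i < N \<Longrightarrow> m \<ge> 0 \<Longrightarrow>
      (\<And>j. j < N \<Longrightarrow> \<bar>u j - v j\<bar> \<le> m) \<Longrightarrow>
      \<bar>F i u - F i v - (\<Sum>j<N. a i j * (u j - v j))\<bar> \<le> eta * m"
    and det: "Determinant.det (fmat N a) \<noteq> 0"
    and small: "entry_sum N (finv N a) * eta \<le> 1 / 2"
    and y: "\<And>i. i < N \<Longrightarrow> \<bar>\<Sum>j<N. finv N a i j * (y j - F j x)\<bar> \<le> r / 2"
  obtains p where "p \<in> cube N x r" "\<And>i. i < N \<Longrightarrow> F i p = y i"
proof -
  let ?b = "finv N a"
  define G where "G u = (\<lambda>i\<in>{..<N}. u i - (\<Sum>j<N. ?b i j * (F j u - y j)))" for u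
  have contr: "\<bar>G u i - G v i\<bar> \<le> m / 2"
    if uv: "u \<in> cube N x r" "v \<in> cube N x r" and m: "m \<ge> 0" "\<And>j. j < N \<Longrightarrow> \<bar>u j - v j\<bar> \<le> m" and i: "i < N" for u v m i
  proof -
    let ?e = "\<lambda>k. F k u - F k v - (\<Sum>j<N. a k j * (u j - v j))"
    have "(\<Sum>k<N. ?b i k * ?e k) = (\<Sum>k<N. ?b i k * (F k u - F k v)) - (\<Sum>k<N. ?b i k * (\<Sum>j<N. a k j * (u j - v j)))"
      by (simp add: right_diff_distrib sum_subtractf)
    also have "(\<Sum>k<N. ?b i k * (\<Sum>j<N. a k j * (u j - v j))) = u i - v i"
      by (rule finv_left_vec[OF det i])
    finally have "G u i - G v i = - (\<Sum>k<N. ?b i k * ?e k)"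
      using i by (simp add: G_def algebra_simps sum_subtractf)
    also have "\<bar>\<dots>\<bar> \<le> entry_sum N ?b * (eta * m)"
      unfolding abs_minus_cancel
      by (rule matvec_bound[OF i]) (use approx[OF uv _ m] m eta in auto)
    also have "\<dots> \<le> 1 / 2 * m"
      using small m(1) by (simp only: mult.assoc[symmetric]) (rule mult_right_mono)
    finally show ?thesis by simp
  qed
  have Gx: "\<bar>G x i - x i\<bar> \<le> r / 2" if "i < N" for i
  proof -
    have "G x i - x i = (\<Sum>j<N. ?b i j * (y j - F j x))"
      using that by (simp add: G_def algebra_simps sum_subtractf)
    then show ?thesis using y[OF that] by simp
  qed
  have xc: "x \<in> cube N x r" using x r by (auto simp: cube_def)
  \<comment> \<open>The centre moves by at most \<open>r / 2\<close>, and the image of any other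
    point stays within \<open>r / 2\<close> of the image of the centre.\<close>
  have Gc: "G u \<in> cube N x r" if u: "u \<in> cube N x r" for u
  proof -
    have "\<bar>G u i - x i\<bar> \<le> r" if i: "i < N" for i
    proof -
      have "\<bar>G u i - G x i\<bar> \<le> r / 2"
        by (rule contr[OF u xc _ _ i]) (use u r in \<open>auto simp: cube_def\<close>)
      then show ?thesis using Gx[OF i] by linarith
    qed
    then show ?thesis by (auto simp: cube_def G_def)
  qed
  define s where "s n = (G ^^ n) x" for n
  have s_Suc: "s (Suc n) = G (s n)" for n by (simp add: s_def)
  have sc: "s n \<in> cube N x r" for n
    by (induction n) (use xc Gc in \<open>auto simp: s_def\<close>)
  have step: "\<bar>s (Suc n) i - s n i\<bar> \<le> r * (1 / 2) ^ n" if "i < N" for n i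
    using that
  proof (induction n arbitrary: i)
    case 0
    then show ?case using Gx[of i] r by (simp add: s_def)
  next
    case (Suc n)
    have "\<bar>G (s (Suc n)) i - G (s n) i\<bar> \<le> r * (1 / 2) ^ n / 2"
      by (rule contr[OF sc sc]) (use Suc r in auto)
    then show ?case by (simp add: s_Suc)
  qed
  have conv: "convergent (\<lambda>n. s n i)" if "i < N" for i
  proof -
    have "summable (\<lambda>n. s (Suc n) i - s n i)"
      by (rule summable_comparison_test'[where g = "\<lambda>n. r * (1 / 2) ^ n" and N = 0])
        (use step[OF that] in \<open>auto intro!: summable_mult summable_geometric\<close>)
    then have "convergent (\<lambda>n. \<Sum>k<n. s (Suc k) i - s k i)"
      by (simp add: summable_iff_convergent)
    then have "convergent (\<lambda>n. s 0 i + (\<Sum>k<n. s (Suc k) i - s k i))"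
      by (intro convergent_add convergent_const)
    moreover have "s 0 i + (\<Sum>k<n. s (Suc k) i - s k i) = s n i" for n
      by (subst sum_lessThan_telescope[of "\<lambda>n. s n i"]) simp
    ultimately show ?thesis by simp
  qed
  define p where "p = (\<lambda>i\<in>{..<N}. lim (\<lambda>n. s n i))"
  have lim: "(\<lambda>n. s n i) \<longlonglongrightarrow> p i" if "i < N" for i
    using conv[OF that] that by (simp add: p_def convergent_LIMSEQ_iff)
  have pc: "p \<in> cube N x r"
  proof -
    have "\<bar>p i - x i\<bar> \<le> r" if "i < N" for i
      by (rule LIMSEQ_le_const2[OF tendsto_rabs[OF tendsto_diff[OF lim[OF that] tendsto_const]]])
        (use sc that in \<open>auto simp: cube_def\<close>)
    then show ?thesis by (auto simp: cube_def p_def)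
  qed
  have Fp: "F i p = y i" if i: "i < N" for i
  proof -
    define d where "d n = (\<Sum>j<N. \<bar>s n j - p j\<bar>)" for n
    have d0: "d \<longlonglongrightarrow> 0"
    proof -
      have "(\<lambda>n. \<Sum>j<N. \<bar>s n j - p j\<bar>) \<longlonglongrightarrow> (\<Sum>j<N. \<bar>p j - p j\<bar>)"
        by (intro tendsto_sum tendsto_rabs tendsto_diff lim tendsto_const) auto
      then show ?thesis by (simp add: d_def[abs_def])
    qed
    have dn: "d n \<ge> 0" for n by (auto simp: d_def intro!: sum_nonneg)
    have dj: "\<bar>s n j - p j\<bar> \<le> d n" if "j < N" for n j
      unfolding d_def using that by (intro member_le_sum[where f = "\<lambda>j. \<bar>s n j - p j\<bar>"]) auto
    have close: "\<bar>F i (s n) - F i p\<bar> \<le> (eta + entry_sum N a) * d n" for n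
    proof -
      have "\<bar>F i (s n) - F i p - (\<Sum>j<N. a i j * (s n j - p j))\<bar> \<le> eta * d n"
        by (rule approx[OF sc pc i dn dj])
      moreover have "\<bar>\<Sum>j<N. a i j * (s n j - p j)\<bar> \<le> entry_sum N a * d n"
        by (rule matvec_bound[OF i dj dn])
      ultimately show ?thesis by (simp add: distrib_right)
    qed
    have "(\<lambda>n. F i (s n) - F i p) \<longlonglongrightarrow> 0"
      by (rule Lim_null_comparison[where g = "\<lambda>n. (eta + entry_sum N a) * d n"])
        (use close d0 in \<open>auto intro!: tendsto_mult_right_zero\<close>)
    \<comment> \<open>The residual is the matrix \<open>a\<close> applied to the difference of
      consecutive iterates, which tends to zero.\<close>
    moreover have "(\<lambda>n. F i (s n) - y i) \<longlonglongrightarrow> 0"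
    proof -
      have eq: "F i (s n) - y i = (\<Sum>k<N. a i k * (s n k - s (Suc n) k))" for n
      proof -
        have "(\<Sum>k<N. a i k * (s n k - s (Suc n) k)) = (\<Sum>k<N. a i k * (\<Sum>j<N. ?b k j * (F j (s n) - y j)))"
          by (intro sum.cong) (auto simp: s_Suc G_def)
        also have "\<dots> = F i (s n) - y i" by (rule finv_right_vec[OF det i])
        finally show ?thesis by simp
      qed
      have "(\<lambda>n. \<Sum>k<N. a i k * (s n k - s (Suc n) k)) \<longlonglongrightarrow> (\<Sum>k<N. a i k * (p k - p k))"
        by (intro tendsto_sum tendsto_mult tendsto_const tendsto_diff lim LIMSEQ_Suc) auto
      then show ?thesis by (simp add: eq)
    qed
    ultimately have "(\<lambda>n. (F i (s n) - y i) - (F i (s n) - F i p)) \<longlonglongrightarrow> 0 - 0"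
      by (intro tendsto_diff)
    then have "F i p - y i = 0" by (simp add: LIMSEQ_const_iff)
    then show ?thesis by simp
  qed
  show ?thesis using that pc Fp by blast
qed

text \<open>The volume of the image of a small cube about \<open>x\<close> is at least \<open>\<bar>det\<bar>\<close> times that of a
  smaller cube, and by Tonelli these volumes integrate to the average number of solutions
  of \<open>F p = y\<close> near a varying \<open>x\<close>.\<close>

lemma integral_abs_det_le:
  fixes F :: "nat \<Rightarrow> (nat \<Rightarrow> real) \<Rightarrow> real" and a :: "nat \<Rightarrow> nat \<Rightarrow> (nat \<Rightarrow> real) \<Rightarrow> real"
    and X :: "(nat \<Rightarrow> real) measure"
  assumes sfX: "sigma_finite_measure X" and setsX [measurable_cong]: "sets X = sets (real_space N)"
    and cubeX: "\<And>p r. p \<in> extensional {..<N} \<Longrightarrow> r > 0 \<Longrightarrow> emeasure X (cube N p r) \<le> ennreal ((2 * r) ^ N)"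
    and F [measurable]: "\<And>i. i < N \<Longrightarrow> F i \<in> borel_measurable (real_space N)"
    and a [measurable]: "\<And>i j. i < N \<Longrightarrow> j < N \<Longrightarrow> a i j \<in> borel_measurable (real_space N)"
    and H [measurable]: "H \<in> borel_measurable (real_space N)" and H0: "\<And>x. H x \<ge> 0"
    and W [measurable]: "W \<in> sets (real_space N)"
    and F1: "\<And>x i. x \<in> W \<Longrightarrow> i < N \<Longrightarrow> \<bar>F i x\<bar> \<le> 1"
    and approx: "\<And>x r u v m i. x \<in> W \<Longrightarrow> r > 0 \<Longrightarrow> r * H x \<le> 1 \<Longrightarrow> u \<in> cube N x r \<Longrightarrow> v \<in> cube N x r \<Longrightarrow>
      i < N \<Longrightarrow> m \<ge> 0 \<Longrightarrow> (\<And>j. j < N \<Longrightarrow> \<bar>u j - v j\<bar> \<le> m) \<Longrightarrow>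
      \<bar>F i u - F i v - (\<Sum>j<N. a i j x * (u j - v j))\<bar> \<le> r * H x * m"
    and good: "\<And>x r p. x \<in> W \<Longrightarrow> r > 0 \<Longrightarrow> r * H x \<le> 1 \<Longrightarrow> p \<in> cube N x r \<Longrightarrow> good p"
    and diff: "\<And>p v i. good p \<Longrightarrow> p \<in> extensional {..<N} \<Longrightarrow> i < N \<Longrightarrow>
      ((\<lambda>t. (F i (\<lambda>j\<in>{..<N}. p j + t * v j) - F i p) / t) \<longlongrightarrow> (\<Sum>j<N. a i j p * v j)) (at_right 0)"
    and count: "\<And>y S. finite S \<Longrightarrow> S \<subseteq> extensional {..<N} \<Longrightarrow> (\<And>p. p \<in> S \<Longrightarrow> good p) \<Longrightarrow>
      (\<And>p i. p \<in> S \<Longrightarrow> i < N \<Longrightarrow> F i p = y i) \<Longrightarrow>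
      (\<And>p. p \<in> S \<Longrightarrow> Determinant.det (fmat N (\<lambda>i j. a i j p)) \<noteq> 0) \<Longrightarrow> card S \<le> K"
  shows "(\<integral>\<^sup>+x. ennreal \<bar>Determinant.det (fmat N (\<lambda>i j. a i j x))\<bar> * indicator W x \<partial>X) \<le> ennreal (8 ^ N * real K)"
proof -
  interpret X: sigma_finite_measure X by fact
  interpret P: product_sigma_finite "\<lambda>_::nat. lborel :: real measure" ..
  interpret Y: sigma_finite_measure "real_space N" by (rule P.sigma_finite) simp
  interpret XY: pair_sigma_finite X "real_space N" ..
  define A where "A x = (\<lambda>i j. a i j x)" for x
  define dt where "dt x = Determinant.det (fmat N (A x))" for x
  define B where "B x = finv N (A x)" for x
  \<comment> \<open>Where \<open>R n * M x \<le> 1\<close>, the radius \<open>R n\<close> is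
    admissible at \<open>x\<close>. The three summands ensure that the linear approximation is valid
    up to radius \<open>2 * R n\<close>, that Newton's condition still holds there with the constant
    one half, and that the values \<open>y\<close> in question stay within distance one of
    \<open>F x\<close>.\<close>
  define M where "M x = 2 * H x + 4 * entry_sum N (B x) * H x + entry_sum N (A x)" for x
  have dt_meas [measurable]: "dt \<in> borel_measurable (real_space N)"
    unfolding dt_def A_def by (rule borel_measurable_det) (rule a)
  have B_meas [measurable]: "(\<lambda>x. B x i j) \<in> borel_measurable (real_space N)" if "i < N" "j < N" for i j
    unfolding B_def A_def by (rule borel_measurable_finv[OF a that])
  have M_meas [measurable]: "M \<in> borel_measurable (real_space N)"
  proof -
    have "(\<lambda>x. entry_sum N (B x)) \<in> borel_measurable (real_space N)"
      unfolding entry_sum_def by (intro borel_measurable_sum borel_measurable_abs B_meas) auto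
    moreover have "(\<lambda>x. entry_sum N (A x)) \<in> borel_measurable (real_space N)"
      unfolding entry_sum_def A_def by (intro borel_measurable_sum borel_measurable_abs a) auto
    ultimately show ?thesis unfolding M_def[abs_def] using H by measurable
  qed
  define R where "R n = 1 / real (Suc n)" for n
  define G where "G n = {x \<in> W. dt x \<noteq> 0 \<and> R n * M x \<le> 1}" for n
  have spW: "W \<subseteq> space (real_space N)" using sets.sets_into_space[OF W] .
  have spX: "space X = space (real_space N)" using setsX by (rule sets_eq_imp_space_eq)
  have ext: "space (real_space N) = extensional {..<N}" by (simp add: space_PiM PiE_def)
  have G_meas [measurable]: "G n \<in> sets (real_space N)" for n
  proof -
    have "G n = W \<inter> {x \<in> space (real_space N). dt x \<noteq> 0 \<and> R n * M x \<le> 1}"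
      using spW by (auto simp: G_def)
    also have "\<dots> \<in> sets (real_space N)" by measurable
    finally show ?thesis .
  qed
  have R0: "R n > 0" for n by (simp add: R_def)
  have M0: "M x \<ge> 0" "2 * H x \<le> M x" "4 * entry_sum N (B x) * H x \<le> M x" "entry_sum N (A x) \<le> M x" for x
    using H0[of x] entry_sum_nonneg[of N "A x"] mult_nonneg_nonneg[OF entry_sum_nonneg[of N "B x"] H0[of x]]
    by (auto simp: M_def)
  \<comment> \<open>The values \<open>y\<close> in the parallelepiped about \<open>F x\<close> that
    the derivative at \<open>x\<close> makes of a cube of half-width \<open>R n / 2\<close>. Each of
    them is reached by Newton's iteration from \<open>x\<close>.\<close>
  define E where "E n x y \<longleftrightarrow> (\<forall>i<N. \<bar>\<Sum>j<N. B x i j * (y j - F j x)\<bar> < R n / 2)" for n x y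
  define Z where "Z y = {p \<in> extensional {..<N}. good p \<and> (\<forall>i<N. F i p = y i) \<and> dt p \<noteq> 0}" for y
  have Z: "finite (Z y) \<and> card (Z y) \<le> K" for y
  proof (rule finite_if_finite_subsets_card_bdd)
    fix S assume S: "S \<subseteq> Z y" "finite S"
    have ZD: "p \<in> extensional {..<N}" "good p" "\<And>i. i < N \<Longrightarrow> F i p = y i"
      "Determinant.det (fmat N (\<lambda>i j. a i j p)) \<noteq> 0" if "p \<in> S" for p
      using S(1) that unfolding Z_def dt_def A_def by blast+
    show "card S \<le> K"
      by (rule count[OF S(2) subsetI[OF ZD(1)] ZD(2) ZD(3) ZD(4)])
  qed
  have key: "\<exists>p\<in>Z y. x \<in> cube N p (R n)" and bounded: "\<And>i. i < N \<Longrightarrow> \<bar>y i\<bar> \<le> 2"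
    if x: "x \<in> G n" and y: "E n x y" for n x y
  proof -
    note [simp] = R0[of n] less_imp_le[OF R0[of n]]
    have xW: "x \<in> W" and d: "dt x \<noteq> 0" and RM: "R n * M x \<le> 1" using x by (auto simp: G_def)
    have xe: "x \<in> extensional {..<N}" using xW spW ext by auto
    have R2: "2 * R n > 0" using R0[of n] by simp
    have RH2: "2 * R n * H x \<le> 1"
    proof -
      have "R n * (2 * H x) \<le> R n * M x" by (intro mult_left_mono M0) simp
      then show ?thesis using RM by (simp only: mult_ac)
    qed
    have RH0: "0 \<le> R n * H x" using H0[of x] R0[of n] by simp
    have RH: "R n * H x \<le> 1" using RH2 RH0 by linarith
    have small2: "entry_sum N (B x) * (2 * R n * H x) \<le> 1 / 2"
    proof -
      have "R n * (4 * entry_sum N (B x) * H x) \<le> R n * M x" by (intro mult_left_mono M0) simp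
      moreover have "entry_sum N (B x) * (2 * R n * H x) = R n * (4 * entry_sum N (B x) * H x) / 2" by simp
      ultimately show ?thesis using RM by linarith
    qed
    have small: "entry_sum N (B x) * (R n * H x) \<le> 1 / 2"
    proof -
      have "entry_sum N (B x) * (2 * R n * H x) = 2 * (entry_sum N (B x) * (R n * H x))" by simp
      moreover have "0 \<le> entry_sum N (B x) * (R n * H x)"
        by (intro mult_nonneg_nonneg entry_sum_nonneg RH0)
      ultimately show ?thesis using small2 by linarith
    qed
    have det: "Determinant.det (fmat N (\<lambda>i j. a i j x)) \<noteq> 0" using d by (simp add: dt_def A_def)
    obtain p where p: "p \<in> cube N x (R n)" "\<And>i. i < N \<Longrightarrow> F i p = y i"
    proof (rule newton_zero[of x N "R n" "R n * H x" F "\<lambda>i j. a i j x" y])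
      show "0 \<le> R n * H x" by (rule RH0)
      show "entry_sum N (finv N (\<lambda>i j. a i j x)) * (R n * H x) \<le> 1 / 2" using small by (simp add: B_def A_def)
      show "\<bar>\<Sum>j<N. finv N (\<lambda>i j. a i j x) i j * (y j - F j x)\<bar> \<le> R n / 2" if "i < N" for i
        using y that by (simp add: E_def B_def A_def less_imp_le)
    qed (use xe det approx[OF xW R0 RH] in auto)
    have gp: "good p" by (rule good[OF xW R0 RH p(1)])
    have pe: "p \<in> extensional {..<N}" using p(1) by (simp add: cube_def)
    \<comment> \<open>The solution \<open>p\<close> is counted only if it is nondegenerate, but
      invertibility is known at \<open>x\<close>. A kernel vector \<open>v\<close> at
      \<open>p\<close> is almost one at \<open>x\<close>: the two derivatives are compared through
      difference quotients in direction \<open>v\<close>, inside the cube of radius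
      \<open>2 * R n\<close> about \<open>x\<close>. The inverse at \<open>x\<close> then gives
      \<open>m \<le> m / 2\<close> for the maximum norm \<open>m\<close> of
      \<open>v\<close>.\<close>
    have "dt p \<noteq> 0"
      unfolding dt_def
    proof (rule det_fmat_nonzeroI)
      fix v :: "nat \<Rightarrow> real" and i0
      assume v: "\<And>i. i < N \<Longrightarrow> (\<Sum>j<N. A p i j * v j) = 0" and i0: "i0 < N"
      show "v i0 = 0"
      proof -
        define m where "m = Max ((\<lambda>j. \<bar>v j\<bar>) ` {..<N})"
        have m: "\<bar>v j\<bar> \<le> m" if "j < N" for j unfolding m_def using that by (intro Max_ge) auto
        have m0: "m \<ge> 0" using m[OF i0] by linarith
        have "m \<in> (\<lambda>j. \<bar>v j\<bar>) ` {..<N}" unfolding m_def using i0 by (intro Max_in) auto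
        then obtain i1 where i1: "i1 < N" "\<bar>v i1\<bar> = m" by auto
        have small_image: "\<bar>\<Sum>j<N. a i j x * v j\<bar> \<le> 2 * R n * H x * m" if i: "i < N" for i
        proof -
          have "((\<lambda>t. (F i (\<lambda>j\<in>{..<N}. p j + t * v j) - F i p) / t - (\<Sum>j<N. a i j x * v j))
            \<longlongrightarrow> (\<Sum>j<N. a i j p * v j) - (\<Sum>j<N. a i j x * v j)) (at_right 0)"
            by (intro tendsto_diff diff gp pe i tendsto_const)
          then have "((\<lambda>t. \<bar>(F i (\<lambda>j\<in>{..<N}. p j + t * v j) - F i p) / t - (\<Sum>j<N. a i j x * v j)\<bar>)
            \<longlongrightarrow> \<bar>(\<Sum>j<N. a i j p * v j) - (\<Sum>j<N. a i j x * v j)\<bar>) (at_right 0)"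
            by (rule tendsto_rabs)
          moreover have "\<forall>\<^sub>F t in at_right 0. \<bar>(F i (\<lambda>j\<in>{..<N}. p j + t * v j) - F i p) / t - (\<Sum>j<N. a i j x * v j)\<bar>
             \<le> 2 * R n * H x * m"
          proof -
            have "\<bar>(F i (\<lambda>j\<in>{..<N}. p j + t * v j) - F i p) / t - (\<Sum>j<N. a i j x * v j)\<bar> \<le> 2 * R n * H x * m"
              if t: "0 < t" "t < R n / (m + 1)" for t
            proof -
              let ?u = "\<lambda>j\<in>{..<N}. p j + t * v j"
              have tm: "t * \<bar>v j\<bar> \<le> R n" if "j < N" for j
              proof -
                have "t * \<bar>v j\<bar> \<le> t * (m + 1)" using m[OF that] t by (intro mult_left_mono) auto
                also have "\<dots> \<le> R n" using t m0 by (simp add: pos_less_divide_eq)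
                finally show ?thesis .
              qed
              have uc: "?u \<in> cube N x (2 * R n)"
              proof -
                have "\<bar>p j + t * v j - x j\<bar> \<le> 2 * R n" if "j < N" for j
                proof -
                  have "\<bar>t * v j\<bar> \<le> R n" using tm[OF that] t by (simp add: abs_mult)
                  moreover have "\<bar>p j - x j\<bar> \<le> R n" using p(1) that by (simp add: cube_def)
                  ultimately show ?thesis by linarith
                qed
                then show ?thesis by (simp add: cube_def)
              qed
              have pc: "p \<in> cube N x (2 * R n)" using p(1) R0[of n] by (force simp: cube_def)
              have "\<bar>F i ?u - F i p - (\<Sum>j<N. a i j x * (?u j - p j))\<bar> \<le> 2 * R n * H x * (t * m)"
              proof (rule approx[OF xW R2 RH2 uc pc i])
                show "0 \<le> t * m" using t m0 by simp
                show "\<bar>?u j - p j\<bar> \<le> t * m" if "j < N" for j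
                  using that m[OF that] t by (simp add: abs_mult)
              qed
              also have "(\<Sum>j<N. a i j x * (?u j - p j)) = t * (\<Sum>j<N. a i j x * v j)"
                by (simp add: sum_distrib_left mult_ac)
              finally have *: "\<bar>F i ?u - F i p - t * (\<Sum>j<N. a i j x * v j)\<bar> \<le> 2 * R n * H x * (t * m)" .
              have "\<bar>(F i ?u - F i p) / t - (\<Sum>j<N. a i j x * v j)\<bar> = \<bar>F i ?u - F i p - t * (\<Sum>j<N. a i j x * v j)\<bar> / t"
                using t by (simp add: abs_divide[symmetric] diff_divide_distrib del: abs_divide)
                  (simp add: field_simps)
              moreover have "2 * R n * H x * (t * m) = 2 * R n * H x * m * t" by (simp only: mult_ac)
              ultimately show ?thesis using * t by (simp only: pos_divide_le_eq)
            qed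
            then show ?thesis
              using m0 by (auto simp: eventually_at_right_field intro!: exI[of _ "R n / (m + 1)"])
          qed
          ultimately have "\<bar>(\<Sum>j<N. a i j p * v j) - (\<Sum>j<N. a i j x * v j)\<bar> \<le> 2 * R n * H x * m"
            by (rule tendsto_upperbound) simp
          then show ?thesis using v[OF i] by (simp add: A_def)
        qed
        have "v i1 = (\<Sum>k<N. B x i1 k * (\<Sum>j<N. a k j x * v j))"
          unfolding B_def A_def by (rule finv_left_vec[OF det i1(1), symmetric])
        also have "\<bar>\<dots>\<bar> \<le> entry_sum N (B x) * (2 * R n * H x * m)"
        proof (rule matvec_bound[OF i1(1) small_image])
          show "0 \<le> 2 * R n * H x * m" using mult_nonneg_nonneg[OF RH0 m0] by (simp only: mult.assoc)
        qed
        also have "\<dots> \<le> 1 / 2 * m"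
          using mult_right_mono[OF small2 m0] by (simp only: mult.assoc)
        finally have "m \<le> 0" using i1(2) by simp
        then show ?thesis using m[OF i0] by simp
      qed
    qed
    then have "p \<in> Z y" using gp pe p(2) by (simp add: Z_def)
    moreover have "x \<in> cube N p (R n)" using p(1) xe by (auto simp: cube_def abs_minus_commute)
    ultimately show "\<exists>p\<in>Z y. x \<in> cube N p (R n)" by blast
    fix i assume i: "i < N"
    have "y i - F i x = (\<Sum>k<N. a i k x * (\<Sum>j<N. B x k j * (y j - F j x)))"
      unfolding B_def A_def by (rule finv_right_vec[OF det i, symmetric])
    also have "\<bar>\<dots>\<bar> \<le> entry_sum N (A x) * (R n / 2)"
      unfolding A_def by (rule matvec_bound[OF i]) (use y in \<open>auto simp: E_def less_imp_le\<close>)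
    also have "\<dots> = R n * entry_sum N (A x) / 2" by simp
    also have "\<dots> \<le> 1"
    proof -
      have "R n * entry_sum N (A x) \<le> R n * M x" by (intro mult_left_mono M0) simp
      then show ?thesis using RM by linarith
    qed
    finally show "\<bar>y i\<bar> \<le> 2" using F1[OF xW i] by linarith
  qed
  \<comment> \<open>The set \<open>S\<close> of pairs \<open>(x, y)\<close> with
    \<open>x \<in> G n\<close> and \<open>E n x y\<close> is measured in two ways. For fixed
    \<open>x\<close> the section has volume \<open>\<bar>dt x\<bar> * R n ^ N\<close>. For fixed
    \<open>y\<close> it is covered by at most \<open>K\<close> cubes about the solutions, each of
    measure at most \<open>(2 * R n) ^ N\<close>, and it is empty unless \<open>y\<close> lies in
    \<open>?Y\<close>, whose volume is \<open>4 ^ N\<close>. The powers of \<open>R n\<close> cancel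
    and \<open>8 ^ N * K\<close> is left.\<close>
  have bound: "(\<integral>\<^sup>+x. ennreal \<bar>dt x\<bar> * indicator (G n) x \<partial>X) \<le> ennreal (8 ^ N * real K)" for n
  proof -
    let ?Y = "\<Pi>\<^sub>E i\<in>{..<N}. {-2..2::real}"
    define S where "S = {z \<in> space (X \<Otimes>\<^sub>M real_space N). fst z \<in> G n \<and> E n (fst z) (snd z)}"
    have S_meas [measurable]: "S \<in> sets (X \<Otimes>\<^sub>M real_space N)"
    proof -
      have onX: "(\<lambda>z. f (fst z)) \<in> borel_measurable (X \<Otimes>\<^sub>M real_space N)"
        if "f \<in> borel_measurable (real_space N)" for f :: "(nat \<Rightarrow> real) \<Rightarrow> real"
        using that measurable_cong_sets[OF setsX refl] by (intro measurable_compose[OF measurable_fst]) auto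
      have snd: "(\<lambda>z. snd z j) \<in> borel_measurable (X \<Otimes>\<^sub>M real_space N)" if "j < N" for j
        using measurable_compose[OF measurable_snd measurable_component_singleton[of j "{..<N}" "\<lambda>_. lborel"]] that
        by simp
      have "{z \<in> space (X \<Otimes>\<^sub>M real_space N). fst z \<in> G n} \<in> sets (X \<Otimes>\<^sub>M real_space N)"
        by measurable
      moreover have "{z \<in> space (X \<Otimes>\<^sub>M real_space N). E n (fst z) (snd z)} \<in> sets (X \<Otimes>\<^sub>M real_space N)"
      proof -
        have "{z \<in> space (X \<Otimes>\<^sub>M real_space N). \<forall>i\<in>{..<N}.
            \<bar>\<Sum>j<N. B (fst z) i j * (snd z j - F j (fst z))\<bar> < R n / 2} \<in> sets (X \<Otimes>\<^sub>M real_space N)"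
        proof (rule sets.sets_Collect_finite_All)
          fix i assume "i \<in> {..<N}"
          then have "(\<lambda>z. \<bar>\<Sum>j<N. B (fst z) i j * (snd z j - F j (fst z))\<bar>) \<in> borel_measurable (X \<Otimes>\<^sub>M real_space N)"
            by (intro borel_measurable_abs borel_measurable_sum borel_measurable_times borel_measurable_diff
                onX[OF B_meas] onX[OF F] snd) auto
          then show "{z \<in> space (X \<Otimes>\<^sub>M real_space N). \<bar>\<Sum>j<N. B (fst z) i j * (snd z j - F j (fst z))\<bar> < R n / 2}
            \<in> sets (X \<Otimes>\<^sub>M real_space N)" by measurable
        qed simp
        then show ?thesis by (simp add: E_def Ball_def)
      qed
      ultimately have "{z \<in> space (X \<Otimes>\<^sub>M real_space N). fst z \<in> G n} \<inter> {z \<in> space (X \<Otimes>\<^sub>M real_space N). E n (fst z) (snd z)}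
        \<in> sets (X \<Otimes>\<^sub>M real_space N)" by (rule sets.Int)
      moreover have "S = {z \<in> space (X \<Otimes>\<^sub>M real_space N). fst z \<in> G n} \<inter> {z \<in> space (X \<Otimes>\<^sub>M real_space N). E n (fst z) (snd z)}"
        unfolding S_def by blast
      ultimately show ?thesis by simp
    qed
    have ind_meas: "(\<lambda>(x, y). indicator S (x, y) :: ennreal) \<in> borel_measurable (X \<Otimes>\<^sub>M real_space N)"
      using S_meas by simp
    have lower: "ennreal \<bar>dt x\<bar> * indicator (G n) x * ennreal (R n ^ N)
      = (\<integral>\<^sup>+y. indicator S (x, y) \<partial>real_space N)" if x: "x \<in> space X" for x
    proof (cases "x \<in> G n")
      case False
      then have "indicator S (x, y) = (0 :: ennreal)" for y by (simp add: S_def)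
      then show ?thesis using False by simp
    next
      case True
      have d: "Determinant.det (fmat N (A x)) \<noteq> 0" using True by (simp add: G_def dt_def)
      let ?c = "\<lambda>i. \<Sum>j<N. B x i j * F j x"
      let ?P = "{y \<in> space (real_space N). \<forall>i<N. \<bar>(\<Sum>j<N. fmat N (B x) $$ (i, j) * y j) - ?c i\<bar> < R n / 2}"
      have dB: "Determinant.det (fmat N (B x)) = 1 / dt x"
        unfolding B_def dt_def by (rule det_finv[OF d])
      have dnz: "dt x \<noteq> 0" using d by (simp add: dt_def)
      have par: "emeasure (real_space N) ?P * ennreal \<bar>1 / dt x\<bar> = ennreal ((2 * (R n / 2)) ^ N)"
        unfolding dB[symmetric] by (rule emeasure_parallelepiped) (use dB dnz R0[of n] in auto)
      have Eeq: "E n x y \<longleftrightarrow> (\<forall>i<N. \<bar>(\<Sum>j<N. fmat N (B x) $$ (i, j) * y j) - ?c i\<bar> < R n / 2)" for y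
        by (simp add: E_def right_diff_distrib sum_subtractf)
      have "(\<integral>\<^sup>+y. indicator S (x, y) \<partial>real_space N) = (\<integral>\<^sup>+y. indicator ?P y \<partial>real_space N)"
      proof (rule nn_integral_cong)
        fix y assume "y \<in> space (real_space N)"
        then have "(x, y) \<in> S \<longleftrightarrow> y \<in> ?P"
          using x True Eeq[of y] by (simp add: S_def space_pair_measure)
        then show "indicator S (x, y) = (indicator ?P y :: ennreal)" by (simp only: indicator_def)
      qed
      also have "\<dots> = emeasure (real_space N) ?P"
        by (rule nn_integral_indicator) measurable
      also have "\<dots> = emeasure (real_space N) ?P * (ennreal \<bar>1 / dt x\<bar> * ennreal \<bar>dt x\<bar>)"
        using dnz by (simp add: ennreal_mult[symmetric])
      also have "\<dots> = ennreal ((2 * (R n / 2)) ^ N) * ennreal \<bar>dt x\<bar>"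
        unfolding par[symmetric] by (rule mult.assoc[symmetric])
      finally show ?thesis using True by (simp add: mult.commute)
    qed
    have upper: "(\<integral>\<^sup>+x. indicator S (x, y) \<partial>X) \<le> ennreal (K * (2 * R n) ^ N) * indicator ?Y y"
      if y: "y \<in> space (real_space N)" for y
    proof (cases "\<exists>x\<in>G n. E n x y")
      case False
      then have "(x, y) \<notin> S" for x unfolding S_def by force
      then show ?thesis by simp
    next
      case True
      then obtain x0 where "x0 \<in> G n" "E n x0 y" by blast
      then have "\<bar>y i\<bar> \<le> 2" if "i < N" for i using bounded that by blast
      then have "y i \<in> {-2..2}" if "i < N" for i using that[THEN \<open>\<And>i. i < N \<Longrightarrow> \<bar>y i\<bar> \<le> 2\<close>] by auto
      moreover have "y \<in> extensional {..<N}" using y ext by blast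
      ultimately have yY: "y \<in> ?Y" unfolding PiE_iff by blast
      have cube_meas: "cube N p (R n) \<in> sets X" for p
      proof -
        have "cube N p (R n) = (\<Pi>\<^sub>E j\<in>{..<N}. {p j - R n..p j + R n})"
        proof -
          have "\<bar>x j - p j\<bar> \<le> R n \<longleftrightarrow> x j \<in> {p j - R n..p j + R n}" for x j by auto
          then show ?thesis unfolding cube_def PiE_def Pi_def by blast
        qed
        then show ?thesis unfolding setsX by (auto intro!: sets_PiM_I_finite)
      qed
      have "(\<integral>\<^sup>+x. indicator S (x, y) \<partial>X) \<le> (\<integral>\<^sup>+x. (\<Sum>p\<in>Z y. indicator (cube N p (R n)) x) \<partial>X)"
      proof (rule nn_integral_mono)
        fix x
        show "indicator S (x, y) \<le> (\<Sum>p\<in>Z y. indicator (cube N p (R n)) x :: ennreal)"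
        proof (cases "(x, y) \<in> S")
          case True
          then have "x \<in> G n" "E n x y" unfolding S_def by simp_all
          then obtain p where p: "p \<in> Z y" "x \<in> cube N p (R n)" using key by blast
          have "indicator S (x, y) = (indicator (cube N p (R n)) x :: ennreal)" using True p by simp
          also have "\<dots> \<le> (\<Sum>p\<in>Z y. indicator (cube N p (R n)) x)"
            using Z p by (intro member_le_sum) auto
          finally show ?thesis .
        qed simp
      qed
      also have "\<dots> = (\<Sum>p\<in>Z y. emeasure X (cube N p (R n)))"
        using cube_meas by (simp add: nn_integral_sum)
      also have "\<dots> \<le> (\<Sum>p\<in>Z y. ennreal ((2 * R n) ^ N))"
        by (intro sum_mono cubeX R0) (simp add: Z_def)
      also have "\<dots> = ennreal (real (card (Z y)) * (2 * R n) ^ N)"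
        using R0[of n] by (simp add: ennreal_mult ennreal_of_nat_eq_real_of_nat)
      also have "\<dots> \<le> ennreal (K * (2 * R n) ^ N)"
        using Z[of y] R0[of n] by (intro ennreal_leI mult_right_mono) auto
      finally show ?thesis using yY by simp
    qed
    have "(\<integral>\<^sup>+x. ennreal \<bar>dt x\<bar> * indicator (G n) x \<partial>X) * ennreal (R n ^ N)
       = (\<integral>\<^sup>+x. ennreal \<bar>dt x\<bar> * indicator (G n) x * ennreal (R n ^ N) \<partial>X)"
      by (rule nn_integral_multc[symmetric]) measurable
    also have "\<dots> = (\<integral>\<^sup>+x. \<integral>\<^sup>+y. indicator S (x, y) \<partial>real_space N \<partial>X)"
      by (rule nn_integral_cong) (rule lower)
    also have "\<dots> = (\<integral>\<^sup>+y. \<integral>\<^sup>+x. indicator S (x, y) \<partial>X \<partial>real_space N)"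
      by (rule XY.Fubini'[symmetric, OF ind_meas])
    also have "\<dots> \<le> (\<integral>\<^sup>+y. ennreal (K * (2 * R n) ^ N) * indicator ?Y y \<partial>real_space N)"
      by (intro nn_integral_mono upper)
    also have "\<dots> = ennreal (K * (2 * R n) ^ N) * emeasure (real_space N) ?Y"
      by (rule nn_integral_cmult_indicator) (intro sets_PiM_I_finite, auto)
    also have "emeasure (real_space N) ?Y = ennreal (4 ^ N)"
    proof -
      have "emeasure (real_space N) ?Y = (\<Prod>i<N. emeasure lborel {-2..2::real})"
        by (rule P.emeasure_PiM) simp_all
      then show ?thesis by (simp add: ennreal_power[symmetric])
    qed
    also have "ennreal (K * (2 * R n) ^ N) * ennreal (4 ^ N) = ennreal (8 ^ N * real K) * ennreal (R n ^ N)"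
    proof -
      have "real K * (2 * R n) ^ N * 4 ^ N = 8 ^ N * real K * R n ^ N"
        using power_mult_distrib[of 2 "4 :: real" N] by (simp add: power_mult_distrib)
      moreover have "0 \<le> real K * (2 * R n) ^ N" "0 \<le> 8 ^ N * real K" "0 \<le> R n ^ N" "(0::real) \<le> 4 ^ N"
        using R0[of n] by simp_all
      ultimately show ?thesis by (simp only: ennreal_mult[symmetric])
    qed
    finally have "(\<integral>\<^sup>+x. ennreal \<bar>dt x\<bar> * indicator (G n) x \<partial>X) * ennreal (R n ^ N)
      \<le> ennreal (8 ^ N * real K) * ennreal (R n ^ N)" .
    then have "ennreal (R n ^ N) * (\<integral>\<^sup>+x. ennreal \<bar>dt x\<bar> * indicator (G n) x \<partial>X)
      \<le> ennreal (R n ^ N) * ennreal (8 ^ N * real K)" by (simp only: mult.commute)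
    then show ?thesis
      by (subst (asm) ennreal_mult_le_mult_iff) (use R0[of n] in auto)
  qed
  \<comment> \<open>The sets \<open>G n\<close> exhaust the part of \<open>W\<close> where
    \<open>dt\<close> is nonzero, and the rest contributes nothing. The bound does not depend on
    \<open>n\<close>, so it survives monotone convergence.\<close>
  have "incseq (\<lambda>n x. ennreal \<bar>dt x\<bar> * indicator (G n) x)"
  proof (rule incseq_SucI, rule le_funI)
    fix n x
    have "R (Suc n) * M x \<le> R n * M x"
      by (rule mult_right_mono[OF _ M0(1)]) (simp add: R_def frac_le)
    then have "x \<in> G n \<Longrightarrow> x \<in> G (Suc n)" by (auto simp: G_def)
    then show "ennreal \<bar>dt x\<bar> * indicator (G n) x \<le> ennreal \<bar>dt x\<bar> * indicator (G (Suc n)) x"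
      by (auto simp: indicator_def)
  qed
  then have "(\<integral>\<^sup>+x. (SUP n. ennreal \<bar>dt x\<bar> * indicator (G n) x) \<partial>X)
     = (SUP n. \<integral>\<^sup>+x. ennreal \<bar>dt x\<bar> * indicator (G n) x \<partial>X)"
    by (intro nn_integral_monotone_convergence_SUP) measurable
  also have "\<dots> \<le> ennreal (8 ^ N * real K)" by (intro SUP_least bound)
  finally have sup: "(\<integral>\<^sup>+x. (SUP n. ennreal \<bar>dt x\<bar> * indicator (G n) x) \<partial>X) \<le> ennreal (8 ^ N * real K)" .
  have "ennreal \<bar>dt x\<bar> * indicator W x \<le> (SUP n. ennreal \<bar>dt x\<bar> * indicator (G n) x)" for x
  proof (cases "x \<in> W \<and> dt x \<noteq> 0")
    case True
    obtain n where "M x \<le> real n" using real_arch_simple by blast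
    then have "x \<in> G n" using True by (simp add: G_def R_def)
    then have "ennreal \<bar>dt x\<bar> * indicator W x = ennreal \<bar>dt x\<bar> * indicator (G n) x" using True by simp
    also have "\<dots> \<le> (SUP n. ennreal \<bar>dt x\<bar> * indicator (G n) x)" by (rule SUP_upper) simp
    finally show ?thesis .
  qed auto
  then have "(\<integral>\<^sup>+x. ennreal \<bar>dt x\<bar> * indicator W x \<partial>X) \<le> (\<integral>\<^sup>+x. (SUP n. ennreal \<bar>dt x\<bar> * indicator (G n) x) \<partial>X)"
    by (intro nn_integral_mono) auto
  then show ?thesis using sup by (simp add: dt_def A_def)
qed

section \<open>Strict differentiability\<close>

text \<open>Strict differentiability on \<open>W\<close> with derivative \<open>D\<close>: on a cube of radius \<open>r\<close> about \<open>x\<close>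
  the function differs from its linearisation at \<open>x\<close> by a function with Lipschitz constant \<open>r * H x\<close>,
  as long as \<open>r * H x \<le> 1\<close>.\<close>

definition strict_diff_modulus ::
    "nat \<Rightarrow> (nat \<Rightarrow> real) set \<Rightarrow> ((nat \<Rightarrow> real) \<Rightarrow> real) \<Rightarrow> (nat \<Rightarrow> (nat \<Rightarrow> real) \<Rightarrow> real) \<Rightarrow> ((nat \<Rightarrow> real) \<Rightarrow> real) \<Rightarrow> bool" where
  "strict_diff_modulus N W f D H \<longleftrightarrow> (\<forall>x. H x \<ge> 0) \<and>
     (\<forall>x\<in>W. \<forall>r>0. r * H x \<le> 1 \<longrightarrow> (\<forall>u\<in>cube N x r. \<forall>v\<in>cube N x r. \<forall>m\<ge>0. (\<forall>j<N. \<bar>u j - v j\<bar> \<le> m) \<longrightarrow>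
       \<bar>f u - f v - (\<Sum>j<N. D j x * (u j - v j))\<bar> \<le> r * H x * m))"

definition strict_diff ::
    "nat \<Rightarrow> (nat \<Rightarrow> real) set \<Rightarrow> ((nat \<Rightarrow> real) \<Rightarrow> real) \<Rightarrow> (nat \<Rightarrow> (nat \<Rightarrow> real) \<Rightarrow> real) \<Rightarrow> bool" where
  "strict_diff N W f D \<longleftrightarrow> W \<subseteq> extensional {..<N} \<and> f \<in> borel_measurable (real_space N) \<and>
     (\<forall>j<N. D j \<in> borel_measurable (real_space N)) \<and>
     (\<exists>H \<in> borel_measurable (real_space N). strict_diff_modulus N W f D H)"

lemma strict_diff_modulusD:
  assumes "strict_diff_modulus N W f D H" "x \<in> W" "r > 0" "r * H x \<le> 1" "u \<in> cube N x r" "v \<in> cube N x r"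
    "m \<ge> 0" "\<And>j. j < N \<Longrightarrow> \<bar>u j - v j\<bar> \<le> m"
  shows "\<bar>f u - f v - (\<Sum>j<N. D j x * (u j - v j))\<bar> \<le> r * H x * m"
  using assms unfolding strict_diff_modulus_def by blast

lemma strict_diff_modulus_mono:
  assumes H: "strict_diff_modulus N W f D H" and le: "\<And>x. x \<in> W \<Longrightarrow> H x \<le> H' x" and H'0: "\<And>x. H' x \<ge> 0"
  shows "strict_diff_modulus N W f D H'"
  unfolding strict_diff_modulus_def
proof (intro conjI allI ballI impI)
  fix x r u v m
  assume *: "x \<in> W" "0 < r" "r * H' x \<le> 1" "u \<in> cube N x r" "v \<in> cube N x r" "0 \<le> (m::real)" "\<forall>j<N. \<bar>u j - v j\<bar> \<le> m"
  have rH: "r * H x \<le> r * H' x" using le[OF *(1)] *(2) by simp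
  then have rH1: "r * H x \<le> 1" using *(3) by (rule order_trans)
  have "\<bar>f u - f v - (\<Sum>j<N. D j x * (u j - v j))\<bar> \<le> r * H x * m"
    by (rule strict_diff_modulusD[OF H *(1,2) rH1 *(4-6)]) (use *(7) in auto)
  also have "\<dots> \<le> r * H' x * m" using rH *(6) by (rule mult_right_mono)
  finally show "\<bar>f u - f v - (\<Sum>j<N. D j x * (u j - v j))\<bar> \<le> r * H' x * m" .
qed (rule H'0)

lemma strict_diff_const: "W \<subseteq> extensional {..<N} \<Longrightarrow> strict_diff N W (\<lambda>x. c) (\<lambda>j x. 0)"
  unfolding strict_diff_def by (auto intro!: bexI[of _ "\<lambda>x. 0"] simp: strict_diff_modulus_def)

lemma strict_diff_coord:
  assumes W: "W \<subseteq> extensional {..<N}" and k: "k < N"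
  shows "strict_diff N W (\<lambda>x. x k) (\<lambda>j x. if j = k then 1 else 0)"
proof -
  have "(\<Sum>j<N. (if j = k then 1 else 0) * (u j - v j)) = u k - (v k :: real)" for u v
  proof -
    have "(\<Sum>j<N. (if j = k then 1 else 0) * (u j - v j)) = (\<Sum>j<N. if j = k then u j - v j else 0)"
      by (intro sum.cong) auto
    then show ?thesis using k by simp
  qed
  then have "strict_diff_modulus N W (\<lambda>x. x k) (\<lambda>j x. if j = k then 1 else 0) (\<lambda>x. 0)"
    by (simp add: strict_diff_modulus_def)
  then show ?thesis
    unfolding strict_diff_def using W k by (auto intro!: bexI[of _ "\<lambda>x. 0"])
qed

lemma strict_diff_add:
  assumes "strict_diff N W f D" "strict_diff N W g D'"
  shows "strict_diff N W (\<lambda>x. f x + g x) (\<lambda>j x. D j x + D' j x)"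
proof -
  obtain H H' where H: "H \<in> borel_measurable (real_space N)" "strict_diff_modulus N W f D H"
    and H': "H' \<in> borel_measurable (real_space N)" "strict_diff_modulus N W g D' H'"
    using assms unfolding strict_diff_def by blast
  have H0: "H x \<ge> 0" "H' x \<ge> 0" for x using H(2) H'(2) by (auto simp: strict_diff_modulus_def)
  have H1: "strict_diff_modulus N W f D (\<lambda>x. H x + H' x)" "strict_diff_modulus N W g D' (\<lambda>x. H x + H' x)"
    using H0 by (auto intro: strict_diff_modulus_mono[OF H(2)] strict_diff_modulus_mono[OF H'(2)])
  have "strict_diff_modulus N W (\<lambda>x. f x + g x) (\<lambda>j x. D j x + D' j x) (\<lambda>x. H x + H' x)"
    unfolding strict_diff_modulus_def
  proof (intro conjI allI ballI impI)
    fix x r u v m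
    assume *: "x \<in> W" "0 < r" "r * (H x + H' x) \<le> 1" "u \<in> cube N x r" "v \<in> cube N x r" "0 \<le> (m::real)" "\<forall>j<N. \<bar>u j - v j\<bar> \<le> m"
    have "r * H x \<le> r * (H x + H' x)" "r * H' x \<le> r * (H x + H' x)"
      using H0[of x] *(2) by (simp_all add: distrib_left)
    then have le: "r * H x \<le> 1" "r * H' x \<le> 1" using *(3) by linarith+
    have "\<bar>f u - f v - (\<Sum>j<N. D j x * (u j - v j))\<bar> \<le> r * H x * m"
      by (rule strict_diff_modulusD[OF H(2) *(1,2) le(1) *(4-6)]) (use * in auto)
    moreover have "\<bar>g u - g v - (\<Sum>j<N. D' j x * (u j - v j))\<bar> \<le> r * H' x * m"
      by (rule strict_diff_modulusD[OF H'(2) *(1,2) le(2) *(4-6)]) (use * in auto)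
    moreover have "(\<Sum>j<N. (D j x + D' j x) * (u j - v j))
      = (\<Sum>j<N. D j x * (u j - v j)) + (\<Sum>j<N. D' j x * (u j - v j))"
      by (simp add: distrib_right sum.distrib)
    moreover have "r * (H x + H' x) * m = r * H x * m + r * H' x * m" by (simp add: algebra_simps)
    ultimately show "\<bar>(f u + g u) - (f v + g v) - (\<Sum>j<N. (D j x + D' j x) * (u j - v j))\<bar> \<le> r * (H x + H' x) * m"
      by linarith
  qed (use H0 in auto)
  moreover have "(\<lambda>x. H x + H' x) \<in> borel_measurable (real_space N)"
    using H(1) H'(1) by (rule borel_measurable_add)
  ultimately show ?thesis using assms unfolding strict_diff_def by (blast intro: borel_measurable_add)
qed

definition slope :: "nat \<Rightarrow> (nat \<Rightarrow> (nat \<Rightarrow> real) \<Rightarrow> real) \<Rightarrow> (nat \<Rightarrow> real) \<Rightarrow> real" where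
  "slope N D x = (\<Sum>j<N. \<bar>D j x\<bar>)"

lemma slope_nonneg: "slope N D x \<ge> 0"
  by (auto simp: slope_def intro!: sum_nonneg)

lemma slope_bound:
  assumes "\<And>j. j < N \<Longrightarrow> \<bar>v j\<bar> \<le> m"
  shows "\<bar>\<Sum>j<N. D j x * v j\<bar> \<le> slope N D x * m"
proof -
  have "\<bar>\<Sum>j<N. D j x * v j\<bar> \<le> (\<Sum>j<N. \<bar>D j x\<bar> * m)"
    by (rule order_trans[OF sum_abs]) (auto simp: abs_mult intro!: sum_mono mult_left_mono assms)
  then show ?thesis by (simp add: slope_def sum_distrib_right)
qed

lemma borel_measurable_slope:
  assumes "\<And>j. j < N \<Longrightarrow> D j \<in> borel_measurable M"
  shows "slope N D \<in> borel_measurable M"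
  unfolding slope_def[abs_def] by (intro borel_measurable_sum borel_measurable_abs assms) auto

lemma strict_diff_close:
  assumes H: "strict_diff_modulus N W f D H" and x: "x \<in> W" "W \<subseteq> extensional {..<N}" and r: "r > 0" "r * H x \<le> 1"
    and u: "u \<in> cube N x r"
  shows "\<bar>f u - f x\<bar> \<le> (slope N D x + 1) * r"
proof -
  have xc: "x \<in> cube N x r" using x r by (auto simp: cube_def)
  have uj: "\<And>j. j < N \<Longrightarrow> \<bar>u j - x j\<bar> \<le> r" using u by (auto simp: cube_def)
  have "\<bar>f u - f x - (\<Sum>j<N. D j x * (u j - x j))\<bar> \<le> r * H x * r"
    by (rule strict_diff_modulusD[OF H x(1) r u xc _ uj]) (use r in auto)
  also have "\<dots> \<le> 1 * r" using r by (intro mult_right_mono) auto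
  finally have "\<bar>f u - f x - (\<Sum>j<N. D j x * (u j - x j))\<bar> \<le> r" by simp
  moreover have "\<bar>\<Sum>j<N. D j x * (u j - x j)\<bar> \<le> slope N D x * r" by (rule slope_bound[OF uj])
  ultimately show ?thesis by (simp add: distrib_right)
qed

lemma strict_diff_mult:
  assumes "strict_diff N W f D" "strict_diff N W g D'"
  shows "strict_diff N W (\<lambda>x. f x * g x) (\<lambda>j x. f x * D' j x + g x * D j x)"
proof -
  have W: "W \<subseteq> extensional {..<N}"
    and fm [measurable]: "f \<in> borel_measurable (real_space N)" and gm [measurable]: "g \<in> borel_measurable (real_space N)"
    and Dm: "\<And>j. j < N \<Longrightarrow> D j \<in> borel_measurable (real_space N)" "\<And>j. j < N \<Longrightarrow> D' j \<in> borel_measurable (real_space N)"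
    using assms unfolding strict_diff_def by auto
  obtain H H' where H [measurable]: "H \<in> borel_measurable (real_space N)" and Hs: "strict_diff_modulus N W f D H"
    and H' [measurable]: "H' \<in> borel_measurable (real_space N)" and Hs': "strict_diff_modulus N W g D' H'"
    using assms unfolding strict_diff_def by blast
  have H0: "H x \<ge> 0" "H' x \<ge> 0" for x using Hs Hs' by (auto simp: strict_diff_modulus_def)
  let ?S = "slope N D" and ?S' = "slope N D'"
  note [measurable] = borel_measurable_slope[OF Dm(1)] borel_measurable_slope[OF Dm(2)]
  \<comment> \<open>The four products are the coefficients of the four error terms in the product
    rule. The summands \<open>H x\<close>, \<open>H' x\<close> and 1 let
    \<open>r * K x \<le> 1\<close> imply the corresponding conditions for \<open>f\<close> and
    \<open>g\<close> as well as \<open>r \<le> 1\<close>, which bounds \<open>f u\<close> and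
    \<open>g v\<close> in terms of the values at \<open>x\<close>.\<close>
  define K where "K x = (?S x + 1) * ?S' x + (?S' x + 1) * ?S x + (\<bar>f x\<bar> + ?S x + 1) * H' x + (\<bar>g x\<bar> + ?S' x + 1) * H x
    + H x + H' x + 1" for x
  have parts: "0 \<le> (?S x + 1) * ?S' x" "0 \<le> (?S' x + 1) * ?S x" "0 \<le> (\<bar>f x\<bar> + ?S x + 1) * H' x" "0 \<le> (\<bar>g x\<bar> + ?S' x + 1) * H x" for x
    using H0[of x] slope_nonneg[of N D x] slope_nonneg[of N D' x] by simp_all
  have K: "K x \<ge> 1" "H x \<le> K x" "H' x \<le> K x" for x
    using parts[of x] H0[of x] by (auto simp: K_def)
  have "strict_diff_modulus N W (\<lambda>x. f x * g x) (\<lambda>j x. f x * D' j x + g x * D j x) K"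
    unfolding strict_diff_modulus_def
  proof (intro conjI allI ballI impI)
    fix x r u v m
    assume *: "x \<in> W" "0 < r" "r * K x \<le> 1" "u \<in> cube N x r" "v \<in> cube N x r" "0 \<le> (m::real)" "\<forall>j<N. \<bar>u j - v j\<bar> \<le> m"
    have rK: "r * 1 \<le> r * K x" "r * H x \<le> r * K x" "r * H' x \<le> r * K x"
      using K[of x] *(2) by (auto intro!: mult_left_mono)
    then have le: "r \<le> 1" "r * H x \<le> 1" "r * H' x \<le> 1" using *(3) by linarith+
    define e where "e = f u - f v - (\<Sum>j<N. D j x * (u j - v j))"
    define e' where "e' = g u - g v - (\<Sum>j<N. D' j x * (u j - v j))"
    define d where "d = (\<Sum>j<N. D j x * (u j - v j))"
    define d' where "d' = (\<Sum>j<N. D' j x * (u j - v j))"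
    have e: "\<bar>e\<bar> \<le> r * H x * m" unfolding e_def
      by (rule strict_diff_modulusD[OF Hs *(1,2) le(2) *(4-6)]) (use * in auto)
    have e': "\<bar>e'\<bar> \<le> r * H' x * m" unfolding e'_def
      by (rule strict_diff_modulusD[OF Hs' *(1,2) le(3) *(4-6)]) (use * in auto)
    have d: "\<bar>d\<bar> \<le> ?S x * m" "\<bar>d'\<bar> \<le> ?S' x * m" unfolding d_def d'_def using *(7) by (auto intro!: slope_bound)
    have cu: "\<bar>f u - f x\<bar> \<le> (?S x + 1) * r" by (rule strict_diff_close[OF Hs *(1) W *(2) le(2) *(4)])
    have cv: "\<bar>g v - g x\<bar> \<le> (?S' x + 1) * r" by (rule strict_diff_close[OF Hs' *(1) W *(2) le(3) *(5)])
    have r1: "(?S x + 1) * r \<le> (?S x + 1) * 1" "(?S' x + 1) * r \<le> (?S' x + 1) * 1"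
      using le(1) slope_nonneg[of N D x] slope_nonneg[of N D' x] by (intro mult_left_mono; simp)+
    have fu: "\<bar>f u\<bar> \<le> \<bar>f x\<bar> + ?S x + 1"
      using cu r1(1) abs_triangle_ineq2[of "f u" "f x"] by simp
    have gv: "\<bar>g v\<bar> \<le> \<bar>g x\<bar> + ?S' x + 1"
      using cv r1(2) abs_triangle_ineq2[of "g v" "g x"] by simp
    have "(\<Sum>j<N. (f x * D' j x + g x * D j x) * (u j - v j)) = f x * d' + g x * d"
      by (simp add: d_def d'_def sum_distrib_left sum.distrib distrib_right mult.assoc)
    moreover have "f u = f v + d + e" "g u = g v + d' + e'" by (simp_all add: e_def e'_def d_def d'_def)
    then have "f u * g u - f v * g v - (f x * d' + g x * d) = (f u - f x) * d' + (g v - g x) * d + f u * e' + g v * e"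
      by (simp add: algebra_simps)
    ultimately have "f u * g u - f v * g v - (\<Sum>j<N. (f x * D' j x + g x * D j x) * (u j - v j))
      = (f u - f x) * d' + (g v - g x) * d + f u * e' + g v * e"
      by (simp only:)
    moreover have "\<bar>(f u - f x) * d'\<bar> \<le> ((?S x + 1) * r) * (?S' x * m)"
      unfolding abs_mult by (intro mult_mono cu d) (use *(2) slope_nonneg[of N D x] in auto)
    moreover have "\<bar>(g v - g x) * d\<bar> \<le> ((?S' x + 1) * r) * (?S x * m)"
      unfolding abs_mult by (intro mult_mono cv d) (use *(2) slope_nonneg[of N D' x] in auto)
    moreover have "\<bar>f u * e'\<bar> \<le> (\<bar>f x\<bar> + ?S x + 1) * (r * H' x * m)"
      unfolding abs_mult by (intro mult_mono fu e') (use slope_nonneg[of N D x] in auto)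
    moreover have "\<bar>g v * e\<bar> \<le> (\<bar>g x\<bar> + ?S' x + 1) * (r * H x * m)"
      unfolding abs_mult by (intro mult_mono gv e) (use slope_nonneg[of N D' x] in auto)
    moreover have "((?S x + 1) * r) * (?S' x * m) + ((?S' x + 1) * r) * (?S x * m) + (\<bar>f x\<bar> + ?S x + 1) * (r * H' x * m)
       + (\<bar>g x\<bar> + ?S' x + 1) * (r * H x * m) = r * (K x - H x - H' x - 1) * m"
      by (simp add: K_def algebra_simps)
    moreover have "r * (K x - H x - H' x - 1) * m \<le> r * K x * m"
      using H0[of x] *(2,6) by (intro mult_right_mono mult_left_mono) auto
    ultimately show "\<bar>f u * g u - f v * g v - (\<Sum>j<N. (f x * D' j x + g x * D j x) * (u j - v j))\<bar> \<le> r * K x * m"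
      by linarith
  qed (use K in \<open>auto intro: order_trans[OF zero_le_one]\<close>)
  moreover have "K \<in> borel_measurable (real_space N)" unfolding K_def[abs_def] by measurable
  ultimately show ?thesis unfolding strict_diff_def using W fm gm Dm by (auto intro!: bexI[of _ K])
qed

text \<open>On a cube where \<open>g\<close> varies by at most half of
  \<open>\<bar>g x\<bar>\<close> the denominators stay away from zero, which makes the usual
  computation uniform. The second claim records the radius of such cubes: solutions found near
  \<open>x\<close> must have nonzero denominators too.\<close>

lemma strict_diff_inverse:
  assumes "strict_diff N W g D" and nz: "\<And>x. x \<in> W \<Longrightarrow> g x \<noteq> 0"
  shows "strict_diff N W (\<lambda>x. inverse (g x)) (\<lambda>j x. - D j x / (g x)\<^sup>2)"
    and "\<exists>H \<in> borel_measurable (real_space N). (\<forall>x. H x \<ge> 0) \<and> (\<forall>x\<in>W. \<forall>r>0. r * H x \<le> 1 \<longrightarrow> (\<forall>u\<in>cube N x r. g u \<noteq> 0))"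
proof -
  have W: "W \<subseteq> extensional {..<N}" and gm [measurable]: "g \<in> borel_measurable (real_space N)"
    and Dm: "\<And>j. j < N \<Longrightarrow> D j \<in> borel_measurable (real_space N)"
    using assms unfolding strict_diff_def by auto
  obtain H where H [measurable]: "H \<in> borel_measurable (real_space N)" and Hs: "strict_diff_modulus N W g D H"
    using assms unfolding strict_diff_def by blast
  have H0: "H x \<ge> 0" for x using Hs by (auto simp: strict_diff_modulus_def)
  let ?S = "slope N D"
  note [measurable] = borel_measurable_slope[OF Dm]
  have S0: "?S x \<ge> 0" for x by (rule slope_nonneg)
  \<comment> \<open>The second summand forces
    \<open>(?S x + 1) * r \<le> \<bar>g x\<bar> / 2\<close>, and the left side bounds the variation
    of \<open>g\<close> on the cube.\<close>
  define K1 where "K1 x = H x + 2 * (?S x + 1) / \<bar>g x\<bar>" for x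
  \<comment> \<open>With \<open>c = \<bar>g x\<bar>\<close>, the product \<open>g u * g v\<close>
    has absolute value at least \<open>c\<^sup>2 / 4\<close>. This gives the 4 in the last summand
    and, together with the \<open>5 / 2 * c\<close> in \<open>num\<close>, the 10.\<close>
  define K where "K x = K1 x + 10 * (?S x + 1) * ?S x / \<bar>g x\<bar> ^ 3 + 4 * H x / \<bar>g x\<bar> ^ 2" for x
  have K1m [measurable]: "K1 \<in> borel_measurable (real_space N)" unfolding K1_def[abs_def] by measurable
  have K10: "K1 x \<ge> 0" "H x \<le> K1 x" for x using H0[of x] S0[of x] by (auto simp: K1_def)
  have K0: "K x \<ge> 0" "K1 x \<le> K x" for x
    using K10[of x] H0[of x] S0[of x] by (auto simp: K_def)
  have half: "\<bar>g u - g x\<bar> \<le> \<bar>g x\<bar> / 2" "\<bar>g u - g x\<bar> \<le> (?S x + 1) * r"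
    if x: "x \<in> W" and r: "r > 0" "r * K1 x \<le> 1" and u: "u \<in> cube N x r" for x r u
  proof -
    have "r * H x \<le> r * K1 x" using K10[of x] r(1) by (intro mult_left_mono) auto
    then have rH: "r * H x \<le> 1" using r(2) by linarith
    show c: "\<bar>g u - g x\<bar> \<le> (?S x + 1) * r"
      by (rule strict_diff_close[OF Hs x W r(1) rH u])
    have "r * (2 * (?S x + 1) / \<bar>g x\<bar>) \<le> r * K1 x" using r H0[of x] by (intro mult_left_mono) (auto simp: K1_def)
    then have "r * (2 * (?S x + 1) / \<bar>g x\<bar>) \<le> 1" using r by linarith
    then have "r * (2 * (?S x + 1)) \<le> \<bar>g x\<bar>" using nz[OF x] by (simp add: pos_divide_le_eq)
    then show "\<bar>g u - g x\<bar> \<le> \<bar>g x\<bar> / 2" using c by (simp add: algebra_simps)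
  qed
  have nzu: "g u \<noteq> 0" if x: "x \<in> W" and r: "r > 0" "r * K1 x \<le> 1" and u: "u \<in> cube N x r" for x r u
    using half(1)[OF that] nz[OF x] by auto
  then show "\<exists>H \<in> borel_measurable (real_space N). (\<forall>x. H x \<ge> 0) \<and> (\<forall>x\<in>W. \<forall>r>0. r * H x \<le> 1 \<longrightarrow> (\<forall>u\<in>cube N x r. g u \<noteq> 0))"
    using K10 by (intro bexI[of _ K1]) auto
  have "strict_diff_modulus N W (\<lambda>x. inverse (g x)) (\<lambda>j x. - D j x / (g x)\<^sup>2) K"
    unfolding strict_diff_modulus_def
  proof (intro conjI allI ballI impI)
    fix x r u v m
    assume *: "x \<in> W" "0 < r" "r * K x \<le> 1" "u \<in> cube N x r" "v \<in> cube N x r" "0 \<le> (m::real)" "\<forall>j<N. \<bar>u j - v j\<bar> \<le> m"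
    have rK: "r * K1 x \<le> r * K x" "r * H x \<le> r * K1 x"
      using K0[of x] K10[of x] *(2) by (auto intro!: mult_left_mono)
    then have le: "r * K1 x \<le> 1" "r * H x \<le> 1" using *(3) by linarith+
    define c where "c = \<bar>g x\<bar>"
    define d where "d = (\<Sum>j<N. D j x * (u j - v j))"
    define e where "e = g u - g v - d"
    have c0: "c > 0" using nz[OF *(1)] by (simp add: c_def)
    have e: "\<bar>e\<bar> \<le> r * H x * m" unfolding e_def d_def
      by (rule strict_diff_modulusD[OF Hs *(1,2) le(2) *(4-6)]) (use * in auto)
    have d: "\<bar>d\<bar> \<le> ?S x * m" unfolding d_def using *(7) by (auto intro!: slope_bound)
    note hu = half[OF *(1,2) le(1) *(4)] and hv = half[OF *(1,2) le(1) *(5)]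
    have gu: "c / 2 \<le> \<bar>g u\<bar>" "\<bar>g u\<bar> \<le> 3 / 2 * c"
      using hu(1) abs_triangle_ineq2[of "g u" "g x"] abs_triangle_ineq2[of "g x" "g u"]
      unfolding c_def abs_minus_commute[of "g x" "g u"] by linarith+
    have gv: "c / 2 \<le> \<bar>g v\<bar>"
      using hv(1) abs_triangle_ineq2[of "g x" "g v"]
      unfolding c_def abs_minus_commute[of "g x" "g v"] by linarith
    have nz': "g u \<noteq> 0" "g v \<noteq> 0" "g x \<noteq> 0" using nzu[OF *(1,2) le(1)] *(4,5) nz[OF *(1)] by auto
    have prod: "c\<^sup>2 / 4 \<le> \<bar>g u * g v\<bar>"
      using mult_mono[OF gu(1) gv] c0 by (simp add: abs_mult power2_eq_square)
    have "(\<Sum>j<N. - D j x / (g x)\<^sup>2 * (u j - v j)) = - d / (g x)\<^sup>2"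
      by (simp add: d_def sum_divide_distrib sum_negf)
    then have eq: "inverse (g u) - inverse (g v) - (\<Sum>j<N. - D j x / (g x)\<^sup>2 * (u j - v j))
      = d * ((g u * g v - (g x)\<^sup>2) / ((g u * g v) * (g x)\<^sup>2)) - e / (g u * g v)"
    proof -
      have "inverse (g u) - inverse (g v) = (g v - g u) / (g u * g v)" using nz' by (simp add: field_simps)
      also have "g v - g u = - d - e" by (simp add: e_def)
      also have "(- d - e) / (g u * g v) + d / (g x)\<^sup>2 = d * ((g u * g v - (g x)\<^sup>2) / ((g u * g v) * (g x)\<^sup>2)) - e / (g u * g v)"
        using nz' by (simp add: field_simps)
      finally show ?thesis using \<open>(\<Sum>j<N. - D j x / (g x)\<^sup>2 * (u j - v j)) = - d / (g x)\<^sup>2\<close> by simp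
    qed
    have num: "\<bar>g u * g v - (g x)\<^sup>2\<bar> \<le> 5 / 2 * c * ((?S x + 1) * r)"
    proof -
      have "g u * g v - (g x)\<^sup>2 = g u * (g v - g x) + g x * (g u - g x)" by (simp add: algebra_simps power2_eq_square)
      moreover have "\<bar>g u * (g v - g x)\<bar> \<le> 3 / 2 * c * ((?S x + 1) * r)"
        unfolding abs_mult by (intro mult_mono gu hv) (use c0 in auto)
      moreover have "\<bar>g x * (g u - g x)\<bar> \<le> c * ((?S x + 1) * r)"
        unfolding abs_mult c_def by (intro mult_left_mono hu) auto
      ultimately show ?thesis by linarith
    qed
    have c4: "c\<^sup>2 / 4 > 0" using c0 by simp
    have "\<bar>(g u * g v - (g x)\<^sup>2) / ((g u * g v) * (g x)\<^sup>2)\<bar> \<le> (5 / 2 * c * ((?S x + 1) * r)) / (c\<^sup>2 / 4 * c\<^sup>2)"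
      unfolding abs_divide
    proof (rule frac_le)
      show "c\<^sup>2 / 4 * c\<^sup>2 \<le> \<bar>g u * g v * (g x)\<^sup>2\<bar>"
        using mult_right_mono[OF prod, of "c\<^sup>2"] by (simp add: abs_mult c_def)
    qed (use num c0 S0[of x] *(2) in auto)
    also have "\<dots> = r * (10 * (?S x + 1) / c ^ 3)"
      using c0 by (simp add: field_simps power2_eq_square power3_eq_cube)
    finally have q: "\<bar>(g u * g v - (g x)\<^sup>2) / ((g u * g v) * (g x)\<^sup>2)\<bar> \<le> r * (10 * (?S x + 1) / c ^ 3)" .
    have "\<bar>d * ((g u * g v - (g x)\<^sup>2) / ((g u * g v) * (g x)\<^sup>2))\<bar> \<le> (?S x * m) * (r * (10 * (?S x + 1) / c ^ 3))"
      unfolding abs_mult[of d] by (intro mult_mono d q) (use S0[of x] *(6) in auto)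
    also have "\<dots> = r * (10 * (?S x + 1) * ?S x / c ^ 3) * m" by (simp add: algebra_simps)
    finally have t1: "\<bar>d * ((g u * g v - (g x)\<^sup>2) / ((g u * g v) * (g x)\<^sup>2))\<bar> \<le> r * (10 * (?S x + 1) * ?S x / c ^ 3) * m" .
    have "\<bar>e / (g u * g v)\<bar> \<le> (r * H x * m) / (c\<^sup>2 / 4)"
      unfolding abs_divide by (rule frac_le[OF _ e c4 prod]) (use *(2,6) H0[of x] in auto)
    also have "\<dots> = r * (4 * H x / c\<^sup>2) * m" by (simp add: field_simps)
    finally have t2: "\<bar>e / (g u * g v)\<bar> \<le> r * (4 * H x / c\<^sup>2) * m" .
    have "r * (10 * (?S x + 1) * ?S x / c ^ 3) * m + r * (4 * H x / c\<^sup>2) * m = r * (K x - K1 x) * m"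
      by (simp add: K_def c_def algebra_simps)
    also have "\<dots> \<le> r * K x * m"
      using K10[of x] *(2,6) by (intro mult_right_mono mult_left_mono) auto
    finally show "\<bar>inverse (g u) - inverse (g v) - (\<Sum>j<N. - D j x / (g x)\<^sup>2 * (u j - v j))\<bar> \<le> r * K x * m"
      unfolding eq using t1 t2 by linarith
  qed (rule K0)
  moreover have "K \<in> borel_measurable (real_space N)" unfolding K_def[abs_def] by measurable
  moreover have "(\<lambda>x. - D j x / (g x)\<^sup>2) \<in> borel_measurable (real_space N)" if "j < N" for j
    using Dm[OF that] by measurable
  ultimately show "strict_diff N W (\<lambda>x. inverse (g x)) (\<lambda>j x. - D j x / (g x)\<^sup>2)"
    unfolding strict_diff_def using W gm by (auto intro!: bexI[of _ K])
qed

text \<open>If \<open>m\<close> bounds the entries of \<open>v\<close>, then \<open>p\<close> and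
  \<open>p + t v\<close> lie in the cube of radius \<open>t * m\<close> about \<open>p\<close>, on
  which the modulus makes the error quadratic in \<open>t\<close>.\<close>

lemma strict_diff_along:
  assumes "strict_diff N W f D" and p: "p \<in> W"
  shows "((\<lambda>t. (f (\<lambda>j\<in>{..<N}. p j + t * v j) - f p) / t) \<longlongrightarrow> (\<Sum>j<N. D j p * v j)) (at_right 0)"
proof -
  have W: "W \<subseteq> extensional {..<N}" using assms unfolding strict_diff_def by auto
  obtain H where Hs: "strict_diff_modulus N W f D H"
    using assms unfolding strict_diff_def by blast
  have H0: "H p \<ge> 0" using Hs by (auto simp: strict_diff_modulus_def)
  define m where "m = (\<Sum>j<N. \<bar>v j\<bar>) + 1"
  have m: "\<bar>v j\<bar> \<le> m" if "j < N" for j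
    using member_le_sum[of j "{..<N}" "\<lambda>j. \<bar>v j\<bar>"] that by (auto simp: m_def)
  have m0: "m > 0" using sum_nonneg[of "{..<N}" "\<lambda>j. \<bar>v j\<bar>"] unfolding m_def by linarith
  have est: "\<bar>(f (\<lambda>j\<in>{..<N}. p j + t * v j) - f p) / t - (\<Sum>j<N. D j p * v j)\<bar> \<le> H p * m\<^sup>2 * t"
    if t: "0 < t" "t < 1 / (m * (H p + 1))" for t
  proof -
    let ?u = "\<lambda>j\<in>{..<N}. p j + t * v j"
    have tv: "\<bar>?u j - p j\<bar> \<le> t * m" if "j < N" for j
      using that m[OF that] t by (simp add: abs_mult)
    have uc: "?u \<in> cube N p (t * m)" using tv by (auto simp: cube_def)
    have pc: "p \<in> cube N p (t * m)" using p W t m0 by (auto simp: cube_def)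
    have "t * (m * (H p + 1)) < 1" using t m0 H0 by (simp add: pos_less_divide_eq)
    then have small: "t * m * H p \<le> 1" using t m0 H0 by (simp add: algebra_simps) (smt (verit) mult_pos_pos)
    have tm: "0 < t * m" using t m0 by simp
    have "\<bar>f ?u - f p - (\<Sum>j<N. D j p * (?u j - p j))\<bar> \<le> t * m * H p * (t * m)"
      by (rule strict_diff_modulusD[OF Hs p tm small uc pc less_imp_le[OF tm] tv])
    also have "(\<Sum>j<N. D j p * (?u j - p j)) = t * (\<Sum>j<N. D j p * v j)"
      by (simp add: sum_distrib_left mult_ac)
    finally have le: "\<bar>f ?u - f p - t * (\<Sum>j<N. D j p * v j)\<bar> \<le> (H p * m\<^sup>2 * t) * t"
      by (simp only: power2_eq_square mult_ac)
    have "(f ?u - f p) / t - (\<Sum>j<N. D j p * v j) = (f ?u - f p - t * (\<Sum>j<N. D j p * v j)) / t"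
      using t by (simp only: diff_divide_distrib) simp
    then show ?thesis using le t by (simp only: abs_divide) (simp add: pos_divide_le_eq)
  qed
  show ?thesis
  proof (rule Lim_transform_eventually[OF _ always_eventually])
    show "((\<lambda>t. ((f (\<lambda>j\<in>{..<N}. p j + t * v j) - f p) / t - (\<Sum>j<N. D j p * v j)) + (\<Sum>j<N. D j p * v j))
      \<longlongrightarrow> (\<Sum>j<N. D j p * v j)) (at_right 0)"
    proof -
      have lim0: "((\<lambda>t. H p * m\<^sup>2 * t) \<longlongrightarrow> H p * m\<^sup>2 * 0) (at_right (0::real))" by (intro tendsto_intros)
      have "((\<lambda>t. (f (\<lambda>j\<in>{..<N}. p j + t * v j) - f p) / t - (\<Sum>j<N. D j p * v j)) \<longlongrightarrow> 0) (at_right 0)"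
      proof (rule Lim_null_comparison)
        have "0 < 1 / (m * (H p + 1))" using m0 H0 by simp
        then show "\<forall>\<^sub>F t in at_right 0. norm ((f (\<lambda>j\<in>{..<N}. p j + t * v j) - f p) / t - (\<Sum>j<N. D j p * v j)) \<le> H p * m\<^sup>2 * t"
          unfolding eventually_at_right_field real_norm_def using est by blast
        show "((\<lambda>t. H p * m\<^sup>2 * t) \<longlongrightarrow> 0) (at_right 0)" using lim0 by simp
      qed
      from tendsto_add[OF this tendsto_const[of "\<Sum>j<N. D j p * v j"]] show ?thesis by simp
    qed
  qed simp
qed

section \<open>Weights of graphs\<close>

lemma angle_lifts_same_derivative:
  assumes lift1: "\<forall>\<^sub>F s in nhds 0. \<exists>m::int. \<theta>1 s = Arg (w s) + 2 * pi * of_int m"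
    and lift2: "\<forall>\<^sub>F s in nhds 0. \<exists>m::int. \<theta>2 s = Arg (w s) + 2 * pi * of_int m"
    and D1: "(\<theta>1 has_real_derivative D1) (at (0::real))" and D2: "(\<theta>2 has_real_derivative D2) (at 0)"
  shows "D1 = D2"
proof -
  have int: "\<forall>\<^sub>F s in nhds 0. \<exists>m::int. \<theta>1 s - \<theta>2 s = 2 * pi * of_int m"
    using lift1 lift2
  proof eventually_elim
    case (elim s)
    then obtain m m' :: int where "\<theta>1 s = Arg (w s) + 2 * pi * of_int m" "\<theta>2 s = Arg (w s) + 2 * pi * of_int m'" by auto
    then show ?case by (intro exI[of _ "m - m'"]) (simp add: algebra_simps)
  qed
  let ?d = "\<lambda>s. \<theta>1 s - \<theta>2 s"
  have Dd: "(?d has_real_derivative D1 - D2) (at 0)" by (rule DERIV_diff[OF D1 D2])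
  then have "isCont ?d 0" by (rule DERIV_isCont)
  then have "(?d \<longlongrightarrow> ?d 0) (nhds 0)" by (simp add: isCont_def tendsto_nhds_iff)
  then have "\<forall>\<^sub>F s in nhds 0. dist (?d s) (?d 0) < 2 * pi" by (rule tendstoD) simp
  moreover obtain m0 :: int where m0: "?d 0 = 2 * pi * of_int m0"
    using eventually_nhds_x_imp_x[OF int] by auto
  moreover note int
  ultimately have "\<forall>\<^sub>F s in nhds 0. dist (?d s) (?d 0) < 2 * pi \<and> (\<exists>m::int. ?d s = 2 * pi * of_int m)"
    by (simp add: eventually_conj_iff)
  then have "\<forall>\<^sub>F s in nhds 0. ?d s = ?d 0"
  proof eventually_elim
    case (elim s)
    then obtain m :: int where m: "?d s = 2 * pi * of_int m" by auto
    have "\<bar>2 * pi * of_int m - 2 * pi * of_int m0\<bar> < 2 * pi" using elim m m0 by (simp add: dist_real_def)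
    then have "2 * pi * \<bar>of_int (m - m0)\<bar> < 2 * pi * 1"
      by (simp add: abs_mult right_diff_distrib[symmetric])
    then have "\<bar>of_int (m - m0) :: real\<bar> < 1" by (simp only: mult_less_cancel_left_pos[OF pi_gt_zero[THEN mult_pos_pos[OF zero_less_numeral]]])
    then have "m = m0" by linarith
    then show ?case using m m0 by simp
  qed
  then have "((\<lambda>s. ?d 0) has_real_derivative D1 - D2) (at 0)"
    using Dd by (rule DERIV_cong_ev[OF refl _ refl, THEN iffD1])
  then have "D1 - D2 = 0" by (rule DERIV_unique) simp
  then show ?thesis by simp
qed

lemma angle_deriv_eq:
  assumes w: "(w has_vector_derivative w') (at 0)" and w0: "w 0 \<noteq> 0"
  shows "angle_deriv w = Im (w' / w 0)"
proof -
  \<comment> \<open>After division by \<open>w 0\<close> the values near 0 are close to 1, away from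
    the cut of \<open>Ln\<close>. The lift is therefore differentiable even if \<open>Arg\<close>
    jumps at \<open>w 0\<close>.\<close>
  define \<theta> where "\<theta> s = Arg (w 0) + Im (Ln (w s / w 0))" for s :: real
  have wn: "((\<lambda>s. w s / w 0) has_vector_derivative w' / w 0) (at 0)"
    using has_vector_derivative_mult_left[OF w, of "1 / w 0"] by simp
  have "((\<lambda>s. Ln (w s / w 0)) has_vector_derivative (w' / w 0) * (1 / 1)) (at 0)"
  proof -
    have "(Ln has_field_derivative 1 / 1) (at (w 0 / w 0))"
      using w0 has_field_derivative_Ln[of 1] by simp
    from field_vector_diff_chain_at[OF wn this] show ?thesis by (simp add: o_def)
  qed
  then have "((\<lambda>s. Im (Ln (w s / w 0))) has_vector_derivative Im ((w' / w 0) * (1 / 1))) (at 0)"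
    by (rule bounded_linear.has_vector_derivative[OF bounded_linear_Im])
  then have D: "(\<theta> has_real_derivative Im (w' / w 0)) (at 0)"
    unfolding \<theta>_def[abs_def] by (auto simp: has_real_derivative_iff_has_vector_derivative intro!: derivative_eq_intros)
  have "isCont w 0" using w has_vector_derivative_continuous by blast
  then have "(w \<longlongrightarrow> w 0) (nhds 0)" by (simp add: isCont_def tendsto_nhds_iff)
  then have ev: "\<forall>\<^sub>F s in nhds 0. w s \<noteq> 0"
    using w0 by (rule tendsto_imp_eventually_ne)
  have lift: "\<forall>\<^sub>F s in nhds 0. \<exists>m::int. \<theta> s = Arg (w s) + 2 * pi * of_int m"
    using ev
  proof eventually_elim
    case (elim s)
    have "cis (\<theta> s) = cis (Arg (w s))"
    proof -
      have "cis (\<theta> s) = cis (Arg (w 0)) * cis (Arg (w s / w 0))"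
        using elim w0 by (simp add: \<theta>_def Arg_eq_Im_Ln cis_mult)
      also have "\<dots> = sgn (w 0) * sgn (w s / w 0)" using elim w0 by (simp add: cis_Arg)
      also have "\<dots> = sgn (w s)" using w0 by (subst sgn_mult[symmetric]) simp
      also have "\<dots> = cis (Arg (w s))" using elim by (simp add: cis_Arg)
      finally show ?thesis .
    qed
    then have "exp (\<i> * of_real (\<theta> s)) = exp (\<i> * of_real (Arg (w s)))" by (simp add: cis_conv_exp)
    then obtain n :: int where n: "\<i> * of_real (\<theta> s) = \<i> * of_real (Arg (w s)) + complex_of_real (real_of_int (2 * n) * pi) * \<i>"
      using exp_eq by blast
    have "\<theta> s = Im (\<i> * of_real (\<theta> s))" by simp
    also have "\<dots> = Arg (w s) + of_int (2 * n) * pi" unfolding n by simp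
    finally have "\<theta> s = Arg (w s) + of_int (2 * n) * pi" by (simp add: complex_eq_iff)
    then show ?case by (intro exI[of _ n]) simp
  qed
  show ?thesis unfolding angle_deriv_def
  proof (rule the_equality)
    show "\<exists>\<theta>. (\<forall>\<^sub>F s in nhds 0. \<exists>m::int. \<theta> s = Arg (w s) + 2 * pi * of_int m) \<and> (\<theta> has_real_derivative Im (w' / w 0)) (at 0)"
      using lift D by blast
  qed (use angle_lifts_same_derivative[OF _ lift _ D] in blast)
qed

fun vertex_re :: "vertex \<Rightarrow> (nat \<Rightarrow> real) \<Rightarrow> real" where
  "vertex_re (Inner k) x = x (2 * k)"
| "vertex_re Left_Vertex x = 0"
| "vertex_re Right_Vertex x = 1"

fun vertex_im :: "vertex \<Rightarrow> (nat \<Rightarrow> real) \<Rightarrow> real" where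
  "vertex_im (Inner k) x = x (2 * k + 1)"
| "vertex_im Left_Vertex x = 0"
| "vertex_im Right_Vertex x = 0"

fun vertex_re_deriv :: "vertex \<Rightarrow> nat \<Rightarrow> (nat \<Rightarrow> real) \<Rightarrow> real" where
  "vertex_re_deriv (Inner k) j x = (if j = 2 * k then 1 else 0)"
| "vertex_re_deriv Left_Vertex j x = 0"
| "vertex_re_deriv Right_Vertex j x = 0"

fun vertex_im_deriv :: "vertex \<Rightarrow> nat \<Rightarrow> (nat \<Rightarrow> real) \<Rightarrow> real" where
  "vertex_im_deriv (Inner k) j x = (if j = 2 * k + 1 then 1 else 0)"
| "vertex_im_deriv Left_Vertex j x = 0"
| "vertex_im_deriv Right_Vertex j x = 0"

text \<open>For an edge from \<open>u\<close> to \<open>v\<close> the angle is the argument of \<open>(u - v) (u - cnj v)\<close>, which has the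
  advantage over \<^const>\<open>edge_ratio\<close> of being a polynomial. In the coordinates \<open>x (2 k)\<close> and \<open>x (2 k + 1)\<close>
  of \<open>z k\<close>, these are its real and imaginary parts and their partial derivatives.\<close>

definition edge_re :: "nat \<Rightarrow> vertex \<Rightarrow> (nat \<Rightarrow> real) \<Rightarrow> real" where
  "edge_re k v x = (x (2 * k) - vertex_re v x) * (x (2 * k) - vertex_re v x)
     + (vertex_im v x * vertex_im v x - x (2 * k + 1) * x (2 * k + 1))"

definition edge_im :: "nat \<Rightarrow> vertex \<Rightarrow> (nat \<Rightarrow> real) \<Rightarrow> real" where
  "edge_im k v x = 2 * (x (2 * k + 1) * (x (2 * k) - vertex_re v x))"

definition edge_re_deriv :: "nat \<Rightarrow> vertex \<Rightarrow> nat \<Rightarrow> (nat \<Rightarrow> real) \<Rightarrow> real" where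
  "edge_re_deriv k v j x = 2 * (x (2 * k) - vertex_re v x) * ((if j = 2 * k then 1 else 0) - vertex_re_deriv v j x)
     + (2 * vertex_im v x * vertex_im_deriv v j x - 2 * x (2 * k + 1) * (if j = 2 * k + 1 then 1 else 0))"

definition edge_im_deriv :: "nat \<Rightarrow> vertex \<Rightarrow> nat \<Rightarrow> (nat \<Rightarrow> real) \<Rightarrow> real" where
  "edge_im_deriv k v j x = 2 * (x (2 * k + 1) * ((if j = 2 * k then 1 else 0) - vertex_re_deriv v j x)
     + (x (2 * k) - vertex_re v x) * (if j = 2 * k + 1 then 1 else 0))"

definition real_coords :: "nat \<Rightarrow> (nat \<Rightarrow> complex) \<Rightarrow> nat \<Rightarrow> real" where
  "real_coords n z = (\<lambda>j\<in>{..<2 * n}. if even j then Re (z (j div 2)) else Im (z (j div 2)))"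

lemma real_coords_even: "k < n \<Longrightarrow> real_coords n z (2 * k) = Re (z k)"
  by (simp add: real_coords_def)

lemma real_coords_odd: "k < n \<Longrightarrow> real_coords n z (Suc (2 * k)) = Im (z k)"
  by (simp add: real_coords_def)

fun vertex_ok :: "nat \<Rightarrow> vertex \<Rightarrow> bool" where
  "vertex_ok n (Inner k) \<longleftrightarrow> k < n"
| "vertex_ok n Left_Vertex \<longleftrightarrow> True"
| "vertex_ok n Right_Vertex \<longleftrightarrow> True"

lemma vertex_ok_iff: "vertex_ok n v \<longleftrightarrow> v \<in> vertices n"
  by (cases v) (auto simp: vertices_def)

lemma vertex_pos_real_coords:
  assumes "vertex_ok n v"
  shows "Re (vertex_pos z v) = vertex_re v (real_coords n z)" "Im (vertex_pos z v) = vertex_im v (real_coords n z)"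
  using assms by (cases v; simp add: real_coords_even real_coords_odd)+

text \<open>The ratio \<open>P / Q\<close> in \<open>edge_ratio\<close> and the product
  \<open>W = P * cnj Q\<close> differ by a positive factor and have the same argument. The right
  side is \<open>Im (W' / W)\<close> in real and imaginary parts. Distinctness of the points gives
  \<open>P \<noteq> 0\<close>, and the sign of the imaginary parts gives
  \<open>Q \<noteq> 0\<close>.\<close>

lemma dangle_eq:
  assumes k: "k < n" and l: "l < n" and v: "vertex_ok n (\<Gamma> (k, a))" "\<Gamma> (k, a) \<noteq> Inner k" and z: "z \<in> configs n"
    and b: "(b = 0 \<and> dir = 1) \<or> (b = 1 \<and> dir = \<i>)"
  defines "x \<equiv> real_coords n z" and "v \<equiv> \<Gamma> (k, a)"
  shows "edge_re k v x \<noteq> 0 \<or> edge_im k v x \<noteq> 0"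
    and "dangle \<Gamma> (k, a) (l, dir) z
      = (edge_re k v x * edge_im_deriv k v (2 * l + b) x - edge_im k v x * edge_re_deriv k v (2 * l + b) x)
        / ((edge_re k v x)\<^sup>2 + (edge_im k v x)\<^sup>2)"
proof -
  define u where "u = z k"
  define p where "p = vertex_pos z v"
  define du where "du = (if l = k then dir else 0)"
  define dp where "dp = (if v = Inner l then dir else 0)"
  have uH: "Im u > 0" using z k by (auto simp: configs_def u_def)
  have pH: "Im p \<ge> 0" using z v(1) by (cases v) (auto simp: configs_def p_def v_def PiE_iff less_imp_le)
  have up: "p \<noteq> u"
  proof (cases v)
    case (Inner l')
    then show ?thesis using z v k by (auto simp: configs_def p_def u_def v_def inj_on_def)
  qed (use uH in \<open>auto simp: p_def\<close>)
  have ucp: "p \<noteq> cnj u" using uH pH by (metis cnj.simps(2) neg_0_le_iff_le not_less)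
  have mv: "edge_ratio \<Gamma> (k, a) (z(l := z l + of_real s * dir))
     = (p + of_real s * dp - (u + of_real s * du)) / (p + of_real s * dp - (cnj u + of_real s * cnj du))" for s
  proof -
    have "vertex_pos (z(l := z l + of_real s * dir)) v = p + of_real s * dp"
      by (cases v) (auto simp: p_def dp_def)
    moreover have "(z(l := z l + of_real s * dir)) k = u + of_real s * du"
      by (auto simp: u_def du_def)
    ultimately show ?thesis by (simp add: edge_ratio_def Let_def v_def del: fun_upd_apply)
  qed
  define W where "W = (p - u) * cnj (p - cnj u)"
  define W' where "W' = (dp - du) * cnj (p - cnj u) + (p - u) * cnj (dp - cnj du)"
  define A B P Q where "A = dp - du" and "B = dp - cnj du" and "P = p - u" and "Q = p - cnj u"
  have PQ: "P \<noteq> 0" "Q \<noteq> 0" "cnj Q \<noteq> 0" using up ucp by (auto simp: P_def Q_def)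
  have W_eq: "W = P * cnj Q" "W' = A * cnj Q + P * cnj B" by (simp_all add: W_def W'_def A_def B_def P_def Q_def)
  have W0: "W \<noteq> 0" using PQ by (simp add: W_eq)
  have "((\<lambda>s. (p + of_real s * dp - (u + of_real s * du)) / (p + of_real s * dp - (cnj u + of_real s * cnj du)))
     has_vector_derivative ((dp - du) * (p - cnj u) - (p - u) * (dp - cnj du)) / (p - cnj u)\<^sup>2) (at 0)"
    using ucp by (auto intro!: derivative_eq_intros simp: has_vector_derivative_def fun_eq_iff power2_eq_square scaleR_conv_of_real field_simps)
  from angle_deriv_eq[OF this]
  have "dangle \<Gamma> (k, a) (l, dir) z = Im (((dp - du) * (p - cnj u) - (p - u) * (dp - cnj du)) / (p - cnj u)\<^sup>2 / ((p - u) / (p - cnj u)))"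
    using up ucp by (simp add: dangle_def mv)
  also have "\<dots> = Im ((A * Q - P * B) / Q\<^sup>2 / (P / Q))" by (simp only: A_def B_def P_def Q_def)
  also have "(A * Q - P * B) / Q\<^sup>2 / (P / Q) = A / P - B / Q"
    using PQ by (simp add: field_simps power2_eq_square)
  \<comment> \<open>\<open>- w\<close> and \<open>cnj w\<close> have the same imaginary part, which
    turns the logarithmic derivative of \<open>P / Q\<close> into that of
    \<open>P * cnj Q\<close>.\<close>
  also have "Im (A / P - B / Q) = Im (A / P + cnj (B / Q))" by (simp only: minus_complex.sel plus_complex.sel cnj.sel)
  also have "A / P + cnj (B / Q) = W' / W"
    using PQ by (simp only: W_eq complex_cnj_divide) (simp add: field_simps)
  also have "Im (W' / W) = (Re W * Im W' - Im W * Re W') / ((Re W)\<^sup>2 + (Im W)\<^sup>2)"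
    by (simp add: Im_divide algebra_simps)
  finally have D: "dangle \<Gamma> (k, a) (l, dir) z = (Re W * Im W' - Im W * Re W') / ((Re W)\<^sup>2 + (Im W)\<^sup>2)" .
  have pc: "Re p = vertex_re v x" "Im p = vertex_im v x"
    using vertex_pos_real_coords[of n v z] v(1) by (auto simp: p_def x_def v_def)
  have uc: "Re u = x (2 * k)" "Im u = x (Suc (2 * k))"
    using k by (auto simp: u_def x_def real_coords_even real_coords_odd)
  have ReW: "Re W = edge_re k v x"
    by (simp add: W_def edge_re_def pc uc algebra_simps)
  have ImW: "Im W = edge_im k v x"
    by (simp add: W_def edge_im_def pc uc algebra_simps)
  have ddu: "Re du = (if 2 * l + b = 2 * k then 1 else 0)" "Im du = (if 2 * l + b = 2 * k + 1 then 1 else 0)"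
    using b by (auto simp: du_def)
  have ddp: "Re dp = vertex_re_deriv v (2 * l + b) x" "Im dp = vertex_im_deriv v (2 * l + b) x"
    using b by (cases v; auto simp: dp_def; presburger)+
  have ReW': "Re W' = edge_re_deriv k v (2 * l + b) x"
    by (simp add: W'_def edge_re_deriv_def pc uc ddu ddp algebra_simps)
  have ImW': "Im W' = edge_im_deriv k v (2 * l + b) x"
    by (simp add: W'_def edge_im_deriv_def pc uc ddu ddp algebra_simps)
  show "edge_re k v x \<noteq> 0 \<or> edge_im k v x \<noteq> 0"
    using W0 ReW ImW by (auto simp: complex_eq_iff)
  show "dangle \<Gamma> (k, a) (l, dir) z
      = (edge_re k v x * edge_im_deriv k v (2 * l + b) x - edge_im k v x * edge_re_deriv k v (2 * l + b) x)
        / ((edge_re k v x)\<^sup>2 + (edge_im k v x)\<^sup>2)"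
    using D by (simp only: ReW ImW ReW' ImW')
qed

section \<open>Differentiability and degrees of the edge polynomials\<close>

lemma strict_diff_cong:
  assumes "strict_diff N W f D" "\<And>x. f x = f' x" "\<And>j x. D j x = D' j x"
  shows "strict_diff N W f' D'"
proof -
  have "f = f'" "D = D'" using assms(2,3) by (auto simp: fun_eq_iff)
  then show ?thesis using assms(1) by simp
qed

lemma strict_diff_cmult:
  assumes "strict_diff N W f D"
  shows "strict_diff N W (\<lambda>x. c * f x) (\<lambda>j x. c * D j x)"
proof -
  have "W \<subseteq> extensional {..<N}" using assms by (simp add: strict_diff_def)
  from strict_diff_mult[OF strict_diff_const[OF this, of c] assms] show ?thesis by simp
qed

lemma strict_diff_diff:
  assumes "strict_diff N W f D" "strict_diff N W g D'"
  shows "strict_diff N W (\<lambda>x. f x - g x) (\<lambda>j x. D j x - D' j x)"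
  using strict_diff_add[OF assms(1) strict_diff_cmult[OF assms(2), of "-1"]] by simp

lemma strict_diff_vertex:
  assumes W: "W \<subseteq> extensional {..<2 * n}" and v: "vertex_ok n v"
  shows "strict_diff (2 * n) W (vertex_re v) (vertex_re_deriv v)" "strict_diff (2 * n) W (vertex_im v) (vertex_im_deriv v)"
proof -
  show "strict_diff (2 * n) W (vertex_re v) (vertex_re_deriv v)"
  proof (cases v)
    case (Inner k)
    show ?thesis by (rule strict_diff_cong[OF strict_diff_coord[OF W, of "2 * k"]]) (use v Inner in auto)
  qed (auto intro: strict_diff_cong[OF strict_diff_const[OF W]])
  show "strict_diff (2 * n) W (vertex_im v) (vertex_im_deriv v)"
  proof (cases v)
    case (Inner k)
    show ?thesis by (rule strict_diff_cong[OF strict_diff_coord[OF W, of "2 * k + 1"]]) (use v Inner in auto)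
  qed (auto intro: strict_diff_cong[OF strict_diff_const[OF W]])
qed

lemma strict_diff_edge:
  assumes W: "W \<subseteq> extensional {..<2 * n}" and k: "k < n" and v: "vertex_ok n v"
  shows "strict_diff (2 * n) W (edge_re k v) (edge_re_deriv k v)" "strict_diff (2 * n) W (edge_im k v) (edge_im_deriv k v)"
proof -
  note x = strict_diff_coord[OF W, of "2 * k"] and y = strict_diff_coord[OF W, of "2 * k + 1"]
  have kk: "2 * k < 2 * n" "2 * k + 1 < 2 * n" using k by auto
  note d = strict_diff_diff[OF x[OF kk(1)] strict_diff_vertex(1)[OF W v]]
  note b = strict_diff_vertex(2)[OF W v]
  show "strict_diff (2 * n) W (edge_re k v) (edge_re_deriv k v)"
    by (rule strict_diff_cong[OF strict_diff_add[OF strict_diff_mult[OF d d]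
      strict_diff_diff[OF strict_diff_mult[OF b b] strict_diff_mult[OF y[OF kk(2)] y[OF kk(2)]]]]])
      (simp_all add: edge_re_def edge_re_deriv_def algebra_simps)
  show "strict_diff (2 * n) W (edge_im k v) (edge_im_deriv k v)"
    by (rule strict_diff_cong[OF strict_diff_cmult[OF strict_diff_mult[OF y[OF kk(2)] d], of 2]])
      (simp_all add: edge_im_def edge_im_deriv_def algebra_simps)
qed

lemma poly_in_coord_vertex:
  assumes "v = Inner (j div 2) \<Longrightarrow> s \<ge> 1"
  shows "poly_in_coord j s (vertex_re v)" "poly_in_coord j s (vertex_im v)"
proof -
  have "poly_in_coord j s (vertex_re v) \<and> poly_in_coord j s (vertex_im v)"
  proof (cases v)
    case (Inner k)
    have "s \<ge> 1 \<or> 2 * k \<noteq> j" "s \<ge> 1 \<or> 2 * k + 1 \<noteq> j" using assms Inner by auto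
    then show ?thesis
      using poly_in_coord_coord[of s "2 * k" j] poly_in_coord_coord[of s "2 * k + 1" j]
      by (simp add: Inner vertex_re.simps[abs_def] vertex_im.simps[abs_def])
  qed (simp_all add: poly_in_coord_const vertex_re.simps[abs_def] vertex_im.simps[abs_def])
  then show "poly_in_coord j s (vertex_re v)" "poly_in_coord j s (vertex_im v)" by blast+
qed

text \<open>Meant for \<open>s\<close> equal to 0 or 1, according to whether the coordinate
  \<open>j\<close> belongs to an end point of the edge. One statement then covers the degrees 0 and
  2.\<close>

lemma poly_in_coord_edge:
  assumes "j div 2 = k \<or> v = Inner (j div 2) \<Longrightarrow> s \<ge> 1"
  shows "poly_in_coord j (s + s) (edge_re k v)" "poly_in_coord j (s + s) (edge_im k v)"
proof -
  have v: "poly_in_coord j s (vertex_re v)" "poly_in_coord j s (vertex_im v)"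
    using assms by (auto intro: poly_in_coord_vertex)
  have "s \<ge> 1 \<or> 2 * k \<noteq> j" "s \<ge> 1 \<or> 2 * k + 1 \<noteq> j" using assms by auto
  then have x: "poly_in_coord j s (\<lambda>x. x (2 * k))" and y: "poly_in_coord j s (\<lambda>x. x (2 * k + 1))"
    using poly_in_coord_coord[of s "2 * k" j] poly_in_coord_coord[of s "2 * k + 1" j] by blast+
  note d = poly_in_coord_diff[OF x v(1)]
  show "poly_in_coord j (s + s) (edge_re k v)"
    using poly_in_coord_add[OF poly_in_coord_mult[OF d d]
      poly_in_coord_diff[OF poly_in_coord_mult[OF v(2) v(2)] poly_in_coord_mult[OF y y]]]
    unfolding edge_re_def[abs_def] .
  show "poly_in_coord j (s + s) (edge_im k v)"
    using poly_in_coord_mult[OF poly_in_coord_const[of j 0 2] poly_in_coord_mult[OF y d]]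
    unfolding edge_im_def[abs_def] by (simp only: add_0)
qed

section \<open>Tangents and cotangents of the edge angles\<close>

definition inner_indegree_le_1 :: "nat \<Rightarrow> (kedge \<Rightarrow> vertex) \<Rightarrow> bool" where
  "inner_indegree_le_1 n \<Gamma> \<longleftrightarrow> (\<forall>l<n. \<forall>ed\<in>set (kedges n). \<forall>ed'\<in>set (kedges n).
     \<Gamma> ed = Inner l \<longrightarrow> \<Gamma> ed' = Inner l \<longrightarrow> ed = ed')"

definition edge_target :: "(kedge \<Rightarrow> vertex) \<Rightarrow> nat \<Rightarrow> vertex" where
  "edge_target \<Gamma> i = \<Gamma> (i div 2, i mod 2)"

text \<open>Edges are numbered as in \<open>kedges\<close>. The slope of edge \<open>i\<close> is
  the tangent of its angle for \<open>i \<in> A\<close> and the cotangent otherwise. Numerator and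
  denominator are kept apart because the zero count concerns the equations with denominators
  cleared.\<close>

definition slope_num :: "(kedge \<Rightarrow> vertex) \<Rightarrow> nat set \<Rightarrow> nat \<Rightarrow> (nat \<Rightarrow> real) \<Rightarrow> real" where
  "slope_num \<Gamma> A i = (if i \<in> A then edge_im else edge_re) (i div 2) (edge_target \<Gamma> i)"

definition slope_den :: "(kedge \<Rightarrow> vertex) \<Rightarrow> nat set \<Rightarrow> nat \<Rightarrow> (nat \<Rightarrow> real) \<Rightarrow> real" where
  "slope_den \<Gamma> A i = (if i \<in> A then edge_re else edge_im) (i div 2) (edge_target \<Gamma> i)"

definition slope_num_deriv :: "(kedge \<Rightarrow> vertex) \<Rightarrow> nat set \<Rightarrow> nat \<Rightarrow> nat \<Rightarrow> (nat \<Rightarrow> real) \<Rightarrow> real" where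
  "slope_num_deriv \<Gamma> A i = (if i \<in> A then edge_im_deriv else edge_re_deriv) (i div 2) (edge_target \<Gamma> i)"

definition slope_den_deriv :: "(kedge \<Rightarrow> vertex) \<Rightarrow> nat set \<Rightarrow> nat \<Rightarrow> nat \<Rightarrow> (nat \<Rightarrow> real) \<Rightarrow> real" where
  "slope_den_deriv \<Gamma> A i = (if i \<in> A then edge_re_deriv else edge_im_deriv) (i div 2) (edge_target \<Gamma> i)"

definition slope_quot :: "(kedge \<Rightarrow> vertex) \<Rightarrow> nat set \<Rightarrow> nat \<Rightarrow> (nat \<Rightarrow> real) \<Rightarrow> real" where
  "slope_quot \<Gamma> A i x = slope_num \<Gamma> A i x * inverse (slope_den \<Gamma> A i x)"

definition slope_quot_deriv :: "(kedge \<Rightarrow> vertex) \<Rightarrow> nat set \<Rightarrow> nat \<Rightarrow> nat \<Rightarrow> (nat \<Rightarrow> real) \<Rightarrow> real" where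
  "slope_quot_deriv \<Gamma> A i j x = slope_num \<Gamma> A i x * (- slope_den_deriv \<Gamma> A i j x / (slope_den \<Gamma> A i x)\<^sup>2)
     + inverse (slope_den \<Gamma> A i x) * slope_num_deriv \<Gamma> A i j x"

definition slope_region :: "nat \<Rightarrow> (kedge \<Rightarrow> vertex) \<Rightarrow> nat set \<Rightarrow> (nat \<Rightarrow> real) set" where
  "slope_region n \<Gamma> A = {x \<in> extensional {..<2 * n}. \<forall>i<2 * n. slope_den \<Gamma> A i x \<noteq> 0 \<and> \<bar>slope_num \<Gamma> A i x\<bar> \<le> \<bar>slope_den \<Gamma> A i x\<bar>}"

lemma kedges_nth: "i < 2 * n \<Longrightarrow> kedges n ! i = (i div 2, i mod 2)"
proof -
  assume i: "i < 2 * n"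
  have "[0, 1] ! (i mod 2) = i mod 2" by (cases "even i") (auto simp: mod2_eq_if)
  moreover have "i div 2 < n" using i by auto
  moreover have "kedges n ! i = ([0..<n] ! (i div length [0, 1 :: nat]), [0, 1] ! (i mod length [0, 1 :: nat]))"
    unfolding kedges_def by (rule product_nth) (use i in simp)
  ultimately show ?thesis by (simp add: numeral_2_eq_2[symmetric])
qed

lemma kedges_set: "set (kedges n) = {..<n} \<times> {0, 1}"
  by (auto simp: kedges_def)

lemma edge_target_ok:
  assumes "\<Gamma> \<in> kgraphs n" "i < 2 * n"
  shows "vertex_ok n (edge_target \<Gamma> i)" "edge_target \<Gamma> i \<noteq> Inner (i div 2)"
proof -
  have i: "(i div 2, i mod 2) \<in> set (kedges n)" using assms(2) by (auto simp: kedges_set)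
  then show "vertex_ok n (edge_target \<Gamma> i)"
    using assms(1) unfolding vertex_ok_iff edge_target_def by (auto simp: kgraphs_def PiE_iff)
  have "i div 2 < n" "i mod 2 = 0 \<or> i mod 2 = 1" using assms(2) by auto
  then show "edge_target \<Gamma> i \<noteq> Inner (i div 2)"
    using assms(1) unfolding edge_target_def by (auto simp: kgraphs_def)
qed

lemma strict_diff_slope:
  assumes G: "\<Gamma> \<in> kgraphs n" and W: "W \<subseteq> extensional {..<2 * n}" and i: "i < 2 * n"
  shows "strict_diff (2 * n) W (slope_num \<Gamma> A i) (slope_num_deriv \<Gamma> A i)"
    "strict_diff (2 * n) W (slope_den \<Gamma> A i) (slope_den_deriv \<Gamma> A i)"
proof -
  have k: "i div 2 < n" using i by auto
  show "strict_diff (2 * n) W (slope_num \<Gamma> A i) (slope_num_deriv \<Gamma> A i)"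
    "strict_diff (2 * n) W (slope_den \<Gamma> A i) (slope_den_deriv \<Gamma> A i)"
    using strict_diff_edge[OF W k edge_target_ok(1)[OF G i]]
    by (auto simp: slope_num_def slope_num_deriv_def slope_den_def slope_den_deriv_def)
qed

text \<open>The coordinate \<open>j\<close> belongs to the vertex \<open>j div 2\<close>, which has
  two outgoing edges and at most one incoming edge.\<close>

lemma incident_edges_le:
  assumes indeg: "inner_indegree_le_1 n \<Gamma>" and j: "j < 2 * n"
  shows "card {i \<in> {..<2 * n}. j div 2 = i div 2 \<or> edge_target \<Gamma> i = Inner (j div 2)} \<le> 3"
proof -
  let ?T = "{i \<in> {..<2 * n}. edge_target \<Gamma> i = Inner (j div 2)}"
  have "card ?T \<le> 1"
  proof (rule card_le_Suc0_iff_eq[THEN iffD2, folded One_nat_def])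
    show "\<forall>i\<in>?T. \<forall>i'\<in>?T. i = i'"
    proof (intro ballI)
      fix i i' assume ii: "i \<in> ?T" "i' \<in> ?T"
      have "(i div 2, i mod 2) \<in> set (kedges n)" "(i' div 2, i' mod 2) \<in> set (kedges n)"
        using ii by (auto simp: kedges_set)
      moreover have "j div 2 < n" using j by auto
      ultimately have "(i div 2, i mod 2) = (i' div 2, i' mod 2)"
        using ii indeg unfolding inner_indegree_le_1_def edge_target_def by blast
      then show "i = i'" by (metis Pair_inject div_mult_mod_eq)
    qed
  qed simp
  note T = this
  have "{i \<in> {..<2 * n}. j div 2 = i div 2 \<or> edge_target \<Gamma> i = Inner (j div 2)}
    \<subseteq> {2 * (j div 2), 2 * (j div 2) + 1} \<union> ?T"
  proof
    fix i assume "i \<in> {i \<in> {..<2 * n}. j div 2 = i div 2 \<or> edge_target \<Gamma> i = Inner (j div 2)}"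
    then have "i \<in> ?T \<or> i div 2 = j div 2" by auto
    moreover have "i = 2 * (i div 2) \<or> i = 2 * (i div 2) + 1" by presburger
    ultimately show "i \<in> {2 * (j div 2), 2 * (j div 2) + 1} \<union> ?T" by auto
  qed
  then have "card {i \<in> {..<2 * n}. j div 2 = i div 2 \<or> edge_target \<Gamma> i = Inner (j div 2)}
    \<le> card ({2 * (j div 2), 2 * (j div 2) + 1} \<union> ?T)" by (intro card_mono) auto
  also have "\<dots> \<le> card {2 * (j div 2), 2 * (j div 2) + 1} + card ?T" by (rule card_Un_le)
  also have "card {2 * (j div 2), 2 * (j div 2) + 1} + card ?T \<le> 3" using T by simp
  finally show ?thesis .
qed

text \<open>Clearing denominators in the prescription of the slopes gives equations of degree at
  most 2 in each coordinate, and at most three of them involve a given coordinate; hence the 6. At a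
  solution the derivative of a cleared equation is \<open>slope_den\<close> times that of the slope,
  so nondegeneracy carries over.\<close>

lemma card_configurations_le:
  assumes G: "\<Gamma> \<in> kgraphs n" and indeg: "inner_indegree_le_1 n \<Gamma>"
    and S: "finite S" "S \<subseteq> extensional {..<2 * n}"
    and den: "\<And>p i. p \<in> S \<Longrightarrow> i < 2 * n \<Longrightarrow> slope_den \<Gamma> A i p \<noteq> 0"
    and y: "\<And>p i. p \<in> S \<Longrightarrow> i < 2 * n \<Longrightarrow> slope_quot \<Gamma> A i p = y i"
    and det: "\<And>p. p \<in> S \<Longrightarrow> Determinant.det (fmat (2 * n) (\<lambda>i j. slope_quot_deriv \<Gamma> A i j p)) \<noteq> 0"
  shows "card S \<le> 6 ^ (2 * n)"
proof (rule card_nondegenerate_zeros_le[where f = "\<lambda>i x. slope_num \<Gamma> A i x - y i * slope_den \<Gamma> A i x"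
      and dg = "\<lambda>i j. of_bool (j div 2 = i div 2 \<or> edge_target \<Gamma> i = Inner (j div 2)) + of_bool (j div 2 = i div 2 \<or> edge_target \<Gamma> i = Inner (j div 2))"
      and J = "\<lambda>p v i. slope_den \<Gamma> A i p * (\<Sum>j<2 * n. slope_quot_deriv \<Gamma> A i j p * v j)", OF S])
  fix i j assume ij: "i < 2 * n" "j < 2 * n"
  let ?s = "of_bool (j div 2 = i div 2 \<or> edge_target \<Gamma> i = Inner (j div 2)) :: nat"
  have "poly_in_coord j (?s + ?s) (slope_num \<Gamma> A i)" "poly_in_coord j (?s + ?s) (slope_den \<Gamma> A i)"
    using poly_in_coord_edge[of j "i div 2" "edge_target \<Gamma> i" ?s] by (auto simp: slope_num_def slope_den_def)
  moreover from poly_in_coord_mult[OF poly_in_coord_const this(2), of 0 "y i"]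
  have "poly_in_coord j (?s + ?s) (\<lambda>x. y i * slope_den \<Gamma> A i x)" by simp
  ultimately show "poly_in_coord j (?s + ?s) (\<lambda>x. slope_num \<Gamma> A i x - y i * slope_den \<Gamma> A i x)"
    by (intro poly_in_coord_diff)
next
  fix j assume j: "j < 2 * n"
  have "(\<Sum>i<2 * n. of_bool (j div 2 = i div 2 \<or> edge_target \<Gamma> i = Inner (j div 2)) :: nat)
     = card {i \<in> {..<2 * n}. j div 2 = i div 2 \<or> edge_target \<Gamma> i = Inner (j div 2)}"
    by (subst sum_of_bool_eq) (simp, simp only: Int_def mem_Collect_eq of_nat_id)
  then show "(\<Sum>i<2 * n. of_bool (j div 2 = i div 2 \<or> edge_target \<Gamma> i = Inner (j div 2))
     + of_bool (j div 2 = i div 2 \<or> edge_target \<Gamma> i = Inner (j div 2))) \<le> (6 :: nat)"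
    using incident_edges_le[OF indeg j] by (simp only: sum.distrib)
next
  fix p v i assume p: "p \<in> S" and i: "i < 2 * n"
  have pS: "{p} \<subseteq> extensional {..<2 * n}" using p S by auto
  have "slope_num \<Gamma> A i p = y i * slope_den \<Gamma> A i p" 
    using den[OF p i] unfolding y[OF p i, symmetric] slope_quot_def by simp
  then have zero: "slope_num \<Gamma> A i p - y i * slope_den \<Gamma> A i p = 0" by simp
  have "slope_den \<Gamma> A i p * slope_quot_deriv \<Gamma> A i j p = slope_num_deriv \<Gamma> A i j p - y i * slope_den_deriv \<Gamma> A i j p" for j
  proof -
    have "b * (a * (- d / b\<^sup>2) + inverse b * c) = c - a * inverse b * d" if "b \<noteq> 0" for a b c d :: real
      using that by (simp add: field_simps power2_eq_square)
    from this[OF den[OF p i]] show ?thesis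
      unfolding y[OF p i, symmetric] slope_quot_def slope_quot_deriv_def .
  qed
  then have "(\<Sum>j<2 * n. (slope_num_deriv \<Gamma> A i j p - y i * slope_den_deriv \<Gamma> A i j p) * v j)
    = slope_den \<Gamma> A i p * (\<Sum>j<2 * n. slope_quot_deriv \<Gamma> A i j p * v j)"
    by (simp only: sum_distrib_left mult.assoc[symmetric])
  then show "((\<lambda>t. (slope_num \<Gamma> A i (along (2 * n) p v t) - y i * slope_den \<Gamma> A i (along (2 * n) p v t)) / t)
     \<longlongrightarrow> slope_den \<Gamma> A i p * (\<Sum>j<2 * n. slope_quot_deriv \<Gamma> A i j p * v j)) (at_right 0)"
    using strict_diff_along[OF strict_diff_diff[OF strict_diff_slope(1)[OF G pS i, of A]
      strict_diff_cmult[OF strict_diff_slope(2)[OF G pS i, of A], of "y i"]] singletonI, of v]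
    unfolding along_def zero diff_0_right by (simp only:)
next
  fix p w assume p: "p \<in> S"
  let ?b = "finv (2 * n) (\<lambda>i j. slope_quot_deriv \<Gamma> A i j p)"
  let ?v = "\<lambda>j. \<Sum>k<2 * n. ?b j k * (w k / slope_den \<Gamma> A k p)"
  have "slope_den \<Gamma> A i p * (\<Sum>j<2 * n. slope_quot_deriv \<Gamma> A i j p * ?v j) = w i" if i: "i < 2 * n" for i
  proof -
    have "(\<Sum>j<2 * n. slope_quot_deriv \<Gamma> A i j p * ?v j) = w i / slope_den \<Gamma> A i p"
      by (rule finv_right_vec[OF det[OF p] i])
    then show ?thesis using den[OF p i] by (simp only:) simp
  qed
  then show "\<exists>v. \<forall>i<2 * n. slope_den \<Gamma> A i p * (\<Sum>j<2 * n. slope_quot_deriv \<Gamma> A i j p * v j) = w i"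
    by (intro exI[of _ ?v] allI impI)
qed

text \<open>Larger than \<open>slope_region\<close>: a solution found by Newton's iteration lies
  near a point of that region, but its slopes may exceed one.\<close>

definition slope_regular :: "nat \<Rightarrow> (kedge \<Rightarrow> vertex) \<Rightarrow> nat set \<Rightarrow> (nat \<Rightarrow> real) set" where
  "slope_regular n \<Gamma> A = {x \<in> extensional {..<2 * n}. \<forall>i<2 * n. slope_den \<Gamma> A i x \<noteq> 0}"

lemma slope_modulus:
  assumes G: "\<Gamma> \<in> kgraphs n" and i: "i < 2 * n"
  shows "slope_quot \<Gamma> A i \<in> borel_measurable (real_space (2 * n))"
    "j < 2 * n \<Longrightarrow> slope_quot_deriv \<Gamma> A i j \<in> borel_measurable (real_space (2 * n))"
    "\<exists>H \<in> borel_measurable (real_space (2 * n)). strict_diff_modulus (2 * n) (slope_regular n \<Gamma> A) (slope_quot \<Gamma> A i) (slope_quot_deriv \<Gamma> A i) H"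
    "\<exists>H \<in> borel_measurable (real_space (2 * n)). (\<forall>x. H x \<ge> 0) \<and> (\<forall>x\<in>slope_regular n \<Gamma> A. \<forall>r>0. r * H x \<le> 1 \<longrightarrow> (\<forall>u\<in>cube (2 * n) x r. slope_den \<Gamma> A i u \<noteq> 0))"
proof -
  have W: "slope_regular n \<Gamma> A \<subseteq> extensional {..<2 * n}" by (auto simp: slope_regular_def)
  have nz: "slope_den \<Gamma> A i x \<noteq> 0" if "x \<in> slope_regular n \<Gamma> A" for x using that i by (auto simp: slope_regular_def)
  note inv = strict_diff_inverse[OF strict_diff_slope(2)[OF G W i] nz]
  have "strict_diff (2 * n) (slope_regular n \<Gamma> A) (slope_quot \<Gamma> A i) (slope_quot_deriv \<Gamma> A i)"
    using strict_diff_mult[OF strict_diff_slope(1)[OF G W i] inv(1)]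
    by (rule strict_diff_cong) (simp_all add: slope_quot_def slope_quot_deriv_def)
  then show "slope_quot \<Gamma> A i \<in> borel_measurable (real_space (2 * n))"
    "j < 2 * n \<Longrightarrow> slope_quot_deriv \<Gamma> A i j \<in> borel_measurable (real_space (2 * n))"
    "\<exists>H \<in> borel_measurable (real_space (2 * n)). strict_diff_modulus (2 * n) (slope_regular n \<Gamma> A) (slope_quot \<Gamma> A i) (slope_quot_deriv \<Gamma> A i) H"
    unfolding strict_diff_def by blast+
  show "\<exists>H \<in> borel_measurable (real_space (2 * n)). (\<forall>x. H x \<ge> 0) \<and> (\<forall>x\<in>slope_regular n \<Gamma> A. \<forall>r>0. r * H x \<le> 1 \<longrightarrow> (\<forall>u\<in>cube (2 * n) x r. slope_den \<Gamma> A i u \<noteq> 0))"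
    by (rule inv(2))
qed

section \<open>The measure on configurations in real coordinates\<close>

lemma measurable_real_coords [measurable]:
  "real_coords n \<in> Pi\<^sub>M {..<n} (\<lambda>_. lborel) \<rightarrow>\<^sub>M real_space (2 * n)"
  unfolding real_coords_def
proof (rule measurable_restrict)
  fix j assume "j \<in> {..<2 * n}"
  then have j: "j div 2 \<in> {..<n}" by auto
  have m: "(\<lambda>z. z (j div 2)) \<in> borel_measurable (Pi\<^sub>M {..<n} (\<lambda>_. lborel :: complex measure))"
    using measurable_component_singleton[OF j, of "\<lambda>_. lborel :: complex measure"] by simp
  have "(\<lambda>z. Re (z (j div 2))) \<in> borel_measurable (Pi\<^sub>M {..<n} (\<lambda>_. lborel))"
    "(\<lambda>z. Im (z (j div 2))) \<in> borel_measurable (Pi\<^sub>M {..<n} (\<lambda>_. lborel))"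
    using m by measurable
  then show "(\<lambda>z. if even j then Re (z (j div 2)) else Im (z (j div 2))) \<in> Pi\<^sub>M {..<n} (\<lambda>_. lborel) \<rightarrow>\<^sub>M lborel"
    by simp
qed

text \<open>Weights are integrals over products of complex planes, so the real coordinates carry an
  image measure. It is not identified with \<open>real_space (2 * n)\<close>: the area inequality
  asks only for its sets, sigma-finiteness and an upper bound on cubes.\<close>

definition real_config_measure :: "nat \<Rightarrow> (nat \<Rightarrow> real) measure" where
  "real_config_measure n = distr (Pi\<^sub>M {..<n} (\<lambda>_. lborel)) (real_space (2 * n)) (real_coords n)"

lemma cube_eq_PiE: "cube N p r = (\<Pi>\<^sub>E j\<in>{..<N}. {p j - r..p j + r})"
proof -
  have "\<bar>x j - p j\<bar> \<le> r \<longleftrightarrow> x j \<in> {p j - r..p j + r}" for x j by auto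
  then show ?thesis unfolding cube_def PiE_def Pi_def by blast
qed

lemma cube_measurable: "cube N p r \<in> sets (real_space N)"
  unfolding cube_eq_PiE by (intro sets_PiM_I_finite) auto

lemma emeasure_real_config_cube:
  assumes "r > 0"
  shows "emeasure (real_config_measure n) (cube (2 * n) p r) \<le> ennreal ((2 * r) ^ (2 * n))"
proof -
  interpret product_sigma_finite "\<lambda>_::nat. lborel :: complex measure" ..
  let ?B = "\<lambda>k. cbox (Complex (p (2 * k) - r) (p (2 * k + 1) - r)) (Complex (p (2 * k) + r) (p (2 * k + 1) + r))"
  have "real_coords n -` cube (2 * n) p r \<inter> space (Pi\<^sub>M {..<n} (\<lambda>_. lborel)) \<subseteq> (\<Pi>\<^sub>E k\<in>{..<n}. ?B k)"
  proof
    fix z assume z: "z \<in> real_coords n -` cube (2 * n) p r \<inter> space (Pi\<^sub>M {..<n} (\<lambda>_. lborel))"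
    have c: "\<bar>real_coords n z j - p j\<bar> \<le> r" if "j < 2 * n" for j using z that by (simp add: cube_def)
    show "z \<in> (\<Pi>\<^sub>E k\<in>{..<n}. ?B k)"
    proof (rule PiE_I)
      fix k assume "k \<in> {..<n}"
      then have k: "k < n" by simp
      have "\<bar>Re (z k) - p (2 * k)\<bar> \<le> r" "\<bar>Im (z k) - p (2 * k + 1)\<bar> \<le> r"
        using c[of "2 * k"] c[of "2 * k + 1"] k by (simp_all add: real_coords_even real_coords_odd)
      then show "z k \<in> ?B k" by (auto simp: in_cbox_complex_iff abs_le_iff)
    next
      fix k assume "k \<notin> {..<n}"
      then show "z k = undefined" using z by (simp add: space_PiM PiE_def extensional_def)
    qed
  qed
  then have "emeasure (real_config_measure n) (cube (2 * n) p r) \<le> emeasure (Pi\<^sub>M {..<n} (\<lambda>_. lborel)) (\<Pi>\<^sub>E k\<in>{..<n}. ?B k)"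
    unfolding real_config_measure_def
    by (subst emeasure_distr) (auto intro!: emeasure_mono sets_PiM_I_finite cube_measurable)
  also have "\<dots> = (\<Prod>k<n. emeasure lborel (?B k))" by (rule emeasure_PiM) auto
  also have "\<dots> = (\<Prod>k<n. ennreal ((2 * r)\<^sup>2))"
    using assms by (intro prod.cong refl) (simp add: emeasure_lborel_cbox_eq Basis_complex_def power2_eq_square)
  also have "\<dots> = ennreal ((2 * r) ^ (2 * n))"
    using assms by (simp add: ennreal_power power_mult)
  finally show ?thesis .
qed

lemma sigma_finite_real_config: "sigma_finite_measure (real_config_measure n)"
proof
  let ?C = "\<lambda>m. cube (2 * n) (\<lambda>j. 0) (real (Suc m))"
  show "\<exists>A. countable A \<and> A \<subseteq> sets (real_config_measure n) \<and> \<Union> A = space (real_config_measure n) \<and>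
    (\<forall>a\<in>A. emeasure (real_config_measure n) a \<noteq> \<infinity>)"
  proof (intro exI[of _ "range ?C"] conjI)
    show "range ?C \<subseteq> sets (real_config_measure n)"
      using cube_measurable[of "2 * n"] by (auto simp: real_config_measure_def)
    show "\<Union> (range ?C) = space (real_config_measure n)"
    proof
      show "space (real_config_measure n) \<subseteq> \<Union> (range ?C)"
      proof
        fix x assume "x \<in> space (real_config_measure n)"
        then have xe: "x \<in> extensional {..<2 * n}" by (simp add: real_config_measure_def space_PiM PiE_def)
        obtain m where m: "(\<Sum>j<2 * n. \<bar>x j\<bar>) \<le> real m" using real_arch_simple by blast
        have "\<bar>x j - 0\<bar> \<le> real (Suc m)" if "j < 2 * n" for j
          using member_le_sum[of j "{..<2 * n}" "\<lambda>j. \<bar>x j\<bar>"] that m by simp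
        then have "x \<in> ?C m" using xe unfolding cube_def by blast
        then show "x \<in> \<Union> (range ?C)" by blast
      qed
    qed (auto simp: real_config_measure_def space_PiM PiE_def cube_def)
    show "\<forall>a\<in>range ?C. emeasure (real_config_measure n) a \<noteq> \<infinity>"
    proof
      fix a assume "a \<in> range ?C"
      then obtain m where "a = ?C m" by blast
      moreover have "emeasure (real_config_measure n) (?C m) < \<infinity>"
        using emeasure_real_config_cube[of "real (Suc m)" n "\<lambda>j. 0"]
        by (rule le_less_trans) auto
      ultimately show "emeasure (real_config_measure n) a \<noteq> \<infinity>" by simp
    qed
  qed simp
qed

lemma slope_region_measurable:
  assumes G: "\<Gamma> \<in> kgraphs n"
  shows "slope_region n \<Gamma> A \<in> sets (real_space (2 * n))"
proof -
  have "{x \<in> space (real_space (2 * n)). slope_den \<Gamma> A i x \<noteq> 0 \<and> \<bar>slope_num \<Gamma> A i x\<bar> \<le> \<bar>slope_den \<Gamma> A i x\<bar>} \<in> sets (real_space (2 * n))"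
    if i: "i \<in> {..<2 * n}" for i
  proof -
    have m: "slope_num \<Gamma> A i \<in> borel_measurable (real_space (2 * n))" "slope_den \<Gamma> A i \<in> borel_measurable (real_space (2 * n))"
      using strict_diff_slope[OF G subset_refl, of i A] i unfolding strict_diff_def by auto
    show ?thesis
      by (intro sets.sets_Collect_conj borel_measurable_neq borel_measurable_le borel_measurable_abs borel_measurable_const m)
  qed
  then have "{x \<in> space (real_space (2 * n)). \<forall>i\<in>{..<2 * n}. slope_den \<Gamma> A i x \<noteq> 0 \<and> \<bar>slope_num \<Gamma> A i x\<bar> \<le> \<bar>slope_den \<Gamma> A i x\<bar>} \<in> sets (real_space (2 * n))"
    by (intro sets.sets_Collect_finite_All) auto
  moreover have "slope_region n \<Gamma> A = {x \<in> space (real_space (2 * n)). \<forall>i\<in>{..<2 * n}. slope_den \<Gamma> A i x \<noteq> 0 \<and> \<bar>slope_num \<Gamma> A i x\<bar> \<le> \<bar>slope_den \<Gamma> A i x\<bar>}"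
    unfolding slope_region_def by (simp add: space_PiM PiE_def Ball_def)
  ultimately show ?thesis by simp
qed

text \<open>The slopes are bounded by one on the region and at most \<open>6 ^ (2 * n)\<close>
  configurations share the same slopes, so the area inequality gives \<open>8 * 6\<close> for each
  real coordinate.\<close>

lemma integral_slope_region_le:
  assumes G: "\<Gamma> \<in> kgraphs n" and indeg: "inner_indegree_le_1 n \<Gamma>"
  shows "(\<integral>\<^sup>+x. ennreal \<bar>Determinant.det (fmat (2 * n) (\<lambda>i j. slope_quot_deriv \<Gamma> A i j x))\<bar> * indicator (slope_region n \<Gamma> A) x
     \<partial>real_config_measure n) \<le> ennreal (48 ^ (2 * n))"
proof -
  let ?N = "2 * n" and ?W = "slope_region n \<Gamma> A"
  have WR: "?W \<subseteq> slope_regular n \<Gamma> A" by (auto simp: slope_region_def slope_regular_def)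
  have "\<exists>H. \<forall>i<?N. H i \<in> borel_measurable (real_space ?N) \<and>
      strict_diff_modulus ?N (slope_regular n \<Gamma> A) (slope_quot \<Gamma> A i) (slope_quot_deriv \<Gamma> A i) (H i)"
    using slope_modulus(3)[OF G, of _ A] by metis
  then obtain H1 where H1: "\<And>i. i < ?N \<Longrightarrow> H1 i \<in> borel_measurable (real_space ?N)"
    "\<And>i. i < ?N \<Longrightarrow> strict_diff_modulus ?N (slope_regular n \<Gamma> A) (slope_quot \<Gamma> A i) (slope_quot_deriv \<Gamma> A i) (H1 i)" by blast
  have "\<exists>H. \<forall>i<?N. H i \<in> borel_measurable (real_space ?N) \<and> (\<forall>x. H i x \<ge> 0) \<and>
      (\<forall>x\<in>slope_regular n \<Gamma> A. \<forall>r>0. r * H i x \<le> 1 \<longrightarrow> (\<forall>u\<in>cube ?N x r. slope_den \<Gamma> A i u \<noteq> 0))"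
    using slope_modulus(4)[OF G, of _ A] by metis
  then obtain H2 where H2: "\<And>i. i < ?N \<Longrightarrow> H2 i \<in> borel_measurable (real_space ?N)" "\<And>i x. i < ?N \<Longrightarrow> H2 i x \<ge> 0"
    "\<And>i x r u. i < ?N \<Longrightarrow> x \<in> slope_regular n \<Gamma> A \<Longrightarrow> r > 0 \<Longrightarrow> r * H2 i x \<le> 1 \<Longrightarrow> u \<in> cube ?N x r \<Longrightarrow> slope_den \<Gamma> A i u \<noteq> 0" by blast
  \<comment> \<open>One modulus for all slopes at once, whose cubes also avoid the zeros of all
    denominators.\<close>
  define H where "H x = (\<Sum>i<?N. H1 i x + H2 i x)" for x
  have H10: "H1 i x \<ge> 0" if "i < ?N" for i x using H1(2)[OF that] by (simp add: strict_diff_modulus_def)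
  have H0: "H x \<ge> 0" for x unfolding H_def using H10 H2(2) by (auto intro!: sum_nonneg add_nonneg_nonneg)
  have le: "H1 i x \<le> H x" "H2 i x \<le> H x" if "i < ?N" for i x
  proof -
    have "H1 i x + H2 i x \<le> H x" unfolding H_def
      using that H10 H2(2) by (intro member_le_sum[where f = "\<lambda>i. H1 i x + H2 i x"]) (auto intro!: add_nonneg_nonneg)
    then show "H1 i x \<le> H x" "H2 i x \<le> H x" using H10[OF that, of x] H2(2)[OF that, of x] by linarith+
  qed
  have Hm: "H \<in> borel_measurable (real_space ?N)"
    unfolding H_def[abs_def] by (intro borel_measurable_sum borel_measurable_add H1 H2) auto
  have "(\<integral>\<^sup>+x. ennreal \<bar>Determinant.det (fmat ?N (\<lambda>i j. slope_quot_deriv \<Gamma> A i j x))\<bar> * indicator ?W x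
     \<partial>real_config_measure n) \<le> ennreal (8 ^ ?N * real (6 ^ ?N))"
  proof (rule integral_abs_det_le[where F = "slope_quot \<Gamma> A" and H = H and good = "\<lambda>p. \<forall>i<?N. slope_den \<Gamma> A i p \<noteq> 0"])
    show "sigma_finite_measure (real_config_measure n)" by (rule sigma_finite_real_config)
    show "sets (real_config_measure n) = sets (real_space ?N)" by (simp add: real_config_measure_def)
    show "H \<in> borel_measurable (real_space ?N)" by (rule Hm)
    show "?W \<in> sets (real_space ?N)" by (rule slope_region_measurable[OF G])
    show "0 \<le> H x" for x by (rule H0)
  next
    fix p :: "nat \<Rightarrow> real" and r :: real assume "0 < r"
    then show "emeasure (real_config_measure n) (cube ?N p r) \<le> ennreal ((2 * r) ^ ?N)"
      by (rule emeasure_real_config_cube)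
  next
    fix i j assume "i < ?N" "j < ?N"
    then show "slope_quot \<Gamma> A i \<in> borel_measurable (real_space ?N)" "slope_quot_deriv \<Gamma> A i j \<in> borel_measurable (real_space ?N)"
      using slope_modulus[OF G] by blast+
  next
    fix x i assume xi: "x \<in> ?W" "i < ?N"
    then have d: "slope_den \<Gamma> A i x \<noteq> 0" "\<bar>slope_num \<Gamma> A i x\<bar> \<le> \<bar>slope_den \<Gamma> A i x\<bar>" by (auto simp: slope_region_def)
    have "\<bar>slope_num \<Gamma> A i x / slope_den \<Gamma> A i x\<bar> \<le> 1"
      unfolding abs_divide using d by (simp add: divide_le_eq_1)
    then show "\<bar>slope_quot \<Gamma> A i x\<bar> \<le> 1" by (simp add: slope_quot_def divide_inverse)
  next
    fix x r u v m i
    assume *: "x \<in> ?W" "0 < r" "r * H x \<le> 1" "u \<in> cube ?N x r" "v \<in> cube ?N x r" "i < ?N" "0 \<le> (m::real)"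
      "\<And>j. j < ?N \<Longrightarrow> \<bar>u j - v j\<bar> \<le> m"
    have rH: "r * H1 i x \<le> r * H x" using le(1)[OF *(6)] *(2) by (intro mult_left_mono) auto
    then have r1: "r * H1 i x \<le> 1" using *(3) by linarith
    have "\<bar>slope_quot \<Gamma> A i u - slope_quot \<Gamma> A i v - (\<Sum>j<?N. slope_quot_deriv \<Gamma> A i j x * (u j - v j))\<bar> \<le> r * H1 i x * m"
      by (rule strict_diff_modulusD[OF H1(2)[OF *(6)] _ *(2) r1 *(4,5,7,8)]) (use *(1) WR in blast)
    also have "\<dots> \<le> r * H x * m" using rH *(7) by (rule mult_right_mono)
    finally show "\<bar>slope_quot \<Gamma> A i u - slope_quot \<Gamma> A i v - (\<Sum>j<?N. slope_quot_deriv \<Gamma> A i j x * (u j - v j))\<bar> \<le> r * H x * m" .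
  next
    fix x r p assume *: "x \<in> ?W" "0 < r" "r * H x \<le> 1" "p \<in> cube ?N x r"
    show "\<forall>i<?N. slope_den \<Gamma> A i p \<noteq> 0"
    proof (intro allI impI)
      fix i assume i: "i < ?N"
      have "r * H2 i x \<le> r * H x" using le(2)[OF i] *(2) by (intro mult_left_mono) auto
      then have "r * H2 i x \<le> 1" using *(3) by linarith
      then show "slope_den \<Gamma> A i p \<noteq> 0" using H2(3)[OF i _ *(2) _ *(4)] *(1) WR by blast
    qed
  next
    fix p v i assume *: "\<forall>i<?N. slope_den \<Gamma> A i p \<noteq> 0" "p \<in> extensional {..<?N}" "i < ?N"
    have R: "slope_regular n \<Gamma> A \<subseteq> extensional {..<?N}" by (auto simp: slope_regular_def)
    have "strict_diff ?N (slope_regular n \<Gamma> A) (slope_quot \<Gamma> A i) (slope_quot_deriv \<Gamma> A i)"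
      unfolding strict_diff_def using R slope_modulus[OF G *(3)] by blast
    from strict_diff_along[OF this, of p v]
    show "((\<lambda>t. (slope_quot \<Gamma> A i (\<lambda>j\<in>{..<?N}. p j + t * v j) - slope_quot \<Gamma> A i p) / t)
      \<longlongrightarrow> (\<Sum>j<?N. slope_quot_deriv \<Gamma> A i j p * v j)) (at_right 0)"
      using * by (simp add: slope_regular_def)
  next
    fix y and S :: "(nat \<Rightarrow> real) set"
    assume *: "finite S" "S \<subseteq> extensional {..<?N}" "\<And>p. p \<in> S \<Longrightarrow> \<forall>i<?N. slope_den \<Gamma> A i p \<noteq> 0"
      "\<And>p i. p \<in> S \<Longrightarrow> i < ?N \<Longrightarrow> slope_quot \<Gamma> A i p = y i"
      "\<And>p. p \<in> S \<Longrightarrow> Determinant.det (fmat ?N (\<lambda>i j. slope_quot_deriv \<Gamma> A i j p)) \<noteq> 0"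
    show "card S \<le> 6 ^ ?N"
      by (rule card_configurations_le[OF G indeg *(1,2) _ *(4,5)]) (use *(3) in blast)+
  qed
  also have "8 ^ ?N * real (6 ^ ?N) = (48 :: real) ^ ?N" by (simp add: power_mult_distrib[symmetric])
  finally show ?thesis .
qed

text \<open>The differential of an angle is \<open>cos\<^sup>2\<close> times that of its tangent and
  \<open>- sin\<^sup>2\<close> times that of its cotangent. Each row of the Jacobian is thus a row
  of slope derivatives multiplied by some \<open>c i\<close> of absolute value at most one. The set
  \<open>A\<close> selects the tangent wherever its absolute value is at most one.\<close>

lemma angle_jacobian_le:
  assumes G: "\<Gamma> \<in> kgraphs n" and z: "z \<in> configs n"
  obtains A where "A \<subseteq> {..<2 * n}" "real_coords n z \<in> slope_region n \<Gamma> A"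
    "\<bar>angle_jacobian n \<Gamma> z\<bar> \<le> \<bar>Determinant.det (fmat (2 * n) (\<lambda>i j. slope_quot_deriv \<Gamma> A i j (real_coords n z)))\<bar>"
proof -
  let ?N = "2 * n" and ?x = "real_coords n z"
  define re where "re i = edge_re (i div 2) (edge_target \<Gamma> i) ?x" for i
  define im where "im i = edge_im (i div 2) (edge_target \<Gamma> i) ?x" for i
  define A where "A = {i \<in> {..<?N}. \<bar>im i\<bar> \<le> \<bar>re i\<bar>}"
  define c where "c i = (if i \<in> A then (re i)\<^sup>2 else - (im i)\<^sup>2) / ((re i)\<^sup>2 + (im i)\<^sup>2)" for i
  have A: "A \<subseteq> {..<?N}" by (auto simp: A_def)
  have ab: "j mod 2 = 0 \<and> [1, \<i>] ! (j mod 2) = 1 \<or> j mod 2 = 1 \<and> [1, \<i>] ! (j mod 2) = \<i>" for j :: nat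
    by (cases "even j") (auto simp: mod2_eq_if)
  have nth: "config_coords n ! j = (j div 2, [1, \<i>] ! (j mod 2))" if "j < ?N" for j
  proof -
    have "config_coords n ! j = ([0..<n] ! (j div length [1, \<i>]), [1, \<i>] ! (j mod length [1, \<i>]))"
      unfolding config_coords_def by (rule product_nth) (use that in simp)
    moreover have "j div 2 < n" using that by auto
    ultimately show ?thesis by (simp add: numeral_2_eq_2[symmetric])
  qed
  have eq: "dangle \<Gamma> (kedges n ! i) (config_coords n ! j) z
      = (re i * edge_im_deriv (i div 2) (edge_target \<Gamma> i) j ?x - im i * edge_re_deriv (i div 2) (edge_target \<Gamma> i) j ?x)
        / ((re i)\<^sup>2 + (im i)\<^sup>2)"
    and nz: "re i \<noteq> 0 \<or> im i \<noteq> 0" if ij: "i < ?N" "j < ?N" for i j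
  proof -
    have k: "i div 2 < n" "j div 2 < n" using ij by auto
    have t: "vertex_ok n (\<Gamma> (i div 2, i mod 2))" "\<Gamma> (i div 2, i mod 2) \<noteq> Inner (i div 2)"
      using edge_target_ok[OF G ij(1)] by (simp_all add: edge_target_def)
    have j: "2 * (j div 2) + j mod 2 = j" by simp
    note d = dangle_eq[where \<Gamma> = \<Gamma>, OF k(1) k(2) t z ab[of j]]
    show "dangle \<Gamma> (kedges n ! i) (config_coords n ! j) z
      = (re i * edge_im_deriv (i div 2) (edge_target \<Gamma> i) j ?x - im i * edge_re_deriv (i div 2) (edge_target \<Gamma> i) j ?x)
        / ((re i)\<^sup>2 + (im i)\<^sup>2)"
      using d(2) unfolding kedges_nth[OF ij(1)] nth[OF ij(2)] j re_def im_def edge_target_def .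
    show "re i \<noteq> 0 \<or> im i \<noteq> 0" using d(1) unfolding re_def im_def edge_target_def .
  qed
  have sel: "slope_num \<Gamma> A i ?x = (if i \<in> A then im i else re i)" "slope_den \<Gamma> A i ?x = (if i \<in> A then re i else im i)" for i
    by (simp_all add: slope_num_def slope_den_def re_def im_def)
  have reg: "?x \<in> slope_region n \<Gamma> A"
  proof -
    have "slope_den \<Gamma> A i ?x \<noteq> 0 \<and> \<bar>slope_num \<Gamma> A i ?x\<bar> \<le> \<bar>slope_den \<Gamma> A i ?x\<bar>" if i: "i < ?N" for i
    proof (cases "\<bar>im i\<bar> \<le> \<bar>re i\<bar>")
      case True
      then have "i \<in> A" using i by (simp add: A_def)
      moreover have "re i \<noteq> 0"
      proof
        assume "re i = 0"
        then have "im i = 0" using True by simp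
        then show False using nz[OF i i] \<open>re i = 0\<close> by blast
      qed
      ultimately show ?thesis using True unfolding sel by simp
    next
      case False
      then have "i \<notin> A" "im i \<noteq> 0" "\<bar>re i\<bar> \<le> \<bar>im i\<bar>" by (simp_all add: A_def)
      then show ?thesis unfolding sel by simp
    qed
    then show ?thesis unfolding slope_region_def mem_Collect_eq by (simp add: real_coords_def)
  qed
  have quot: "dangle \<Gamma> (kedges n ! i) (config_coords n ! j) z = c i * slope_quot_deriv \<Gamma> A i j ?x" if ij: "i < ?N" "j < ?N" for i j
  proof -
    have den: "slope_den \<Gamma> A i ?x \<noteq> 0" using reg ij(1) unfolding slope_region_def by blast
    have gen: "b\<^sup>2 / q * (a * (- d / b\<^sup>2) + inverse b * e) = (b * e - a * d) / q" if "b \<noteq> 0" for a b d e q :: real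
    proof -
      have "b\<^sup>2 * (a * (- d / b\<^sup>2) + inverse b * e) = b * e - a * d"
        using that by (simp add: field_simps power2_eq_square)
      then show ?thesis by (simp only: times_divide_eq_left)
    qed
    define q d_re d_im where "q = (re i)\<^sup>2 + (im i)\<^sup>2" and "d_re = edge_re_deriv (i div 2) (edge_target \<Gamma> i) j ?x"
      and "d_im = edge_im_deriv (i div 2) (edge_target \<Gamma> i) j ?x"
    have seld: "slope_num_deriv \<Gamma> A i j ?x = (if i \<in> A then d_im else d_re)" "slope_den_deriv \<Gamma> A i j ?x = (if i \<in> A then d_re else d_im)"
      by (simp_all add: slope_num_deriv_def slope_den_deriv_def d_re_def d_im_def)
    have e: "dangle \<Gamma> (kedges n ! i) (config_coords n ! j) z = (re i * d_im - im i * d_re) / q"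
      using eq[OF ij] by (simp only: q_def d_re_def d_im_def)
    have ci: "c i = (if i \<in> A then (re i)\<^sup>2 else - (im i)\<^sup>2) / q" by (simp only: c_def q_def)
    show ?thesis
    proof (cases "i \<in> A")
      case True
      then have "re i \<noteq> 0" using den unfolding sel(2) by simp
      from gen[OF this, of q "im i" d_re d_im] show ?thesis
        using True unfolding e ci slope_quot_deriv_def sel seld by (simp only: if_True)
    next
      case False
      then have "im i \<noteq> 0" using den unfolding sel(2) by simp
      note g = gen[OF this, of "- q" "re i" d_im d_re]
      have "- (im i)\<^sup>2 / q * (re i * (- d_im / (im i)\<^sup>2) + inverse (im i) * d_re) = (re i * d_im - im i * d_re) / q"
      proof -
        have "(im i)\<^sup>2 / - q = - (im i)\<^sup>2 / q" "(im i * d_re - re i * d_im) / - q = (re i * d_im - im i * d_re) / q"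
          by (simp, simp only: divide_minus_right minus_divide_left minus_diff_eq)
        then show ?thesis using g by (simp only:)
      qed
      then show ?thesis using False unfolding e ci slope_quot_deriv_def sel seld by (simp only: if_False)
    qed
  qed
  have c1: "\<bar>c i\<bar> \<le> 1" for i
  proof -
    have gen: "\<bar>(if P then s else - t) / (s + t)\<bar> \<le> 1" if "s \<ge> 0" "t \<ge> 0" for P and s t :: real
    proof (cases "s + t = 0")
      case False
      then have "s + t > 0" using that by simp
      then show ?thesis using that by (simp add: abs_divide)
    qed simp
    show ?thesis unfolding c_def by (rule gen) simp_all
  qed
  have "angle_jacobian n \<Gamma> z = Determinant.det (fmat ?N (\<lambda>i j. dangle \<Gamma> (kedges n ! i) (config_coords n ! j) z))"
    by (simp add: angle_jacobian_def fmat_def)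
  also have "\<dots> = (\<Sum>p\<in>{p. p permutes {0..<?N}}. signof p * (\<Prod>i = 0..<?N. c i * slope_quot_deriv \<Gamma> A i (p i) ?x))"
    unfolding det_fmat
  proof (intro sum.cong refl arg_cong2[where f = "(*)"] prod.cong)
    fix p i assume "p \<in> {p. p permutes {0..<?N}}" "i \<in> {0..<?N}"
    then have "p i < ?N" "i < ?N" by (auto dest: permutes_in_image[where x = i])
    then show "dangle \<Gamma> (kedges n ! i) (config_coords n ! p i) z = c i * slope_quot_deriv \<Gamma> A i (p i) ?x" by (intro quot)
  qed
  also have "\<dots> = (\<Prod>i = 0..<?N. c i) * Determinant.det (fmat ?N (\<lambda>i j. slope_quot_deriv \<Gamma> A i j ?x))"
    unfolding det_fmat by (simp add: prod.distrib sum_distrib_left mult_ac)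
  finally have "\<bar>angle_jacobian n \<Gamma> z\<bar> = (\<Prod>i = 0..<?N. \<bar>c i\<bar>) * \<bar>Determinant.det (fmat ?N (\<lambda>i j. slope_quot_deriv \<Gamma> A i j ?x))\<bar>"
    by (simp add: abs_mult abs_prod)
  also have "\<dots> \<le> 1 * \<bar>Determinant.det (fmat ?N (\<lambda>i j. slope_quot_deriv \<Gamma> A i j ?x))\<bar>"
    by (intro mult_right_mono prod_le_1) (use c1 in auto)
  finally show ?thesis using that[OF A reg] by simp
qed

text \<open>The choice between tangent and cotangent varies with the configuration, so the bounds
  for all \<open>2 ^ (2 * n)\<close> sets \<open>A\<close> are added. With
  \<open>48 ^ (2 * n)\<close> for each this makes \<open>9216 ^ n\<close>; the powers of
  \<open>2 * pi\<close> are just estimated from below by one.\<close>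

lemma weight_bound:
  assumes G: "\<Gamma> \<in> kgraphs n" and indeg: "inner_indegree_le_1 n \<Gamma>"
  shows "\<bar>weight n \<Gamma>\<bar> \<le> 9216 ^ n / fact n"
proof -
  let ?N = "2 * n" and ?M = "Pi\<^sub>M {..<n} (\<lambda>_. lborel :: complex measure)"
  let ?f = "\<lambda>z. indicator (configs n) z *\<^sub>R angle_jacobian n \<Gamma> z"
  let ?D = "\<lambda>A x. ennreal \<bar>Determinant.det (fmat ?N (\<lambda>i j. slope_quot_deriv \<Gamma> A i j x))\<bar> * indicator (slope_region n \<Gamma> A) x"
  have Dm: "?D A \<in> borel_measurable (real_space ?N)" for A
  proof -
    have "(\<lambda>x. Determinant.det (fmat ?N (\<lambda>i j. slope_quot_deriv \<Gamma> A i j x))) \<in> borel_measurable (real_space ?N)"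
      by (rule borel_measurable_det) (rule slope_modulus(2)[OF G])
    moreover have "indicator (slope_region n \<Gamma> A) \<in> borel_measurable (real_space ?N)"
      using slope_region_measurable[OF G, of A] by (rule borel_measurable_indicator)
    ultimately show ?thesis
      by (intro borel_measurable_times_ennreal measurable_compose[OF _ measurable_ennreal] borel_measurable_abs)
  qed
  have "(\<integral>\<^sup>+z. ennreal (norm (?f z)) \<partial>?M) \<le> (\<integral>\<^sup>+z. (\<Sum>A\<in>Pow {..<?N}. ?D A (real_coords n z)) \<partial>?M)"
  proof (rule nn_integral_mono)
    fix z
    show "ennreal (norm (?f z)) \<le> (\<Sum>A\<in>Pow {..<?N}. ?D A (real_coords n z))"
    proof (cases "z \<in> configs n")
      case True
      obtain A where A: "A \<subseteq> {..<?N}" "real_coords n z \<in> slope_region n \<Gamma> A"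
        "\<bar>angle_jacobian n \<Gamma> z\<bar> \<le> \<bar>Determinant.det (fmat ?N (\<lambda>i j. slope_quot_deriv \<Gamma> A i j (real_coords n z)))\<bar>"
        by (rule angle_jacobian_le[OF G True])
      have "ennreal (norm (?f z)) \<le> ?D A (real_coords n z)" using True A by (simp add: ennreal_leI)
      also have "\<dots> \<le> (\<Sum>A\<in>Pow {..<?N}. ?D A (real_coords n z))"
        using A by (intro member_le_sum[where f = "\<lambda>A. ?D A (real_coords n z)"]) auto
      finally show ?thesis .
    qed simp
  qed
  also have "\<dots> = (\<Sum>A\<in>Pow {..<?N}. \<integral>\<^sup>+z. ?D A (real_coords n z) \<partial>?M)"
    by (intro nn_integral_sum measurable_compose[OF measurable_real_coords Dm])
  also have "\<dots> = (\<Sum>A\<in>Pow {..<?N}. \<integral>\<^sup>+x. ?D A x \<partial>real_config_measure n)"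
    unfolding real_config_measure_def by (intro sum.cong refl nn_integral_distr[symmetric] measurable_real_coords) (simp add: Dm)
  also have "\<dots> \<le> (\<Sum>A\<in>Pow {..<?N}. ennreal (48 ^ ?N))"
    by (intro sum_mono integral_slope_region_le G indeg)
  also have "\<dots> = ennreal (2 ^ ?N * 48 ^ ?N)"
    by (simp add: card_Pow ennreal_mult ennreal_power[symmetric])
  also have "2 ^ ?N * 48 ^ ?N = (9216 :: real) ^ n"
    by (simp add: power_mult power_mult_distrib[symmetric])
  finally have bound: "(\<integral>\<^sup>+z. ennreal (norm (?f z)) \<partial>?M) \<le> ennreal (9216 ^ n)" .
  have "norm (integral\<^sup>L ?M ?f) \<le> 9216 ^ n"
  \<comment> \<open>By convention the integral of a nonintegrable function is 0, which satisfies the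
    bound as well.\<close>
  proof (cases "integrable ?M ?f")
    case True
    have "ennreal (norm (integral\<^sup>L ?M ?f)) \<le> ennreal (9216 ^ n)"
      using integral_norm_bound_ennreal[OF True] bound by (rule order_trans)
    then show ?thesis by simp
  qed (simp add: not_integrable_integral_eq)
  then have I: "\<bar>LINT z : configs n | ?M. angle_jacobian n \<Gamma> z\<bar> \<le> 9216 ^ n"
    by (simp add: set_lebesgue_integral_def)
  have "1 \<le> 2 * pi" using pi_gt3 by simp
  then have "fact n * 1 \<le> fact n * (2 * pi) ^ ?N" by (intro mult_left_mono one_le_power) auto
  then have "1 / (fact n * (2 * pi) ^ ?N) \<le> 1 / fact n" by (intro divide_left_mono) auto
  moreover have "\<bar>weight n \<Gamma>\<bar> = 1 / (fact n * (2 * pi) ^ ?N) * \<bar>LINT z : configs n | ?M. angle_jacobian n \<Gamma> z\<bar>"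
    by (simp add: weight_def abs_mult)
  ultimately have "\<bar>weight n \<Gamma>\<bar> \<le> 1 / fact n * 9216 ^ n"
    using I by (simp only:) (intro mult_mono, auto)
  then show ?thesis by simp
qed

section \<open>Smooth functions\<close>

text \<open>The distance of \<open>a\<close> from the span controls the coefficient of
  \<open>a\<close>. Both the closedness of finitely generated subspaces and the continuity of
  coordinates rest on this estimate.\<close>

lemma infdist_le_norm_combination:
  fixes a :: "'a::real_normed_vector"
  assumes s: "s \<in> span S"
  shows "\<bar>c\<bar> * infdist a (span S) \<le> norm (c *\<^sub>R a + s)"
proof (cases "c = 0")
  case False
  have "- (1 / c) *\<^sub>R s \<in> span S" using s by (rule span_scale)
  then have "infdist a (span S) \<le> dist a (- (1 / c) *\<^sub>R s)" by (rule infdist_le)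
  then have "\<bar>c\<bar> * infdist a (span S) \<le> \<bar>c\<bar> * norm (a + (1 / c) *\<^sub>R s)"
    by (intro mult_left_mono) (simp_all add: dist_norm)
  also have "\<dots> = norm (c *\<^sub>R (a + (1 / c) *\<^sub>R s))" by simp
  also have "c *\<^sub>R (a + (1 / c) *\<^sub>R s) = c *\<^sub>R a + s" using False by (simp add: scaleR_add_right)
  finally show ?thesis .
qed simp

text \<open>Along a convergent sequence the coefficients of the new vector form a Cauchy sequence,
  because its distance from the old span, closed by induction, is positive. Subtracting the
  multiples of the new vector leads back to the old span.\<close>

lemma closed_span_finite:
  fixes S :: "'a::real_normed_vector set"
  assumes "finite S"
  shows "closed (span S)"
  using assms
proof (induction S rule: finite_induct)
  case (insert a S)
  show ?case
  proof (cases "a \<in> span S")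
    case True
    then show ?thesis using insert.IH by (simp add: span_redundant)
  next
    case False
    define \<delta> where "\<delta> = infdist a (span S)"
    have "span S \<noteq> {}" using span_zero by blast
    then have \<delta>: "\<delta> > 0" unfolding \<delta>_def
      using infdist_pos_not_in_closed[OF insert.IH _ False] by simp
    show ?thesis
    proof (rule closed_sequential_limits[THEN iffD2], intro allI impI)
      fix x l assume "(\<forall>n. x n \<in> span (insert a S)) \<and> x \<longlonglongrightarrow> l"
      then have xs: "\<And>n. x n \<in> span (insert a S)" and xl: "x \<longlonglongrightarrow> l" by auto
      have "\<forall>n. \<exists>k. x n - k *\<^sub>R a \<in> span S"
        using xs unfolding span_insert by blast
      from choice[OF this] obtain c where c: "\<And>n. x n - c n *\<^sub>R a \<in> span S" by blast
      have close: "\<bar>c m - c n\<bar> * \<delta> \<le> dist (x m) (x n)" for m n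
      proof -
        have "(x m - c m *\<^sub>R a) - (x n - c n *\<^sub>R a) \<in> span S" by (rule span_diff[OF c c])
        from infdist_le_norm_combination[OF this, of "c m - c n" a]
        show ?thesis by (simp add: \<delta>_def dist_norm algebra_simps)
      qed
      have "Cauchy c"
      proof (rule metric_CauchyI)
        fix \<epsilon> :: real assume "\<epsilon> > 0"
        then have "\<epsilon> * \<delta> > 0" using \<delta> by simp
        from metric_CauchyD[OF LIMSEQ_imp_Cauchy[OF xl] this]
        obtain M where M: "\<forall>m\<ge>M. \<forall>n\<ge>M. dist (x m) (x n) < \<epsilon> * \<delta>" by blast
        show "\<exists>M. \<forall>m\<ge>M. \<forall>n\<ge>M. dist (c m) (c n) < \<epsilon>"
        proof (intro exI allI impI)
          fix m n assume "m \<ge> M" "n \<ge> M"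
          then have "\<bar>c m - c n\<bar> * \<delta> < \<epsilon> * \<delta>" using close[of m n] M by (meson le_less_trans)
          then show "dist (c m) (c n) < \<epsilon>" using \<delta> by (simp add: dist_real_def)
        qed
      qed
      then obtain c0 where c0: "c \<longlonglongrightarrow> c0" by (auto simp: Cauchy_convergent_iff convergent_def)
      have "(\<lambda>n. x n - c n *\<^sub>R a) \<longlonglongrightarrow> l - c0 *\<^sub>R a" by (intro tendsto_intros xl c0)
      then have "l - c0 *\<^sub>R a \<in> span S"
        by (rule closed_sequentially[OF insert.IH c])
      then show "l \<in> span (insert a S)" unfolding span_insert by blast
    qed
  qed
qed simp

section \<open>Calculus of directional derivatives\<close>

lemma eventually_on_line:
  fixes x v :: "'a::real_normed_vector"
  assumes "open U" "x \<in> U"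
  shows "\<forall>\<^sub>F t in nhds (0::real). x + t *\<^sub>R v \<in> U"
proof -
  have "isCont (\<lambda>t. x + t *\<^sub>R v) 0" by (intro continuous_intros)
  then have "((\<lambda>t. x + t *\<^sub>R v) \<longlongrightarrow> x + 0 *\<^sub>R v) (nhds 0)" by (simp add: isCont_def tendsto_nhds_iff)
  then show ?thesis using assms by (intro topological_tendstoD) simp_all
qed

lemma dir_deriv_has_derivative:
  assumes "(f has_derivative D) (at x)"
  shows "dir_deriv v f x = D v"
proof -
  have lin: "linear D" using assms by (rule has_derivative_linear)
  have 1: "((\<lambda>t. x + t *\<^sub>R v) has_derivative (\<lambda>t. t *\<^sub>R v)) (at (0::real))"
    by (auto intro!: derivative_eq_intros)
  have 2: "(f has_derivative D) (at (x + (0::real) *\<^sub>R v))" using assms by simp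
  have "((\<lambda>t. f (x + t *\<^sub>R v)) has_derivative (\<lambda>t. D (t *\<^sub>R v))) (at 0)"
    using has_derivative_compose[OF 1 2] by simp
  then have "((\<lambda>t. f (x + t *\<^sub>R v)) has_vector_derivative D v) (at 0)"
    by (simp add: has_vector_derivative_def linear_cmul[OF lin])
  then show ?thesis unfolding dir_deriv_def by (rule vector_derivative_at)
qed

lemma dir_deriv_cong:
  assumes "open U" "x \<in> U" "\<And>y. y \<in> U \<Longrightarrow> f y = g y"
  shows "dir_deriv v f x = dir_deriv v g x"
  unfolding dir_deriv_def
proof (rule vector_derivative_cong_eq)
  show "\<forall>\<^sub>F t in nhds 0. t \<in> UNIV \<longrightarrow> f (x + t *\<^sub>R v) = g (x + t *\<^sub>R v)"
    using eventually_on_line[OF assms(1,2), of v] by eventually_elim (simp add: assms(3))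
qed auto

lemma C_k_on_cong:
  assumes "open U" "\<And>y. y \<in> U \<Longrightarrow> f y = g y" "C_k_on k U f"
  shows "C_k_on k U g"
  using assms(2,3)
proof (induction k arbitrary: f g)
  case 0
  then show ?case using continuous_on_cong[OF refl, of U f g] by (simp only: C_k_on.simps)
next
  case (Suc k)
  have "g differentiable_on U"
    unfolding differentiable_on_def differentiable_def
  proof
    fix x assume x: "x \<in> U"
    then obtain D where "(f has_derivative D) (at x within U)"
      using Suc.prems(2) unfolding C_k_on.simps differentiable_on_def differentiable_def by blast
    then have "(g has_derivative D) (at x within U)"
      by (rule has_derivative_transform[OF x Suc.prems(1)[symmetric], rotated])
    then show "\<exists>D. (g has_derivative D) (at x within U)" by blast
  qed
  moreover have "C_k_on k U (dir_deriv v g)" for v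
  proof (rule Suc.IH[of "dir_deriv v f"])
    show "dir_deriv v f y = dir_deriv v g y" if "y \<in> U" for y
      by (rule dir_deriv_cong[OF assms(1) that Suc.prems(1)])
    show "C_k_on k U (dir_deriv v f)" using Suc.prems(2) unfolding C_k_on.simps by blast
  qed
  ultimately show ?case unfolding C_k_on.simps by blast
qed

lemma C_k_on_subset:
  assumes "C_k_on k U f" "V \<subseteq> U"
  shows "C_k_on k V f"
  using assms(1)
proof (induction k arbitrary: f)
  case 0
  then show ?case using continuous_on_subset[OF _ assms(2)] unfolding C_k_on.simps by blast
next
  case (Suc k)
  then show ?case using differentiable_on_subset[OF _ assms(2)] unfolding C_k_on.simps by blast
qed

lemma C_k_on_Suc: "C_k_on (Suc k) U f \<Longrightarrow> C_k_on k U f"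
proof (induction k arbitrary: f)
  case 0
  then show ?case using differentiable_imp_continuous_on unfolding C_k_on.simps by blast
next
  case (Suc k)
  then show ?case unfolding C_k_on.simps(2) by blast
qed

definition smooth_on :: "'g::real_normed_vector set \<Rightarrow> ('g \<Rightarrow> complex) \<Rightarrow> bool" where
  "smooth_on U f \<longleftrightarrow> open U \<and> (\<forall>k. C_k_on k U f)"

lemma smooth_near_iff: "smooth_near x f \<longleftrightarrow> (\<exists>U. x \<in> U \<and> smooth_on U f)"
  by (auto simp: smooth_near_def smooth_on_def)

lemma smooth_on_open: "smooth_on U f \<Longrightarrow> open U"
  by (simp add: smooth_on_def)

lemma smooth_on_subset: "smooth_on U f \<Longrightarrow> open V \<Longrightarrow> V \<subseteq> U \<Longrightarrow> smooth_on V f"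
  by (auto simp: smooth_on_def intro: C_k_on_subset)

lemma smooth_on_cong: "smooth_on U f \<Longrightarrow> (\<And>y. y \<in> U \<Longrightarrow> f y = g y) \<Longrightarrow> smooth_on U g"
  by (auto simp: smooth_on_def intro: C_k_on_cong)

lemma smooth_on_differentiable: "smooth_on U f \<Longrightarrow> x \<in> U \<Longrightarrow> f differentiable (at x)"
  unfolding smooth_on_def using C_k_on.simps(2)[of 0 U f] differentiable_on_eq_differentiable_at by blast

lemma smooth_on_continuous: "smooth_on U f \<Longrightarrow> continuous_on U f"
  unfolding smooth_on_def using C_k_on.simps(1)[of U f] by blast

lemma smooth_on_dir_deriv: "smooth_on U f \<Longrightarrow> smooth_on U (dir_deriv v f)"
  unfolding smooth_on_def using C_k_on.simps(2) by blast

text \<open>Smoothness is coinductive: it holds for the members of any class of differentiable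
  functions that is closed under directional derivatives.\<close>

lemma smooth_on_coinduct:
  assumes "P f" "open U" and diff: "\<And>g x. P g \<Longrightarrow> x \<in> U \<Longrightarrow> g differentiable (at x)"
    and step: "\<And>g v. P g \<Longrightarrow> \<exists>h. P h \<and> (\<forall>y\<in>U. h y = dir_deriv v g y)"
  shows "smooth_on U f"
proof -
  have diffon: "g differentiable_on U" if "P g" for g
    using diff[OF that] assms(2) by (simp add: differentiable_on_eq_differentiable_at)
  have "C_k_on k U f" for k
    using assms(1)
  proof (induction k arbitrary: f)
    case 0
    then show ?case using diffon by (auto intro: differentiable_imp_continuous_on)
  next
    case (Suc k)
    have "C_k_on k U (dir_deriv v f)" for v
    proof -
      obtain h where "P h" "\<forall>y\<in>U. h y = dir_deriv v f y" using step[OF Suc.prems] by blast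
      then show ?thesis using Suc.IH[of h] C_k_on_cong[OF assms(2), of h "dir_deriv v f"] by blast
    qed
    then show ?case using diffon[OF Suc.prems] by simp
  qed
  then show ?thesis using assms(2) by (simp add: smooth_on_def)
qed

lemma dir_deriv_add:
  assumes "f differentiable (at x)" "g differentiable (at x)"
  shows "dir_deriv v (\<lambda>y. f y + g y) x = dir_deriv v f x + dir_deriv v g x"
proof -
  obtain D D' where "(f has_derivative D) (at x)" "(g has_derivative D') (at x)"
    using assms by (auto simp: differentiable_def)
  then show ?thesis
    using dir_deriv_has_derivative[OF has_derivative_add, of f D x g D' v] by (simp add: dir_deriv_has_derivative)
qed

lemma dir_deriv_mult:
  assumes "f differentiable (at x)" "g differentiable (at x)"
  shows "dir_deriv v (\<lambda>y. f y * g y) x = f x * dir_deriv v g x + dir_deriv v f x * g x"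
proof -
  obtain D D' where "(f has_derivative D) (at x)" "(g has_derivative D') (at x)"
    using assms by (auto simp: differentiable_def)
  then show ?thesis
    using dir_deriv_has_derivative[OF has_derivative_mult, of f D x g D' v] by (simp add: dir_deriv_has_derivative)
qed

lemma dir_deriv_const [simp]: "dir_deriv v (\<lambda>y. c) x = 0"
  by (rule dir_deriv_has_derivative[where D = "\<lambda>_. 0"]) simp

lemma smooth_on_const: "open U \<Longrightarrow> smooth_on U (\<lambda>x. c)"
  by (rule smooth_on_coinduct[where P = "\<lambda>f. \<exists>c. f = (\<lambda>x. c)"]) (auto intro!: exI[of _ "\<lambda>x. 0"])

lemma smooth_on_add:
  assumes "smooth_on U f" "smooth_on U g"
  shows "smooth_on U (\<lambda>x. f x + g x)"
proof (rule smooth_on_coinduct[where P = "\<lambda>h. \<exists>f g. smooth_on U f \<and> smooth_on U g \<and> h = (\<lambda>x. f x + g x)"])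
  fix h v assume "\<exists>f g. smooth_on U f \<and> smooth_on U g \<and> h = (\<lambda>x. f x + g x)"
  then obtain f g where fg: "smooth_on U f" "smooth_on U g" "h = (\<lambda>x. f x + g x)" by blast
  show "\<exists>h'. (\<exists>f g. smooth_on U f \<and> smooth_on U g \<and> h' = (\<lambda>x. f x + g x)) \<and> (\<forall>y\<in>U. h' y = dir_deriv v h y)"
  proof (rule exI[of _ "\<lambda>x. dir_deriv v f x + dir_deriv v g x"], intro conjI ballI)
    show "\<exists>f' g'. smooth_on U f' \<and> smooth_on U g' \<and> (\<lambda>x. dir_deriv v f x + dir_deriv v g x) = (\<lambda>x. f' x + g' x)"
      by (intro exI conjI, rule smooth_on_dir_deriv[OF fg(1)], rule smooth_on_dir_deriv[OF fg(2)], rule refl)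
    show "dir_deriv v f y + dir_deriv v g y = dir_deriv v h y" if "y \<in> U" for y
      unfolding fg(3)
      by (rule dir_deriv_add[symmetric, OF smooth_on_differentiable[OF fg(1) that] smooth_on_differentiable[OF fg(2) that]])
  qed
qed (use assms in \<open>auto simp: smooth_on_open smooth_on_differentiable\<close>)

lemma smooth_on_sum:
  assumes "open U" "\<And>i. i \<in> I \<Longrightarrow> smooth_on U (f i)"
  shows "smooth_on U (\<lambda>x. \<Sum>i\<in>I. f i x)"
  using assms(2) by (induction I rule: infinite_finite_induct) (auto simp: smooth_on_const assms(1) smooth_on_add)

text \<open>Products are not closed under directional derivatives, since Leibniz's rule produces
  sums of them. The induction is therefore on the order of differentiability, for all pairs of
  factors at once.\<close>

lemma C_k_on_mult:
  assumes U: "open U" and "C_k_on k U f" "C_k_on k U g"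
  shows "C_k_on k U (\<lambda>x. f x * g x)"
  using assms(2,3)
proof (induction k arbitrary: f g)
  case 0
  then show ?case by (auto intro: continuous_intros)
next
  case (Suc k)
  have df: "f differentiable (at x)" "g differentiable (at x)" if "x \<in> U" for x
    using Suc.prems U that by (auto simp: differentiable_on_eq_differentiable_at)
  have add: "C_k_on k U (\<lambda>x. f x + g x)" if "C_k_on k U f" "C_k_on k U g" for k f g
    using that
  proof (induction k arbitrary: f g)
    case 0
    then show ?case by (auto intro: continuous_intros)
  next
    case (Suc k)
    have "C_k_on k U (dir_deriv v (\<lambda>x. f x + g x))" for v
      by (rule C_k_on_cong[OF U _ Suc.IH[of "dir_deriv v f" "dir_deriv v g"]])
        (use Suc.prems U in \<open>auto simp: dir_deriv_add differentiable_on_eq_differentiable_at\<close>)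
    then show ?case using Suc.prems by (auto intro: differentiable_on_add)
  qed
  have "C_k_on k U (dir_deriv v (\<lambda>x. f x * g x))" for v
  proof (rule C_k_on_cong[OF U])
    show "C_k_on k U (\<lambda>x. f x * dir_deriv v g x + dir_deriv v f x * g x)"
    proof (intro add Suc.IH)
      show "C_k_on k U f" "C_k_on k U g" by (rule C_k_on_Suc[OF Suc.prems(1)], rule C_k_on_Suc[OF Suc.prems(2)])
      show "C_k_on k U (dir_deriv v f)" "C_k_on k U (dir_deriv v g)" using Suc.prems unfolding C_k_on.simps(2) by blast+
    qed
  qed (simp add: dir_deriv_mult df)
  then show ?case using Suc.prems by (auto intro: differentiable_on_mult)
qed

lemma smooth_on_mult: "smooth_on U f \<Longrightarrow> smooth_on U g \<Longrightarrow> smooth_on U (\<lambda>x. f x * g x)"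
  by (simp add: smooth_on_def C_k_on_mult)

section \<open>Symmetry of second derivatives\<close>

lemma line_has_vector_derivative:
  assumes "smooth_on U f" "x + t *\<^sub>R v \<in> U"
  shows "((\<lambda>t. f (x + t *\<^sub>R v)) has_vector_derivative dir_deriv v f (x + t *\<^sub>R v)) (at t)"
proof -
  obtain D where D: "(f has_derivative D) (at (x + t *\<^sub>R v))"
    using smooth_on_differentiable[OF assms] by (auto simp: differentiable_def)
  have lin: "linear D" using D by (rule has_derivative_linear)
  have 1: "((\<lambda>t. x + t *\<^sub>R v) has_derivative (\<lambda>t. t *\<^sub>R v)) (at t)"
    by (auto intro!: derivative_eq_intros)
  have "((\<lambda>t. f (x + t *\<^sub>R v)) has_derivative (\<lambda>t. D (t *\<^sub>R v))) (at t)"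
    using has_derivative_compose[OF 1 D] by simp
  then show ?thesis
    by (simp add: has_vector_derivative_def linear_cmul[OF lin] dir_deriv_has_derivative[OF D])
qed

text \<open>The second difference \<open>f (x + s u + s v) - f (x + s u) - f (x + s v) + f x\<close>, composed with a
  real functional \<open>\<phi>\<close> (the real or imaginary part), is a second derivative at an intermediate point.\<close>

lemma second_difference:
  assumes f: "smooth_on U f" and \<phi>: "bounded_linear (\<phi> :: complex \<Rightarrow> real)" and s: "s > 0"
    and U: "\<And>a b. 0 \<le> a \<Longrightarrow> a \<le> s \<Longrightarrow> 0 \<le> b \<Longrightarrow> b \<le> s \<Longrightarrow> x + a *\<^sub>R u + b *\<^sub>R v \<in> U"
  obtains a b where "0 \<le> a" "a \<le> s" "0 \<le> b" "b \<le> s"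
    "\<phi> (f (x + s *\<^sub>R u + s *\<^sub>R v)) - \<phi> (f (x + s *\<^sub>R u)) - \<phi> (f (x + s *\<^sub>R v)) + \<phi> (f x)
       = s * s * \<phi> (dir_deriv v (dir_deriv u f) (x + a *\<^sub>R u + b *\<^sub>R v))"
proof -
  have D: "((\<lambda>t. \<phi> (g (y + t *\<^sub>R w))) has_real_derivative \<phi> (dir_deriv w g (y + t *\<^sub>R w))) (at t)"
    if "smooth_on U g" "y + t *\<^sub>R w \<in> U" for g y w t
    using bounded_linear.has_vector_derivative[OF \<phi> line_has_vector_derivative[OF that]]
    by (simp add: has_real_derivative_iff_has_vector_derivative)
  define h where "h t = \<phi> (f (x + s *\<^sub>R v + t *\<^sub>R u)) - \<phi> (f (x + t *\<^sub>R u))" for t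
  have "\<exists>a>0. a < s \<and> h s - h 0 = (s - 0) * (\<phi> (dir_deriv u f (x + s *\<^sub>R v + a *\<^sub>R u)) - \<phi> (dir_deriv u f (x + a *\<^sub>R u)))"
  proof (rule MVT2[OF s])
    fix t assume "0 \<le> t" "t \<le> s"
    then have "x + s *\<^sub>R v + t *\<^sub>R u \<in> U" "x + t *\<^sub>R u \<in> U"
      using U[of t s] U[of t 0] s by (simp_all add: algebra_simps)
    then show "(h has_real_derivative \<phi> (dir_deriv u f (x + s *\<^sub>R v + t *\<^sub>R u)) - \<phi> (dir_deriv u f (x + t *\<^sub>R u))) (at t)"
      unfolding h_def[abs_def] by (intro DERIV_diff D f)
  qed
  then obtain a where a: "0 < a" "a < s"
    "h s - h 0 = s * (\<phi> (dir_deriv u f (x + s *\<^sub>R v + a *\<^sub>R u)) - \<phi> (dir_deriv u f (x + a *\<^sub>R u)))" by auto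
  define k where "k t = \<phi> (dir_deriv u f (x + a *\<^sub>R u + t *\<^sub>R v))" for t
  have "\<exists>b>0. b < s \<and> k s - k 0 = (s - 0) * \<phi> (dir_deriv v (dir_deriv u f) (x + a *\<^sub>R u + b *\<^sub>R v))"
  proof (rule MVT2[OF s])
    fix t assume "0 \<le> t" "t \<le> s"
    then show "(k has_real_derivative \<phi> (dir_deriv v (dir_deriv u f) (x + a *\<^sub>R u + t *\<^sub>R v))) (at t)"
      unfolding k_def[abs_def] using a U[of a t] by (intro D smooth_on_dir_deriv f) auto
  qed
  then obtain b where b: "0 < b" "b < s" "k s - k 0 = s * \<phi> (dir_deriv v (dir_deriv u f) (x + a *\<^sub>R u + b *\<^sub>R v))" by auto
  have "k s - k 0 = \<phi> (dir_deriv u f (x + s *\<^sub>R v + a *\<^sub>R u)) - \<phi> (dir_deriv u f (x + a *\<^sub>R u))"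
    by (simp add: k_def add_ac)
  then have "h s - h 0 = s * (s * \<phi> (dir_deriv v (dir_deriv u f) (x + a *\<^sub>R u + b *\<^sub>R v)))"
    using a(3) b(3) by simp
  moreover have "h s - h 0 = \<phi> (f (x + s *\<^sub>R u + s *\<^sub>R v)) - \<phi> (f (x + s *\<^sub>R u)) - \<phi> (f (x + s *\<^sub>R v)) + \<phi> (f x)"
    by (simp add: h_def add_ac)
  ultimately show ?thesis using that[of a b] a b by simp
qed

text \<open>The second difference is symmetric in \<open>u\<close> and \<open>v\<close>, and divided
  by \<open>s * s\<close> it is a value of either mixed derivative at a point near \<open>x\<close>,
  where both are continuous. The mean value theorem requires real values, hence the functionals
  \<open>\<phi>\<close>.\<close>

lemma dir_deriv_commute:
  assumes f: "smooth_on U f" and x: "x \<in> U"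
  shows "dir_deriv u (dir_deriv v f) x = dir_deriv v (dir_deriv u f) x"
proof -
  have U: "open U" using f by (rule smooth_on_open)
  have eq: "\<phi> (dir_deriv u (dir_deriv v f) x) = \<phi> (dir_deriv v (dir_deriv u f) x)"
    if \<phi>: "bounded_linear (\<phi> :: complex \<Rightarrow> real)" for \<phi>
  proof -
    obtain r where r: "r > 0" "ball x r \<subseteq> U" using U x by (auto simp: open_contains_ball)
    define c where "c = norm u + norm v + 1"
    have c: "c > 0" by (simp add: c_def add_nonneg_pos)
    define P where "P y = \<phi> (dir_deriv v (dir_deriv u f) y)" for y
    define Q where "Q y = \<phi> (dir_deriv u (dir_deriv v f) y)" for y
    have cont: "isCont P x" "isCont Q x"
      unfolding P_def[abs_def] Q_def[abs_def]
      using continuous_on_interior[OF smooth_on_continuous[OF smooth_on_dir_deriv[OF smooth_on_dir_deriv[OF f]]], of x] x U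
      by (auto intro!: bounded_linear.isCont[OF \<phi>] simp: interior_open)
    have near: "norm (a *\<^sub>R u + b *\<^sub>R v) \<le> s * c" if "0 \<le> a" "a \<le> s" "0 \<le> b" "b \<le> s" for a b s
    proof -
      have "norm (a *\<^sub>R u + b *\<^sub>R v) \<le> a * norm u + b * norm v"
        using norm_triangle_ineq[of "a *\<^sub>R u" "b *\<^sub>R v"] that by simp
      also have "\<dots> \<le> s * norm u + s * norm v" using that by (intro add_mono mult_right_mono) auto
      also have "\<dots> \<le> s * c" using that by (simp add: c_def algebra_simps)
      finally show ?thesis .
    qed
    have small: "\<bar>P x - Q x\<bar> < \<epsilon>" if \<epsilon>: "\<epsilon> > 0" for \<epsilon>
    proof -
      obtain \<rho>1 where \<rho>1: "\<rho>1 > 0" "\<And>y. dist y x < \<rho>1 \<Longrightarrow> dist (P y) (P x) < \<epsilon> / 2"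
        using cont(1) \<epsilon> unfolding continuous_at_eps_delta by (metis half_gt_zero)
      obtain \<rho>2 where \<rho>2: "\<rho>2 > 0" "\<And>y. dist y x < \<rho>2 \<Longrightarrow> dist (Q y) (Q x) < \<epsilon> / 2"
        using cont(2) \<epsilon> unfolding continuous_at_eps_delta by (metis half_gt_zero)
      define \<rho> where "\<rho> = min r (min \<rho>1 \<rho>2)"
      have \<rho>: "\<rho> > 0" using r \<rho>1 \<rho>2 by (simp add: \<rho>_def)
      define s where "s = \<rho> / (2 * c)"
      have s: "s > 0" using \<rho> c by (simp add: s_def)
      have sc: "s * c < \<rho>" using \<rho> c by (simp add: s_def)
      have inball: "dist (x + a *\<^sub>R u + b *\<^sub>R v) x < \<rho>" if "0 \<le> a" "a \<le> s" "0 \<le> b" "b \<le> s" for a b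
        using near[OF that] sc by (simp add: dist_norm)
      have inU: "x + a *\<^sub>R u + b *\<^sub>R v \<in> U" if "0 \<le> a" "a \<le> s" "0 \<le> b" "b \<le> s" for a b
        using inball[OF that] r(2) by (auto simp: \<rho>_def dist_commute)
      have inU': "x + b *\<^sub>R v + a *\<^sub>R u \<in> U" if "0 \<le> b" "b \<le> s" "0 \<le> a" "a \<le> s" for a b
        using inU[OF that(3,4,1,2)] by (simp add: add_ac)
      obtain a b where ab: "0 \<le> a" "a \<le> s" "0 \<le> b" "b \<le> s"
        "\<phi> (f (x + s *\<^sub>R u + s *\<^sub>R v)) - \<phi> (f (x + s *\<^sub>R u)) - \<phi> (f (x + s *\<^sub>R v)) + \<phi> (f x)
          = s * s * P (x + a *\<^sub>R u + b *\<^sub>R v)"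
        unfolding P_def by (rule second_difference[OF f \<phi> s inU])
      obtain a' b' where ab': "0 \<le> a'" "a' \<le> s" "0 \<le> b'" "b' \<le> s"
        "\<phi> (f (x + s *\<^sub>R v + s *\<^sub>R u)) - \<phi> (f (x + s *\<^sub>R v)) - \<phi> (f (x + s *\<^sub>R u)) + \<phi> (f x)
          = s * s * Q (x + a' *\<^sub>R v + b' *\<^sub>R u)"
        unfolding Q_def by (rule second_difference[OF f \<phi> s inU'])
      have "s * s * P (x + a *\<^sub>R u + b *\<^sub>R v) = s * s * Q (x + a' *\<^sub>R v + b' *\<^sub>R u)"
      proof -
        have "x + s *\<^sub>R v + s *\<^sub>R u = x + s *\<^sub>R u + s *\<^sub>R v" by (simp add: add_ac)
        from ab(5) ab'(5)[unfolded this] show ?thesis by linarith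
      qed
      then have PQ: "P (x + a *\<^sub>R u + b *\<^sub>R v) = Q (x + b' *\<^sub>R u + a' *\<^sub>R v)" using s by (simp add: add_ac)
      have "dist (P (x + a *\<^sub>R u + b *\<^sub>R v)) (P x) < \<epsilon> / 2"
        by (rule \<rho>1(2)) (use inball[OF ab(1-4)] in \<open>simp add: \<rho>_def\<close>)
      moreover have "dist (Q (x + b' *\<^sub>R u + a' *\<^sub>R v)) (Q x) < \<epsilon> / 2"
        by (rule \<rho>2(2)) (use inball[OF ab'(3,4,1,2)] in \<open>simp add: \<rho>_def\<close>)
      ultimately show ?thesis unfolding PQ dist_real_def by arith
    qed
    have "\<bar>P x - Q x\<bar> \<le> 0" by (rule field_le_epsilon) (use small in \<open>auto intro: less_imp_le\<close>)
    then show ?thesis by (simp add: P_def Q_def)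
  qed
  show ?thesis using eq[OF bounded_linear_Re] eq[OF bounded_linear_Im] by (simp add: complex_eq_iff)
qed

section \<open>Mixed derivatives and distributions\<close>

lemma poly_mapping_monomial_expansion:
  "r = (\<Sum>m\<in>Poly_Mapping.keys r. Poly_Mapping.single m (Poly_Mapping.lookup r m))"
proof (rule poly_mapping_eqI)
  fix k
  have "Poly_Mapping.lookup (\<Sum>m\<in>Poly_Mapping.keys r. Poly_Mapping.single m (Poly_Mapping.lookup r m)) k
    = (\<Sum>m\<in>Poly_Mapping.keys r. if m = k then Poly_Mapping.lookup r k else 0)"
    unfolding lookup_sum by (intro sum.cong refl) (auto simp: lookup_single)
  also have "\<dots> = Poly_Mapping.lookup r k" by (simp add: in_keys_iff)
  finally show "Poly_Mapping.lookup r k = Poly_Mapping.lookup (\<Sum>m\<in>Poly_Mapping.keys r. Poly_Mapping.single m (Poly_Mapping.lookup r m)) k" by simp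
qed

lemma multi_indices_0: "0 \<in> multi_indices d"
  by (simp add: multi_indices_def)

lemma multi_indices_add_single: "m \<in> multi_indices d \<Longrightarrow> i < d \<Longrightarrow> m + Poly_Mapping.single i k \<in> multi_indices d"
  using keys_add[of m "Poly_Mapping.single i k"] by (auto simp: multi_indices_def split: if_splits)

lemma multi_indices_diff: "m \<in> multi_indices d \<Longrightarrow> m - m' \<in> multi_indices d"
  by (auto simp: multi_indices_def in_keys_iff lookup_minus subset_iff)

lemma multi_indices_add: "m \<in> multi_indices d \<Longrightarrow> m' \<in> multi_indices d \<Longrightarrow> m + m' \<in> multi_indices d"
  using keys_add[of m m'] by (auto simp: multi_indices_def)

definition mdeg :: "nat \<Rightarrow> multi_index \<Rightarrow> nat" where
  "mdeg d m = (\<Sum>i<d. Poly_Mapping.lookup m i)"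

lemma mdeg_add: "mdeg d (m + m') = mdeg d m + mdeg d m'"
  by (simp add: mdeg_def lookup_add sum.distrib)

lemma mdeg_single: "i < d \<Longrightarrow> mdeg d (Poly_Mapping.single i k) = k"
  by (simp add: mdeg_def lookup_single when_def)

lemma mdeg_0 [simp]: "mdeg d 0 = 0"
  by (simp add: mdeg_def)

lemma lookup_le_mdeg: "i < d \<Longrightarrow> Poly_Mapping.lookup m i \<le> mdeg d m"
  unfolding mdeg_def by (intro member_le_sum) auto

lemma minus_single_add_single:
  assumes "Poly_Mapping.lookup (m :: multi_index) i > 0"
  shows "m - Poly_Mapping.single i 1 + Poly_Mapping.single i 1 = m"
  using assms by (intro poly_mapping_eqI) (auto simp: lookup_add lookup_minus lookup_single when_def)

lemma multi_index_nonzero: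
  assumes "m \<in> multi_indices d" "m \<noteq> 0"
  obtains i where "i < d" "Poly_Mapping.lookup m i > 0"
proof -
  obtain i where "i \<in> Poly_Mapping.keys m" using assms(2) by fastforce
  moreover from this have "Poly_Mapping.lookup m i > 0" by (simp add: in_keys_iff)
  ultimately show ?thesis using that[of i] assms(1) unfolding multi_indices_def by blast
qed

lemma multi_index_induct [consumes 1, case_names zero add]:
  assumes "m \<in> multi_indices d" and "P 0"
    and step: "\<And>m i. m \<in> multi_indices d \<Longrightarrow> i < d \<Longrightarrow> P m \<Longrightarrow> P (m + Poly_Mapping.single i 1)"
  shows "P m"
  using assms(1)
proof (induction "mdeg d m" arbitrary: m)
  case 0
  have "m = 0"
  proof (rule ccontr)
    assume "m \<noteq> 0"
    then obtain i where "i < d" "Poly_Mapping.lookup m i > 0" using multi_index_nonzero[OF 0(2)] by blast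
    then show False using lookup_le_mdeg[of i d m] 0(1) by simp
  qed
  then show ?case using assms(2) by simp
next
  case (Suc k)
  then have "m \<noteq> 0" by auto
  then obtain i where i: "i < d" "Poly_Mapping.lookup m i > 0" using multi_index_nonzero[OF Suc.prems] by blast
  let ?m = "m - Poly_Mapping.single i 1"
  have eq: "?m + Poly_Mapping.single i 1 = m" by (rule minus_single_add_single[OF i(2)])
  have "mdeg d m = mdeg d ?m + 1" using mdeg_add[of d ?m "Poly_Mapping.single i 1"] i(1) unfolding eq by (simp add: mdeg_single)
  then have "P ?m" using Suc.hyps(1)[of ?m] Suc.hyps(2) multi_indices_diff[OF Suc.prems] by simp
  from step[OF multi_indices_diff[OF Suc.prems] i(1) this] show ?case unfolding eq .
qed

section \<open>Iterated partial derivatives in any order\<close>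

lemma smooth_on_iterate: "smooth_on U f \<Longrightarrow> smooth_on U ((dir_deriv v ^^ k) f)"
  by (induction k) (simp_all add: smooth_on_dir_deriv)

lemma iterate_dir_deriv_cong:
  assumes U: "open U" and eq: "\<And>y. y \<in> U \<Longrightarrow> f y = g y" and x: "x \<in> U"
  shows "(dir_deriv v ^^ k) f x = (dir_deriv v ^^ k) g x"
  using x
proof (induction k arbitrary: x)
  case (Suc k)
  then show ?case using dir_deriv_cong[OF U Suc.prems, of "(dir_deriv v ^^ k) f" "(dir_deriv v ^^ k) g"] by simp
qed (simp add: eq)

lemma iterate_dir_deriv_commute:
  assumes f: "smooth_on U f" and x: "x \<in> U"
  shows "(dir_deriv v ^^ k) (dir_deriv u f) x = dir_deriv u ((dir_deriv v ^^ k) f) x"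
  using x
proof (induction k arbitrary: x)
  case (Suc k)
  have "dir_deriv v ((dir_deriv v ^^ k) (dir_deriv u f)) x = dir_deriv v (dir_deriv u ((dir_deriv v ^^ k) f)) x"
    by (rule dir_deriv_cong[OF smooth_on_open[OF f] Suc.prems Suc.IH])
  also have "\<dots> = dir_deriv u (dir_deriv v ((dir_deriv v ^^ k) f)) x"
    by (rule dir_deriv_commute[OF smooth_on_iterate[OF f] Suc.prems])
  finally show ?case by simp
qed simp

text \<open>The mixed derivative with an arbitrary list in place of \<open>[0..<d]\<close> and a
  function in place of the multi-index, which makes induction on the list possible.\<close>

definition list_deriv :: "(nat \<Rightarrow> 'g::real_normed_vector) \<Rightarrow> (nat \<Rightarrow> nat) \<Rightarrow> nat list \<Rightarrow> ('g \<Rightarrow> complex) \<Rightarrow> 'g \<Rightarrow> complex" where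
  "list_deriv e m xs f = foldr (\<lambda>i. dir_deriv (e i) ^^ m i) xs f"

lemma list_deriv_Cons: "list_deriv e m (i # xs) f = (dir_deriv (e i) ^^ m i) (list_deriv e m xs f)"
  by (simp add: list_deriv_def)

lemma list_deriv_Nil: "list_deriv e m [] f = f"
  by (simp add: list_deriv_def)

lemma mixed_deriv_list: "mixed_deriv d e m f = list_deriv e (Poly_Mapping.lookup m) [0..<d] f"
  by (simp add: mixed_deriv_def list_deriv_def)

lemma smooth_on_list_deriv: "smooth_on U f \<Longrightarrow> smooth_on U (list_deriv e m xs f)"
  by (induction xs) (simp_all add: list_deriv_Cons list_deriv_Nil smooth_on_iterate)

lemma list_deriv_cong:
  assumes "open U" "\<And>y. y \<in> U \<Longrightarrow> f y = g y" "x \<in> U"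
  shows "list_deriv e m xs f x = list_deriv e m xs g x"
  using assms(3)
proof (induction xs arbitrary: x)
  case (Cons i xs)
  show ?case unfolding list_deriv_Cons by (rule iterate_dir_deriv_cong[OF assms(1) Cons.IH Cons.prems])
qed (simp add: assms list_deriv_Nil)

lemma list_deriv_commute:
  assumes f: "smooth_on U f" and x: "x \<in> U"
  shows "list_deriv e m xs (dir_deriv u f) x = dir_deriv u (list_deriv e m xs f) x"
  using x
proof (induction xs arbitrary: x)
  case (Cons i xs)
  have "list_deriv e m (i # xs) (dir_deriv u f) x = (dir_deriv (e i) ^^ m i) (dir_deriv u (list_deriv e m xs f)) x"
    unfolding list_deriv_Cons by (rule iterate_dir_deriv_cong[OF smooth_on_open[OF f] Cons.IH Cons.prems])
  also have "\<dots> = dir_deriv u (list_deriv e m (i # xs) f) x"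
    unfolding list_deriv_Cons by (rule iterate_dir_deriv_commute[OF smooth_on_list_deriv[OF f] Cons.prems])
  finally show ?case .
qed (simp add: list_deriv_Nil)

lemma list_deriv_notin: "i \<notin> set xs \<Longrightarrow> list_deriv e (m(i := k)) xs f = list_deriv e m xs f"
  by (induction xs) (simp_all add: list_deriv_Cons list_deriv_Nil)

text \<open>The additional derivative arises in the middle of the iteration. Commuting derivatives
  moves it to the innermost place, where it acts on \<open>f\<close> first.\<close>

lemma list_deriv_increment:
  assumes f: "smooth_on U f" and x: "x \<in> U" and xs: "distinct xs" "i \<in> set xs"
  shows "list_deriv e (m(i := Suc (m i))) xs f x = list_deriv e m xs (dir_deriv (e i) f) x"
  using x xs
proof (induction xs arbitrary: x)
  case (Cons j xs)
  show ?case
  proof (cases "i = j")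
    case True
    then have "i \<notin> set xs" using Cons.prems by simp
    then have "list_deriv e (m(i := Suc (m i))) (j # xs) f x = (dir_deriv (e i) ^^ Suc (m i)) (list_deriv e m xs f) x"
      unfolding list_deriv_Cons by (simp add: list_deriv_notin True)
    also have "\<dots> = (dir_deriv (e i) ^^ m i) (dir_deriv (e i) (list_deriv e m xs f)) x"
      by (simp only: funpow_Suc_right o_apply)
    also have "\<dots> = (dir_deriv (e i) ^^ m i) (list_deriv e m xs (dir_deriv (e i) f)) x"
      by (rule iterate_dir_deriv_cong[OF smooth_on_open[OF f] list_deriv_commute[OF f, symmetric] Cons.prems(1)])
    finally show ?thesis unfolding list_deriv_Cons True .
  next
    case False
    then have xs: "distinct xs" "i \<in> set xs" using Cons.prems by auto
    have "list_deriv e (m(i := Suc (m i))) (j # xs) f x = (dir_deriv (e j) ^^ m j) (list_deriv e (m(i := Suc (m i))) xs f) x"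
      unfolding list_deriv_Cons using False by simp
    also have "\<dots> = (dir_deriv (e j) ^^ m j) (list_deriv e m xs (dir_deriv (e i) f)) x"
      by (rule iterate_dir_deriv_cong[OF smooth_on_open[OF f] Cons.IH[OF _ xs] Cons.prems(1)])
    finally show ?thesis unfolding list_deriv_Cons .
  qed
qed simp

lemma smooth_on_mixed_deriv: "smooth_on U f \<Longrightarrow> smooth_on U (mixed_deriv d e m f)"
  unfolding mixed_deriv_list by (rule smooth_on_list_deriv)

lemma mixed_deriv_cong:
  assumes "open U" "\<And>y. y \<in> U \<Longrightarrow> f y = g y" "x \<in> U"
  shows "mixed_deriv d e m f x = mixed_deriv d e m g x"
  unfolding mixed_deriv_list by (rule list_deriv_cong[OF assms])

lemma mixed_deriv_0: "mixed_deriv d e 0 f = f"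
proof -
  have "list_deriv e (Poly_Mapping.lookup 0) xs f = f" for xs
    by (induction xs) (simp_all add: list_deriv_Cons list_deriv_Nil)
  then show ?thesis by (simp add: mixed_deriv_list)
qed

lemma mixed_deriv_add_single:
  assumes f: "smooth_on U f" and x: "x \<in> U" and i: "i < d"
  shows "mixed_deriv d e (m + Poly_Mapping.single i 1) f x = mixed_deriv d e m (dir_deriv (e i) f) x"
proof -
  have "Poly_Mapping.lookup (m + Poly_Mapping.single i 1) = (Poly_Mapping.lookup m)(i := Suc (Poly_Mapping.lookup m i))"
    by (auto simp: fun_eq_iff lookup_add lookup_single when_def)
  then show ?thesis unfolding mixed_deriv_list using list_deriv_increment[OF f x, of "[0..<d]" i] i by simp
qed

lemma mixed_deriv_plus:
  assumes m: "m \<in> multi_indices d" and f: "smooth_on U f" and g: "smooth_on U g" and x: "x \<in> U"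
  shows "mixed_deriv d e m (\<lambda>y. f y + g y) x = mixed_deriv d e m f x + mixed_deriv d e m g x"
  using m f g
proof (induction m arbitrary: f g rule: multi_index_induct)
  case (add m i)
  have U: "open U" by (rule smooth_on_open[OF add.prems(1)])
  have "mixed_deriv d e (m + Poly_Mapping.single i 1) (\<lambda>y. f y + g y) x = mixed_deriv d e m (dir_deriv (e i) (\<lambda>y. f y + g y)) x"
    by (rule mixed_deriv_add_single[OF smooth_on_add[OF add.prems] x add.hyps(2)])
  also have "\<dots> = mixed_deriv d e m (\<lambda>y. dir_deriv (e i) f y + dir_deriv (e i) g y) x"
    by (rule mixed_deriv_cong[OF U _ x])
      (rule dir_deriv_add[OF smooth_on_differentiable[OF add.prems(1)] smooth_on_differentiable[OF add.prems(2)]])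
  also have "\<dots> = mixed_deriv d e m (dir_deriv (e i) f) x + mixed_deriv d e m (dir_deriv (e i) g) x"
    by (rule add.IH[OF smooth_on_dir_deriv[OF add.prems(1)] smooth_on_dir_deriv[OF add.prems(2)]])
  finally show ?case
    by (simp only: mixed_deriv_add_single[OF add.prems(1) x add.hyps(2)] mixed_deriv_add_single[OF add.prems(2) x add.hyps(2)])
qed (simp add: mixed_deriv_0)

lemma mixed_deriv_cmult:
  assumes m: "m \<in> multi_indices d" and f: "smooth_on U f" and x: "x \<in> U"
  shows "mixed_deriv d e m (\<lambda>y. c * f y) x = c * mixed_deriv d e m f x"
  using m f
proof (induction m arbitrary: f rule: multi_index_induct)
  case (add m i)
  have U: "open U" by (rule smooth_on_open[OF add.prems])
  have cf: "smooth_on U (\<lambda>y. c * f y)" by (rule smooth_on_mult[OF smooth_on_const[OF U] add.prems])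
  have "mixed_deriv d e (m + Poly_Mapping.single i 1) (\<lambda>y. c * f y) x = mixed_deriv d e m (dir_deriv (e i) (\<lambda>y. c * f y)) x"
    by (rule mixed_deriv_add_single[OF cf x add.hyps(2)])
  also have "\<dots> = mixed_deriv d e m (\<lambda>y. c * dir_deriv (e i) f y) x"
  proof (rule mixed_deriv_cong[OF U _ x])
    fix y assume y: "y \<in> U"
    show "dir_deriv (e i) (\<lambda>y. c * f y) y = c * dir_deriv (e i) f y"
      using dir_deriv_mult[OF smooth_on_differentiable[OF smooth_on_const[OF U] y] smooth_on_differentiable[OF add.prems y], of "e i" c] by simp
  qed
  also have "\<dots> = c * mixed_deriv d e m (dir_deriv (e i) f) x"
    by (rule add.IH[OF smooth_on_dir_deriv[OF add.prems]])
  finally show ?case by (simp only: mixed_deriv_add_single[OF add.prems x add.hyps(2)])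
qed (simp add: mixed_deriv_0)

section \<open>Coordinates, and the pairing of polynomials with functions\<close>

locale finite_basis =
  fixes d :: nat and e :: "nat \<Rightarrow> 'g::real_normed_vector"
  assumes basis: "is_basis d e"
begin

lemma basis_facts: "inj_on e {..<d}" "independent (e ` {..<d})" "span (e ` {..<d}) = UNIV"
  using basis unfolding is_basis_def by blast+

lemma coord_sum: "(\<Sum>i<d. coord d e i x *\<^sub>R e i) = x"
proof -
  have "(\<Sum>b\<in>e ` {..<d}. representation (e ` {..<d}) x b *\<^sub>R b) = x"
    by (rule sum_representation_eq[OF basis_facts(2)]) (simp_all add: basis_facts(3))
  then show ?thesis by (simp add: sum.reindex[OF basis_facts(1)] coord_def)
qed

lemma coord_basis: "i < d \<Longrightarrow> j < d \<Longrightarrow> coord d e i (e j) = (if i = j then 1 else 0)"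
proof -
  assume ij: "i < d" "j < d"
  have "representation (e ` {..<d}) (e j) = (\<lambda>v. if v = e j then 1 else 0)"
    by (rule representation_basis[OF basis_facts(2)]) (use ij in blast)
  moreover have "e i = e j \<longleftrightarrow> i = j" using inj_on_eq_iff[OF basis_facts(1)] ij by simp
  ultimately show ?thesis by (simp add: coord_def)
qed

lemma coord_add: "coord d e i (x + y) = coord d e i x + coord d e i y"
proof -
  have "x \<in> span (e ` {..<d})" "y \<in> span (e ` {..<d})" unfolding basis_facts(3) by simp_all
  from representation_add[OF basis_facts(2) this(2,1)] representation_add[OF basis_facts(2) this]
  show ?thesis unfolding coord_def by (simp add: add.commute)
qed

lemma coord_scale: "coord d e i (c *\<^sub>R x) = c * coord d e i x"
proof -
  have "x \<in> span (e ` {..<d})" unfolding basis_facts(3) by simp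
  from representation_scale[OF basis_facts(2) this] show ?thesis unfolding coord_def by simp
qed

text \<open>The span of the other basis vectors is closed and does not contain \<open>e i\<close>,
  so the distance of \<open>e i\<close> from it is positive; its inverse bounds the
  coordinate.\<close>

lemma bounded_linear_coord:
  assumes i: "i < d"
  shows "bounded_linear (coord d e i)"
proof -
  let ?S = "e ` ({..<d} - {i})"
  define \<delta> where "\<delta> = infdist (e i) (span ?S)"
  have S: "?S = e ` {..<d} - {e i}"
    using inj_on_image_set_diff[OF basis_facts(1), of "{..<d}" "{i}"] i by simp
  have "e i \<notin> span ?S" unfolding S using basis_facts(2) i unfolding dependent_def by blast
  moreover have "span ?S \<noteq> {}" using span_zero by blast
  moreover have "closed (span ?S)" by (rule closed_span_finite) simp
  ultimately have \<delta>: "\<delta> > 0" unfolding \<delta>_def by (rule_tac infdist_pos_not_in_closed)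
  show ?thesis
  proof (rule bounded_linear_intro)
    fix x
    have "(\<Sum>j\<in>{..<d} - {i}. coord d e j x *\<^sub>R e j) \<in> span ?S"
      by (intro span_sum span_scale span_base) auto
    from infdist_le_norm_combination[OF this, of "coord d e i x" "e i"]
    have "\<bar>coord d e i x\<bar> * \<delta> \<le> norm (\<Sum>j<d. coord d e j x *\<^sub>R e j)"
      unfolding \<delta>_def using i by (simp add: sum.remove[of "{..<d}" i])
    then show "norm (coord d e i x) \<le> norm x * (1 / \<delta>)"
      using \<delta> by (simp add: coord_sum pos_le_divide_eq)
  qed (simp_all add: coord_add coord_scale)
qed

abbreviation X :: "nat \<Rightarrow> 'g \<Rightarrow> complex" where
  "X i x \<equiv> complex_of_real (coord d e i x)"

lemma X_has_derivative: "i < d \<Longrightarrow> (X i has_derivative X i) (at x)"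
proof -
  assume "i < d"
  then have "(coord d e i has_derivative coord d e i) (at x)"
    by (intro bounded_linear_imp_has_derivative bounded_linear_coord)
  then show ?thesis by (rule bounded_linear.has_derivative[OF bounded_linear_of_real])
qed

lemma dir_deriv_X: "i < d \<Longrightarrow> dir_deriv v (X i) x = X i v"
  by (rule dir_deriv_has_derivative[OF X_has_derivative])

lemma smooth_on_X:
  assumes "i < d" "open U"
  shows "smooth_on U (X i)"
proof (rule smooth_on_coinduct[where P = "\<lambda>f. f = X i \<or> (\<exists>c. f = (\<lambda>x. c))"])
  have "X i differentiable at x" for x using X_has_derivative[OF assms(1)] unfolding differentiable_def by blast
  then show "g differentiable at x" if "g = X i \<or> (\<exists>c. g = (\<lambda>x. c))" for g x
    using that differentiable_const by blast
next
  fix g v assume "g = X i \<or> (\<exists>c. g = (\<lambda>x. c))"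
  then show "\<exists>h. (h = X i \<or> (\<exists>c. h = (\<lambda>x. c))) \<and> (\<forall>y\<in>U. h y = dir_deriv v g y)"
  proof
    assume "g = X i"
    then have "\<forall>y\<in>U. X i v = dir_deriv v g y" by (simp add: dir_deriv_X assms)
    then show ?thesis by blast
  next
    assume "\<exists>c. g = (\<lambda>x. c)"
    then have "\<forall>y\<in>U. 0 = dir_deriv v g y" by auto
    then show ?thesis by blast
  qed
qed (rule disjI1, rule refl, rule assms(2))

text \<open>The term with \<open>m - single i 1\<close> vanishes in the case of truncation.\<close>

lemma mixed_deriv_X_mult:
  assumes m: "m \<in> multi_indices d" and i: "i < d" and f: "smooth_on U f" and x: "x \<in> U"
  shows "mixed_deriv d e m (\<lambda>y. X i y * f y) x
    = X i x * mixed_deriv d e m f x + of_nat (Poly_Mapping.lookup m i) * mixed_deriv d e (m - Poly_Mapping.single i 1) f x"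
  using m f
proof (induction m arbitrary: f rule: multi_index_induct)
  case (add m j)
  note j = add.hyps(2) and f = add.prems
  have U: "open U" by (rule smooth_on_open[OF f])
  have Xf: "smooth_on U (\<lambda>y. X i y * f y)" by (rule smooth_on_mult[OF smooth_on_X[OF i U] f])
  have Df: "smooth_on U (dir_deriv (e j) f)" by (rule smooth_on_dir_deriv[OF f])
  have XDf: "smooth_on U (\<lambda>y. X i y * dir_deriv (e j) f y)" by (rule smooth_on_mult[OF smooth_on_X[OF i U] Df])
  let ?\<delta> = "if i = j then 1 else 0 :: complex"
  have cf: "smooth_on U (\<lambda>y. ?\<delta> * f y)" by (rule smooth_on_mult[OF smooth_on_const[OF U] f])
  have "mixed_deriv d e (m + Poly_Mapping.single j 1) (\<lambda>y. X i y * f y) x = mixed_deriv d e m (dir_deriv (e j) (\<lambda>y. X i y * f y)) x"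
    by (rule mixed_deriv_add_single[OF Xf x j])
  also have "\<dots> = mixed_deriv d e m (\<lambda>y. X i y * dir_deriv (e j) f y + ?\<delta> * f y) x"
  proof (rule mixed_deriv_cong[OF U _ x])
    fix y assume y: "y \<in> U"
    show "dir_deriv (e j) (\<lambda>y. X i y * f y) y = X i y * dir_deriv (e j) f y + ?\<delta> * f y"
      using dir_deriv_mult[OF smooth_on_differentiable[OF smooth_on_X[OF i U] y] smooth_on_differentiable[OF f y], of "e j"]
      by (simp add: dir_deriv_X[OF i] coord_basis[OF i j])
  qed
  also have "\<dots> = mixed_deriv d e m (\<lambda>y. X i y * dir_deriv (e j) f y) x + ?\<delta> * mixed_deriv d e m f x"
    unfolding mixed_deriv_plus[OF add.hyps(1) XDf cf x] mixed_deriv_cmult[OF add.hyps(1) f x] ..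
  also have "\<dots> = X i x * mixed_deriv d e m (dir_deriv (e j) f) x
    + (of_nat (Poly_Mapping.lookup m i) * mixed_deriv d e (m - Poly_Mapping.single i 1) (dir_deriv (e j) f) x + ?\<delta> * mixed_deriv d e m f x)"
    unfolding add.IH[OF Df] by simp
  also have "of_nat (Poly_Mapping.lookup m i) * mixed_deriv d e (m - Poly_Mapping.single i 1) (dir_deriv (e j) f) x + ?\<delta> * mixed_deriv d e m f x
    = of_nat (Poly_Mapping.lookup (m + Poly_Mapping.single j 1) i) * mixed_deriv d e (m + Poly_Mapping.single j 1 - Poly_Mapping.single i 1) f x"
  proof (cases "Poly_Mapping.lookup m i = 0")
    case True
    then show ?thesis by (simp add: lookup_add lookup_single when_def)
  next
    case False
    then have "m - Poly_Mapping.single i 1 + Poly_Mapping.single j 1 = m + Poly_Mapping.single j 1 - Poly_Mapping.single i 1"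
      by (intro poly_mapping_eqI) (auto simp: lookup_add lookup_minus lookup_single when_def)
    then have eq: "mixed_deriv d e (m - Poly_Mapping.single i 1) (dir_deriv (e j) f) x = mixed_deriv d e (m + Poly_Mapping.single j 1 - Poly_Mapping.single i 1) f x"
      using mixed_deriv_add_single[OF f x j, where m = "m - Poly_Mapping.single i 1" and e = e] by simp
    show ?thesis unfolding eq by (simp add: lookup_add lookup_single when_def distrib_right)
  qed
  finally show ?case by (simp only: mixed_deriv_add_single[OF f x j])
qed (simp add: mixed_deriv_0)

definition pairing :: "cpoly \<Rightarrow> ('g \<Rightarrow> complex) \<Rightarrow> complex" where
  "pairing r f = (\<Sum>m\<in>Poly_Mapping.keys r. Poly_Mapping.lookup r m * mixed_deriv d e m f 0)"

lemma pairing_superset: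
  assumes "finite K" "Poly_Mapping.keys r \<subseteq> K"
  shows "pairing r f = (\<Sum>m\<in>K. Poly_Mapping.lookup r m * mixed_deriv d e m f 0)"
  unfolding pairing_def using assms by (intro sum.mono_neutral_left) (auto simp: in_keys_iff)

lemma pairing_add: "pairing (r + s) f = pairing r f + pairing s f"
proof -
  let ?K = "Poly_Mapping.keys r \<union> Poly_Mapping.keys s"
  have "Poly_Mapping.keys (r + s) \<subseteq> ?K" by (rule keys_add)
  then show ?thesis
    by (simp add: pairing_superset[of ?K] lookup_add distrib_right sum.distrib)
qed

lemma pairing_single: "pairing (Poly_Mapping.single m c) f = c * mixed_deriv d e m f 0"
  by (subst pairing_superset[of "{m}"]) auto

lemma pairing_zero: "pairing 0 f = 0"
  by (simp add: pairing_def)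

lemma pairing_sum: "pairing (\<Sum>i\<in>I. r i) f = (\<Sum>i\<in>I. pairing (r i) f)"
  by (induction I rule: infinite_finite_induct) (simp_all add: pairing_zero pairing_add)

lemma pairing_cong:
  assumes "open U" "0 \<in> U" "\<And>y. y \<in> U \<Longrightarrow> f y = g y"
  shows "pairing r f = pairing r g"
  unfolding pairing_def using mixed_deriv_cong[OF assms(1,3,2)] by simp

lemma pairing_pvar_mult:
  assumes f: "smooth_on U f" "0 \<in> U" and i: "i < d"
  shows "pairing (pvar i * r) f = pairing r (dir_deriv (e i) f)"
proof -
  have "pairing (pvar i * r) f = pairing (\<Sum>m\<in>Poly_Mapping.keys r. pvar i * Poly_Mapping.single m (Poly_Mapping.lookup r m)) f"
    by (subst poly_mapping_monomial_expansion[of r]) (simp add: sum_distrib_left)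
  also have "\<dots> = (\<Sum>m\<in>Poly_Mapping.keys r. Poly_Mapping.lookup r m * mixed_deriv d e (m + Poly_Mapping.single i 1) f 0)"
    unfolding pairing_sum by (simp add: pvar_def mult_single pairing_single add.commute)
  also have "\<dots> = pairing r (dir_deriv (e i) f)"
    unfolding pairing_def mixed_deriv_add_single[OF f i] ..
  finally show ?thesis .
qed

lemma pairing_const_mult: "pairing (pconst c * r) f = c * pairing r f"
proof -
  have "pairing (pconst c * r) f = pairing (\<Sum>m\<in>Poly_Mapping.keys r. pconst c * Poly_Mapping.single m (Poly_Mapping.lookup r m)) f"
    by (subst poly_mapping_monomial_expansion[of r]) (simp add: sum_distrib_left)
  also have "\<dots> = (\<Sum>m\<in>Poly_Mapping.keys r. c * Poly_Mapping.lookup r m * mixed_deriv d e m f 0)"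
    unfolding pairing_sum by (simp add: pconst_def mult_single pairing_single)
  also have "\<dots> = c * pairing r f" by (simp add: pairing_def sum_distrib_left mult.assoc)
  finally show ?thesis .
qed

lemma pairing_X_mult:
  assumes r: "r \<in> Sym d" and f: "smooth_on U f" "0 \<in> U" and i: "i < d"
  shows "pairing r (\<lambda>y. X i y * f y) = pairing (pdiff i r) f"
proof -
  \<comment> \<open>The coordinate vanishes at the origin, so only the second term of the product
    formula survives there.\<close>
  have 0: "coord d e i 0 = 0" using coord_scale[of i 0 0] by simp
  have "Poly_Mapping.lookup r m * mixed_deriv d e m (\<lambda>y. X i y * f y) 0
     = of_nat (Poly_Mapping.lookup m i) * Poly_Mapping.lookup r m * mixed_deriv d e (m - Poly_Mapping.single i 1) f 0"
    if m: "m \<in> Poly_Mapping.keys r" for m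
  proof -
    have "m \<in> multi_indices d" using r m by (auto simp: Sym_def)
    then show ?thesis using mixed_deriv_X_mult[OF _ i f] by (simp add: 0)
  qed
  then have "pairing r (\<lambda>y. X i y * f y) = (\<Sum>m\<in>Poly_Mapping.keys r. of_nat (Poly_Mapping.lookup m i) * Poly_Mapping.lookup r m * mixed_deriv d e (m - Poly_Mapping.single i 1) f 0)"
    unfolding pairing_def by (intro sum.cong) auto
  then show ?thesis by (simp add: pdiff_def pairing_sum pairing_single)
qed

lemma distribution_of_eq: "distribution_of d e r = (\<lambda>f\<in>{f. smooth_near 0 f}. pairing r f)"
  by (simp add: distribution_of_def pairing_def)

end

section \<open>Power series\<close>

definition multi_index_of :: "nat \<Rightarrow> (nat \<Rightarrow> nat) \<Rightarrow> multi_index" where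
  "multi_index_of d g = (\<Sum>i<d. Poly_Mapping.single i (g i))"

lemma lookup_multi_index_of: "Poly_Mapping.lookup (multi_index_of d g) i = (if i < d then g i else 0)"
  unfolding multi_index_of_def lookup_sum by (simp add: lookup_single when_def)

lemma multi_index_of_in: "multi_index_of d g \<in> multi_indices d"
  by (auto simp: multi_indices_def in_keys_iff lookup_multi_index_of split: if_splits)

lemma multi_index_of_lookup:
  assumes "m \<in> multi_indices d"
  shows "multi_index_of d (restrict (Poly_Mapping.lookup m) {..<d}) = m"
proof (rule poly_mapping_eqI)
  fix i
  have "Poly_Mapping.lookup m i = 0" if "\<not> i < d"
  proof (rule ccontr)
    assume "Poly_Mapping.lookup m i \<noteq> 0"
    then have "i \<in> Poly_Mapping.keys m" by (simp add: in_keys_iff)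
    then show False using assms that unfolding multi_indices_def by blast
  qed
  then show "Poly_Mapping.lookup (multi_index_of d (restrict (Poly_Mapping.lookup m) {..<d})) i = Poly_Mapping.lookup m i"
    by (simp add: lookup_multi_index_of)
qed

lemma bij_betw_box:
  "bij_betw (multi_index_of d) (\<Pi>\<^sub>E i\<in>{..<d}. {..k i}) {m \<in> multi_indices d. \<forall>i<d. Poly_Mapping.lookup m i \<le> k i}"
proof (rule bij_betw_byWitness[where f' = "\<lambda>m. restrict (Poly_Mapping.lookup m) {..<d}"])
  show "\<forall>g\<in>\<Pi>\<^sub>E i\<in>{..<d}. {..k i}. restrict (Poly_Mapping.lookup (multi_index_of d g)) {..<d} = g"
  proof
    fix g assume "g \<in> (\<Pi>\<^sub>E i\<in>{..<d}. {..k i})"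
    then have "g \<in> extensional {..<d}" by (simp add: PiE_iff)
    then show "restrict (Poly_Mapping.lookup (multi_index_of d g)) {..<d} = g"
      by (intro extensionalityI[of _ "{..<d}"]) (simp_all add: lookup_multi_index_of)
  qed
  show "\<forall>m\<in>{m \<in> multi_indices d. \<forall>i<d. Poly_Mapping.lookup m i \<le> k i}.
      multi_index_of d (restrict (Poly_Mapping.lookup m) {..<d}) = m"
    using multi_index_of_lookup by blast
  show "multi_index_of d ` (\<Pi>\<^sub>E i\<in>{..<d}. {..k i}) \<subseteq> {m \<in> multi_indices d. \<forall>i<d. Poly_Mapping.lookup m i \<le> k i}"
  proof
    fix m assume "m \<in> multi_index_of d ` (\<Pi>\<^sub>E i\<in>{..<d}. {..k i})"
    then obtain g where g: "g \<in> (\<Pi>\<^sub>E i\<in>{..<d}. {..k i})" "m = multi_index_of d g" by blast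
    have "g i \<le> k i" if "i < d" for i using PiE_mem[OF g(1), of i] that by simp
    then show "m \<in> {m \<in> multi_indices d. \<forall>i<d. Poly_Mapping.lookup m i \<le> k i}"
      by (simp add: g(2) multi_index_of_in lookup_multi_index_of)
  qed
  show "(\<lambda>m. restrict (Poly_Mapping.lookup m) {..<d}) ` {m \<in> multi_indices d. \<forall>i<d. Poly_Mapping.lookup m i \<le> k i} \<subseteq> (\<Pi>\<^sub>E i\<in>{..<d}. {..k i})"
    by (simp add: image_subset_iff PiE_iff)
qed

lemma finite_box: "finite {m \<in> multi_indices d. \<forall>i<d. Poly_Mapping.lookup m i \<le> k i}"
  using bij_betw_finite[OF bij_betw_box] by (simp add: finite_PiE)

lemma finite_mdeg_le: "finite {m \<in> multi_indices d. mdeg d m \<le> K}"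
  by (rule finite_subset[OF _ finite_box[of d "\<lambda>_. K"]]) (auto intro: order_trans[OF lookup_le_mdeg])

text \<open>Every finite set of multi-indices lies in a box, and the sum over a box is a product of
  \<open>d\<close> geometric sums.\<close>

lemma geometric_multi_summable:
  assumes t: "0 \<le> t" "t < (1::real)"
  shows "(\<lambda>m. t ^ mdeg d m) summable_on multi_indices d"
proof (rule nonneg_bdd_above_summable_on)
  show "bdd_above (sum (\<lambda>m. t ^ mdeg d m) ` {F. F \<subseteq> multi_indices d \<and> finite F})"
  proof (rule bdd_aboveI2)
    fix F assume "F \<in> {F. F \<subseteq> multi_indices d \<and> finite F}"
    then have F: "F \<subseteq> multi_indices d" "finite F" by auto
    define K where "K = (\<Sum>m\<in>F. mdeg d m)"
    have K: "mdeg d m \<le> K" if "m \<in> F" for m unfolding K_def using that F by (intro member_le_sum) auto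
    let ?B = "{m \<in> multi_indices d. \<forall>i<d. Poly_Mapping.lookup m i \<le> K}"
    have sub: "F \<subseteq> ?B"
    proof
      fix m assume m: "m \<in> F"
      have "Poly_Mapping.lookup m i \<le> K" if "i < d" for i using lookup_le_mdeg[OF that, of m] K[OF m] by (rule order_trans)
      then show "m \<in> ?B" using F m by blast
    qed
    have "(\<Sum>m\<in>F. t ^ mdeg d m) \<le> (\<Sum>m\<in>?B. t ^ mdeg d m)"
      using sub t by (intro sum_mono2 finite_box) simp_all
    also have "\<dots> = (\<Sum>g\<in>(\<Pi>\<^sub>E i\<in>{..<d}. {..K}). t ^ mdeg d (multi_index_of d g))"
      by (rule sum.reindex_bij_betw[OF bij_betw_box, symmetric])
    also have "\<dots> = (\<Sum>g\<in>(\<Pi>\<^sub>E i\<in>{..<d}. {..K}). \<Prod>i<d. t ^ g i)"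
      by (simp add: mdeg_def lookup_multi_index_of power_sum)
    also have "\<dots> = (\<Prod>i<d. \<Sum>k\<le>K. t ^ k)" by (rule prod_sum_PiE[symmetric]) auto
    also have "\<dots> \<le> (\<Prod>i<d. 1 / (1 - t))"
    proof (rule prod_mono)
      have "(\<Sum>k\<le>K. t ^ k) \<le> suminf (\<lambda>k. t ^ k)"
        by (rule sum_le_suminf[OF summable_geometric]) (use t in simp_all)
      also have "\<dots> = 1 / (1 - t)" using t by (intro suminf_geometric) simp
      finally show "0 \<le> (\<Sum>k\<le>K. t ^ k) \<and> (\<Sum>k\<le>K. t ^ k) \<le> 1 / (1 - t)" for i :: nat using t by (simp add: sum_nonneg)
    qed
    finally show "(\<Sum>m\<in>F. t ^ mdeg d m) \<le> (\<Prod>i<d. 1 / (1 - t))" .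
  qed
qed (use t in simp)

definition geom_total :: "nat \<Rightarrow> real" where
  "geom_total d = infsum (\<lambda>m. (1 / 2) ^ mdeg d m) (multi_indices d)"

lemma half_summable: "(\<lambda>m. (1 / 2 :: real) ^ mdeg d m) summable_on multi_indices d"
  by (rule geometric_multi_summable) auto

text \<open>The binomial coefficient of \<open>m + k\<close> over \<open>m\<close>. The arguments
  are the two parts rather than the total, because in a recentred series both range freely.\<close>

definition multi_binomial :: "nat \<Rightarrow> multi_index \<Rightarrow> multi_index \<Rightarrow> nat" where
  "multi_binomial d m k = (\<Prod>i<d. (Poly_Mapping.lookup m i + Poly_Mapping.lookup k i) choose Poly_Mapping.lookup m i)"

lemma multi_binomial_le: "real (multi_binomial d m k) \<le> 2 ^ (mdeg d m + mdeg d k)"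
proof -
  have "multi_binomial d m k \<le> (\<Prod>i<d. 2 ^ (Poly_Mapping.lookup m i + Poly_Mapping.lookup k i))"
    unfolding multi_binomial_def by (intro prod_mono) (simp add: binomial_le_pow2)
  also have "\<dots> = 2 ^ (mdeg d m + mdeg d k)" by (simp add: mdeg_def power_sum[symmetric] sum.distrib)
  finally show ?thesis by (metis of_nat_le_iff of_nat_numeral of_nat_power)
qed

text \<open>An estimate of Cauchy's type, with one radius for all coordinates, used in place of a
  domain of convergence.\<close>

definition geom_bounded :: "nat \<Rightarrow> real \<Rightarrow> real \<Rightarrow> (multi_index \<Rightarrow> complex) \<Rightarrow> bool" where
  "geom_bounded d \<rho> B c \<longleftrightarrow> \<rho> > 0 \<and> (\<forall>m\<in>multi_indices d. norm (c m) * \<rho> ^ mdeg d m \<le> B)"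

lemma geom_boundedD: "geom_bounded d \<rho> B c \<Longrightarrow> m \<in> multi_indices d \<Longrightarrow> norm (c m) \<le> B / \<rho> ^ mdeg d m"
  unfolding geom_bounded_def by (simp add: pos_le_divide_eq)

lemma geom_bounded_nonneg: "geom_bounded d \<rho> B c \<Longrightarrow> B \<ge> 0"
  unfolding geom_bounded_def using multi_indices_0[of d] by (metis mdeg_0 mult.right_neutral norm_ge_zero order_trans power_0)

section \<open>Recentring a power series\<close>

context finite_basis
begin

definition xpow :: "multi_index \<Rightarrow> 'g \<Rightarrow> complex" where
  "xpow m x = (\<Prod>i<d. X i x ^ Poly_Mapping.lookup m i)"

definition polydisc :: "real \<Rightarrow> 'g set" where
  "polydisc r = {x. \<forall>i<d. \<bar>coord d e i x\<bar> \<le> r}"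

lemma norm_xpow_le:
  assumes "x \<in> polydisc r"
  shows "norm (xpow m x) \<le> r ^ mdeg d m"
proof -
  have "norm (xpow m x) = (\<Prod>i<d. norm (X i x ^ Poly_Mapping.lookup m i))"
    unfolding xpow_def by (rule prod_norm[symmetric])
  also have "\<dots> = (\<Prod>i<d. \<bar>coord d e i x\<bar> ^ Poly_Mapping.lookup m i)"
    by (intro prod.cong refl) (simp only: norm_power norm_of_real)
  also have "\<dots> \<le> (\<Prod>i<d. r ^ Poly_Mapping.lookup m i)"
  proof (rule prod_mono)
    fix i assume "i \<in> {..<d}"
    then have "\<bar>coord d e i x\<bar> \<le> r" using assms unfolding polydisc_def by blast
    then have "\<bar>coord d e i x\<bar> ^ Poly_Mapping.lookup m i \<le> r ^ Poly_Mapping.lookup m i"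
      by (rule power_mono) simp
    then show "0 \<le> \<bar>coord d e i x\<bar> ^ Poly_Mapping.lookup m i \<and> \<bar>coord d e i x\<bar> ^ Poly_Mapping.lookup m i \<le> r ^ Poly_Mapping.lookup m i"
      by simp
  qed
  finally show ?thesis by (simp only: mdeg_def power_sum)
qed

lemma xpow_zero: "xpow 0 x = 1"
  by (simp add: xpow_def)

lemma coord_zero: "coord d e i 0 = 0"
  using coord_scale[of i 0 0] by simp

lemma xpow_add: "xpow (m + k) x = xpow m x * xpow k x"
  by (simp add: xpow_def lookup_add power_add prod.distrib)

lemma xpow_single: 
  assumes "i < d"
  shows "xpow (Poly_Mapping.single i 1) x = X i x"
proof -
  have "xpow (Poly_Mapping.single i 1) x = (\<Prod>j<d. if j = i then X i x else 1)"
    unfolding xpow_def by (intro prod.cong) (auto simp: lookup_single when_def)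
  then show ?thesis using assms by simp
qed

text \<open>The binomial theorem in each coordinate; the product of the sums is then expanded over
  the box below \<open>a\<close>.\<close>

lemma xpow_plus:
  assumes "a \<in> multi_indices d"
  shows "xpow a (x + h) = (\<Sum>m\<in>{m \<in> multi_indices d. \<forall>i<d. Poly_Mapping.lookup m i \<le> Poly_Mapping.lookup a i}.
     of_nat (multi_binomial d m (a - m)) * xpow m h * xpow (a - m) x)"
proof -
  let ?P = "\<Pi>\<^sub>E i\<in>{..<d}. {..Poly_Mapping.lookup a i}"
  have "xpow a (x + h) = (\<Prod>i<d. (X i h + X i x) ^ Poly_Mapping.lookup a i)"
    by (simp add: xpow_def coord_add add.commute)
  also have "\<dots> = (\<Prod>i<d. \<Sum>k\<le>Poly_Mapping.lookup a i. of_nat (Poly_Mapping.lookup a i choose k) * X i h ^ k * X i x ^ (Poly_Mapping.lookup a i - k))"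
    by (simp only: binomial_ring)
  also have "\<dots> = (\<Sum>g\<in>?P. \<Prod>i<d. of_nat (Poly_Mapping.lookup a i choose g i) * X i h ^ g i * X i x ^ (Poly_Mapping.lookup a i - g i))"
    by (rule prod_sum_PiE) auto
  also have "\<dots> = (\<Sum>g\<in>?P. of_nat (multi_binomial d (multi_index_of d g) (a - multi_index_of d g)) * xpow (multi_index_of d g) h * xpow (a - multi_index_of d g) x)"
  proof (rule sum.cong[OF refl])
    fix g assume g: "g \<in> ?P"
    have "g i \<le> Poly_Mapping.lookup a i" if "i < d" for i using PiE_mem[OF g, of i] that by simp
    then have "(\<Prod>i<d. of_nat (Poly_Mapping.lookup a i choose g i) * X i h ^ g i * X i x ^ (Poly_Mapping.lookup a i - g i))
      = (\<Prod>i<d. of_nat ((Poly_Mapping.lookup (multi_index_of d g) i + Poly_Mapping.lookup (a - multi_index_of d g) i) choose Poly_Mapping.lookup (multi_index_of d g) i)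
         * X i h ^ Poly_Mapping.lookup (multi_index_of d g) i * X i x ^ Poly_Mapping.lookup (a - multi_index_of d g) i)"
      by (intro prod.cong refl) (simp add: lookup_multi_index_of lookup_minus)
    then show "(\<Prod>i<d. of_nat (Poly_Mapping.lookup a i choose g i) * X i h ^ g i * X i x ^ (Poly_Mapping.lookup a i - g i))
      = of_nat (multi_binomial d (multi_index_of d g) (a - multi_index_of d g)) * xpow (multi_index_of d g) h * xpow (a - multi_index_of d g) x"
      by (simp add: multi_binomial_def xpow_def prod.distrib)
  qed
  also have "\<dots> = (\<Sum>m\<in>{m \<in> multi_indices d. \<forall>i<d. Poly_Mapping.lookup m i \<le> Poly_Mapping.lookup a i}.
     of_nat (multi_binomial d m (a - m)) * xpow m h * xpow (a - m) x)"
    by (rule sum.reindex_bij_betw[OF bij_betw_box])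
  finally show ?thesis .
qed

definition recentred :: "(multi_index \<Rightarrow> complex) \<Rightarrow> 'g \<Rightarrow> multi_index \<Rightarrow> complex" where
  "recentred c x m = infsum (\<lambda>k. c (m + k) * of_nat (multi_binomial d m k) * xpow k x) (multi_indices d)"

text \<open>Recentring costs binomial coefficients of size at most
  \<open>2 ^ (mdeg d m + mdeg d k)\<close>. The radius \<open>\<rho> / 4\<close> makes up for this:
  each degree of \<open>k\<close> contributes
  \<open>(2 / \<rho>) * (\<rho> / 4) = 1 / 2\<close>.\<close>

lemma recentred_term_bound:
  assumes c: "geom_bounded d \<rho> B c" and x: "x \<in> polydisc (\<rho> / 4)" and m: "m \<in> multi_indices d" and k: "k \<in> multi_indices d"
  shows "norm (c (m + k) * of_nat (multi_binomial d m k) * xpow k x) \<le> B * (2 / \<rho>) ^ mdeg d m * (1 / 2) ^ mdeg d k"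
proof -
  have \<rho>: "\<rho> > 0" using c unfolding geom_bounded_def by blast
  have B: "B \<ge> 0" by (rule geom_bounded_nonneg[OF c])
  have "norm (c (m + k) * of_nat (multi_binomial d m k) * xpow k x) = norm (c (m + k)) * real (multi_binomial d m k) * norm (xpow k x)"
    by (simp add: norm_mult)
  also have "\<dots> \<le> (B / \<rho> ^ (mdeg d m + mdeg d k)) * 2 ^ (mdeg d m + mdeg d k) * (\<rho> / 4) ^ mdeg d k"
  proof -
    have "norm (c (m + k)) \<le> B / \<rho> ^ (mdeg d m + mdeg d k)"
      using geom_boundedD[OF c multi_indices_add[OF m k]] by (simp only: mdeg_add)
    moreover have "0 \<le> B / \<rho> ^ (mdeg d m + mdeg d k)" using B \<rho> by simp
    ultimately show ?thesis
      by (intro mult_mono multi_binomial_le norm_xpow_le[OF x] mult_nonneg_nonneg) simp_all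
  qed
  also have "(B / \<rho> ^ (mdeg d m + mdeg d k)) * 2 ^ (mdeg d m + mdeg d k) = B * (2 / \<rho>) ^ (mdeg d m + mdeg d k)"
    by (simp add: power_divide)
  also have "B * (2 / \<rho>) ^ (mdeg d m + mdeg d k) * (\<rho> / 4) ^ mdeg d k = B * (2 / \<rho>) ^ mdeg d m * ((2 / \<rho>) * (\<rho> / 4)) ^ mdeg d k"
    unfolding power_add power_mult_distrib by (simp only: mult_ac)
  also have "(2 / \<rho>) * (\<rho> / 4) = 1 / 2" using \<rho> by simp
  finally show ?thesis .
qed

lemma recentred_summable:
  assumes c: "geom_bounded d \<rho> B c" and x: "x \<in> polydisc (\<rho> / 4)" and m: "m \<in> multi_indices d"
  shows "(\<lambda>k. norm (c (m + k) * of_nat (multi_binomial d m k) * xpow k x)) summable_on multi_indices d"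
    "norm (recentred c x m) \<le> B * geom_total d * (2 / \<rho>) ^ mdeg d m"
proof -
  have s: "(\<lambda>k. B * (2 / \<rho>) ^ mdeg d m * (1 / 2) ^ mdeg d k) summable_on multi_indices d"
    by (rule summable_on_cmult_right[OF half_summable])
  show 1: "(\<lambda>k. norm (c (m + k) * of_nat (multi_binomial d m k) * xpow k x)) summable_on multi_indices d"
    by (rule Infinite_Sum.abs_summable_on_comparison_test'[OF s recentred_term_bound[OF c x m]])
  have "norm (recentred c x m) \<le> infsum (\<lambda>k. norm (c (m + k) * of_nat (multi_binomial d m k) * xpow k x)) (multi_indices d)"
    unfolding recentred_def by (rule norm_infsum_bound[OF 1])
  also have "\<dots> \<le> infsum (\<lambda>k. B * (2 / \<rho>) ^ mdeg d m * (1 / 2) ^ mdeg d k) (multi_indices d)"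
    by (rule infsum_mono[OF 1 s recentred_term_bound[OF c x m]])
  also have "\<dots> = B * (2 / \<rho>) ^ mdeg d m * geom_total d"
    unfolding geom_total_def by (rule infsum_cmult_right[OF half_summable])
  finally show "norm (recentred c x m) \<le> B * geom_total d * (2 / \<rho>) ^ mdeg d m" by (simp only: mult_ac)
qed

text \<open>The double series over \<open>(m, k)\<close> converges absolutely. Summed over
  \<open>k\<close> first, it is the recentred series; summed over the finite sets of pairs with
  \<open>m + k = a\<close>, it is the original series at \<open>x + h\<close> by the binomial
  theorem.\<close>

lemma recentred_has_sum:
  assumes c: "geom_bounded d \<rho> B c" and x: "x \<in> polydisc (\<rho> / 4)" and h: "h \<in> polydisc (\<rho> / 4)"
  shows "((\<lambda>m. recentred c x m * xpow m h) has_sum infsum (\<lambda>a. c a * xpow a (x + h)) (multi_indices d)) (multi_indices d)"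
    and "((\<lambda>a. c a * xpow a (x + h)) has_sum infsum (\<lambda>a. c a * xpow a (x + h)) (multi_indices d)) (multi_indices d)"
proof -
  let ?M = "multi_indices d"
  have \<rho>: "\<rho> > 0" using c unfolding geom_bounded_def by blast
  have B: "B \<ge> 0" by (rule geom_bounded_nonneg[OF c])
  define F where "F = (\<lambda>(m, k). c (m + k) * of_nat (multi_binomial d m k) * xpow k x * xpow m h)"
  have bound: "norm (F (m, k)) \<le> B * (1 / 2) ^ mdeg d m * (1 / 2) ^ mdeg d k" if mk: "m \<in> ?M" "k \<in> ?M" for m k
  proof -
    have "norm (F (m, k)) \<le> (B * (2 / \<rho>) ^ mdeg d m * (1 / 2) ^ mdeg d k) * (\<rho> / 4) ^ mdeg d m"
      unfolding F_def prod.case norm_mult[of "c (m + k) * of_nat (multi_binomial d m k) * xpow k x"]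
      by (intro mult_mono recentred_term_bound[OF c x mk] norm_xpow_le[OF h]) (use B \<rho> in simp_all)
    also have "\<dots> = B * ((2 / \<rho>) * (\<rho> / 4)) ^ mdeg d m * (1 / 2) ^ mdeg d k"
      by (simp only: power_mult_distrib mult_ac)
    also have "(2 / \<rho>) * (\<rho> / 4) = 1 / 2" using \<rho> by simp
    finally show ?thesis .
  qed
  have "(\<lambda>p. B * (1 / 2) ^ mdeg d (fst p) * (1 / 2) ^ mdeg d (snd p)) summable_on Sigma ?M (\<lambda>_. ?M)"
  proof (rule summable_on_SigmaI[where g = "\<lambda>m. B * (1 / 2) ^ mdeg d m * geom_total d"])
    show "((\<lambda>k. B * (1 / 2) ^ mdeg d (fst (m, k)) * (1 / 2) ^ mdeg d (snd (m, k))) has_sum B * (1 / 2) ^ mdeg d m * geom_total d) ?M" for m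
      unfolding fst_conv snd_conv geom_total_def by (rule has_sum_cmult_right[OF has_sum_infsum[OF half_summable]])
    show "(\<lambda>m. B * (1 / 2) ^ mdeg d m * geom_total d) summable_on ?M"
      by (intro summable_on_cmult_left summable_on_cmult_right half_summable)
  qed (use B in simp)
  then have "(\<lambda>p. norm (F p)) summable_on Sigma ?M (\<lambda>_. ?M)"
  proof (rule Infinite_Sum.abs_summable_on_comparison_test')
    fix p assume "p \<in> ?M \<times> ?M"
    then show "norm (F p) \<le> B * (1 / 2) ^ mdeg d (fst p) * (1 / 2) ^ mdeg d (snd p)"
      using bound[of "fst p" "snd p"] by (simp add: mem_Times_iff)
  qed
  then have "F summable_on Sigma ?M (\<lambda>_. ?M)" by (rule abs_summable_summable)
  then have S: "(F has_sum infsum F (?M \<times> ?M)) (Sigma ?M (\<lambda>_. ?M))" by (rule has_sum_infsum)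
  have row: "((\<lambda>k. F (m, k)) has_sum recentred c x m * xpow m h) ?M" if "m \<in> ?M" for m
  proof -
    have "((\<lambda>k. c (m + k) * of_nat (multi_binomial d m k) * xpow k x * xpow m h) has_sum recentred c x m * xpow m h) ?M"
      unfolding recentred_def
      by (rule has_sum_cmult_left[OF has_sum_infsum[OF abs_summable_summable[OF recentred_summable(1)[OF c x that]]]])
    then show ?thesis by (simp only: F_def prod.case)
  qed
  have 1: "((\<lambda>m. recentred c x m * xpow m h) has_sum infsum F (?M \<times> ?M)) ?M"
    by (rule has_sum_SigmaD[OF S row])
  let ?L = "\<lambda>a. {m \<in> ?M. \<forall>i<d. Poly_Mapping.lookup m i \<le> Poly_Mapping.lookup a i}"
  have sub: "a - m \<in> ?M" "m + (a - m) = a" if a: "a \<in> ?M" and m: "m \<in> ?L a" for a m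
  proof -
    show "a - m \<in> ?M" by (rule multi_indices_diff[OF a])
    have "Poly_Mapping.lookup m i \<le> Poly_Mapping.lookup a i" for i
    proof (cases "i < d")
      case False
      then have "i \<notin> Poly_Mapping.keys m" using m unfolding multi_indices_def by blast
      then show ?thesis by (simp add: in_keys_iff)
    qed (use m in blast)
    then show "m + (a - m) = a" by (intro poly_mapping_eqI) (simp add: lookup_add lookup_minus)
  qed
  have bij: "bij_betw (\<lambda>(a, m). (m, a - m)) (Sigma ?M ?L) (?M \<times> ?M)"
  proof (rule bij_betw_byWitness[where f' = "\<lambda>(m, k). (m + k, m)"])
    show "\<forall>p\<in>Sigma ?M ?L. (case case p of (a, m) \<Rightarrow> (m, a - m) of (m, k) \<Rightarrow> (m + k, m)) = p"
    proof
      fix p assume "p \<in> Sigma ?M ?L"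
      then obtain a m where p: "p = (a, m)" "a \<in> ?M" "m \<in> ?L a" by blast
      show "(case case p of (a, m) \<Rightarrow> (m, a - m) of (m, k) \<Rightarrow> (m + k, m)) = p"
        unfolding p(1) prod.case sub(2)[OF p(2,3)] ..
    qed
    show "\<forall>p\<in>?M \<times> ?M. (case case p of (m, k) \<Rightarrow> (m + k, m) of (a, m) \<Rightarrow> (m, a - m)) = p"
      unfolding split_paired_Ball_Sigma prod.case by simp
    show "(\<lambda>(a, m). (m, a - m)) ` Sigma ?M ?L \<subseteq> ?M \<times> ?M"
    proof
      fix q assume "q \<in> (\<lambda>(a, m). (m, a - m)) ` Sigma ?M ?L"
      then obtain p where p: "q = (case p of (a, m) \<Rightarrow> (m, a - m))" "p \<in> Sigma ?M ?L" by (rule imageE)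
      obtain a m where am: "p = (a, m)" by (cases p)
      have q: "q = (m, a - m)" "a \<in> ?M" "m \<in> ?L a" using p unfolding am by simp_all
      then show "q \<in> ?M \<times> ?M" using sub(1)[OF q(2,3)] by simp
    qed
    show "(\<lambda>(m, k). (m + k, m)) ` (?M \<times> ?M) \<subseteq> Sigma ?M ?L"
    proof
      fix q assume "q \<in> (\<lambda>(m, k). (m + k, m)) ` (?M \<times> ?M)"
      then obtain p where p: "q = (case p of (m, k) \<Rightarrow> (m + k, m))" "p \<in> ?M \<times> ?M" by (rule imageE)
      obtain m k where mk: "p = (m, k)" by (cases p)
      have q: "q = (m + k, m)" "m \<in> ?M" "k \<in> ?M" using p unfolding mk by simp_all
      then show "q \<in> Sigma ?M ?L" using multi_indices_add[OF q(2,3)] by (simp add: lookup_add)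
    qed
  qed
  have S': "((\<lambda>p. F (case p of (a, m) \<Rightarrow> (m, a - m))) has_sum infsum F (?M \<times> ?M)) (Sigma ?M ?L)"
    using S unfolding has_sum_reindex_bij_betw[OF bij] .
  have row': "((\<lambda>m. F (case (a, m) of (a, m) \<Rightarrow> (m, a - m))) has_sum c a * xpow a (x + h)) (?L a)" if a: "a \<in> ?M" for a
  proof (rule has_sum_finiteI[OF finite_box])
    have "(\<Sum>m\<in>?L a. F (m, a - m)) = (\<Sum>m\<in>?L a. c a * (of_nat (multi_binomial d m (a - m)) * xpow m h * xpow (a - m) x))"
    proof (rule sum.cong[OF refl])
      fix m assume "m \<in> ?L a"
      then have "m + (a - m) = a" by (rule sub(2)[OF a])
      then show "F (m, a - m) = c a * (of_nat (multi_binomial d m (a - m)) * xpow m h * xpow (a - m) x)"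
        unfolding F_def prod.case by (simp only: mult_ac)
    qed
    also have "\<dots> = c a * xpow a (x + h)" unfolding xpow_plus[OF a] by (rule sum_distrib_left[symmetric])
    finally show "c a * xpow a (x + h) = (\<Sum>m\<in>?L a. F (case (a, m) of (a, m) \<Rightarrow> (m, a - m)))" by simp
  qed
  have 2: "((\<lambda>a. c a * xpow a (x + h)) has_sum infsum F (?M \<times> ?M)) ?M"
    by (rule has_sum_SigmaD[OF S' row'])
  have "infsum (\<lambda>a. c a * xpow a (x + h)) ?M = infsum F (?M \<times> ?M)" by (rule infsumI[OF 2])
  then show "((\<lambda>m. recentred c x m * xpow m h) has_sum infsum (\<lambda>a. c a * xpow a (x + h)) ?M) ?M"
    "((\<lambda>a. c a * xpow a (x + h)) has_sum infsum (\<lambda>a. c a * xpow a (x + h)) ?M) ?M"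
    using 1 2 by simp_all
qed

end

section \<open>Analytic functions: estimates, derivatives and vanishing\<close>

lemma has_sum_finite_sum:
  fixes f :: "'i \<Rightarrow> 'a \<Rightarrow> complex"
  assumes "finite I" "\<And>i. i \<in> I \<Longrightarrow> (f i has_sum s i) A"
  shows "((\<lambda>x. \<Sum>i\<in>I. f i x) has_sum (\<Sum>i\<in>I. s i)) A"
  using assms
proof (induction I rule: finite_induct)
  case (insert i I)
  have "((\<lambda>x. f i x + (\<Sum>i\<in>I. f i x)) has_sum s i + (\<Sum>i\<in>I. s i)) A"
    by (rule has_sum_add[OF insert.prems[OF insertI1] insert.IH[OF insert.prems[OF insertI2]]])
  then show ?case by (simp add: insert.hyps)
qed simp

context finite_basis
begin

text \<open>Analyticity at \<open>x\<close> together with a family of coefficients, so that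
  derivatives can be read off from the coefficients.\<close>

definition psat :: "'g \<Rightarrow> ('g \<Rightarrow> complex) \<Rightarrow> (multi_index \<Rightarrow> complex) \<Rightarrow> bool" where
  "psat x f c \<longleftrightarrow> (\<forall>\<^sub>F y in nhds x. ((\<lambda>m. c m * xpow m (y - x)) has_sum f y) (multi_indices d))"

lemma real_analytic_on_iff: "real_analytic_on d e U f \<longleftrightarrow> (\<forall>x\<in>U. \<exists>c. psat x f c)"
  unfolding real_analytic_on_def psat_def xpow_def ..

lemma eventually_polydisc:
  assumes r: "r > 0"
  shows "\<forall>\<^sub>F y in nhds x. y - x \<in> polydisc r"
proof -
  have "\<forall>\<^sub>F y in nhds x. \<forall>i\<in>{..<d}. \<bar>coord d e i (y - x)\<bar> < r"
  proof (rule eventually_ball_finite)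
    show "\<forall>i\<in>{..<d}. \<forall>\<^sub>F y in nhds x. \<bar>coord d e i (y - x)\<bar> < r"
    proof
      fix i assume "i \<in> {..<d}"
      then have bl: "bounded_linear (coord d e i)" by (intro bounded_linear_coord) simp
      have "isCont (\<lambda>y. \<bar>coord d e i (y - x)\<bar>) x"
        by (intro continuous_rabs bounded_linear.continuous[OF bl] continuous_intros)
      then have "((\<lambda>y. \<bar>coord d e i (y - x)\<bar>) \<longlongrightarrow> \<bar>coord d e i (x - x)\<bar>) (nhds x)"
        by (simp add: isCont_def tendsto_nhds_iff)
      then show "\<forall>\<^sub>F y in nhds x. \<bar>coord d e i (y - x)\<bar> < r"
        by (rule order_tendstoD(2)) (simp add: coord_zero r)
    qed
  qed simp
  then show ?thesis
    by (rule eventually_mono) (simp add: polydisc_def less_imp_le)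
qed

text \<open>Absolute convergence at one point whose coordinates relative to \<open>x\<close> are all
  equal to \<open>\<rho>\<close> suffices: there the term of index \<open>m\<close> has absolute
  value \<open>norm (c m) * \<rho> ^ mdeg d m\<close>. The point
  \<open>x + \<rho> *\<^sub>R s\<close>, with \<open>s\<close> the sum of the basis, is such a
  point.\<close>

lemma psat_bounded:
  assumes "psat x f c"
  obtains \<rho> B where "geom_bounded d \<rho> B c"
    "\<forall>\<^sub>F y in nhds x. f y = infsum (\<lambda>m. c m * xpow m (y - x)) (multi_indices d)"
proof -
  obtain \<delta> where \<delta>: "\<delta> > 0" "\<And>y. dist y x < \<delta> \<Longrightarrow> ((\<lambda>m. c m * xpow m (y - x)) has_sum f y) (multi_indices d)"
    using assms unfolding psat_def eventually_nhds_metric by blast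
  define s where "s = (\<Sum>j<d. e j)"
  define \<rho> where "\<rho> = \<delta> / (2 * (norm s + 1))"
  have n: "2 * (norm s + 1) > 0" by (simp add: add_nonneg_pos)
  have \<rho>: "\<rho> > 0" unfolding \<rho>_def using \<delta>(1) n by (rule divide_pos_pos)
  have "dist (x + \<rho> *\<^sub>R s) x < \<delta>"
  proof -
    have "dist (x + \<rho> *\<^sub>R s) x = \<rho> * norm s" using \<rho> by (simp add: dist_norm)
    also have "\<dots> < \<rho> * (2 * (norm s + 1))"
      by (rule mult_strict_left_mono[OF _ \<rho>]) (smt (verit) norm_ge_zero)
    also have "\<dots> = \<delta>" unfolding \<rho>_def using n by simp
    finally show ?thesis .
  qed
  then have hs: "((\<lambda>m. c m * xpow m (\<rho> *\<^sub>R s)) has_sum f (x + \<rho> *\<^sub>R s)) (multi_indices d)"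
    using \<delta>(2)[of "x + \<rho> *\<^sub>R s"] by simp
  have cs: "coord d e i (\<rho> *\<^sub>R s) = \<rho>" if "i < d" for i
  proof -
    have "coord d e i s = (\<Sum>j<d. coord d e i (e j))"
      unfolding s_def by (rule linear_sum[OF bounded_linear.linear[OF bounded_linear_coord[OF that]]])
    also have "\<dots> = (\<Sum>j<d. if j = i then 1 else 0)" by (intro sum.cong refl) (simp add: coord_basis that)
    finally show ?thesis using that by (simp add: coord_scale)
  qed
  have "xpow m (\<rho> *\<^sub>R s) = (\<Prod>i<d. of_real \<rho> ^ Poly_Mapping.lookup m i)" for m
    unfolding xpow_def by (intro prod.cong refl) (simp add: cs)
  then have xp: "norm (xpow m (\<rho> *\<^sub>R s)) = \<rho> ^ mdeg d m" for m
    using \<rho> by (simp add: mdeg_def power_sum[symmetric] norm_power)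
  have sm: "(\<lambda>m. norm (c m * xpow m (\<rho> *\<^sub>R s))) summable_on multi_indices d"
    using has_sum_imp_summable[OF hs] unfolding summable_on_iff_abs_summable_on_complex .
  have "norm (c m) * \<rho> ^ mdeg d m \<le> infsum (\<lambda>m. norm (c m * xpow m (\<rho> *\<^sub>R s))) (multi_indices d)"
    if m: "m \<in> multi_indices d" for m
  proof -
    have "(\<Sum>m\<in>{m}. norm (c m * xpow m (\<rho> *\<^sub>R s))) \<le> infsum (\<lambda>m. norm (c m * xpow m (\<rho> *\<^sub>R s))) (multi_indices d)"
      by (rule finite_sum_le_infsum[OF sm]) (use m in simp_all)
    then show ?thesis by (simp add: norm_mult xp)
  qed
  then have "geom_bounded d \<rho> (infsum (\<lambda>m. norm (c m * xpow m (\<rho> *\<^sub>R s))) (multi_indices d)) c"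
    unfolding geom_bounded_def using \<rho> by blast
  moreover have "\<forall>\<^sub>F y in nhds x. f y = infsum (\<lambda>m. c m * xpow m (y - x)) (multi_indices d)"
    using assms unfolding psat_def by (rule eventually_mono) (rule infsumI[symmetric])
  ultimately show ?thesis using that by blast
qed

lemma psat_power_series:
  assumes c: "geom_bounded d \<rho> B c" and x: "x \<in> polydisc (\<rho> / 4)"
  shows "psat x (\<lambda>y. infsum (\<lambda>a. c a * xpow a y) (multi_indices d)) (recentred c x)"
  unfolding psat_def
proof -
  have "\<rho> / 4 > 0" using c unfolding geom_bounded_def by simp
  then show "\<forall>\<^sub>F y in nhds x. ((\<lambda>m. recentred c x m * xpow m (y - x)) has_sum infsum (\<lambda>a. c a * xpow a y) (multi_indices d)) (multi_indices d)"
    by (rule eventually_mono[OF eventually_polydisc[of _ x]]) (use recentred_has_sum(1)[OF c x] in force)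
qed

text \<open>Analyticity spreads from \<open>z\<close> to a neighbourhood, and the coefficients at
  all nearby points are given by one formula in the coefficients at \<open>z\<close>.\<close>

lemma psat_recentre:
  assumes "psat z f c"
  obtains \<rho> B where "geom_bounded d \<rho> B c"
    "\<forall>\<^sub>F x in nhds z. x - z \<in> polydisc (\<rho> / 4) \<and> psat x f (recentred c (x - z))"
proof -
  obtain \<rho> B where c: "geom_bounded d \<rho> B c"
    and f: "\<forall>\<^sub>F y in nhds z. f y = infsum (\<lambda>m. c m * xpow m (y - z)) (multi_indices d)"
    using psat_bounded[OF assms] by blast
  have r: "\<rho> / 4 > 0" using c unfolding geom_bounded_def by simp
  have "\<forall>\<^sub>F x in nhds z. f x = infsum (\<lambda>m. c m * xpow m (x - z)) (multi_indices d) \<and> x - z \<in> polydisc (\<rho> / 4)"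
    by (rule eventually_conj[OF f eventually_polydisc[OF r]])
  then obtain W where W: "open W" "z \<in> W"
    "\<And>x. x \<in> W \<Longrightarrow> f x = infsum (\<lambda>m. c m * xpow m (x - z)) (multi_indices d) \<and> x - z \<in> polydisc (\<rho> / 4)"
    unfolding eventually_nhds by blast
  have "x - z \<in> polydisc (\<rho> / 4) \<and> psat x f (recentred c (x - z))" if x: "x \<in> W" for x
  proof
    show xz: "x - z \<in> polydisc (\<rho> / 4)" using W(3)[OF x] by blast
    have "\<forall>\<^sub>F y in nhds x. y \<in> W \<and> y - x \<in> polydisc (\<rho> / 4)"
      by (rule eventually_conj[OF eventually_nhds_in_open[OF W(1) x] eventually_polydisc[OF r]])
    then show "psat x f (recentred c (x - z))"
      unfolding psat_def
    proof (rule eventually_mono)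
      fix y assume y: "y \<in> W \<and> y - x \<in> polydisc (\<rho> / 4)"
      have "f y = infsum (\<lambda>m. c m * xpow m (y - z)) (multi_indices d)" using W(3) y by blast
      also have "y - z = (x - z) + (y - x)" by simp
      finally have fy: "f y = infsum (\<lambda>m. c m * xpow m ((x - z) + (y - x))) (multi_indices d)" .
      show "((\<lambda>m. recentred c (x - z) m * xpow m (y - x)) has_sum f y) (multi_indices d)"
        unfolding fy by (rule recentred_has_sum(1)[OF c xz]) (use y in blast)
    qed
  qed
  then have "\<forall>\<^sub>F x in nhds z. x - z \<in> polydisc (\<rho> / 4) \<and> psat x f (recentred c (x - z))"
    unfolding eventually_nhds using W(1,2) by blast
  then show ?thesis using that c by blast
qed

lemma low_multi_indices: "{m \<in> multi_indices d. mdeg d m < 2} = insert 0 ((\<lambda>i. Poly_Mapping.single i (1::nat)) ` {..<d})"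
proof (rule Set.set_eqI, rule iffI)
  fix m :: multi_index assume m: "m \<in> {m \<in> multi_indices d. mdeg d m < 2}"
  show "m \<in> insert 0 ((\<lambda>i. Poly_Mapping.single i (1::nat)) ` {..<d})"
  proof (cases "m = 0")
    case False
    have mM: "m \<in> multi_indices d" using m by blast
    obtain i where i: "i < d" "Poly_Mapping.lookup m i > 0" using multi_index_nonzero[OF mM False] by blast
    let ?k = "m - Poly_Mapping.single i (1::nat)"
    have eq: "?k + Poly_Mapping.single i (1::nat) = m" by (rule minus_single_add_single[OF i(2)])
    have "mdeg d m = mdeg d ?k + 1" using mdeg_add[of d ?k "Poly_Mapping.single i (1::nat)"] unfolding eq by (simp add: mdeg_single i(1))
    then have k0: "mdeg d ?k = 0" using m by simp
    have "?k = 0"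
    proof (rule ccontr)
      assume "?k \<noteq> 0"
      then obtain j where "j < d" "Poly_Mapping.lookup ?k j > 0" using multi_index_nonzero[OF multi_indices_diff[OF mM]] by blast
      then show False using lookup_le_mdeg[of j d ?k] k0 by simp
    qed
    then have "m = Poly_Mapping.single i (1::nat)" using eq by simp
    then show ?thesis using i(1) by blast
  qed simp
next
  fix m :: multi_index assume "m \<in> insert 0 ((\<lambda>i. Poly_Mapping.single i (1::nat)) ` {..<d})"
  then have "m = 0 \<or> (\<exists>i<d. m = Poly_Mapping.single i (1::nat))" by auto
  then consider "m = 0" | i where "m = Poly_Mapping.single i (1::nat)" "i < d" by blast
  then show "m \<in> {m \<in> multi_indices d. mdeg d m < 2}"
  proof cases
    case 1
    then show ?thesis by (simp add: multi_indices_0)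
  next
    case 2
    then show ?thesis using multi_indices_add_single[OF multi_indices_0 2(2), of 1] by (simp add: mdeg_single)
  qed
qed

text \<open>A term of degree at least two is bounded by \<open>B * (s / \<rho>) ^ mdeg d m\<close>,
  which is \<open>B * t ^ mdeg d m * (1 / 2) ^ mdeg d m\<close> for
  \<open>t = 2 * s / \<rho>\<close>. Since \<open>t \<le> 1\<close>, the power of \<open>t\<close>
  is at most \<open>t\<^sup>2\<close>, and the powers of one half are summable.\<close>

lemma psat_remainder:
  assumes c: "geom_bounded d \<rho> B c" and h: "h \<in> polydisc s" and s: "0 \<le> s" "2 * s \<le> \<rho>"
    and sum: "((\<lambda>m. c m * xpow m h) has_sum a) (multi_indices d)"
  shows "norm (a - (c 0 + (\<Sum>i<d. c (Poly_Mapping.single i 1) * X i h))) \<le> B * geom_total d * (2 * s / \<rho>)\<^sup>2"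
proof -
  let ?L = "{m \<in> multi_indices d. mdeg d m < 2}"
  have \<rho>: "\<rho> > 0" using c unfolding geom_bounded_def by blast
  have B: "B \<ge> 0" by (rule geom_bounded_nonneg[OF c])
  define t where "t = 2 * s / \<rho>"
  have t: "0 \<le> t" "t \<le> 1" using s \<rho> by (simp_all add: t_def)
  have inj: "inj_on (\<lambda>i. Poly_Mapping.single i (1::nat)) {..<d}"
  proof (rule inj_onI)
    fix i j :: nat assume "Poly_Mapping.single i (1::nat) = Poly_Mapping.single j 1"
    then have "Poly_Mapping.lookup (Poly_Mapping.single i (1::nat)) i = Poly_Mapping.lookup (Poly_Mapping.single j 1) i" by simp
    then show "i = j" by (simp add: lookup_single when_def split: if_splits)
  qed
  have not0: "(0::multi_index) \<notin> (\<lambda>i. Poly_Mapping.single i (1::nat)) ` {..<d}"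
  proof
    assume "(0::multi_index) \<in> (\<lambda>i. Poly_Mapping.single i (1::nat)) ` {..<d}"
    then obtain i where "(0::multi_index) = Poly_Mapping.single i (1::nat)" by (rule imageE)
    then have "Poly_Mapping.lookup (0::multi_index) i = Poly_Mapping.lookup (Poly_Mapping.single i (1::nat)) i" by simp
    then show False by simp
  qed
  have low: "(\<Sum>m\<in>?L. c m * xpow m h) = c 0 + (\<Sum>i<d. c (Poly_Mapping.single i 1) * X i h)"
  proof -
    have "(\<Sum>m\<in>?L. c m * xpow m h) = c 0 * xpow 0 h + (\<Sum>m\<in>(\<lambda>i. Poly_Mapping.single i 1) ` {..<d}. c m * xpow m h)"
      unfolding low_multi_indices by (rule sum.insert[OF _ not0]) simp
    also have "(\<Sum>m\<in>(\<lambda>i. Poly_Mapping.single i 1) ` {..<d}. c m * xpow m h) = (\<Sum>i<d. c (Poly_Mapping.single i 1) * X i h)"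
      unfolding sum.reindex[OF inj] by (intro sum.cong refl) (simp only: o_apply xpow_single lessThan_iff)
    finally show ?thesis by (simp add: xpow_zero)
  qed
  have finL: "finite ?L" unfolding low_multi_indices by simp
  have tail: "((\<lambda>m. c m * xpow m h) has_sum (a - (\<Sum>m\<in>?L. c m * xpow m h))) (multi_indices d - ?L)"
    by (rule has_sum_Diff[OF sum has_sum_finite[OF finL]]) blast
  have tbound: "norm (c m * xpow m h) \<le> B * t\<^sup>2 * (1 / 2) ^ mdeg d m" if m: "m \<in> multi_indices d - ?L" for m
  proof -
    have mM: "m \<in> multi_indices d" and m2: "2 \<le> mdeg d m" using m by auto
    have "norm (c m * xpow m h) \<le> (B / \<rho> ^ mdeg d m) * s ^ mdeg d m"
      unfolding norm_mult using B \<rho> s by (intro mult_mono geom_boundedD[OF c mM] norm_xpow_le[OF h]) simp_all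
    also have "\<dots> = B * (t * (1 / 2)) ^ mdeg d m" by (simp add: t_def power_divide)
    also have "\<dots> = B * (t ^ mdeg d m * (1 / 2) ^ mdeg d m)" by (simp only: power_mult_distrib)
    also have "\<dots> \<le> B * (t\<^sup>2 * (1 / 2) ^ mdeg d m)"
      using B t m2 by (intro mult_left_mono mult_right_mono power_decreasing) simp_all
    finally show ?thesis by (simp only: mult.assoc)
  qed
  have sub: "multi_indices d - ?L \<subseteq> multi_indices d" by blast
  have gs: "(\<lambda>m. B * t\<^sup>2 * (1 / 2) ^ mdeg d m) summable_on multi_indices d"
    by (rule summable_on_cmult_right[OF half_summable])
  have gs': "(\<lambda>m. B * t\<^sup>2 * (1 / 2) ^ mdeg d m) summable_on multi_indices d - ?L"
    by (rule summable_on_subset_banach[OF gs sub])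
  have ns: "(\<lambda>m. norm (c m * xpow m h)) summable_on multi_indices d - ?L"
    by (rule Infinite_Sum.abs_summable_on_comparison_test'[OF gs' tbound])
  have "norm (a - (\<Sum>m\<in>?L. c m * xpow m h)) = norm (infsum (\<lambda>m. c m * xpow m h) (multi_indices d - ?L))"
    unfolding infsumI[OF tail] ..
  also have "\<dots> \<le> infsum (\<lambda>m. norm (c m * xpow m h)) (multi_indices d - ?L)"
    by (rule norm_infsum_bound[OF ns])
  also have "\<dots> \<le> infsum (\<lambda>m. B * t\<^sup>2 * (1 / 2) ^ mdeg d m) (multi_indices d - ?L)"
    by (rule infsum_mono[OF ns gs' tbound])
  also have "\<dots> \<le> infsum (\<lambda>m. B * t\<^sup>2 * (1 / 2) ^ mdeg d m) (multi_indices d)"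
    by (rule infsum_mono2[OF gs' gs sub]) (use B in simp)
  also have "\<dots> = B * t\<^sup>2 * geom_total d"
    unfolding geom_total_def by (rule infsum_cmult_right[OF half_summable])
  finally show ?thesis unfolding low t_def by (simp only: mult_ac)
qed

lemma psat_at: "psat x f c \<Longrightarrow> f x = c 0"
proof -
  assume p: "psat x f c"
  obtain \<rho> B where c: "geom_bounded d \<rho> B c" using psat_bounded[OF p] by blast
  have \<rho>: "\<rho> > 0" using c unfolding geom_bounded_def by blast
  have "((\<lambda>m. c m * xpow m (x - x)) has_sum f x) (multi_indices d)"
    using p unfolding psat_def by (rule eventually_nhds_x_imp_x)
  then have hs: "((\<lambda>m. c m * xpow m 0) has_sum f x) (multi_indices d)" by simp
  have "0 \<in> polydisc 0" by (simp add: polydisc_def coord_zero)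
  from psat_remainder[OF c this _ _ hs] \<rho>
  have "norm (f x - (c 0 + (\<Sum>i<d. c (Poly_Mapping.single i 1) * X i 0))) \<le> 0" by simp
  then show ?thesis by (simp add: coord_zero)
qed

lemma psat_has_derivative:
  assumes p: "psat x f c"
  shows "(f has_derivative (\<lambda>h. \<Sum>i<d. c (Poly_Mapping.single i 1) * X i h)) (at x)"
proof -
  obtain \<rho> B where c: "geom_bounded d \<rho> B c" using psat_bounded[OF p] by blast
  have \<rho>: "\<rho> > 0" using c unfolding geom_bounded_def by blast
  have "\<exists>k. \<forall>i<d. (\<forall>h. \<bar>coord d e i h\<bar> \<le> k i * norm h) \<and> k i \<ge> 0"
  proof -
    have "\<exists>k. (\<forall>h. \<bar>coord d e i h\<bar> \<le> k * norm h) \<and> k \<ge> 0" if "i < d" for i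
      using bounded_linear.nonneg_bounded[OF bounded_linear_coord[OF that]] by (simp add: mult.commute) blast
    then show ?thesis by metis
  qed
  then obtain k where k: "\<And>i h. i < d \<Longrightarrow> \<bar>coord d e i h\<bar> \<le> k i * norm h" "\<And>i. i < d \<Longrightarrow> k i \<ge> 0" by blast
  define K where "K = (\<Sum>i<d. k i) + 1"
  have K: "K > 0" unfolding K_def using k(2) by (intro add_nonneg_pos sum_nonneg) simp_all
  have pd: "h \<in> polydisc (K * norm h)" for h
  proof -
    have "\<bar>coord d e i h\<bar> \<le> K * norm h" if "i < d" for i
    proof -
      have "k i \<le> (\<Sum>i<d. k i)" using that k(2) by (intro member_le_sum) simp_all
      then have "k i \<le> K" by (simp add: K_def)
      then have "k i * norm h \<le> K * norm h" by (rule mult_right_mono) simp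
      then show ?thesis using k(1)[OF that, of h] by linarith
    qed
    then show ?thesis unfolding polydisc_def by blast
  qed
  obtain \<delta> where \<delta>: "\<delta> > 0" "\<And>y. dist y x < \<delta> \<Longrightarrow> ((\<lambda>m. c m * xpow m (y - x)) has_sum f y) (multi_indices d)"
    using p unfolding psat_def eventually_nhds_metric by blast
  define C where "C = B * geom_total d * (2 * K / \<rho>)\<^sup>2"
  have bl: "bounded_linear (\<lambda>h. \<Sum>i<d. c (Poly_Mapping.single i 1) * X i h)"
    by (intro bounded_linear_sum bounded_linear_const_mult bounded_linear_compose[OF bounded_linear_of_real] bounded_linear_coord) simp
  show ?thesis
  proof (rule has_derivativeI_sandwich[where e = "min \<delta> (\<rho> / (2 * K))" and H = "\<lambda>y. C * norm (y - x)"])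
    show "0 < min \<delta> (\<rho> / (2 * K))" using \<delta>(1) \<rho> K by simp
    show "bounded_linear (\<lambda>h. \<Sum>i<d. c (Poly_Mapping.single i 1) * X i h)" by (rule bl)
    have "((\<lambda>y. C * norm (y - x)) \<longlongrightarrow> C * norm (x - x)) (at x)" by (intro tendsto_intros)
    then show "((\<lambda>y. C * norm (y - x)) \<longlongrightarrow> 0) (at x)" by simp
    fix y assume y: "y \<noteq> x" "dist y x < min \<delta> (\<rho> / (2 * K))"
    have n0: "norm (y - x) > 0" using y(1) by simp
    have "norm (y - x) < \<rho> / (2 * K)" using y(2) by (simp add: dist_norm)
    then have "norm (y - x) * (2 * K) < \<rho>" using K by (simp add: pos_less_divide_eq)
    then have small: "2 * (K * norm (y - x)) \<le> \<rho>" by (simp add: mult_ac)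
    have "dist y x < \<delta>" using y(2) by simp
    from psat_remainder[OF c pd _ small \<delta>(2)[OF this]] K
    have "norm (f y - (c 0 + (\<Sum>i<d. c (Poly_Mapping.single i 1) * X i (y - x)))) \<le> B * geom_total d * (2 * (K * norm (y - x)) / \<rho>)\<^sup>2" by simp
    also have "\<dots> = C * norm (y - x) * norm (y - x)" by (simp add: C_def power2_eq_square)
    finally have "norm ((f y - f x) - (\<Sum>i<d. c (Poly_Mapping.single i 1) * X i (y - x))) \<le> C * norm (y - x) * norm (y - x)"
      unfolding psat_at[OF p] by (simp only: diff_diff_eq)
    then show "norm ((f y - f x) - (\<Sum>i<d. c (Poly_Mapping.single i 1) * X i (y - x))) / norm (y - x) \<le> C * norm (y - x)"
      using n0 by (simp only: pos_divide_le_eq)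
  qed
qed

lemma multi_binomial_single:
  assumes "i < d"
  shows "multi_binomial d (Poly_Mapping.single i 1) k = Poly_Mapping.lookup k i + 1"
proof -
  have "multi_binomial d (Poly_Mapping.single i 1) k = (\<Prod>j<d. if j = i then Poly_Mapping.lookup k i + 1 else 1)"
    unfolding multi_binomial_def by (intro prod.cong refl) (simp add: lookup_single when_def)
  then show ?thesis using assms by simp
qed

text \<open>The derivative at a nearby \<open>y\<close> is the linear part of the series recentred
  at \<open>y\<close>. As a series in \<open>y - x\<close> its coefficients carry the binomial
  factor \<open>lookup k i + 1\<close>: this is termwise differentiation, and recentring supplies
  the convergence.\<close>

lemma psat_dir_deriv:
  assumes p: "psat x f c"
  shows "psat x (dir_deriv v f) (\<lambda>k. \<Sum>i<d. X i v * (of_nat (Poly_Mapping.lookup k i + 1) * c (k + Poly_Mapping.single i 1)))"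
proof -
  obtain \<rho> B where c: "geom_bounded d \<rho> B c"
    and ev: "\<forall>\<^sub>F y in nhds x. y - x \<in> polydisc (\<rho> / 4) \<and> psat y f (recentred c (y - x))"
    using psat_recentre[OF p] by blast
  show ?thesis unfolding psat_def
  proof (rule eventually_mono[OF ev])
    fix y assume y: "y - x \<in> polydisc (\<rho> / 4) \<and> psat y f (recentred c (y - x))"
    have dd: "dir_deriv v f y = (\<Sum>i<d. recentred c (y - x) (Poly_Mapping.single i 1) * X i v)"
      using y by (intro dir_deriv_has_derivative psat_has_derivative) blast
    have "((\<lambda>k. \<Sum>i<d. X i v * (of_nat (Poly_Mapping.lookup k i + 1) * c (k + Poly_Mapping.single i 1)) * xpow k (y - x))
      has_sum (\<Sum>i<d. recentred c (y - x) (Poly_Mapping.single i 1) * X i v)) (multi_indices d)"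
    proof (rule has_sum_finite_sum)
      fix i assume "i \<in> {..<d}"
      then have i: "i < d" by simp
      have iM: "Poly_Mapping.single i 1 \<in> multi_indices d"
        using multi_indices_add_single[OF multi_indices_0 i, of 1] by simp
      have "((\<lambda>k. c (Poly_Mapping.single i 1 + k) * of_nat (multi_binomial d (Poly_Mapping.single i 1) k) * xpow k (y - x))
        has_sum recentred c (y - x) (Poly_Mapping.single i 1)) (multi_indices d)"
        unfolding recentred_def
        by (rule has_sum_infsum[OF abs_summable_summable[OF recentred_summable(1)[OF c _ iM]]]) (use y in blast)
      from has_sum_cmult_left[OF this, of "X i v"]
      show "((\<lambda>k. X i v * (of_nat (Poly_Mapping.lookup k i + 1) * c (k + Poly_Mapping.single i 1)) * xpow k (y - x))
        has_sum recentred c (y - x) (Poly_Mapping.single i 1) * X i v) (multi_indices d)"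
        unfolding multi_binomial_single[OF i] by (simp only: mult_ac add.commute[of "Poly_Mapping.single i 1"])
    qed simp
    then show "((\<lambda>k. (\<Sum>i<d. X i v * (of_nat (Poly_Mapping.lookup k i + 1) * c (k + Poly_Mapping.single i 1))) * xpow k (y - x))
      has_sum dir_deriv v f y) (multi_indices d)"
      unfolding dd sum_distrib_right .
  qed
qed

text \<open>Analytic functions are differentiable and their directional derivatives are analytic, so
  they form a class to which coinduction applies.\<close>

lemma smooth_on_analytic:
  assumes U: "open U" and f: "\<forall>x\<in>U. \<exists>c. psat x f c"
  shows "smooth_on U f"
proof (rule smooth_on_coinduct[where P = "\<lambda>g. \<forall>x\<in>U. \<exists>c. psat x g c", OF f U])
  fix g x assume "\<forall>x\<in>U. \<exists>c. psat x g c" "x \<in> U"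
  then show "g differentiable (at x)" using psat_has_derivative unfolding differentiable_def by blast
next
  fix g v assume "\<forall>x\<in>U. \<exists>c. psat x g c"
  then have "\<forall>x\<in>U. \<exists>c. psat x (dir_deriv v g) c" using psat_dir_deriv by blast
  then show "\<exists>h. (\<forall>x\<in>U. \<exists>c. psat x h c) \<and> (\<forall>y\<in>U. h y = dir_deriv v g y)" by blast
qed

lemma psat_smooth:
  assumes "psat x f c"
  obtains U where "x \<in> U" "smooth_on U f" "\<forall>y\<in>U. \<exists>c. psat y f c"
proof -
  obtain \<rho> B where "\<forall>\<^sub>F y in nhds x. y - x \<in> polydisc (\<rho> / 4) \<and> psat y f (recentred c (y - x))"
    using psat_recentre[OF assms] by blast
  then obtain U where U: "open U" "x \<in> U" "\<forall>y\<in>U. y - x \<in> polydisc (\<rho> / 4) \<and> psat y f (recentred c (y - x))"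
    unfolding eventually_nhds by blast
  then have an: "\<forall>y\<in>U. \<exists>c. psat y f c" by blast
  show ?thesis by (rule that[OF U(2) smooth_on_analytic[OF U(1) an] an])
qed

text \<open>The factor \<open>q\<close> is the factorial of \<open>m\<close>. What matters is that
  it is nonzero and the same for all functions.\<close>

lemma mixed_deriv_psat:
  assumes "m \<in> multi_indices d"
  shows "\<exists>q\<noteq>0. \<forall>f c. psat 0 f c \<longrightarrow> mixed_deriv d e m f 0 = q * c m"
  using assms
proof (induction m rule: multi_index_induct)
  case zero
  have "\<forall>f c. psat 0 f c \<longrightarrow> mixed_deriv d e 0 f 0 = 1 * c 0" by (simp add: mixed_deriv_0 psat_at)
  then show ?case using zero_neq_one by metis
next
  case (add m i)
  then obtain q where q: "q \<noteq> 0" "\<And>f c. psat 0 f c \<Longrightarrow> mixed_deriv d e m f 0 = q * c m" by blast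
  have "mixed_deriv d e (m + Poly_Mapping.single i 1) f 0 = (q * of_nat (Poly_Mapping.lookup m i + 1)) * c (m + Poly_Mapping.single i 1)"
    if p: "psat 0 f c" for f c
  proof -
    obtain U where U: "0 \<in> U" "smooth_on U f" using psat_smooth[OF p] by blast
    have "mixed_deriv d e (m + Poly_Mapping.single i 1) f 0 = mixed_deriv d e m (dir_deriv (e i) f) 0"
      by (rule mixed_deriv_add_single[OF U(2,1) add.hyps(2)])
    also have "\<dots> = q * (\<Sum>j<d. X j (e i) * (of_nat (Poly_Mapping.lookup m j + 1) * c (m + Poly_Mapping.single j 1)))"
      by (rule q(2)[OF psat_dir_deriv[OF p]])
    also have "(\<Sum>j<d. X j (e i) * (of_nat (Poly_Mapping.lookup m j + 1) * c (m + Poly_Mapping.single j 1)))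
       = (\<Sum>j<d. if j = i then of_nat (Poly_Mapping.lookup m i + 1) * c (m + Poly_Mapping.single i 1) else 0)"
      by (intro sum.cong refl) (simp add: coord_basis add.hyps(2))
    also have "\<dots> = of_nat (Poly_Mapping.lookup m i + 1) * c (m + Poly_Mapping.single i 1)" using add.hyps(2) by simp
    finally show ?thesis by (simp only: mult.assoc)
  qed
  moreover have "q * of_nat (Poly_Mapping.lookup m i + 1) \<noteq> 0" using q(1) of_nat_neq_0 by simp
  ultimately show ?case by blast
qed

lemma psat_eq_zero:
  assumes p: "psat 0 f c" and z: "\<And>m. m \<in> multi_indices d \<Longrightarrow> mixed_deriv d e m f 0 = 0"
  shows "\<forall>\<^sub>F y in nhds 0. f y = 0"
proof -
  have c0: "c m = 0" if m: "m \<in> multi_indices d" for m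
    using mixed_deriv_psat[OF m] p z[OF m] by fastforce
  show ?thesis
  proof (rule eventually_mono[OF p[unfolded psat_def]])
    fix y assume "((\<lambda>m. c m * xpow m (y - 0)) has_sum f y) (multi_indices d)"
    moreover have "((\<lambda>m. c m * xpow m (y - 0)) has_sum 0) (multi_indices d)"
      by (rule has_sum_0) (simp add: c0)
    ultimately show "f y = 0" by (rule has_sum_unique)
  qed
qed

lemma psat_diff:
  assumes "psat x f c" "psat x g c'"
  shows "psat x (\<lambda>y. f y - g y) (\<lambda>m. c m - c' m)"
  unfolding psat_def
proof (rule eventually_mono[OF eventually_conj[OF assms[unfolded psat_def]]])
  fix y assume "((\<lambda>m. c m * xpow m (y - x)) has_sum f y) (multi_indices d) \<and> ((\<lambda>m. c' m * xpow m (y - x)) has_sum g y) (multi_indices d)"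
  then have 1: "((\<lambda>m. c m * xpow m (y - x)) has_sum f y) (multi_indices d)"
    and 2: "((\<lambda>m. c' m * xpow m (y - x)) has_sum g y) (multi_indices d)" by blast+
  have "((\<lambda>m. c m * xpow m (y - x) + (- 1) * (c' m * xpow m (y - x))) has_sum (f y + (- 1) * g y)) (multi_indices d)"
    by (rule has_sum_add[OF 1 has_sum_cmult_right[OF 2]])
  then show "((\<lambda>m. (c m - c' m) * xpow m (y - x)) has_sum (f y - g y)) (multi_indices d)"
    by (simp add: left_diff_distrib)
qed

lemma psat_const: "psat x (\<lambda>y. 0) (\<lambda>m. 0)"
  unfolding psat_def by (simp add: has_sum_0)

end

section \<open>Germs of differential operators\<close>

context finite_basis
begin

section \<open>Monomials as test functions, and jets at the origin\<close>

lemma smooth_on_xpow: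
  assumes "m \<in> multi_indices d"
  shows "smooth_on UNIV (xpow m)"
  using assms
proof (induction m rule: multi_index_induct)
  case zero
  have "xpow 0 = (\<lambda>x. 1)" by (rule ext) (rule xpow_zero)
  then show ?case by (simp add: smooth_on_const)
next
  case (add m i)
  have "xpow (m + Poly_Mapping.single i 1) = (\<lambda>x. xpow m x * X i x)"
    by (rule ext) (simp only: xpow_add xpow_single[OF add.hyps(2)])
  then show ?case using smooth_on_mult[OF add.IH smooth_on_X[OF add.hyps(2) open_UNIV]] by simp
qed

lemma mixed_deriv_const:
  assumes "m \<in> multi_indices d" "m \<noteq> 0"
  shows "mixed_deriv d e m (\<lambda>y. c) x = 0"
proof -
  obtain i where i: "i < d" "Poly_Mapping.lookup m i > 0" by (rule multi_index_nonzero[OF assms])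
  let ?k = "m - Poly_Mapping.single i (1::nat)"
  have k: "?k \<in> multi_indices d" by (rule multi_indices_diff[OF assms(1)])
  have "mixed_deriv d e m (\<lambda>y. c) x = mixed_deriv d e (?k + Poly_Mapping.single i 1) (\<lambda>y. c) x"
    unfolding minus_single_add_single[OF i(2)] ..
  also have "\<dots> = mixed_deriv d e ?k (dir_deriv (e i) (\<lambda>y. c)) x"
    by (rule mixed_deriv_add_single[OF smooth_on_const[OF open_UNIV] UNIV_I i(1)])
  also have "dir_deriv (e i) (\<lambda>y. c) = (\<lambda>y::'g. 0 * (1::complex))" by (rule ext) simp
  also have "mixed_deriv d e ?k (\<lambda>y::'g. 0 * (1::complex)) x = 0 * mixed_deriv d e ?k (\<lambda>y. 1) x"
    by (rule mixed_deriv_cmult[OF k smooth_on_const[OF open_UNIV] UNIV_I])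
  finally show ?thesis by simp
qed

text \<open>Of the derivatives of the same or higher degree only the one with index \<open>m\<close>
  does not kill \<open>xpow m\<close>, and it gives a constant. An operator without terms of lower
  degree thus reveals its coefficient at \<open>m\<close>.\<close>

lemma mixed_deriv_xpow:
  assumes "m \<in> multi_indices d"
  shows "(\<forall>m'\<in>multi_indices d. mdeg d m \<le> mdeg d m' \<longrightarrow> m' \<noteq> m \<longrightarrow> (\<forall>x. mixed_deriv d e m' (xpow m) x = 0))
    \<and> (\<exists>q. q \<noteq> 0 \<and> (\<forall>x. mixed_deriv d e m (xpow m) x = q))"
  using assms
proof (induction m rule: multi_index_induct)
  case zero
  have x0: "xpow 0 = (\<lambda>x. 1)" by (rule ext) (rule xpow_zero)
  have "\<forall>m'\<in>multi_indices d. mdeg d 0 \<le> mdeg d m' \<longrightarrow> m' \<noteq> 0 \<longrightarrow> (\<forall>x. mixed_deriv d e m' (xpow 0) x = 0)"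
    unfolding x0 using mixed_deriv_const by blast
  moreover have "(1::complex) \<noteq> 0 \<and> (\<forall>x. mixed_deriv d e 0 (xpow 0) x = 1)" by (simp add: x0 mixed_deriv_0)
  ultimately show ?case by blast
next
  case (add m i)
  let ?s = "Poly_Mapping.single i (1::nat)"
  have i: "i < d" by (rule add.hyps(2))
  from add.IH obtain q where
    A: "\<And>m' x. m' \<in> multi_indices d \<Longrightarrow> mdeg d m \<le> mdeg d m' \<Longrightarrow> m' \<noteq> m \<Longrightarrow> mixed_deriv d e m' (xpow m) x = 0"
    and q: "q \<noteq> 0" "\<And>x. mixed_deriv d e m (xpow m) x = q" by blast
  have xp: "xpow (m + ?s) = (\<lambda>x. X i x * xpow m x)"
    by (rule ext) (simp only: xpow_add xpow_single[OF i] mult.commute)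
  have step: "mixed_deriv d e m' (xpow (m + ?s)) x = X i x * mixed_deriv d e m' (xpow m) x
      + of_nat (Poly_Mapping.lookup m' i) * mixed_deriv d e (m' - ?s) (xpow m) x"
    if "m' \<in> multi_indices d" for m' x
    unfolding xp by (rule mixed_deriv_X_mult[OF that i smooth_on_xpow[OF add.hyps(1)] UNIV_I])
  have deg: "mdeg d (m + ?s) = mdeg d m + 1" by (simp add: mdeg_add mdeg_single[OF i])
  have 1: "mixed_deriv d e m' (xpow (m + ?s)) x = 0"
    if m': "m' \<in> multi_indices d" "mdeg d (m + ?s) \<le> mdeg d m'" "m' \<noteq> m + ?s" for m' x
  proof -
    have "m' \<noteq> m" using m'(2) deg by auto
    then have z: "mixed_deriv d e m' (xpow m) x = 0" using m'(2) deg by (intro A m'(1)) simp_all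
    show ?thesis
    proof (cases "Poly_Mapping.lookup m' i = 0")
      case True
      then show ?thesis unfolding step[OF m'(1)] z by simp
    next
      case False
      then have eq: "m' - ?s + ?s = m'" by (intro minus_single_add_single) simp
      have d': "mdeg d m' = mdeg d (m' - ?s) + 1" using mdeg_add[of d "m' - ?s" ?s] unfolding eq by (simp add: mdeg_single[OF i])
      have "mixed_deriv d e (m' - ?s) (xpow m) x = 0"
      proof (rule A[OF multi_indices_diff[OF m'(1)]])
        show "mdeg d m \<le> mdeg d (m' - ?s)" using m'(2) deg d' by simp
        show "m' - ?s \<noteq> m" using eq m'(3) by metis
      qed
      then show ?thesis unfolding step[OF m'(1)] z by simp
    qed
  qed
  have sM: "m + ?s \<in> multi_indices d" by (rule multi_indices_add_single[OF add.hyps(1) i])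
  have ne: "m + ?s \<noteq> m" using deg by force
  have "mixed_deriv d e (m + ?s) (xpow m) x = 0" for x by (rule A[OF sM _ ne]) (unfold deg, simp)
  then have 2: "mixed_deriv d e (m + ?s) (xpow (m + ?s)) x = of_nat (Poly_Mapping.lookup m i + 1) * q" for x
    unfolding step[OF sM] by (simp add: q(2) lookup_add)
  have "of_nat (Poly_Mapping.lookup m i + 1) * q \<noteq> 0" using q(1) of_nat_neq_0 by simp
  then show ?case using 1 2 by blast
qed

text \<open>By Leibniz's rule every resulting term contains a derivative of \<open>h\<close> at 0 of
  degree at most that of \<open>m\<close>.\<close>

lemma mixed_deriv_mult_flat:
  assumes "m \<in> multi_indices d" "smooth_on U h" "smooth_on U g" "0 \<in> U"
    "\<And>k. k \<in> multi_indices d \<Longrightarrow> mdeg d k \<le> mdeg d m \<Longrightarrow> mixed_deriv d e k h 0 = 0"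
  shows "mixed_deriv d e m (\<lambda>y. h y * g y) 0 = 0"
  using assms(1-3,5)
proof (induction m arbitrary: h g rule: multi_index_induct)
  case zero
  have "mixed_deriv d e 0 h 0 = 0" by (rule zero.prems(3)[OF multi_indices_0]) simp
  then show ?case by (simp add: mixed_deriv_0)
next
  case (add m i)
  note i = add.hyps(2) and h = add.prems(1) and g = add.prems(2)
  let ?s = "Poly_Mapping.single i (1::nat)"
  have U: "open U" by (rule smooth_on_open[OF h])
  have "mixed_deriv d e (m + ?s) (\<lambda>y. h y * g y) 0 = mixed_deriv d e m (dir_deriv (e i) (\<lambda>y. h y * g y)) 0"
    by (rule mixed_deriv_add_single[OF smooth_on_mult[OF h g] assms(4) i])
  also have "\<dots> = mixed_deriv d e m (\<lambda>y. h y * dir_deriv (e i) g y + dir_deriv (e i) h y * g y) 0"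
    by (rule mixed_deriv_cong[OF U _ assms(4)]) (intro dir_deriv_mult smooth_on_differentiable[OF h] smooth_on_differentiable[OF g])
  also have "\<dots> = mixed_deriv d e m (\<lambda>y. h y * dir_deriv (e i) g y) 0 + mixed_deriv d e m (\<lambda>y. dir_deriv (e i) h y * g y) 0"
    by (rule mixed_deriv_plus[OF add.hyps(1) smooth_on_mult[OF h smooth_on_dir_deriv[OF g]] smooth_on_mult[OF smooth_on_dir_deriv[OF h] g] assms(4)])
  also have "mixed_deriv d e m (\<lambda>y. h y * dir_deriv (e i) g y) 0 = 0"
    by (rule add.IH[OF h smooth_on_dir_deriv[OF g]]) (rule add.prems(3), simp_all add: mdeg_add)
  also have "mixed_deriv d e m (\<lambda>y. dir_deriv (e i) h y * g y) 0 = 0"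
  proof (rule add.IH[OF smooth_on_dir_deriv[OF h] g])
    fix k assume k: "k \<in> multi_indices d" "mdeg d k \<le> mdeg d m"
    have "mixed_deriv d e k (dir_deriv (e i) h) 0 = mixed_deriv d e (k + ?s) h 0"
      by (rule mixed_deriv_add_single[OF h assms(4) i, symmetric])
    also have "\<dots> = 0"
      by (rule add.prems(3)[OF multi_indices_add_single[OF k(1) i]]) (use k(2) in \<open>simp add: mdeg_add mdeg_single[OF i]\<close>)
    finally show "mixed_deriv d e k (dir_deriv (e i) h) 0 = 0" .
  qed
  finally show ?case by simp
qed

text \<open>A distribution of order at most \<open>R\<close> sees only derivatives up to order
  \<open>R\<close> at the origin. This permits replacing an analytic coefficient by its Taylor
  polynomial.\<close>

lemma pairing_equal_jets:
  assumes r: "r \<in> Sym d" "\<And>m. m \<in> Poly_Mapping.keys r \<Longrightarrow> mdeg d m \<le> R"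
    and a: "smooth_on U a" and b: "smooth_on U b" and g: "smooth_on U g" and U: "0 \<in> U"
    and jets: "\<And>k. k \<in> multi_indices d \<Longrightarrow> mdeg d k \<le> R \<Longrightarrow> mixed_deriv d e k a 0 = mixed_deriv d e k b 0"
  shows "pairing r (\<lambda>y. a y * g y) = pairing r (\<lambda>y. b y * g y)"
proof -
  have oU: "open U" by (rule smooth_on_open[OF a])
  define h where "h = (\<lambda>y. a y + (- 1) * b y)"
  have nb: "smooth_on U (\<lambda>y. (- 1) * b y)" by (rule smooth_on_mult[OF smooth_on_const[OF oU] b])
  have h: "smooth_on U h" unfolding h_def by (rule smooth_on_add[OF a nb])
  have hk: "mixed_deriv d e k h 0 = 0" if k: "k \<in> multi_indices d" "mdeg d k \<le> R" for k
  proof -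
    have "mixed_deriv d e k h 0 = mixed_deriv d e k a 0 + (- 1) * mixed_deriv d e k b 0"
      unfolding h_def mixed_deriv_plus[OF k(1) a nb U] mixed_deriv_cmult[OF k(1) b U] ..
    then show ?thesis using jets[OF k] by simp
  qed
  have "mixed_deriv d e m (\<lambda>y. a y * g y) 0 = mixed_deriv d e m (\<lambda>y. b y * g y) 0"
    if m: "m \<in> Poly_Mapping.keys r" for m
  proof -
    have mM: "m \<in> multi_indices d" using r(1) m unfolding Sym_def by blast
    have "(\<lambda>y. a y * g y) = (\<lambda>y. b y * g y + h y * g y)" by (rule ext) (simp add: h_def algebra_simps)
    then have "mixed_deriv d e m (\<lambda>y. a y * g y) 0 = mixed_deriv d e m (\<lambda>y. b y * g y) 0 + mixed_deriv d e m (\<lambda>y. h y * g y) 0"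
      using mixed_deriv_plus[OF mM smooth_on_mult[OF b g] smooth_on_mult[OF h g] U] by simp
    also have "mixed_deriv d e m (\<lambda>y. h y * g y) 0 = 0"
      by (rule mixed_deriv_mult_flat[OF mM h g U]) (rule hk, assumption, use r(2)[OF m] in linarith)
    finally show ?thesis by simp
  qed
  then show ?thesis unfolding pairing_def by (intro sum.cong refl) simp
qed

section \<open>Representatives of germs and their action on distributions\<close>

lemma local_diffopE:
  assumes "P \<in> local_diffops d e"
  obtains U M a where "open U" "0 \<in> U" "finite M" "M \<subseteq> multi_indices d"
    "\<And>m x. m \<in> M \<Longrightarrow> x \<in> U \<Longrightarrow> \<exists>c. psat x (a m) c"
    "\<And>x f. x \<in> U \<Longrightarrow> smooth_near x f \<Longrightarrow> P f x = (\<Sum>m\<in>M. a m x * mixed_deriv d e m f x)"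
proof -
  obtain U where U: "open U" "0 \<in> U" "analytic_diffop_on d e U P"
    using assms unfolding local_diffops_def by blast
  obtain M a where M: "finite M" "M \<subseteq> multi_indices d" "\<forall>m\<in>M. real_analytic_on d e U (a m)"
    "\<forall>x\<in>U. \<forall>f. smooth_near x f \<longrightarrow> P f x = (\<Sum>m\<in>M. a m x * mixed_deriv d e m f x)"
    using U(3) unfolding analytic_diffop_on_def by blast
  show ?thesis
    by (rule that[OF U(1,2) M(1,2)]) (use M(3,4) in \<open>simp_all add: real_analytic_on_iff\<close>)
qed

text \<open>For a distribution to be applied to \<open>P f\<close>, this function must again be
  smooth near 0; it is, because analytic coefficients are smooth.\<close>

lemma local_diffop_smooth:
  assumes P: "P \<in> local_diffops d e" and f: "smooth_near 0 f"
  obtains U where "0 \<in> U" "smooth_on U f" "smooth_on U (P f)"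
proof -
  obtain V M a where V: "open V" "0 \<in> V" and M: "finite M" "M \<subseteq> multi_indices d"
    and a: "\<And>m x. m \<in> M \<Longrightarrow> x \<in> V \<Longrightarrow> \<exists>c. psat x (a m) c"
    and Pf: "\<And>x f. x \<in> V \<Longrightarrow> smooth_near x f \<Longrightarrow> P f x = (\<Sum>m\<in>M. a m x * mixed_deriv d e m f x)"
    using local_diffopE[OF P] by blast
  obtain W where W: "0 \<in> W" "smooth_on W f" using f unfolding smooth_near_iff by blast
  have o: "open (V \<inter> W)" using V(1) smooth_on_open[OF W(2)] by blast
  have fU: "smooth_on (V \<inter> W) f" by (rule smooth_on_subset[OF W(2) o]) blast
  have aU: "smooth_on (V \<inter> W) (a m)" if "m \<in> M" for m
    by (rule smooth_on_subset[OF smooth_on_analytic[OF V(1)] o]) (use a[OF that] in blast)+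
  have "smooth_on (V \<inter> W) (\<lambda>x. \<Sum>m\<in>M. a m x * mixed_deriv d e m f x)"
    by (intro smooth_on_sum[OF o] smooth_on_mult aU smooth_on_mixed_deriv fU)
  then have "smooth_on (V \<inter> W) (P f)"
  proof (rule smooth_on_cong)
    fix y assume "y \<in> V \<inter> W"
    then have "y \<in> V" "smooth_near y f" using W(2) unfolding smooth_near_iff by blast+
    then show "(\<Sum>m\<in>M. a m y * mixed_deriv d e m f y) = P f y" by (rule Pf[symmetric])
  qed
  then show ?thesis using that V(2) W(1) fU by blast
qed

lemma diffop_germ_rel_iff:
  "(P, Q) \<in> diffop_germ_rel d e \<longleftrightarrow> P \<in> local_diffops d e \<and> Q \<in> local_diffops d e
     \<and> (\<forall>\<^sub>F x in nhds 0. \<forall>f. smooth_near x f \<longrightarrow> P f x = Q f x)"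
  unfolding diffop_germ_rel_def by simp

lemma diffop_germ_class_eq:
  assumes "(P, Q) \<in> diffop_germ_rel d e"
  shows "diffop_germ_rel d e `` {P} = diffop_germ_rel d e `` {Q}"
proof -
  have PQ: "\<forall>\<^sub>F x in nhds 0. \<forall>f. smooth_near x f \<longrightarrow> P f x = Q f x"
    and L: "P \<in> local_diffops d e" "Q \<in> local_diffops d e"
    using assms unfolding diffop_germ_rel_iff by blast+
  have "(\<forall>\<^sub>F x in nhds 0. \<forall>f. smooth_near x f \<longrightarrow> P f x = T f x)
      \<longleftrightarrow> (\<forall>\<^sub>F x in nhds 0. \<forall>f. smooth_near x f \<longrightarrow> Q f x = T f x)" for T
    by (rule eventually_cong[OF PQ]) auto
  then show ?thesis using L by (auto simp: diffop_germ_rel_iff)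
qed

text \<open>The representative chosen in \<open>right_act\<close> agrees with \<open>P\<close> on
  \<open>f\<close> throughout a neighbourhood of 0, and the pairing depends only on the values
  there.\<close>

lemma right_act_class:
  assumes P: "P \<in> local_diffops d e" and f: "smooth_near 0 f"
  shows "right_act (distribution_of d e r) (diffop_germ_rel d e `` {P}) f = pairing r (P f)"
proof -
  define Q where "Q = (SOME Q. Q \<in> diffop_germ_rel d e `` {P})"
  have "P \<in> diffop_germ_rel d e `` {P}" using P by (simp add: diffop_germ_rel_iff)
  then have "Q \<in> diffop_germ_rel d e `` {P}" unfolding Q_def
    by (rule someI[where P = "\<lambda>Q. Q \<in> diffop_germ_rel d e `` {P}"])
  then have Q: "Q \<in> local_diffops d e" "\<forall>\<^sub>F x in nhds 0. \<forall>f. smooth_near x f \<longrightarrow> P f x = Q f x"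
    by (simp_all add: diffop_germ_rel_iff)
  obtain U where U: "0 \<in> U" "smooth_on U f" "smooth_on U (Q f)" by (rule local_diffop_smooth[OF Q(1) f])
  obtain W where W: "open W" "0 \<in> W" "\<And>x f. x \<in> W \<Longrightarrow> smooth_near x f \<Longrightarrow> P f x = Q f x"
    using Q(2) unfolding eventually_nhds by blast
  have "pairing r (Q f) = pairing r (P f)"
  proof (rule pairing_cong[of "U \<inter> W"])
    show "open (U \<inter> W)" using W(1) smooth_on_open[OF U(2)] by blast
    show "0 \<in> U \<inter> W" using U(1) W(2) by blast
    fix y assume y: "y \<in> U \<inter> W"
    then have "smooth_near y f" using U(2) unfolding smooth_near_iff by blast
    then show "Q f y = P f y" using W(3) y by simp
  qed
  moreover have "smooth_near 0 (Q f)" using U(1,3) unfolding smooth_near_iff by blast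
  ultimately show ?thesis unfolding right_act_def distribution_of_eq Q_def[symmetric] using f by simp
qed

lemma psat_cmult:
  assumes "psat x f c"
  shows "psat x (\<lambda>y. f y * q) (\<lambda>m. c m * q)"
  unfolding psat_def
proof (rule eventually_mono[OF assms[unfolded psat_def]])
  fix y assume "((\<lambda>m. c m * xpow m (y - x)) has_sum f y) (multi_indices d)"
  from has_sum_cmult_left[OF this, of q]
  show "((\<lambda>m. c m * q * xpow m (y - x)) has_sum f y * q) (multi_indices d)" by (simp only: mult_ac)
qed

lemma diffop_germ_determined:
  assumes P: "P \<in> local_diffops d e" and Q: "Q \<in> local_diffops d e"
    and eq: "\<And>r f. r \<in> Sym d \<Longrightarrow> smooth_near 0 f \<Longrightarrow> pairing r (P f) = pairing r (Q f)"
  shows "(P, Q) \<in> diffop_germ_rel d e"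
proof -
  obtain U M a where U: "open U" "0 \<in> U" and M: "finite M" "M \<subseteq> multi_indices d"
    and a: "\<And>m x. m \<in> M \<Longrightarrow> x \<in> U \<Longrightarrow> \<exists>c. psat x (a m) c"
    and Pf: "\<And>x f. x \<in> U \<Longrightarrow> smooth_near x f \<Longrightarrow> P f x = (\<Sum>m\<in>M. a m x * mixed_deriv d e m f x)"
    using local_diffopE[OF P] by blast
  obtain V N b where V: "open V" "0 \<in> V" and N: "finite N" "N \<subseteq> multi_indices d"
    and b: "\<And>m x. m \<in> N \<Longrightarrow> x \<in> V \<Longrightarrow> \<exists>c. psat x (b m) c"
    and Qf: "\<And>x f. x \<in> V \<Longrightarrow> smooth_near x f \<Longrightarrow> Q f x = (\<Sum>m\<in>N. b m x * mixed_deriv d e m f x)"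
    using local_diffopE[OF Q] by blast
  \<comment> \<open>Extension by zero puts the coefficients of both operators over one common set of
    indices.\<close>
  define a' where "a' = (\<lambda>m x. if m \<in> M then a m x else 0)"
  define b' where "b' = (\<lambda>m x. if m \<in> N then b m x else 0)"
  define h where "h = (\<lambda>m x. a' m x - b' m x)"
  have hp: "\<exists>c. psat 0 (h m) c" for m
  proof -
    have "\<exists>c. psat 0 (a' m) c" using a[OF _ U(2)] psat_const[of 0] by (cases "m \<in> M") (auto simp: a'_def)
    moreover have "\<exists>c. psat 0 (b' m) c" using b[OF _ V(2)] psat_const[of 0] by (cases "m \<in> N") (auto simp: b'_def)
    ultimately show ?thesis unfolding h_def using psat_diff by blast
  qed
  let ?K = "M \<union> N"
  have K: "finite ?K" "?K \<subseteq> multi_indices d" using M N by blast+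
  have diff: "P f x - Q f x = (\<Sum>m\<in>?K. h m x * mixed_deriv d e m f x)"
    if x: "x \<in> U" "x \<in> V" and f: "smooth_near x f" for f x
  proof -
    have "P f x = (\<Sum>m\<in>?K. a' m x * mixed_deriv d e m f x)"
      unfolding Pf[OF x(1) f] by (rule sum.mono_neutral_cong_left[OF K(1)]) (auto simp: a'_def)
    moreover have "Q f x = (\<Sum>m\<in>?K. b' m x * mixed_deriv d e m f x)"
      unfolding Qf[OF x(2) f] by (rule sum.mono_neutral_cong_left[OF K(1)]) (auto simp: b'_def)
    ultimately show ?thesis by (simp only: h_def left_diff_distrib sum_subtractf)
  qed
  have UV: "\<forall>\<^sub>F x in nhds 0. x \<in> U \<and> x \<in> V"
    by (rule eventually_conj[OF eventually_nhds_in_open[OF U] eventually_nhds_in_open[OF V]])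
  have key: "\<forall>\<^sub>F x in nhds 0. h m x = 0" if "m \<in> ?K" for m
    using that
  proof (induction "mdeg d m" arbitrary: m rule: less_induct)
    case less
    have mM: "m \<in> multi_indices d" using less.prems K(2) by blast
    obtain q where
      A: "\<And>m' x. m' \<in> multi_indices d \<Longrightarrow> mdeg d m \<le> mdeg d m' \<Longrightarrow> m' \<noteq> m \<Longrightarrow> mixed_deriv d e m' (xpow m) x = 0"
      and q: "q \<noteq> 0" "\<And>x. mixed_deriv d e m (xpow m) x = q" using mixed_deriv_xpow[OF mM] by blast
    have sm: "smooth_near x (xpow m)" for x using smooth_on_xpow[OF mM] unfolding smooth_near_iff by blast
    have "\<forall>\<^sub>F x in nhds 0. \<forall>k\<in>{k \<in> ?K. mdeg d k < mdeg d m}. h k x = 0"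
      by (rule eventually_ball_finite) (use K(1) less.hyps in auto)
    then have ev: "\<forall>\<^sub>F x in nhds 0. h m x * q = P (xpow m) x + (- 1) * Q (xpow m) x"
      using UV
    proof eventually_elim
      case (elim x)
      have "P (xpow m) x - Q (xpow m) x = (\<Sum>k\<in>?K. h k x * mixed_deriv d e k (xpow m) x)"
        using elim(2) sm by (intro diff) blast+
      also have "\<dots> = (\<Sum>k\<in>?K. if k = m then h m x * q else 0)"
      proof (rule sum.cong[OF refl])
        fix k assume k: "k \<in> ?K"
        show "h k x * mixed_deriv d e k (xpow m) x = (if k = m then h m x * q else 0)"
        proof (cases "k = m")
          case False
          have "h k x = 0 \<or> mixed_deriv d e k (xpow m) x = 0"
          proof (cases "mdeg d k < mdeg d m")
            case True
            then show ?thesis using elim(1) k by blast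
          next
            case nl: False
            have kM: "k \<in> multi_indices d" using k K(2) by blast
            from nl have "mdeg d m \<le> mdeg d k" by simp
            from A[OF kM this False] show ?thesis by blast
          qed
          then show ?thesis using False by auto
        qed (simp add: q(2))
      qed
      also have "\<dots> = h m x * q" using K(1) less.prems by simp
      finally show ?case by simp
    qed
    obtain U1 where U1: "0 \<in> U1" "smooth_on U1 (P (xpow m))" using local_diffop_smooth[OF P sm] by blast
    obtain U2 where U2: "0 \<in> U2" "smooth_on U2 (Q (xpow m))" using local_diffop_smooth[OF Q sm] by blast
    obtain W where W: "open W" "0 \<in> W" "\<And>x. x \<in> W \<Longrightarrow> h m x * q = P (xpow m) x + (- 1) * Q (xpow m) x"
      using ev unfolding eventually_nhds by blast
    let ?W = "U1 \<inter> U2 \<inter> W"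
    have oW: "open ?W" and W0: "0 \<in> ?W"
      using W(1,2) U1(1) U2(1) smooth_on_open[OF U1(2)] smooth_on_open[OF U2(2)] by blast+
    have PW: "smooth_on ?W (P (xpow m))" by (rule smooth_on_subset[OF U1(2) oW]) blast
    have QW: "smooth_on ?W (Q (xpow m))" by (rule smooth_on_subset[OF U2(2) oW]) blast
    obtain c where c: "psat 0 (h m) c" using hp by blast
    have "\<forall>\<^sub>F y in nhds 0. h m y * q = 0"
    proof (rule psat_eq_zero[OF psat_cmult[OF c]])
      fix k assume k: "k \<in> multi_indices d"
      \<comment> \<open>The derivative of index \<open>k\<close> at 0 is the pairing with the
        monomial of index \<open>k\<close>, and there both operators agree by assumption.\<close>
      have "Poly_Mapping.single k (1::complex) \<in> Sym d" using k by (simp add: Sym_def)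
      from eq[OF this sm] have e1: "mixed_deriv d e k (P (xpow m)) 0 = mixed_deriv d e k (Q (xpow m)) 0"
        by (simp add: pairing_single)
      have "mixed_deriv d e k (\<lambda>y. h m y * q) 0 = mixed_deriv d e k (\<lambda>y. P (xpow m) y + (- 1) * Q (xpow m) y) 0"
        by (rule mixed_deriv_cong[OF oW _ W0]) (use W(3) in blast)
      also have "\<dots> = mixed_deriv d e k (P (xpow m)) 0 + mixed_deriv d e k (\<lambda>y. (- 1) * Q (xpow m) y) 0"
        by (rule mixed_deriv_plus[OF k PW smooth_on_mult[OF smooth_on_const[OF oW] QW] W0])
      also have "mixed_deriv d e k (\<lambda>y. (- 1) * Q (xpow m) y) 0 = (- 1) * mixed_deriv d e k (Q (xpow m)) 0"
        by (rule mixed_deriv_cmult[OF k QW W0])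
      finally show "mixed_deriv d e k (\<lambda>y. h m y * q) 0 = 0" by (simp add: e1)
    qed
    then show ?case by (rule eventually_mono) (use q(1) in simp)
  qed
  have "\<forall>\<^sub>F x in nhds 0. \<forall>m\<in>?K. h m x = 0" by (rule eventually_ball_finite[OF K(1)]) (use key in blast)
  then have "\<forall>\<^sub>F x in nhds 0. \<forall>f. smooth_near x f \<longrightarrow> P f x = Q f x"
    using UV
  proof eventually_elim
    case (elim x)
    show ?case
    proof (intro allI impI)
      fix f assume "smooth_near x f"
      with elim(2) have "P f x - Q f x = (\<Sum>m\<in>?K. h m x * mixed_deriv d e m f x)" by (intro diff) blast+
      also have "\<dots> = 0" using elim(1) by (intro sum.neutral) auto
      finally show "P f x = Q f x" by simp
    qed
  qed
  then show ?thesis using P Q by (simp add: diffop_germ_rel_iff)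
qed

end

section \<open>The terms of the star product\<close>

text \<open>A submultiplicative norm that dominates every single coefficient and grows under
  differentiation only by the degree.\<close>

definition l1 :: "cpoly \<Rightarrow> real" where
  "l1 f = (\<Sum>m\<in>Poly_Mapping.keys f. norm (Poly_Mapping.lookup f m))"

lemma l1_superset: "finite K \<Longrightarrow> Poly_Mapping.keys f \<subseteq> K \<Longrightarrow> l1 f = (\<Sum>m\<in>K. norm (Poly_Mapping.lookup f m))"
  unfolding l1_def by (rule sum.mono_neutral_left) (auto simp: in_keys_iff)

lemma l1_nonneg: "l1 f \<ge> 0"
  by (simp add: l1_def sum_nonneg)

lemma norm_lookup_le_l1: "norm (Poly_Mapping.lookup f m) \<le> l1 f"
proof (cases "m \<in> Poly_Mapping.keys f")
  case True
  then show ?thesis unfolding l1_def by (intro member_le_sum[where f = "\<lambda>m. norm (Poly_Mapping.lookup f m)"]) simp_all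
next
  case False
  then show ?thesis by (simp add: in_keys_iff l1_nonneg)
qed

lemma l1_add: "l1 (f + g) \<le> l1 f + l1 g"
proof -
  let ?K = "Poly_Mapping.keys f \<union> Poly_Mapping.keys g"
  have fin: "finite ?K" by simp
  have "l1 (f + g) = (\<Sum>m\<in>?K. norm (Poly_Mapping.lookup f m + Poly_Mapping.lookup g m))"
    unfolding lookup_add[symmetric] by (rule l1_superset[OF fin keys_add])
  also have "\<dots> \<le> (\<Sum>m\<in>?K. norm (Poly_Mapping.lookup f m) + norm (Poly_Mapping.lookup g m))"
    by (intro sum_mono norm_triangle_ineq)
  also have "\<dots> = l1 f + l1 g"
    unfolding sum.distrib by (intro arg_cong2[where f = "(+)"] l1_superset[OF fin, symmetric]) blast+
  finally show ?thesis .
qed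

lemma l1_sum: "l1 (\<Sum>i\<in>I. f i) \<le> (\<Sum>i\<in>I. l1 (f i))"
proof (induction I rule: infinite_finite_induct)
  case (insert i I)
  have "l1 (f i + (\<Sum>i\<in>I. f i)) \<le> l1 (f i) + (\<Sum>i\<in>I. l1 (f i))"
    using l1_add[of "f i" "\<Sum>i\<in>I. f i"] insert.IH by linarith
  then show ?case by (simp add: insert.hyps)
qed (simp_all add: l1_def)

lemma l1_single: "l1 (Poly_Mapping.single m c) = norm c"
  by (cases "c = 0") (simp_all add: l1_def)

lemma l1_mult: "l1 (f * g) \<le> l1 f * l1 g"
proof -
  have "f * g = (\<Sum>m\<in>Poly_Mapping.keys f. Poly_Mapping.single m (Poly_Mapping.lookup f m))
      * (\<Sum>k\<in>Poly_Mapping.keys g. Poly_Mapping.single k (Poly_Mapping.lookup g k))"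
    unfolding poly_mapping_monomial_expansion[symmetric] ..
  also have "\<dots> = (\<Sum>m\<in>Poly_Mapping.keys f. \<Sum>k\<in>Poly_Mapping.keys g.
      Poly_Mapping.single (m + k) (Poly_Mapping.lookup f m * Poly_Mapping.lookup g k))"
    by (simp only: sum_product mult_single)
  finally have "l1 (f * g) = l1 \<dots>" by (rule arg_cong)
  also have "\<dots> \<le> (\<Sum>m\<in>Poly_Mapping.keys f. l1 (\<Sum>k\<in>Poly_Mapping.keys g.
      Poly_Mapping.single (m + k) (Poly_Mapping.lookup f m * Poly_Mapping.lookup g k)))" by (rule l1_sum)
  also have "\<dots> \<le> (\<Sum>m\<in>Poly_Mapping.keys f. \<Sum>k\<in>Poly_Mapping.keys g.
      l1 (Poly_Mapping.single (m + k) (Poly_Mapping.lookup f m * Poly_Mapping.lookup g k)))" by (intro sum_mono l1_sum)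
  also have "\<dots> = l1 f * l1 g" unfolding l1_single norm_mult by (simp only: l1_def sum_product)
  finally show ?thesis .
qed

lemma l1_prod: "l1 (\<Prod>k\<in>A. f k) \<le> (\<Prod>k\<in>A. l1 (f k))"
proof (induction A rule: infinite_finite_induct)
  case (insert k A)
  have "l1 (f k * (\<Prod>k\<in>A. f k)) \<le> l1 (f k) * (\<Prod>k\<in>A. l1 (f k))"
    by (rule order_trans[OF l1_mult mult_left_mono[OF insert.IH l1_nonneg]])
  then show ?case by (simp add: insert.hyps)
qed (simp_all add: l1_def)

text \<open>The degree is an integer so that differentiation always lowers it by one; only the zero
  polynomial has negative degree.\<close>

definition pdeg_le :: "nat \<Rightarrow> int \<Rightarrow> cpoly \<Rightarrow> bool" where
  "pdeg_le d D f \<longleftrightarrow> (\<forall>m\<in>Poly_Mapping.keys f. m \<in> multi_indices d \<and> int (mdeg d m) \<le> D)"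

lemma pdeg_le_neg: "pdeg_le d D f \<Longrightarrow> D < 0 \<Longrightarrow> f = 0"
proof -
  assume a: "pdeg_le d D f" "D < 0"
  then have "Poly_Mapping.keys f = {}" unfolding pdeg_le_def by fastforce
  then show ?thesis by simp
qed

lemma pdeg_le_sum: "(\<And>i. i \<in> I \<Longrightarrow> pdeg_le d D (f i)) \<Longrightarrow> pdeg_le d D (\<Sum>i\<in>I. f i)"
  unfolding pdeg_le_def using keys_sum[of f I] by blast

lemma pdeg_le_mult:
  assumes f: "pdeg_le d D f" and g: "pdeg_le d D' g"
  shows "pdeg_le d (D + D') (f * g)"
  unfolding pdeg_le_def
proof
  fix m assume "m \<in> Poly_Mapping.keys (f * g)"
  then obtain a b where m: "m = a + b" and a: "a \<in> Poly_Mapping.keys f" and b: "b \<in> Poly_Mapping.keys g"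
    using keys_mult[of f g] by blast
  have "a \<in> multi_indices d" "int (mdeg d a) \<le> D" "b \<in> multi_indices d" "int (mdeg d b) \<le> D'"
    using f g a b unfolding pdeg_le_def by blast+
  then show "m \<in> multi_indices d \<and> int (mdeg d m) \<le> D + D'" unfolding m by (simp add: multi_indices_add mdeg_add)
qed

lemma pdeg_le_prod:
  assumes "finite A" "\<And>k. k \<in> A \<Longrightarrow> pdeg_le d (D k) (f k)"
  shows "pdeg_le d (\<Sum>k\<in>A. D k) (\<Prod>k\<in>A. f k)"
  using assms
proof (induction A rule: finite_induct)
  case empty
  show ?case by (simp add: pdeg_le_def multi_indices_0)
next
  case (insert k A)
  have "pdeg_le d (D k + (\<Sum>k\<in>A. D k)) (f k * (\<Prod>k\<in>A. f k))"
    by (rule pdeg_le_mult[OF insert.prems[OF insertI1] insert.IH[OF insert.prems[OF insertI2]]])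
  then show ?case by (simp add: insert.hyps)
qed

lemma keys_pdiffE:
  assumes "k \<in> Poly_Mapping.keys (pdiff i f)"
  obtains m where "m \<in> Poly_Mapping.keys f" "Poly_Mapping.lookup m i > 0" "k = m - Poly_Mapping.single i 1"
proof -
  obtain m where m: "m \<in> Poly_Mapping.keys f"
    "k \<in> Poly_Mapping.keys (Poly_Mapping.single (m - Poly_Mapping.single i 1) (of_nat (Poly_Mapping.lookup m i) * Poly_Mapping.lookup f m))"
    using assms unfolding pdiff_def by (blast dest: subsetD[OF keys_sum])
  from m(2) have "k = m - Poly_Mapping.single i 1" "Poly_Mapping.lookup m i > 0" by (auto split: if_splits)
  with m(1) that show ?thesis by blast
qed

lemma pdeg_le_pdiff:
  assumes f: "pdeg_le d D f" and i: "i < d"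
  shows "pdeg_le d (D - 1) (pdiff i f)"
  unfolding pdeg_le_def
proof
  fix k assume "k \<in> Poly_Mapping.keys (pdiff i f)"
  then obtain m where m: "m \<in> Poly_Mapping.keys f" "Poly_Mapping.lookup m i > 0" "k = m - Poly_Mapping.single i 1"
    by (rule keys_pdiffE)
  have m': "m \<in> multi_indices d" "int (mdeg d m) \<le> D" using f m(1) unfolding pdeg_le_def by blast+
  have "mdeg d m = mdeg d k + 1"
    using mdeg_add[of d k "Poly_Mapping.single i 1"] minus_single_add_single[OF m(2)] unfolding m(3)
    by (simp add: mdeg_single[OF i])
  then show "k \<in> multi_indices d \<and> int (mdeg d k) \<le> D - 1" using m' multi_indices_diff[OF m'(1)] m(3) by simp
qed

lemma pdeg_le_foldr:
  "set ks \<subseteq> {..<d} \<Longrightarrow> pdeg_le d D f \<Longrightarrow> pdeg_le d (D - int (length ks)) (foldr pdiff ks f)"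
proof (induction ks)
  case (Cons k ks)
  then have "pdeg_le d (D - int (length ks) - 1) (pdiff k (foldr pdiff ks f))" by (intro pdeg_le_pdiff) simp_all
  then show ?case by (simp add: algebra_simps)
qed simp

lemma pdeg_le_weaken: "pdeg_le d D f \<Longrightarrow> D \<le> D' \<Longrightarrow> pdeg_le d D' f"
  unfolding pdeg_le_def by force

lemma l1_pdiff:
  assumes f: "pdeg_le d (int M) f" and i: "i < d"
  shows "l1 (pdiff i f) \<le> real M * l1 f"
proof -
  have "l1 (pdiff i f) \<le> (\<Sum>m\<in>Poly_Mapping.keys f. l1 (Poly_Mapping.single (m - Poly_Mapping.single i 1)
      (of_nat (Poly_Mapping.lookup m i) * Poly_Mapping.lookup f m)))" unfolding pdiff_def by (rule l1_sum)
  also have "\<dots> \<le> (\<Sum>m\<in>Poly_Mapping.keys f. real M * norm (Poly_Mapping.lookup f m))"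
  proof (rule sum_mono)
    fix m assume "m \<in> Poly_Mapping.keys f"
    then have "mdeg d m \<le> M" using f unfolding pdeg_le_def by simp
    then have "real (Poly_Mapping.lookup m i) \<le> real M" using lookup_le_mdeg[OF i, of m] by simp
    then show "l1 (Poly_Mapping.single (m - Poly_Mapping.single i 1) (of_nat (Poly_Mapping.lookup m i) * Poly_Mapping.lookup f m))
        \<le> real M * norm (Poly_Mapping.lookup f m)"
      unfolding l1_single norm_mult by (simp add: mult_right_mono)
  qed
  also have "\<dots> = real M * l1 f" by (simp only: l1_def sum_distrib_left)
  finally show ?thesis .
qed

lemma l1_foldr:
  assumes "set ks \<subseteq> {..<d}" "pdeg_le d (int M) f"
  shows "l1 (foldr pdiff ks f) \<le> real M ^ length ks * l1 f"
  using assms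
proof (induction ks)
  case (Cons k ks)
  have ks: "set ks \<subseteq> {..<d}" "k < d" using Cons.prems(1) by simp_all
  have "pdeg_le d (int M) (foldr pdiff ks f)"
    by (rule pdeg_le_weaken[OF pdeg_le_foldr[OF ks(1) Cons.prems(2)]]) simp
  from l1_pdiff[OF this ks(2)] have "l1 (foldr pdiff (k # ks) f) \<le> real M * l1 (foldr pdiff ks f)" by simp
  also have "\<dots> \<le> real M * (real M ^ length ks * l1 f)"
    by (rule mult_left_mono[OF Cons.IH[OF ks(1) Cons.prems(2)]]) simp
  finally show ?case by simp
qed simp

lemma pdeg_le_kgamma: "pdeg_le d 1 (kgamma br d e i j)"
  unfolding kgamma_def
proof (rule pdeg_le_sum)
  fix k assume "k \<in> {..<d}"
  then have k: "k < d" by simp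
  have "Poly_Mapping.single k (1::nat) \<in> multi_indices d" using multi_indices_add_single[OF multi_indices_0 k, of 1] by simp
  then show "pdeg_le d 1 (pconst (complex_of_real (structure_const br d e i j k / 2)) * pvar k)"
    unfolding pconst_def pvar_def mult_single pdeg_le_def by (simp add: mdeg_single[OF k, of 1, simplified])
qed

section \<open>Edges of a graph, degrees and norms of its terms\<close>

lemma sum_length_filter:
  assumes "finite V"
  shows "(\<And>x. x \<in> set xs \<Longrightarrow> g x \<in> V) \<Longrightarrow> (\<Sum>v\<in>V. length (filter (\<lambda>x. g x = v) xs)) = length xs"
proof (induction xs)
  case (Cons x xs)
  have "(\<Sum>v\<in>V. length (filter (\<lambda>x. g x = v) (x # xs))) = (\<Sum>v\<in>V. (if v = g x then 1 else 0) + length (filter (\<lambda>x. g x = v) xs))"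
    by (intro sum.cong refl) auto
  also have "\<dots> = (\<Sum>v\<in>V. if v = g x then 1 else 0) + (\<Sum>v\<in>V. length (filter (\<lambda>x. g x = v) xs))"
    by (rule sum.distrib)
  also have "\<dots> = 1 + length xs" using assms Cons by simp
  finally show ?case by simp
qed simp

lemma length_filter_pairs:
  fixes P :: "kedge \<Rightarrow> bool"
  shows "(\<And>k. k \<in> set xs \<Longrightarrow> \<not> (P (k, 0) \<and> P (k, 1))) \<Longrightarrow> length (filter P (List.product xs [0, 1])) \<le> length xs"
proof (induction xs)
  case (Cons k xs)
  have "length (filter P (List.product xs [0, 1])) \<le> length xs" by (rule Cons.IH) (use Cons.prems in simp)
  moreover have "\<not> (P (k, 0) \<and> P (k, 1))" by (rule Cons.prems) simp
  ultimately show ?case by (cases "P (k, 0)") auto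
qed simp

definition edge_inputs :: "nat \<Rightarrow> (kedge \<Rightarrow> vertex) \<Rightarrow> (kedge \<Rightarrow> nat) \<Rightarrow> vertex \<Rightarrow> nat list" where
  "edge_inputs n \<Gamma> I v = map I (filter (\<lambda>ed. \<Gamma> ed = v) (kedges n))"

lemma pdiff_incoming_eq: "pdiff_incoming n \<Gamma> I v f = foldr pdiff (edge_inputs n \<Gamma> I v) f"
  by (simp add: pdiff_incoming_def edge_inputs_def foldr_map comp_def)

lemma edge_inputs_less: "I \<in> set (kedges n) \<rightarrow>\<^sub>E {..<d} \<Longrightarrow> set (edge_inputs n \<Gamma> I v) \<subseteq> {..<d}"
  by (auto simp: edge_inputs_def)

lemma edge_count:
  assumes "\<Gamma> \<in> kgraphs n"
  shows "(\<Sum>l<n. length (edge_inputs n \<Gamma> I (Inner l))) + length (edge_inputs n \<Gamma> I Left_Vertex)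
    + length (edge_inputs n \<Gamma> I Right_Vertex) = 2 * n"
proof -
  have in_V: "\<Gamma> x \<in> vertices n" if "x \<in> set (kedges n)" for x
    using assms that by (auto simp: kgraphs_def)
  have V: "vertices n = insert Left_Vertex (insert Right_Vertex (Inner ` {..<n}))" by (auto simp: vertices_def)
  have "length (kedges n) = 2 * n" by (simp add: kedges_def length_product)
  moreover have "(\<Sum>v\<in>vertices n. length (edge_inputs n \<Gamma> I v)) = length (kedges n)"
    unfolding edge_inputs_def length_map by (rule sum_length_filter[OF _ in_V]) (simp_all add: V)
  moreover have "(\<Sum>v\<in>vertices n. length (edge_inputs n \<Gamma> I v))
    = length (edge_inputs n \<Gamma> I Left_Vertex) + (length (edge_inputs n \<Gamma> I Right_Vertex) + (\<Sum>v\<in>Inner ` {..<n}. length (edge_inputs n \<Gamma> I v)))"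
    unfolding V by (subst sum.insert | simp add: image_iff)+
  moreover have "(\<Sum>v\<in>Inner ` {..<n}. length (edge_inputs n \<Gamma> I v)) = (\<Sum>l<n. length (edge_inputs n \<Gamma> I (Inner l)))"
    by (subst sum.reindex) (simp_all add: inj_on_def)
  ultimately show ?thesis by linarith
qed

text \<open>The two edges that start at one vertex have different targets, so each of the
  \<open>n\<close> sources sends at most one edge to \<open>v\<close>.\<close>

lemma edge_inputs_length_le:
  assumes "\<Gamma> \<in> kgraphs n"
  shows "length (edge_inputs n \<Gamma> I v) \<le> n"
proof -
  have "length (filter (\<lambda>ed. \<Gamma> ed = v) (List.product [0..<n] [0, 1])) \<le> length [0..<n]"
  proof (rule length_filter_pairs)
    fix k assume "k \<in> set [0..<n]"
    then have "k < n" by simp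
    then have "\<Gamma> (k, 0) \<noteq> \<Gamma> (k, 1)" using assms unfolding kgraphs_def by blast
    then show "\<not> (\<Gamma> (k, 0) = v \<and> \<Gamma> (k, 1) = v)" by metis
  qed
  then show ?thesis by (simp add: edge_inputs_def kedges_def)
qed

text \<open>The term of a labelled graph in the product with \<open>p\<close> on the right, without
  the factor at \<open>L\<close>. That factor is turned into a monomial in the coordinates of the
  Lie algebra by duality.\<close>

definition kterm :: "('g::real_vector \<Rightarrow> 'g \<Rightarrow> 'g) \<Rightarrow> nat \<Rightarrow> (nat \<Rightarrow> 'g) \<Rightarrow> cpoly \<Rightarrow> nat
    \<Rightarrow> (kedge \<Rightarrow> vertex) \<Rightarrow> (kedge \<Rightarrow> nat) \<Rightarrow> cpoly" where
  "kterm br d e p n \<Gamma> I =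
     (\<Prod>k<n. pdiff_incoming n \<Gamma> I (Inner k) (kgamma br d e (I (k, 0)) (I (k, 1))))
     * pdiff_incoming n \<Gamma> I Right_Vertex p"

text \<open>The factors have total degree \<open>n + M\<close> before differentiation, and each edge
  that does not end at \<open>L\<close> lowers it by one. If \<open>l\<close> of the
  \<open>2 * n\<close> edges end at \<open>L\<close>, then \<open>n + M - (2 * n - l)\<close> is
  left.\<close>

lemma pdeg_le_kterm:
  assumes \<Gamma>: "\<Gamma> \<in> kgraphs n" and I: "I \<in> set (kedges n) \<rightarrow>\<^sub>E {..<d}" and p: "pdeg_le d (int M) p"
  shows "pdeg_le d (int M - int n + int (length (edge_inputs n \<Gamma> I Left_Vertex))) (kterm br d e p n \<Gamma> I)"
proof -
  have "pdeg_le d ((\<Sum>k<n. 1 - int (length (edge_inputs n \<Gamma> I (Inner k)))) + (int M - int (length (edge_inputs n \<Gamma> I Right_Vertex))))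
    (kterm br d e p n \<Gamma> I)"
    unfolding kterm_def pdiff_incoming_eq
    by (intro pdeg_le_mult pdeg_le_prod pdeg_le_foldr edge_inputs_less[OF I] pdeg_le_kgamma p) simp
  moreover have "(\<Sum>k<n. 1 - int (length (edge_inputs n \<Gamma> I (Inner k)))) = int n - int (\<Sum>k<n. length (edge_inputs n \<Gamma> I (Inner k)))"
    by (simp add: sum_subtractf)
  ultimately show ?thesis by (elim pdeg_le_weaken) (use edge_count[OF \<Gamma>, of I] in linarith)
qed

text \<open>Differentiation of the linear factors costs nothing, and \<open>p\<close> receives at
  most \<open>n\<close> derivatives, each at the cost of a factor \<open>M\<close>. The base
  \<open>M + 1\<close> is at least one, so that the exponent may be raised to
  \<open>n\<close>.\<close>

lemma l1_kterm_le:
  assumes \<Gamma>: "\<Gamma> \<in> kgraphs n" and I: "I \<in> set (kedges n) \<rightarrow>\<^sub>E {..<d}" and p: "pdeg_le d (int M) p"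
    and K: "\<And>i j. i < d \<Longrightarrow> j < d \<Longrightarrow> l1 (kgamma br d e i j) \<le> K"
  shows "l1 (kterm br d e p n \<Gamma> I) \<le> K ^ n * (real (M + 1) ^ n * l1 p)"
proof -
  have fac: "l1 (foldr pdiff (edge_inputs n \<Gamma> I (Inner k)) (kgamma br d e (I (k, 0)) (I (k, 1)))) \<le> K" if k: "k < n" for k
  proof -
    have "(k, 0) \<in> set (kedges n)" "(k, 1) \<in> set (kedges n)" using k by (simp_all add: kedges_set)
    then have "I (k, 0) < d" "I (k, 1) < d" using I by auto
    then have "l1 (kgamma br d e (I (k, 0)) (I (k, 1))) \<le> K" by (rule K)
    moreover have "l1 (foldr pdiff (edge_inputs n \<Gamma> I (Inner k)) (kgamma br d e (I (k, 0)) (I (k, 1))))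
      \<le> real 1 ^ length (edge_inputs n \<Gamma> I (Inner k)) * l1 (kgamma br d e (I (k, 0)) (I (k, 1)))"
      by (rule l1_foldr[OF edge_inputs_less[OF I]]) (use pdeg_le_kgamma in simp)
    ultimately show ?thesis by simp
  qed
  have "l1 (\<Prod>k<n. foldr pdiff (edge_inputs n \<Gamma> I (Inner k)) (kgamma br d e (I (k, 0)) (I (k, 1)))) \<le>
      (\<Prod>k<n. l1 (foldr pdiff (edge_inputs n \<Gamma> I (Inner k)) (kgamma br d e (I (k, 0)) (I (k, 1)))))" by (rule l1_prod)
  also have "\<dots> \<le> (\<Prod>k<n. K)" by (intro prod_mono conjI l1_nonneg fac) simp
  finally have 1: "l1 (\<Prod>k<n. foldr pdiff (edge_inputs n \<Gamma> I (Inner k)) (kgamma br d e (I (k, 0)) (I (k, 1)))) \<le> K ^ n" by simp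
  have "l1 (foldr pdiff (edge_inputs n \<Gamma> I Right_Vertex) p) \<le> real M ^ length (edge_inputs n \<Gamma> I Right_Vertex) * l1 p"
    by (rule l1_foldr[OF edge_inputs_less[OF I] p])
  also have "\<dots> \<le> real (M + 1) ^ n * l1 p"
  proof (rule mult_right_mono[OF _ l1_nonneg])
    have "real M ^ length (edge_inputs n \<Gamma> I Right_Vertex) \<le> real (M + 1) ^ length (edge_inputs n \<Gamma> I Right_Vertex)"
      by (rule power_mono) simp_all
    also have "\<dots> \<le> real (M + 1) ^ n" by (rule power_increasing[OF edge_inputs_length_le[OF \<Gamma>]]) simp
    finally show "real M ^ length (edge_inputs n \<Gamma> I Right_Vertex) \<le> real (M + 1) ^ n" .
  qed
  finally have 2: "l1 (foldr pdiff (edge_inputs n \<Gamma> I Right_Vertex) p) \<le> real (M + 1) ^ n * l1 p" .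
  have "0 \<le> K ^ n" using order_trans[OF l1_nonneg 1] .
  then show ?thesis unfolding kterm_def pdiff_incoming_eq
    by (intro order_trans[OF l1_mult] mult_mono 1 2 l1_nonneg)
qed

lemma kterm_eq_0:
  assumes \<Gamma>: "\<Gamma> \<in> kgraphs n" and I: "I \<in> set (kedges n) \<rightarrow>\<^sub>E {..<d}" and n: "\<not> inner_indegree_le_1 n \<Gamma>"
  shows "kterm br d e p n \<Gamma> I = 0"
proof -
  obtain l ed ed' where l: "l < n" and ed: "ed \<in> set (kedges n)" "ed' \<in> set (kedges n)"
    "\<Gamma> ed = Inner l" "\<Gamma> ed' = Inner l" "ed \<noteq> ed'"
    using n unfolding inner_indegree_le_1_def by blast
  have "card {ed, ed'} \<le> card (set (filter (\<lambda>ed. \<Gamma> ed = Inner l) (kedges n)))"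
    by (rule card_mono) (use ed in auto)
  also have "\<dots> \<le> length (edge_inputs n \<Gamma> I (Inner l))" unfolding edge_inputs_def length_map by (rule card_length)
  finally have len: "2 \<le> length (edge_inputs n \<Gamma> I (Inner l))" using ed(5) by simp
  have "pdiff_incoming n \<Gamma> I (Inner l) (kgamma br d e (I (l, 0)) (I (l, 1))) = 0"
    unfolding pdiff_incoming_eq
    by (rule pdeg_le_neg[OF pdeg_le_foldr[OF edge_inputs_less[OF I] pdeg_le_kgamma]]) (use len in linarith)
  then have "(\<Prod>k<n. pdiff_incoming n \<Gamma> I (Inner k) (kgamma br d e (I (k, 0)) (I (k, 1)))) = 0"
    using l by (intro prod_zero) auto
  then show ?thesis by (simp add: kterm_def)
qed

text \<open>The number of injections is a falling factorial: it divides \<open>fact n\<close>, or it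
  is zero if \<open>S\<close> is too large. The bound thus holds for every size of
  \<open>S\<close>.\<close>

lemma card_injective_le_fact:
  assumes "finite S"
  shows "card {f \<in> S \<rightarrow>\<^sub>E {..<n}. inj_on f S} \<le> fact n"
proof -
  have c: "card {f \<in> S \<rightarrow>\<^sub>E {..<n}. inj_on f S} = (\<Prod>i\<in>{0..<card S}. n - i)"
    using card_inj_on_subset_funcset[OF assms finite_lessThan subset_refl, of n] by simp
  show ?thesis
  proof (cases "card S \<le> n")
    case True
    have "(\<Prod>i\<in>{0..<card S}. n - i) dvd (\<Prod>i\<in>{0..<n}. n - i)" by (rule prod_dvd_prod_subset) (use True in auto)
    also have "(\<Prod>i\<in>{0..<n}. n - i) = fact n" using fact_prod_rev[of n, where ?'a = nat] by simp
    finally show ?thesis unfolding c by (rule dvd_imp_le) simp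
  next
    case False
    then have "(\<Prod>i\<in>{0..<card S}. n - i) = 0" by (intro prod_zero bexI[of _ n]) auto
    then show ?thesis unfolding c by (rule order_trans[OF eq_refl le0])
  qed
qed

fun vertex_kind :: "vertex \<Rightarrow> nat" where
  "vertex_kind (Inner k) = 0"
| "vertex_kind Left_Vertex = 1"
| "vertex_kind Right_Vertex = 2"

fun inner_index :: "vertex \<Rightarrow> nat" where
  "inner_index (Inner k) = k"
| "inner_index Left_Vertex = 0"
| "inner_index Right_Vertex = 0"

lemma vertex_eqI: "vertex_kind v = vertex_kind w \<Longrightarrow> (vertex_kind v = 0 \<Longrightarrow> inner_index v = inner_index w) \<Longrightarrow> v = w"
  by (cases v; cases w) auto

lemma finite_kgraphs: "finite (kgraphs n)"
proof -
  have "finite (set (kedges n) \<rightarrow>\<^sub>E vertices n)" by (intro finite_PiE) (simp_all add: vertices_def)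
  then show ?thesis by (rule finite_subset[rotated]) (auto simp: kgraphs_def)
qed

text \<open>For each of the \<open>2 * n\<close> edges first fix whether it ends at an inner vertex,
  at \<open>L\<close> or at \<open>R\<close>; these are \<open>3 ^ (2 * n)\<close> choices. The
  graph is then determined by the targets of the edges of the first kind, and these targets are
  distinct.\<close>

lemma card_low_indegree:
  "card {\<Gamma> \<in> kgraphs n. inner_indegree_le_1 n \<Gamma>} \<le> 9 ^ n * fact n"
proof -
  let ?E = "set (kedges n)"
  let ?T = "?E \<rightarrow>\<^sub>E {..<3::nat}"
  define S where "S \<tau> = {ed \<in> ?E. \<tau> ed = 0}" for \<tau> :: "kedge \<Rightarrow> nat"
  define G where "G \<tau> = {\<Gamma> \<in> kgraphs n. inner_indegree_le_1 n \<Gamma> \<and> (\<forall>ed\<in>?E. vertex_kind (\<Gamma> ed) = \<tau> ed)}" for \<tau>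
  have in_V: "\<Gamma> ed \<in> vertices n" if "\<Gamma> \<in> kgraphs n" "ed \<in> ?E" for \<Gamma> ed using that by (auto simp: kgraphs_def)
  have finT: "finite ?T" by (intro finite_PiE) simp_all
  have cardE: "card ?E = 2 * n" by (simp add: kedges_set card_cartesian_product)
  have cG: "card (G \<tau>) \<le> fact n" for \<tau>
  proof -
    let ?r = "\<lambda>\<Gamma>. restrict (\<lambda>ed. inner_index (\<Gamma> ed)) (S \<tau>)"
    have "inj_on ?r (G \<tau>)"
    proof (rule inj_onI)
      fix \<Gamma> \<Gamma>' assume g: "\<Gamma> \<in> G \<tau>" "\<Gamma>' \<in> G \<tau>" and eq: "?r \<Gamma> = ?r \<Gamma>'"
      have ext: "\<Gamma> \<in> extensional ?E" "\<Gamma>' \<in> extensional ?E" using g by (auto simp: G_def kgraphs_def PiE_def)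
      show "\<Gamma> = \<Gamma>'"
      proof (rule extensionalityI[OF ext])
        fix ed assume ed: "ed \<in> ?E"
        have k: "vertex_kind (\<Gamma> ed) = \<tau> ed" "vertex_kind (\<Gamma>' ed) = \<tau> ed" using g ed unfolding G_def by blast+
        show "\<Gamma> ed = \<Gamma>' ed"
        proof (rule vertex_eqI)
          assume "vertex_kind (\<Gamma> ed) = 0"
          then have "ed \<in> S \<tau>" using k ed by (simp add: S_def)
          then show "inner_index (\<Gamma> ed) = inner_index (\<Gamma>' ed)" using fun_cong[OF eq, of ed] by simp
        qed (simp add: k)
      qed
    qed
    moreover have "?r ` G \<tau> \<subseteq> {f \<in> S \<tau> \<rightarrow>\<^sub>E {..<n}. inj_on f (S \<tau>)}"
    proof
      fix f assume "f \<in> ?r ` G \<tau>"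
      then obtain \<Gamma> where \<Gamma>: "\<Gamma> \<in> G \<tau>" and f: "f = ?r \<Gamma>" by blast
      have inn: "\<exists>l<n. \<Gamma> ed = Inner l" if "ed \<in> S \<tau>" for ed
      proof -
        have "vertex_kind (\<Gamma> ed) = 0" "\<Gamma> ed \<in> vertices n" using that \<Gamma> in_V unfolding S_def G_def by auto
        then show ?thesis by (cases "\<Gamma> ed") (auto simp: vertices_def)
      qed
      have "f \<in> S \<tau> \<rightarrow>\<^sub>E {..<n}" unfolding f
      proof (rule restrict_PiE_iff[THEN iffD2], rule ballI)
        fix ed assume "ed \<in> S \<tau>"
        from inn[OF this] show "inner_index (\<Gamma> ed) \<in> {..<n}" by auto
      qed
      moreover have "inj_on f (S \<tau>)"
      proof (rule inj_onI)
        fix a b assume ab: "a \<in> S \<tau>" "b \<in> S \<tau>" and eq: "f a = f b"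
        obtain l where l: "l < n" "\<Gamma> a = Inner l" using inn[OF ab(1)] by blast
        obtain l' where l': "l' < n" "\<Gamma> b = Inner l'" using inn[OF ab(2)] by blast
        have "l = l'" using eq ab l(2) l'(2) by (simp add: f)
        moreover have "a \<in> ?E" "b \<in> ?E" using ab by (simp_all add: S_def)
        moreover have "inner_indegree_le_1 n \<Gamma>" using \<Gamma> by (simp add: G_def)
        ultimately show "a = b" using l l'(2) unfolding inner_indegree_le_1_def by blast
      qed
      ultimately show "f \<in> {f \<in> S \<tau> \<rightarrow>\<^sub>E {..<n}. inj_on f (S \<tau>)}" by blast
    qed
    moreover have "finite {f \<in> S \<tau> \<rightarrow>\<^sub>E {..<n}. inj_on f (S \<tau>)}"
    proof -
      have "finite (S \<tau> \<rightarrow>\<^sub>E {..<n})" by (intro finite_PiE) (simp_all add: S_def)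
      then show ?thesis by (rule finite_subset[rotated]) blast
    qed
    ultimately have "card (G \<tau>) \<le> card {f \<in> S \<tau> \<rightarrow>\<^sub>E {..<n}. inj_on f (S \<tau>)}" by (rule card_inj_on_le)
    also have "\<dots> \<le> fact n" by (rule card_injective_le_fact) (simp add: S_def)
    finally show ?thesis .
  qed
  have "{\<Gamma> \<in> kgraphs n. inner_indegree_le_1 n \<Gamma>} \<subseteq> (\<Union>\<tau>\<in>?T. G \<tau>)"
  proof
    fix \<Gamma> assume \<Gamma>: "\<Gamma> \<in> {\<Gamma> \<in> kgraphs n. inner_indegree_le_1 n \<Gamma>}"
    have "vertex_kind v < 3" for v by (cases v) auto
    then have "restrict (\<lambda>ed. vertex_kind (\<Gamma> ed)) ?E \<in> ?T" by auto
    moreover have "\<Gamma> \<in> G (restrict (\<lambda>ed. vertex_kind (\<Gamma> ed)) ?E)" using \<Gamma> by (simp add: G_def)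
    ultimately show "\<Gamma> \<in> (\<Union>\<tau>\<in>?T. G \<tau>)" by blast
  qed
  then have "card {\<Gamma> \<in> kgraphs n. inner_indegree_le_1 n \<Gamma>} \<le> card (\<Union>\<tau>\<in>?T. G \<tau>)"
    by (rule card_mono[rotated]) (use finT finite_kgraphs in \<open>auto simp: G_def\<close>)
  also have "\<dots> \<le> (\<Sum>\<tau>\<in>?T. card (G \<tau>))" by (rule card_UN_le[OF finT])
  also have "\<dots> \<le> (\<Sum>\<tau>\<in>?T. fact n)" by (intro sum_mono cG)
  also have "\<dots> = 3 ^ (2 * n) * fact n" by (simp add: card_funcsetE cardE)
  also have "\<dots> = 9 ^ n * fact n" by (simp add: power_mult)
  finally show ?thesis .
qed

text \<open>The factorial in the number of graphs cancels against the one in the weights. There are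
  \<open>d ^ (2 * n)\<close> labellings, and all remaining factors are exponential in
  \<open>n\<close>.\<close>

lemma kterm_total_le:
  assumes p: "pdeg_le d (int M) p"
    and K: "\<And>i j. i < d \<Longrightarrow> j < d \<Longrightarrow> l1 (kgamma br d e i j) \<le> K" "K \<ge> 0"
  shows "(\<Sum>\<Gamma>\<in>kgraphs n. \<Sum>I\<in>set (kedges n) \<rightarrow>\<^sub>E {..<d}. \<bar>weight n \<Gamma>\<bar> * l1 (kterm br d e p n \<Gamma> I))
    \<le> l1 p * (9 * 9216 * (real d)\<^sup>2 * K * real (M + 1)) ^ n"
proof -
  let ?J = "set (kedges n) \<rightarrow>\<^sub>E {..<d}"
  let ?L = "{\<Gamma> \<in> kgraphs n. inner_indegree_le_1 n \<Gamma>}"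
  let ?t = "K ^ n * (real (M + 1) ^ n * l1 p)"
  have t0: "0 \<le> ?t" using K(2) l1_nonneg[of p] by simp
  have cJ: "card ?J = d ^ (2 * n)" by (simp add: card_funcsetE kedges_set card_cartesian_product mult_2 mult_2_right)
  have "(\<Sum>\<Gamma>\<in>kgraphs n. \<Sum>I\<in>?J. \<bar>weight n \<Gamma>\<bar> * l1 (kterm br d e p n \<Gamma> I))
      = (\<Sum>\<Gamma>\<in>?L. \<Sum>I\<in>?J. \<bar>weight n \<Gamma>\<bar> * l1 (kterm br d e p n \<Gamma> I))"
    by (rule sum.mono_neutral_right[OF finite_kgraphs]) (auto intro!: sum.neutral simp: kterm_eq_0 l1_def)
  also have "\<dots> \<le> (\<Sum>\<Gamma>\<in>?L. \<Sum>I\<in>?J. 9216 ^ n / fact n * ?t)"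
  proof (intro sum_mono mult_mono)
    fix \<Gamma> I assume \<Gamma>: "\<Gamma> \<in> ?L" and I: "I \<in> ?J"
    show "\<bar>weight n \<Gamma>\<bar> \<le> 9216 ^ n / fact n" using \<Gamma> weight_bound by blast
    show "l1 (kterm br d e p n \<Gamma> I) \<le> ?t" using \<Gamma> by (intro l1_kterm_le[OF _ I p K(1)]) blast+
  qed (simp_all add: l1_nonneg)
  also have "\<dots> = real (card ?L) * (real d ^ (2 * n) * (9216 ^ n / fact n * ?t))" by (simp only: sum_constant cJ of_nat_power)
  also have "\<dots> \<le> (9 ^ n * fact n) * (real d ^ (2 * n) * (9216 ^ n / fact n * ?t))"
  proof (rule mult_right_mono)
    have "real (card ?L) \<le> real (9 ^ n * fact n)" using card_low_indegree[of n] by (simp only: of_nat_le_iff)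
    then show "real (card ?L) \<le> 9 ^ n * fact n" by simp
    show "0 \<le> real d ^ (2 * n) * (9216 ^ n / fact n * ?t)" by (rule mult_nonneg_nonneg[OF _ mult_nonneg_nonneg[OF _ t0]]) simp_all
  qed
  also have "\<dots> = (9 ^ n * 9216 ^ n * real d ^ (2 * n) * K ^ n * real (M + 1) ^ n) * l1 p" by simp
  also have "\<dots> = l1 p * (9 * 9216 * (real d)\<^sup>2 * K * real (M + 1)) ^ n"
    by (simp only: power_mult_distrib power_mult[symmetric] mult_ac)
  finally show ?thesis .
qed

section \<open>The right multiplication operator\<close>

definition left_index :: "nat \<Rightarrow> (kedge \<Rightarrow> vertex) \<Rightarrow> (kedge \<Rightarrow> nat) \<Rightarrow> multi_index" where
  "left_index n \<Gamma> I = (\<Sum>i\<leftarrow>edge_inputs n \<Gamma> I Left_Vertex. Poly_Mapping.single i 1)"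

lemma index_of_list:
  "set ks \<subseteq> {..<d} \<Longrightarrow> (\<Sum>i\<leftarrow>ks. Poly_Mapping.single i (1::nat)) \<in> multi_indices d
     \<and> mdeg d (\<Sum>i\<leftarrow>ks. Poly_Mapping.single i (1::nat)) = length ks"
proof (induction ks)
  case (Cons k ks)
  have k: "k < d" and IH: "(\<Sum>i\<leftarrow>ks. Poly_Mapping.single i (1::nat)) \<in> multi_indices d"
    "mdeg d (\<Sum>i\<leftarrow>ks. Poly_Mapping.single i (1::nat)) = length ks" using Cons by simp_all
  have "Poly_Mapping.single k (1::nat) \<in> multi_indices d"
    using multi_indices_add_single[OF multi_indices_0 k, of 1] by simp
  from multi_indices_add[OF this IH(1)] show ?case
    using mdeg_add[of d "Poly_Mapping.single k 1" "\<Sum>i\<leftarrow>ks. Poly_Mapping.single i (1::nat)"] mdeg_single[OF k, of 1] IH(2) by simp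
qed (simp add: multi_indices_0)

lemma left_index_in: "I \<in> set (kedges n) \<rightarrow>\<^sub>E {..<d} \<Longrightarrow> left_index n \<Gamma> I \<in> multi_indices d"
  and mdeg_left_index: "I \<in> set (kedges n) \<rightarrow>\<^sub>E {..<d} \<Longrightarrow> mdeg d (left_index n \<Gamma> I) = length (edge_inputs n \<Gamma> I Left_Vertex)"
  unfolding left_index_def using index_of_list[OF edge_inputs_less] by blast+

text \<open>The coefficient of \<open>x\<^sup>\<alpha> \<partial>\<^sup>\<beta>\<close>; it no longer depends on \<open>N\<close> once \<open>N \<ge> \<bar>\<alpha>\<bar> + deg p\<close>.\<close>

definition star_coeff :: "('g::real_vector \<Rightarrow> 'g \<Rightarrow> 'g) \<Rightarrow> nat \<Rightarrow> (nat \<Rightarrow> 'g) \<Rightarrow> cpoly \<Rightarrow> nat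
    \<Rightarrow> multi_index \<Rightarrow> multi_index \<Rightarrow> complex" where
  "star_coeff br d e p N \<beta> \<alpha> = (\<Sum>n\<le>N. \<Sum>\<Gamma>\<in>kgraphs n. \<Sum>I\<in>set (kedges n) \<rightarrow>\<^sub>E {..<d}.
     if left_index n \<Gamma> I = \<alpha> then complex_of_real (weight n \<Gamma>) * Poly_Mapping.lookup (kterm br d e p n \<Gamma> I) \<beta> else 0)"

lemma kterm_eq_0_large:
  assumes "\<Gamma> \<in> kgraphs n" "I \<in> set (kedges n) \<rightarrow>\<^sub>E {..<d}" "pdeg_le d (int M) p"
    and "M + mdeg d (left_index n \<Gamma> I) < n"
  shows "kterm br d e p n \<Gamma> I = 0"
  by (rule pdeg_le_neg[OF pdeg_le_kterm[OF assms(1-3)]]) (use assms(4) mdeg_left_index[OF assms(2), of \<Gamma>] in linarith)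

lemma star_coeff_stable:
  assumes p: "pdeg_le d (int M) p" and N: "mdeg d \<alpha> + M \<le> N"
  shows "star_coeff br d e p N \<beta> \<alpha> = star_coeff br d e p (mdeg d \<alpha> + M) \<beta> \<alpha>"
  unfolding star_coeff_def
proof (rule sum.mono_neutral_right)
  show "\<forall>n\<in>{..N} - {..mdeg d \<alpha> + M}. (\<Sum>\<Gamma>\<in>kgraphs n. \<Sum>I\<in>set (kedges n) \<rightarrow>\<^sub>E {..<d}.
     if left_index n \<Gamma> I = \<alpha> then complex_of_real (weight n \<Gamma>) * Poly_Mapping.lookup (kterm br d e p n \<Gamma> I) \<beta> else 0) = 0"
  proof (intro ballI sum.neutral)
    fix n \<Gamma> I assume n: "n \<in> {..N} - {..mdeg d \<alpha> + M}" and \<Gamma>: "\<Gamma> \<in> kgraphs n" and I: "I \<in> set (kedges n) \<rightarrow>\<^sub>E {..<d}"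
    have "kterm br d e p n \<Gamma> I = 0" if "left_index n \<Gamma> I = \<alpha>"
      by (rule kterm_eq_0_large[OF \<Gamma> I p]) (use that n in simp)
    then show "(if left_index n \<Gamma> I = \<alpha> then complex_of_real (weight n \<Gamma>) * Poly_Mapping.lookup (kterm br d e p n \<Gamma> I) \<beta> else 0) = 0"
      by simp
  qed
qed (use N in auto)

text \<open>The sum for the index \<open>\<alpha>\<close> stops at
  \<open>n = mdeg d \<alpha> + M\<close>, so a bound exponential in \<open>n\<close> is exponential
  in the degree of \<open>\<alpha>\<close>. Radius and constant are the same for all
  \<open>\<beta>\<close>, and one neighbourhood of 0 will serve all coefficients of the
  operator.\<close>

lemma star_coeff_geometric:
  assumes p: "pdeg_le d (int M) p"
  shows "\<exists>\<rho> B. \<forall>\<beta>. geom_bounded d \<rho> B (\<lambda>\<alpha>. star_coeff br d e p (mdeg d \<alpha> + M) \<beta> \<alpha>)"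
proof -
  define K where "K = (\<Sum>i<d. \<Sum>j<d. l1 (kgamma br d e i j))"
  have K: "l1 (kgamma br d e i j) \<le> K" if "i < d" "j < d" for i j
  proof -
    have "l1 (kgamma br d e i j) \<le> (\<Sum>j<d. l1 (kgamma br d e i j))"
      using that by (intro member_le_sum[where f = "\<lambda>j. l1 (kgamma br d e i j)"]) (simp_all add: l1_nonneg)
    also have "\<dots> \<le> K" unfolding K_def
      using that by (intro member_le_sum[where f = "\<lambda>i. \<Sum>j<d. l1 (kgamma br d e i j)"]) (simp_all add: l1_nonneg sum_nonneg)
    finally show ?thesis .
  qed
  have K0: "K \<ge> 0" unfolding K_def by (intro sum_nonneg l1_nonneg)
  define g where "g = 9 * 9216 * (real d)\<^sup>2 * K * real (M + 1)"
  have g: "g \<ge> 0" unfolding g_def using K0 by simp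
  \<comment> \<open>At least one, so that its powers increase and the sum over
    \<open>n \<le> N\<close> is at most \<open>N + 1\<close>, hence \<open>2 ^ N\<close>, times its
    last term.\<close>
  define G where "G = g + 1"
  have G: "G \<ge> 1" "g \<le> G" using g by (simp_all add: G_def)
  have bound: "norm (star_coeff br d e p N \<beta> \<alpha>) \<le> l1 p * (2 * G) ^ N" for N \<beta> \<alpha>
  proof -
    have "norm (star_coeff br d e p N \<beta> \<alpha>) \<le> (\<Sum>n\<le>N. \<Sum>\<Gamma>\<in>kgraphs n. \<Sum>I\<in>set (kedges n) \<rightarrow>\<^sub>E {..<d}.
        \<bar>weight n \<Gamma>\<bar> * l1 (kterm br d e p n \<Gamma> I))"
      unfolding star_coeff_def
      by (intro sum_norm_le) (simp add: norm_mult mult_left_mono norm_lookup_le_l1 l1_nonneg)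
    also have "\<dots> \<le> (\<Sum>n\<le>N. l1 p * g ^ n)"
      unfolding g_def by (intro sum_mono kterm_total_le p K K0)
    also have "\<dots> \<le> (\<Sum>n\<le>N. l1 p * G ^ N)"
    proof (rule sum_mono)
      fix n assume "n \<in> {..N}"
      then have "G ^ n \<le> G ^ N" using G(1) by (intro power_increasing) simp_all
      moreover have "g ^ n \<le> G ^ n" by (rule power_mono[OF G(2) g])
      ultimately show "l1 p * g ^ n \<le> l1 p * G ^ N" by (intro mult_left_mono l1_nonneg) linarith
    qed
    also have "\<dots> = real (Suc N) * (l1 p * G ^ N)" by simp
    also have "\<dots> \<le> 2 ^ N * (l1 p * G ^ N)"
    proof (rule mult_right_mono)
      have "Suc N \<le> 2 ^ N" by (rule Suc_leI[OF less_exp])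
      then have "real (Suc N) \<le> real (2 ^ N)" by (simp only: of_nat_le_iff)
      then show "real (Suc N) \<le> 2 ^ N" by simp
      show "0 \<le> l1 p * G ^ N" using G(1) l1_nonneg[of p] by (intro mult_nonneg_nonneg) simp_all
    qed
    finally show ?thesis by (simp only: power_mult_distrib mult_ac)
  qed
  have "geom_bounded d (1 / (2 * G)) (l1 p * (2 * G) ^ M) (\<lambda>\<alpha>. star_coeff br d e p (mdeg d \<alpha> + M) \<beta> \<alpha>)" for \<beta>
    unfolding geom_bounded_def
  proof (intro conjI ballI)
    show "0 < 1 / (2 * G)" using G(1) by simp
    fix \<alpha>
    have "norm (star_coeff br d e p (mdeg d \<alpha> + M) \<beta> \<alpha>) * (1 / (2 * G)) ^ mdeg d \<alpha>
        \<le> l1 p * (2 * G) ^ (mdeg d \<alpha> + M) * (1 / (2 * G)) ^ mdeg d \<alpha>"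
      by (rule mult_right_mono[OF bound]) (use G(1) in simp)
    also have "\<dots> = l1 p * (2 * G) ^ M * ((2 * G) ^ mdeg d \<alpha> * (1 / (2 * G)) ^ mdeg d \<alpha>)"
      by (simp only: power_add mult_ac)
    also have "(2 * G) ^ mdeg d \<alpha> * (1 / (2 * G)) ^ mdeg d \<alpha> = 1"
      unfolding power_mult_distrib[symmetric] using G(1) by simp
    finally show "norm (star_coeff br d e p (mdeg d \<alpha> + M) \<beta> \<alpha>) * (1 / (2 * G)) ^ mdeg d \<alpha> \<le> l1 p * (2 * G) ^ M" by simp
  qed
  then show ?thesis by blast
qed

lemma pdiff_Sym: "f \<in> Sym d \<Longrightarrow> pdiff i f \<in> Sym d"
  unfolding Sym_def by (auto elim!: keys_pdiffE intro!: multi_indices_diff)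

lemma foldr_pdiff_Sym: "f \<in> Sym d \<Longrightarrow> foldr pdiff ks f \<in> Sym d"
  by (induction ks) (simp_all add: pdiff_Sym)

lemma Sym_pdeg_le:
  assumes "f \<in> Sym d"
  obtains R :: nat where "pdeg_le d (int R) f"
proof -
  have "pdeg_le d (int (\<Sum>m\<in>Poly_Mapping.keys f. mdeg d m)) f"
    unfolding pdeg_le_def
  proof
    fix m assume m: "m \<in> Poly_Mapping.keys f"
    have "mdeg d m \<le> (\<Sum>m\<in>Poly_Mapping.keys f. mdeg d m)" by (rule member_le_sum[OF m]) simp_all
    then have "int (mdeg d m) \<le> int (\<Sum>m\<in>Poly_Mapping.keys f. mdeg d m)" by (simp only: of_nat_le_iff)
    then show "m \<in> multi_indices d \<and> int (mdeg d m) \<le> int (\<Sum>m\<in>Poly_Mapping.keys f. mdeg d m)"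
      using m assms unfolding Sym_def by blast
  qed
  then show ?thesis by (rule that)
qed

lemma sum_swap_inner:
  "(\<Sum>i\<in>A. \<Sum>j\<in>B. \<Sum>k\<in>C. g i j k) = (\<Sum>k\<in>C. \<Sum>i\<in>A. \<Sum>j\<in>B. g i j k)"
proof -
  have "(\<Sum>i\<in>A. \<Sum>j\<in>B. \<Sum>k\<in>C. g i j k) = (\<Sum>i\<in>A. \<Sum>k\<in>C. \<Sum>j\<in>B. g i j k)"
    by (intro sum.cong refl sum.swap)
  also have "\<dots> = (\<Sum>k\<in>C. \<Sum>i\<in>A. \<Sum>j\<in>B. g i j k)" by (rule sum.swap)
  finally show ?thesis .
qed

context finite_basis
begin

section \<open>The star product paired with a function\<close>

lemma pairing_foldr_pdiff:
  assumes r: "r \<in> Sym d" and U: "0 \<in> U"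
  shows "smooth_on U g \<Longrightarrow> set ks \<subseteq> {..<d} \<Longrightarrow>
    pairing (foldr pdiff ks r) g = pairing r (\<lambda>y. xpow (\<Sum>i\<leftarrow>ks. Poly_Mapping.single i 1) y * g y)"
proof (induction ks arbitrary: g)
  case Nil
  then show ?case by (simp add: xpow_zero)
next
  case (Cons k ks)
  have k: "k < d" and ks: "set ks \<subseteq> {..<d}" using Cons.prems(2) by simp_all
  have "pairing (foldr pdiff (k # ks) r) g = pairing (foldr pdiff ks r) (\<lambda>y. X k y * g y)"
    using pairing_X_mult[OF foldr_pdiff_Sym[OF r] Cons.prems(1) U k, of ks] by simp
  also have "\<dots> = pairing r (\<lambda>y. xpow (\<Sum>i\<leftarrow>ks. Poly_Mapping.single i 1) y * (X k y * g y))"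
    by (rule Cons.IH[OF smooth_on_mult[OF smooth_on_X[OF k smooth_on_open[OF Cons.prems(1)]] Cons.prems(1)] ks])
  also have "(\<lambda>y. xpow (\<Sum>i\<leftarrow>ks. Poly_Mapping.single i 1) y * (X k y * g y))
      = (\<lambda>y. xpow (\<Sum>i\<leftarrow>k # ks. Poly_Mapping.single i 1) y * g y)"
    unfolding list.map sum_list.Cons xpow_add xpow_single[OF k] by (simp only: mult_ac)
  finally show ?case .
qed

lemma pairing_monomial_mult:
  assumes "m \<in> multi_indices d" "smooth_on U f" "0 \<in> U"
  shows "pairing (Poly_Mapping.single m 1 * s) f = pairing s (mixed_deriv d e m f)"
  using assms(1,2)
proof (induction m arbitrary: f rule: multi_index_induct)
  case zero
  then show ?case by (simp add: mixed_deriv_0)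
next
  case (add m i)
  note i = add.hyps(2) and f = add.prems
  have "Poly_Mapping.single (m + Poly_Mapping.single i (1::nat)) (1::complex) * s = pvar i * (Poly_Mapping.single m 1 * s)"
    unfolding pvar_def mult.assoc[symmetric] mult_single by (simp add: add.commute)
  then have "pairing (Poly_Mapping.single (m + Poly_Mapping.single i 1) 1 * s) f = pairing (pvar i * (Poly_Mapping.single m 1 * s)) f"
    by (rule arg_cong[where f = "\<lambda>z. pairing z f"])
  also have "\<dots> = pairing (Poly_Mapping.single m 1 * s) (dir_deriv (e i) f)" by (rule pairing_pvar_mult[OF f assms(3) i])
  also have "\<dots> = pairing s (mixed_deriv d e m (dir_deriv (e i) f))" by (rule add.IH[OF smooth_on_dir_deriv[OF f]])
  also have "\<dots> = pairing s (mixed_deriv d e (m + Poly_Mapping.single i 1) f)"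
    by (rule pairing_cong[OF smooth_on_open[OF f] assms(3)]) (rule mixed_deriv_add_single[OF f _ i, symmetric])
  finally show ?case .
qed

lemma pairing_mult:
  assumes K: "finite K" "Poly_Mapping.keys z \<subseteq> K" "K \<subseteq> multi_indices d" and f: "smooth_on U f" "0 \<in> U"
  shows "pairing (z * s) f = (\<Sum>m\<in>K. Poly_Mapping.lookup z m * pairing s (mixed_deriv d e m f))"
proof -
  have "z * s = (\<Sum>m\<in>Poly_Mapping.keys z. Poly_Mapping.single m (Poly_Mapping.lookup z m)) * s"
    unfolding poly_mapping_monomial_expansion[symmetric] ..
  also have "\<dots> = (\<Sum>m\<in>Poly_Mapping.keys z. pconst (Poly_Mapping.lookup z m) * (Poly_Mapping.single m 1 * s))"
    unfolding sum_distrib_right pconst_def mult.assoc[symmetric] mult_single by simp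
  finally have "pairing (z * s) f = (\<Sum>m\<in>Poly_Mapping.keys z. pairing (pconst (Poly_Mapping.lookup z m) * (Poly_Mapping.single m 1 * s)) f)"
    by (simp only: pairing_sum)
  also have "\<dots> = (\<Sum>m\<in>Poly_Mapping.keys z. Poly_Mapping.lookup z m * pairing s (mixed_deriv d e m f))"
    unfolding pairing_const_mult
    by (intro sum.cong refl arg_cong2[where f = "(*)"] pairing_monomial_mult[OF _ f]) (use K(2,3) in blast)
  also have "\<dots> = (\<Sum>m\<in>K. Poly_Mapping.lookup z m * pairing s (mixed_deriv d e m f))"
    by (rule sum.mono_neutral_left[OF K(1,2)]) (simp add: in_keys_iff)
  finally show ?thesis .
qed

lemma pairing_fun_sum:
  assumes r: "r \<in> Sym d" and U: "open U" "0 \<in> U" and "finite I" "\<And>i. i \<in> I \<Longrightarrow> smooth_on U (h i)"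
  shows "pairing r (\<lambda>y. \<Sum>i\<in>I. c i * h i y) = (\<Sum>i\<in>I. c i * pairing r (h i))"
  using assms(4,5)
proof (induction I rule: finite_induct)
  case empty
  have "mixed_deriv d e m (\<lambda>y. 0) 0 = 0" if "m \<in> Poly_Mapping.keys r" for m
  proof (cases "m = 0")
    case False
    then show ?thesis using r that unfolding Sym_def by (intro mixed_deriv_const) blast
  qed (simp add: mixed_deriv_0)
  then show ?case by (simp add: pairing_def)
next
  case (insert i I)
  have hi: "smooth_on U (h i)" by (rule insert.prems) simp
  have ci: "smooth_on U (\<lambda>y. c i * h i y)" by (rule smooth_on_mult[OF smooth_on_const[OF U(1)] hi])
  have cs: "smooth_on U (\<lambda>y. \<Sum>i\<in>I. c i * h i y)"
    by (intro smooth_on_sum[OF U(1)] smooth_on_mult smooth_on_const[OF U(1)] insert.prems) simp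
  have "mixed_deriv d e m (\<lambda>y. c i * h i y + (\<Sum>i\<in>I. c i * h i y)) 0
      = c i * mixed_deriv d e m (h i) 0 + mixed_deriv d e m (\<lambda>y. \<Sum>i\<in>I. c i * h i y) 0"
    if "m \<in> Poly_Mapping.keys r" for m
  proof -
    have m: "m \<in> multi_indices d" using r that unfolding Sym_def by blast
    show ?thesis unfolding mixed_deriv_plus[OF m ci cs U(2)] mixed_deriv_cmult[OF m hi U(2)] ..
  qed
  then have "pairing r (\<lambda>y. c i * h i y + (\<Sum>i\<in>I. c i * h i y))
     = (\<Sum>m\<in>Poly_Mapping.keys r. c i * (Poly_Mapping.lookup r m * mixed_deriv d e m (h i) 0)
        + Poly_Mapping.lookup r m * mixed_deriv d e m (\<lambda>y. \<Sum>i\<in>I. c i * h i y) 0)"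
    unfolding pairing_def by (intro sum.cong refl) (simp add: algebra_simps)
  also have "\<dots> = c i * pairing r (h i) + pairing r (\<lambda>y. \<Sum>i\<in>I. c i * h i y)"
    unfolding pairing_def sum.distrib sum_distrib_left ..
  also have "pairing r (\<lambda>y. \<Sum>i\<in>I. c i * h i y) = (\<Sum>i\<in>I. c i * pairing r (h i))"
    by (rule insert.IH) (rule insert.prems, simp)
  finally show ?case by (simp add: insert.hyps)
qed

text \<open>More than \<open>R\<close> edges into \<open>L\<close> annihilate \<open>r\<close>, and
  with at most \<open>R\<close> of them the degree count annihilates the other factor once
  \<open>n > R + M\<close>. Since at most \<open>n\<close> edges end at \<open>L\<close>, the same
  count shows that only \<open>\<beta>\<close> of degree at most \<open>M\<close> occur.\<close>

lemma pairing_star: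
  assumes r: "r \<in> Sym d" "pdeg_le d (int R) r" and p: "pdeg_le d (int M) p"
    and f: "smooth_on U f" "0 \<in> U"
  shows "pairing (star br d e r p) f = (\<Sum>n\<le>R + M. \<Sum>\<Gamma>\<in>kgraphs n. \<Sum>I\<in>set (kedges n) \<rightarrow>\<^sub>E {..<d}.
     \<Sum>\<beta>\<in>{\<beta> \<in> multi_indices d. mdeg d \<beta> \<le> M}. complex_of_real (weight n \<Gamma>) * Poly_Mapping.lookup (kterm br d e p n \<Gamma> I) \<beta>
       * pairing r (\<lambda>y. xpow (left_index n \<Gamma> I) y * mixed_deriv d e \<beta> f y))"
proof -
  let ?K = "{\<beta> \<in> multi_indices d. mdeg d \<beta> \<le> M}"
  have go: "graph_op br d e n \<Gamma> r p = (\<Sum>I\<in>set (kedges n) \<rightarrow>\<^sub>E {..<d}.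
      kterm br d e p n \<Gamma> I * foldr pdiff (edge_inputs n \<Gamma> I Left_Vertex) r)" for n \<Gamma>
    unfolding graph_op_def kterm_def pdiff_incoming_eq by (intro sum.cong refl) (simp only: mult_ac)
  have z: "kterm br d e p n \<Gamma> I * foldr pdiff (edge_inputs n \<Gamma> I Left_Vertex) r = 0"
    if n: "R + M < n" and \<Gamma>: "\<Gamma> \<in> kgraphs n" and I: "I \<in> set (kedges n) \<rightarrow>\<^sub>E {..<d}" for n \<Gamma> I
  proof (cases "length (edge_inputs n \<Gamma> I Left_Vertex) \<le> R")
    case True
    then have "kterm br d e p n \<Gamma> I = 0"
      by (intro kterm_eq_0_large[OF \<Gamma> I p]) (use n in \<open>simp add: mdeg_left_index[OF I]\<close>)
    then show ?thesis by simp
  next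
    case False
    have "foldr pdiff (edge_inputs n \<Gamma> I Left_Vertex) r = 0"
      by (rule pdeg_le_neg[OF pdeg_le_foldr[OF edge_inputs_less[OF I] r(2)]]) (use False in linarith)
    then show ?thesis by simp
  qed
  have "star br d e r p = (\<Sum>n\<le>R + M. \<Sum>\<Gamma>\<in>kgraphs n. pconst (complex_of_real (weight n \<Gamma>)) * graph_op br d e n \<Gamma> r p)"
    unfolding star_def
  proof (rule Sum_any.expand_superset)
    show "{n. (\<Sum>\<Gamma>\<in>kgraphs n. pconst (complex_of_real (weight n \<Gamma>)) * graph_op br d e n \<Gamma> r p) \<noteq> 0} \<subseteq> {..R + M}"
    proof
      fix n assume n: "n \<in> {n. (\<Sum>\<Gamma>\<in>kgraphs n. pconst (complex_of_real (weight n \<Gamma>)) * graph_op br d e n \<Gamma> r p) \<noteq> 0}"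
      show "n \<in> {..R + M}"
      proof (rule ccontr)
        assume "n \<notin> {..R + M}"
        then have "R + M < n" by simp
        then have "graph_op br d e n \<Gamma> r p = 0" if "\<Gamma> \<in> kgraphs n" for \<Gamma>
          unfolding go by (intro sum.neutral ballI z that)
        then have "(\<Sum>\<Gamma>\<in>kgraphs n. pconst (complex_of_real (weight n \<Gamma>)) * graph_op br d e n \<Gamma> r p) = 0"
          by (intro sum.neutral ballI) simp
        then show False using n by blast
      qed
    qed
  qed simp
  then have "pairing (star br d e r p) f = (\<Sum>n\<le>R + M. \<Sum>\<Gamma>\<in>kgraphs n. complex_of_real (weight n \<Gamma>) *
      (\<Sum>I\<in>set (kedges n) \<rightarrow>\<^sub>E {..<d}. pairing (kterm br d e p n \<Gamma> I * foldr pdiff (edge_inputs n \<Gamma> I Left_Vertex) r) f))"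
    by (simp only: go pairing_sum pairing_const_mult)
  also have "\<dots> = (\<Sum>n\<le>R + M. \<Sum>\<Gamma>\<in>kgraphs n. complex_of_real (weight n \<Gamma>) *
      (\<Sum>I\<in>set (kedges n) \<rightarrow>\<^sub>E {..<d}. \<Sum>\<beta>\<in>?K. Poly_Mapping.lookup (kterm br d e p n \<Gamma> I) \<beta>
        * pairing r (\<lambda>y. xpow (left_index n \<Gamma> I) y * mixed_deriv d e \<beta> f y)))"
  proof (intro sum.cong refl arg_cong2[where f = "(*)"])
    fix n \<Gamma> I assume \<Gamma>: "\<Gamma> \<in> kgraphs n" and I: "I \<in> set (kedges n) \<rightarrow>\<^sub>E {..<d}"
    have "pdeg_le d (int M) (kterm br d e p n \<Gamma> I)"
      by (rule pdeg_le_weaken[OF pdeg_le_kterm[OF \<Gamma> I p]]) (use edge_inputs_length_le[OF \<Gamma>, of I Left_Vertex] in linarith)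
    then have k: "Poly_Mapping.keys (kterm br d e p n \<Gamma> I) \<subseteq> ?K" unfolding pdeg_le_def by auto
    have "pairing (kterm br d e p n \<Gamma> I * foldr pdiff (edge_inputs n \<Gamma> I Left_Vertex) r) f
      = (\<Sum>\<beta>\<in>?K. Poly_Mapping.lookup (kterm br d e p n \<Gamma> I) \<beta> * pairing (foldr pdiff (edge_inputs n \<Gamma> I Left_Vertex) r) (mixed_deriv d e \<beta> f))"
      by (rule pairing_mult[OF finite_mdeg_le k _ f]) blast
    then show "pairing (kterm br d e p n \<Gamma> I * foldr pdiff (edge_inputs n \<Gamma> I Left_Vertex) r) f
      = (\<Sum>\<beta>\<in>?K. Poly_Mapping.lookup (kterm br d e p n \<Gamma> I) \<beta> * pairing r (\<lambda>y. xpow (left_index n \<Gamma> I) y * mixed_deriv d e \<beta> f y))"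
      unfolding pairing_foldr_pdiff[OF r(1) f(2) smooth_on_mixed_deriv[OF f(1)] edge_inputs_less[OF I]] left_index_def .
  qed
  finally show ?thesis by (simp only: sum_distrib_left mult.assoc)
qed

text \<open>By duality the pairing is one with a derivative of \<open>r\<close> of order greater
  than its degree.\<close>

lemma pairing_xpow_eq_0:
  assumes r: "r \<in> Sym d" "pdeg_le d (int R) r" and g: "smooth_on U g" "0 \<in> U"
    and I: "I \<in> set (kedges n) \<rightarrow>\<^sub>E {..<d}" and R: "R < mdeg d (left_index n \<Gamma> I)"
  shows "pairing r (\<lambda>y. xpow (left_index n \<Gamma> I) y * g y) = 0"
proof -
  have "foldr pdiff (edge_inputs n \<Gamma> I Left_Vertex) r = 0"
    by (rule pdeg_le_neg[OF pdeg_le_foldr[OF edge_inputs_less[OF I] r(2)]]) (use R in \<open>simp add: mdeg_left_index[OF I]\<close>)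
  then show ?thesis
    using pairing_foldr_pdiff[OF r(1) g(2,1) edge_inputs_less[OF I], of \<Gamma> Left_Vertex] unfolding left_index_def
    by (simp add: pairing_zero)
qed

lemma psat_partial_sum:
  assumes "finite L" "L \<subseteq> multi_indices d"
  shows "psat 0 (\<lambda>y. \<Sum>\<alpha>\<in>L. c \<alpha> * xpow \<alpha> y) (\<lambda>\<alpha>. if \<alpha> \<in> L then c \<alpha> else 0)"
  unfolding psat_def
proof (rule always_eventually, rule allI)
  fix y
  have "((\<lambda>m. (if m \<in> L then c m else 0) * xpow m (y - 0)) has_sum (\<Sum>\<alpha>\<in>L. c \<alpha> * xpow \<alpha> y)) (multi_indices d)
     \<longleftrightarrow> ((\<lambda>m. c m * xpow m y) has_sum (\<Sum>\<alpha>\<in>L. c \<alpha> * xpow \<alpha> y)) L"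
    by (rule has_sum_cong_neutral) (use assms(2) in auto)
  then show "((\<lambda>m. (if m \<in> L then c m else 0) * xpow m (y - 0)) has_sum (\<Sum>\<alpha>\<in>L. c \<alpha> * xpow \<alpha> y)) (multi_indices d)"
    using has_sum_finite[OF assms(1), of "\<lambda>m. c m * xpow m y"] by blast
qed

lemma star_right_diffop:
  assumes pS: "p \<in> Sym d"
  obtains P where "P \<in> local_diffops d e"
    "\<And>r f. r \<in> Sym d \<Longrightarrow> smooth_near 0 f \<Longrightarrow> pairing (star br d e r p) f = pairing r (P f)"
proof -
  obtain M where p: "pdeg_le d (int M) p" using Sym_pdeg_le[OF pS] by blast
  define c where "c = (\<lambda>\<beta> \<alpha>. star_coeff br d e p (mdeg d \<alpha> + M) \<beta> \<alpha>)"
  obtain \<rho> B where gb: "geom_bounded d \<rho> B (c \<beta>)" for \<beta>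
    using star_coeff_geometric[OF p, of br e] unfolding c_def by blast
  have \<rho>: "\<rho> / 4 > 0" using gb unfolding geom_bounded_def by simp
  define a where "a = (\<lambda>\<beta> x. infsum (\<lambda>\<alpha>. c \<beta> \<alpha> * xpow \<alpha> x) (multi_indices d))"
  let ?K = "{\<beta> \<in> multi_indices d. mdeg d \<beta> \<le> M}"
  have finK: "finite ?K" by (rule finite_mdeg_le)
  define P where "P = (\<lambda>f x. \<Sum>\<beta>\<in>?K. a \<beta> x * mixed_deriv d e \<beta> f x)"
  have "\<forall>\<^sub>F y in nhds 0. y - 0 \<in> polydisc (\<rho> / 4)" by (rule eventually_polydisc[OF \<rho>])
  then obtain U where U: "open U" "0 \<in> U" and U\<rho>: "\<And>y. y \<in> U \<Longrightarrow> y \<in> polydisc (\<rho> / 4)"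
    unfolding eventually_nhds by auto
  have an: "\<forall>x\<in>U. \<exists>c'. psat x (a \<beta>) c'" for \<beta>
    using psat_power_series[OF gb U\<rho>] unfolding a_def by blast
  \<comment> \<open>The analyticity in \<open>an\<close> comes with recentred coefficients; at the
    origin the coefficients \<open>c \<beta>\<close> themselves are wanted.\<close>
  have a0: "psat 0 (a \<beta>) (c \<beta>)" for \<beta>
    unfolding psat_def
  proof (rule eventually_mono[OF eventually_nhds_in_open[OF U]])
    fix y assume "y \<in> U"
    from recentred_has_sum(2)[OF gb U\<rho>[OF U(2)] U\<rho>[OF this], of \<beta>]
    show "((\<lambda>m. c \<beta> m * xpow m (y - 0)) has_sum a \<beta> y) (multi_indices d)" by (simp add: a_def)
  qed
  have sa: "smooth_on U (a \<beta>)" for \<beta> by (rule smooth_on_analytic[OF U(1) an])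
  have "analytic_diffop_on d e U P"
    unfolding analytic_diffop_on_def real_analytic_on_iff
  proof (intro exI conjI)
    show "\<forall>m\<in>?K. \<forall>x\<in>U. \<exists>c. psat x (a m) c" using an by blast
    show "\<forall>x\<in>U. \<forall>f. smooth_near x f \<longrightarrow> P f x = (\<Sum>m\<in>?K. a m x * mixed_deriv d e m f x)" by (simp add: P_def)
  qed (use finK in blast)+
  then have PL: "P \<in> local_diffops d e" unfolding local_diffops_def using U by blast
  moreover have "pairing (star br d e r p) f = pairing r (P f)" if r: "r \<in> Sym d" and fs: "smooth_near 0 f" for r f
  proof -
    obtain R where rR: "pdeg_le d (int R) r" using Sym_pdeg_le[OF r] by blast
    obtain V where V: "0 \<in> V" "smooth_on V f" using fs unfolding smooth_near_iff by blast
    let ?W = "U \<inter> V"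
    have W: "open ?W" "0 \<in> ?W" using U V smooth_on_open[OF V(2)] by blast+
    have f: "smooth_on ?W f" by (rule smooth_on_subset[OF V(2) W(1)]) blast
    have g: "smooth_on ?W (mixed_deriv d e \<beta> f)" for \<beta> by (rule smooth_on_mixed_deriv[OF f])
    have aW: "smooth_on ?W (a \<beta>)" for \<beta> by (rule smooth_on_subset[OF sa W(1)]) blast
    let ?L = "{\<alpha> \<in> multi_indices d. mdeg d \<alpha> \<le> R}"
    have finL: "finite ?L" by (rule finite_mdeg_le)
    have xW: "smooth_on ?W (xpow \<alpha>)" if "\<alpha> \<in> ?L" for \<alpha>
      by (rule smooth_on_subset[OF smooth_on_xpow W(1)]) (use that in blast)+
    \<comment> \<open>The Taylor polynomial of \<open>a \<beta>\<close> of degree \<open>R\<close>.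
      It cannot be told from \<open>a \<beta>\<close> by \<open>r\<close>, and it makes all sums
      finite.\<close>
    define A where "A = (\<lambda>\<beta> y. \<Sum>\<alpha>\<in>?L. c \<beta> \<alpha> * xpow \<alpha> y)"
    have A: "smooth_on ?W (A \<beta>)" for \<beta>
      unfolding A_def by (intro smooth_on_sum[OF W(1)] smooth_on_mult smooth_on_const[OF W(1)] xW)
    define T where "T = (\<lambda>\<alpha> \<beta>. pairing r (\<lambda>y. xpow \<alpha> y * mixed_deriv d e \<beta> f y))"
    define q where "q = (\<lambda>n \<Gamma> I \<beta>. complex_of_real (weight n \<Gamma>) * Poly_Mapping.lookup (kterm br d e p n \<Gamma> I) \<beta>)"
    have "pairing r (\<lambda>y. a \<beta> y * mixed_deriv d e \<beta> f y) = (\<Sum>\<alpha>\<in>?L. star_coeff br d e p (R + M) \<beta> \<alpha> * T \<alpha> \<beta>)" for \<beta>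
    proof -
      have "pairing r (\<lambda>y. a \<beta> y * mixed_deriv d e \<beta> f y) = pairing r (\<lambda>y. A \<beta> y * mixed_deriv d e \<beta> f y)"
      proof (rule pairing_equal_jets[OF r _ aW A g W(2)])
        show "mdeg d m \<le> R" if "m \<in> Poly_Mapping.keys r" for m using rR that unfolding pdeg_le_def by simp
        fix k assume k: "k \<in> multi_indices d" "mdeg d k \<le> R"
        obtain s where s: "\<And>f c. psat 0 f c \<Longrightarrow> mixed_deriv d e k f 0 = s * c k"
          using mixed_deriv_psat[OF k(1)] by blast
        have pA: "psat 0 (A \<beta>) (\<lambda>\<alpha>. if \<alpha> \<in> ?L then c \<beta> \<alpha> else 0)"
          unfolding A_def by (rule psat_partial_sum[OF finL]) blast
        show "mixed_deriv d e k (a \<beta>) 0 = mixed_deriv d e k (A \<beta>) 0"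
          unfolding s[OF a0] s[OF pA] using k by simp
      qed
      also have "(\<lambda>y. A \<beta> y * mixed_deriv d e \<beta> f y) = (\<lambda>y. \<Sum>\<alpha>\<in>?L. c \<beta> \<alpha> * (xpow \<alpha> y * mixed_deriv d e \<beta> f y))"
        unfolding A_def by (rule ext) (simp only: sum_distrib_right mult.assoc)
      also have "pairing r \<dots> = (\<Sum>\<alpha>\<in>?L. c \<beta> \<alpha> * T \<alpha> \<beta>)"
        unfolding T_def by (intro pairing_fun_sum[OF r W finL] smooth_on_mult xW g)
      \<comment> \<open>For all \<open>\<alpha>\<close> of degree at most \<open>R\<close> the
        coefficients have stabilised at \<open>R + M\<close>. With this common range for
        \<open>n\<close> the sums can be interchanged.\<close>
      also have "\<dots> = (\<Sum>\<alpha>\<in>?L. star_coeff br d e p (R + M) \<beta> \<alpha> * T \<alpha> \<beta>)"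
      proof (rule sum.cong[OF refl])
        fix \<alpha> assume "\<alpha> \<in> ?L"
        then have "mdeg d \<alpha> + M \<le> R + M" by simp
        from star_coeff_stable[OF p this, of br e \<beta>]
        show "c \<beta> \<alpha> * T \<alpha> \<beta> = star_coeff br d e p (R + M) \<beta> \<alpha> * T \<alpha> \<beta>" by (simp only: c_def)
      qed
      finally show ?thesis .
    qed
    moreover have "pairing r (P f) = (\<Sum>\<beta>\<in>?K. pairing r (\<lambda>y. a \<beta> y * mixed_deriv d e \<beta> f y))"
      using pairing_fun_sum[OF r W finK, of "\<lambda>\<beta> y. a \<beta> y * mixed_deriv d e \<beta> f y" "\<lambda>\<beta>. 1"] smooth_on_mult[OF aW g]
      by (simp add: P_def)
    ultimately have "pairing r (P f) = (\<Sum>\<beta>\<in>?K. \<Sum>\<alpha>\<in>?L. star_coeff br d e p (R + M) \<beta> \<alpha> * T \<alpha> \<beta>)" by simp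
    also have "\<dots> = (\<Sum>\<beta>\<in>?K. \<Sum>\<alpha>\<in>?L. \<Sum>n\<le>R + M. \<Sum>\<Gamma>\<in>kgraphs n. \<Sum>I\<in>set (kedges n) \<rightarrow>\<^sub>E {..<d}.
        (if left_index n \<Gamma> I = \<alpha> then q n \<Gamma> I \<beta> else 0) * T \<alpha> \<beta>)"
      unfolding star_coeff_def sum_distrib_right q_def ..
    also have "\<dots> = (\<Sum>n\<le>R + M. \<Sum>\<beta>\<in>?K. \<Sum>\<alpha>\<in>?L. \<Sum>\<Gamma>\<in>kgraphs n. \<Sum>I\<in>set (kedges n) \<rightarrow>\<^sub>E {..<d}.
        (if left_index n \<Gamma> I = \<alpha> then q n \<Gamma> I \<beta> else 0) * T \<alpha> \<beta>)" by (rule sum_swap_inner)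
    also have "\<dots> = (\<Sum>n\<le>R + M. \<Sum>\<Gamma>\<in>kgraphs n. \<Sum>\<beta>\<in>?K. \<Sum>\<alpha>\<in>?L. \<Sum>I\<in>set (kedges n) \<rightarrow>\<^sub>E {..<d}.
        (if left_index n \<Gamma> I = \<alpha> then q n \<Gamma> I \<beta> else 0) * T \<alpha> \<beta>)" by (rule sum.cong[OF refl sum_swap_inner])
    also have "\<dots> = (\<Sum>n\<le>R + M. \<Sum>\<Gamma>\<in>kgraphs n. \<Sum>I\<in>set (kedges n) \<rightarrow>\<^sub>E {..<d}. \<Sum>\<beta>\<in>?K. \<Sum>\<alpha>\<in>?L.
        (if left_index n \<Gamma> I = \<alpha> then q n \<Gamma> I \<beta> else 0) * T \<alpha> \<beta>)"
      by (rule sum.cong[OF refl sum.cong[OF refl sum_swap_inner]])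
    \<comment> \<open>The sum over \<open>\<alpha>\<close> merely selects the index of the edges
      into \<open>L\<close>. If its degree exceeds \<open>R\<close>, it does not occur in
      \<open>?L\<close>, but then the pairing \<open>T\<close> vanishes as well.\<close>
    also have "\<dots> = (\<Sum>n\<le>R + M. \<Sum>\<Gamma>\<in>kgraphs n. \<Sum>I\<in>set (kedges n) \<rightarrow>\<^sub>E {..<d}. \<Sum>\<beta>\<in>?K. q n \<Gamma> I \<beta> * T (left_index n \<Gamma> I) \<beta>)"
    proof (intro sum.cong[OF refl])
      fix n \<Gamma> I \<beta> assume I: "I \<in> set (kedges n) \<rightarrow>\<^sub>E {..<d}"
      let ?l = "left_index n \<Gamma> I"
      have "(\<Sum>\<alpha>\<in>?L. (if ?l = \<alpha> then q n \<Gamma> I \<beta> else 0) * T \<alpha> \<beta>) = (\<Sum>\<alpha>\<in>?L. if \<alpha> = ?l then q n \<Gamma> I \<beta> * T ?l \<beta> else 0)"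
        by (intro sum.cong refl) auto
      also have "\<dots> = (if ?l \<in> ?L then q n \<Gamma> I \<beta> * T ?l \<beta> else 0)" by (rule sum.delta[OF finL])
      also have "\<dots> = q n \<Gamma> I \<beta> * T ?l \<beta>"
      proof (cases "?l \<in> ?L")
        case False
        then have "R < mdeg d ?l" using left_index_in[OF I, of \<Gamma>] by simp
        then have "T ?l \<beta> = 0" unfolding T_def by (rule pairing_xpow_eq_0[OF r rR g W(2) I])
        then show ?thesis by simp
      qed simp
      finally show "(\<Sum>\<alpha>\<in>?L. (if ?l = \<alpha> then q n \<Gamma> I \<beta> else 0) * T \<alpha> \<beta>) = q n \<Gamma> I \<beta> * T ?l \<beta>" .
    qed
    also have "\<dots> = pairing (star br d e r p) f"
      unfolding pairing_star[OF r rR p f W(2)] q_def T_def ..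
    finally show ?thesis by (rule sym)
  qed
  ultimately show ?thesis by (rule that)
qed

text \<open>All functionals are cut off outside the functions smooth near 0, so their equality is an
  identity of pairings with such functions. Two operators with the same pairings are equivalent near
  0 and define one germ.\<close>

lemma star_germ_unique:
  assumes p: "p \<in> Sym d"
  shows "\<exists>!D. D \<in> diffop_germs d e \<and>
    (\<forall>r\<in>Sym d. distribution_of d e (star br d e r p) = right_act (distribution_of d e r) D)"
proof -
  have iff: "distribution_of d e s = right_act (distribution_of d e r) (diffop_germ_rel d e `` {P})
      \<longleftrightarrow> (\<forall>f. smooth_near 0 f \<longrightarrow> pairing s f = pairing r (P f))" (is "?l \<longleftrightarrow> ?r")
    if P: "P \<in> local_diffops d e" for r s P
  proof
    assume l: ?l
    show ?r
    proof (intro allI impI)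
      fix f :: "'g \<Rightarrow> complex" assume f: "smooth_near 0 f"
      have "pairing s f = distribution_of d e s f" unfolding distribution_of_eq using f by simp
      also have "\<dots> = pairing r (P f)" unfolding l by (rule right_act_class[OF P f])
      finally show "pairing s f = pairing r (P f)" .
    qed
  next
    assume r: ?r
    show ?l
    proof
      fix f :: "'g \<Rightarrow> complex"
      show "distribution_of d e s f = right_act (distribution_of d e r) (diffop_germ_rel d e `` {P}) f"
      proof (cases "smooth_near 0 f")
        case True
        have "distribution_of d e s f = pairing s f" unfolding distribution_of_eq using True by simp
        then show ?thesis unfolding right_act_class[OF P True] using r True by simp
      next
        case False
        then show ?thesis unfolding distribution_of_eq right_act_def by simp
      qed
    qed
  qed
  obtain P where P: "P \<in> local_diffops d e"
    "\<And>r f. r \<in> Sym d \<Longrightarrow> smooth_near 0 f \<Longrightarrow> pairing (star br d e r p) f = pairing r (P f)"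
    using star_right_diffop[OF p] by blast
  show ?thesis
  proof (rule ex1I)
    show "diffop_germ_rel d e `` {P} \<in> diffop_germs d e \<and>
      (\<forall>r\<in>Sym d. distribution_of d e (star br d e r p) = right_act (distribution_of d e r) (diffop_germ_rel d e `` {P}))"
      unfolding iff[OF P(1)] diffop_germs_def using P quotientI[OF P(1)] by blast
  next
    fix D assume D: "D \<in> diffop_germs d e \<and>
      (\<forall>r\<in>Sym d. distribution_of d e (star br d e r p) = right_act (distribution_of d e r) D)"
    then obtain Q where Q: "Q \<in> local_diffops d e" "D = diffop_germ_rel d e `` {Q}"
      unfolding diffop_germs_def by (blast elim: quotientE)
    have "pairing r (Q f) = pairing r (P f)" if "r \<in> Sym d" "smooth_near 0 f" for r f
      using D P(2)[OF that] that unfolding Q(2) iff[OF Q(1)] by simp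
    then have "(Q, P) \<in> diffop_germ_rel d e" by (rule diffop_germ_determined[OF Q(1) P(1)])
    then show "D = diffop_germ_rel d e `` {P}" unfolding Q(2) by (rule diffop_germ_class_eq)
  qed
qed

end

theorem theorem4:
  fixes br :: "'g::real_normed_vector \<Rightarrow> 'g \<Rightarrow> 'g"
    and e :: "nat \<Rightarrow> 'g" and d :: nat and p :: cpoly
  assumes "lie_bracket br"
    and "is_basis d e"
    and "p \<in> Sym d"
  shows "\<exists>!D. D \<in> diffop_germs d e \<and>
    (\<forall>r \<in> Sym d. distribution_of d e (star br d e r p) = right_act (distribution_of d e r) D)"
proof -
  interpret finite_basis d e by unfold_locales (rule assms(2))
  show ?thesis by (rule star_germ_unique[OF assms(3)])
qed

end
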